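(* Let $\mu:\mathrm{TS}\to\mathcal P(\mathbb S)$ be regular, let $M_t=\mu(t,U_t)$, $t\in[0,T]$ (used to construct $X$ and $\mathbb P^\alpha$), and let $\alpha:\mathrm{TS}\times\mathbb S\to\mathbb A$ be a Borel feedback strategy (i.e. $\alpha_t=\alpha(t,U_{t-},X_{t-})$). Then $\mathbb P^\alpha(X_t=j\mid\mathfrak G_T)=\mathbb P^\alpha(X_t=j\mid U_t)$ for all $t\in[0,T]$, $j\in\mathbb S$. Moreover, the conditional aggregate distribution evolves as $$d\,\mathbb P^\alpha(X_t=j\mid U_t)=\sum_{i\in\mathbb S}\mathbb P^\alpha(X_t=i\mid U_t)\,Q^{ij}\big(t,Z(U_t),M_t,\alpha(t,U_t,i)\big)\,dt\quad\text{on }\{\Delta U_t=0\},$$ $$\mathbb P^\alpha(X_t=j\mid U_t)=\sum_{i\in\mathbb S}\mathbb I_{\{J^i(t,M_{t-})=j\}}\,\mathbb P^\alpha(X_{t}=i\mid U_{t-})\quad\text{on }\{\Delta U_t\ne0\},$$ with initial condition $\mathbb P^\alpha(X_0=j\mid U_0)=\mathbb P(X_0=j)$.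
   Context: Setting. Fix a probability space $(\Omega,\mathfrak A,\mathbb P)$, $T>0$, $n\in\mathbb N$, $\mathbb S=\{1,\dots,S\}$, $\mathbb A\subseteq\mathbb R^A$; $\mathcal P(\mathbb S)$ is the probability simplex. Coefficients are bounded Borel functions $\lambda=(\lambda^1,\dots,\lambda^n):[0,T]\times\mathcal P(\mathbb S)\to(0,\infty)^n$, $Q:[0,T]\times\{0,\dots,n\}\times\mathcal P(\mathbb S)\times\mathbb A\to\mathbb R^{S\times S}$ (intensity matrices), $J:[0,T]\times\mathcal P(\mathbb S)\to\mathbb S^{\mathbb S}$ (components $J^i$). Under $\mathbb P$, $X_0$ ($\mathbb S$-valued), unit-intensity Poisson processes $N^{ikj}$ ($i\ne j$, $k\in\{0,\dots,n\}$) and $N^k$ ($k\in\{1,\dots,n\}$) are independent. $Z_0=0$, $dZ_t=\sum_{k=1}^n\mathbb I_{\{Z_{t-}=k-1\}}dN^k_t$; $\mathfrak G_t=\sigma(Z_s:s\le t)$. Given $M$, $X$ starts at $X_0$ with $dX_t=\sum_{i\ne j}\sum_{k=0}^n\mathbb I_{\{X_{t-}=i,Z_{t-}=k\}}(j-i)dN^{ikj}_t+\sum_i\sum_{k=1}^n\mathbb I_{\{X_{t-}=i,Z_{t-}=k-1\}}(J^i(t,M_{t-})-i)dN^k_t$. $\mathfrak F$ is generated by $X_0$ and all $N^{ikj},N^k$. For an $\mathfrak F$-predictable $\mathbb A$-valued strategy process $\alpha_t$, $\mathbb P^\alpha$ is defined by $\frac{d\mathbb P^\alpha}{d\mathbb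 P}=\prod_{i\ne j}\prod_{k=0}^n\Big(e^{\int_0^T(1-Q^{ij}(s,k,M_s,\alpha_s))\mathbb I_{\{Z_s=k\}}ds}\prod_{s:\Delta N^{ikj}_s\ne0}(Q^{ij}(s,k,M_{s-},\alpha_s)\mathbb I_{\{Z_{s-}=k\}}+\mathbb I_{\{Z_{s-}\ne k\}})\Big)\prod_{l=1}^n\Big(e^{\int_0^T(1-\lambda^l(s,M_s))\mathbb I_{\{Z_s=l-1\}}ds}\prod_{s:\Delta N^l_s\ne0}(\lambda^l(s,M_{s-})\mathbb I_{\{Z_{s-}=l-1\}}+\mathbb I_{\{Z_{s-}\ne l-1\}})\Big)$. Shock times: $U_t=(U^1_t,\dots,U^n_t)$, $U^k_t=\int_0^t(s+1)\mathbb I_{\{Z_{s-}=k-1\}}dN^k_s-1$; $U_0=(-1,\dots,-1)$; $\sigma(U_t)=\mathfrak G_t$. $\mathbb U$ is the set of $u\in(\{-1\}\cup[0,T])^n$ with $0\le u^1\le\dots\le u^k$ and $u^{k+1}=\dots=u^n=-1$ for some $k\in\{0,\dots,n\}$; $Z(u)$ is this $k$. $\mathrm{TS}=\{(t,u)\in[0,T]\times\mathbb U:\max_ku^k\le t\}$. A function on $\mathrm{TS}$ is regular if it is absolutely continuous in $t$ on $\{t:(t,u)\in\mathrm{TS}\}$ for each $u$. *)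

theory Defs
  imports "HOL-Probability.Probability"
begin

definition lft :: "(real \<Rightarrow> 'b::t2_space) \<Rightarrow> real \<Rightarrow> 'b" where
  "lft f t = (if t \<le> 0 then f 0 else Lim (at_left t) f)"

text \<open>Pathwise stochastic integral over (0,t] of g against a counting path Np
  (sum over the jump times of Np of g times the jump size).\<close>
definition pint :: "(real \<Rightarrow> real) \<Rightarrow> (real \<Rightarrow> nat) \<Rightarrow> real \<Rightarrow> real" where
  "pint g Np t = (\<Sum>s\<in>{s. 0 < s \<and> s \<le> t \<and> Np s \<noteq> lft Np s}.
                     g s * (real (Np s) - real (lft Np s)))"

definition jump_times :: "(real \<Rightarrow> nat) \<Rightarrow> real \<Rightarrow> real set" where
  "jump_times Np T = {s. 0 < s \<and> s \<le> T \<and> Np s \<noteq> lft Np s}"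

definition unit_poisson_process :: "'w measure \<Rightarrow> (real \<Rightarrow> 'w \<Rightarrow> nat) \<Rightarrow> bool" where
  "unit_poisson_process P N \<longleftrightarrow>
     (\<forall>t. N t \<in> measurable P (count_space UNIV)) \<and>
     (\<forall>\<omega>\<in>space P. N 0 \<omega> = 0 \<and> mono_on {0..} (\<lambda>t. N t \<omega>) \<and>
        (\<forall>t\<ge>0. continuous (at_right t) (\<lambda>s. N s \<omega>))) \<and>
     (\<forall>s t k. 0 \<le> s \<and> s \<le> t \<longrightarrow>
        prob_space.prob P {\<omega>\<in>space P. N t \<omega> - N s \<omega> = k}
          = (t - s) ^ k / fact k * exp (- (t - s))) \<and>
     (\<forall>ts::real list. sorted_wrt (<) ts \<and> (\<forall>x\<in>set ts. 0 \<le> x) \<longrightarrow>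
        prob_space.indep_vars P (\<lambda>_. count_space UNIV)
          (\<lambda>i \<omega>. N (ts ! Suc i) \<omega> - N (ts ! i) \<omega>) {..<length ts - 1})"

text \<open>Index set of the driving Poisson processes:
  NX i k j stands for N^{ikj}, NZ k for N^k.\<close>
datatype noise = NX nat nat nat | NZ nat

definition noise_idx :: "nat \<Rightarrow> nat \<Rightarrow> noise set" where
  "noise_idx S n = {NX i k j | i k j. i \<in> {1..S} \<and> j \<in> {1..S} \<and> i \<noteq> j \<and> k \<le> n}
                   \<union> {NZ k | k. k \<in> {1..n}}"

definition prob_simplex :: "nat \<Rightarrow> (nat \<Rightarrow> real) set" where
  "prob_simplex S = {m. (\<forall>i. 0 \<le> m i) \<and> (\<forall>i. i \<notin> {1..S} \<longrightarrow> m i = 0) \<and> (\<Sum>i=1..S. m i) = 1}"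

definition Uset :: "nat \<Rightarrow> real \<Rightarrow> (nat \<Rightarrow> real) set" where
  "Uset n T = {u. (\<forall>k. k \<notin> {1..n} \<longrightarrow> u k = 0) \<and>
     (\<exists>m\<le>n. (\<forall>k\<in>{1..m}. 0 \<le> u k \<and> u k \<le> T) \<and>
             (\<forall>k\<in>{1..<m}. u k \<le> u (Suc k)) \<and>
             (\<forall>k\<in>{m<..n}. u k = -1))}"

definition Zof :: "nat \<Rightarrow> (nat \<Rightarrow> real) \<Rightarrow> nat" where
  "Zof n u = card {k\<in>{1..n}. 0 \<le> u k}"

definition TS :: "nat \<Rightarrow> real \<Rightarrow> (real \<times> (nat \<Rightarrow> real)) set" where
  "TS n T = {(t, u). t \<in> {0..T} \<and> u \<in> Uset n T \<and> (\<forall>k\<in>{1..n}. u k \<le> t)}"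

definition u_init :: "nat \<Rightarrow> (nat \<Rightarrow> real)" where
  "u_init n = (\<lambda>k. if k \<in> {1..n} then -1 else 0)"

definition abs_continuous_on :: "real set \<Rightarrow> (real \<Rightarrow> real) \<Rightarrow> bool" where
  "abs_continuous_on I f \<longleftrightarrow>
     (\<forall>e>0. \<exists>d>0. \<forall>D::(real \<times> real) set.
        finite D \<and> (\<forall>(a,b)\<in>D. a \<le> b \<and> {a..b} \<subseteq> I) \<and>
        pairwise (\<lambda>(a,b) (c,d). b \<le> c \<or> d \<le> a) D \<and>
        (\<Sum>(a,b)\<in>D. b - a) < d \<longrightarrow> (\<Sum>(a,b)\<in>D. \<bar>f b - f a\<bar>) < e)"

definition regular_TS :: "nat \<Rightarrow> real \<Rightarrow> (real \<Rightarrow> (nat \<Rightarrow> real) \<Rightarrow> nat \<Rightarrow> real) \<Rightarrow> bool" where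
  "regular_TS n T f \<longleftrightarrow>
     (\<forall>u i. abs_continuous_on {t. (t, u) \<in> TS n T} (\<lambda>t. f t u i))"

definition Uproc :: "nat \<Rightarrow> (noise \<Rightarrow> real \<Rightarrow> 'w \<Rightarrow> nat) \<Rightarrow> (real \<Rightarrow> 'w \<Rightarrow> nat)
                      \<Rightarrow> real \<Rightarrow> 'w \<Rightarrow> (nat \<Rightarrow> real)" where
  "Uproc n N Z t \<omega> = (\<lambda>k. if k \<in> {1..n} then
       pint (\<lambda>s. (s + 1) * (if lft (\<lambda>r. Z r \<omega>) s = k - 1 then 1 else 0)) (\<lambda>r. N (NZ k) r \<omega>) t - 1
     else 0)"

definition density_alpha ::
  "nat \<Rightarrow> nat \<Rightarrow> real
   \<Rightarrow> (nat \<Rightarrow> real \<Rightarrow> (nat \<Rightarrow> real) \<Rightarrow> real)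
   \<Rightarrow> (real \<Rightarrow> nat \<Rightarrow> (nat \<Rightarrow> real) \<Rightarrow> 'a \<Rightarrow> nat \<Rightarrow> nat \<Rightarrow> real)
   \<Rightarrow> (noise \<Rightarrow> real \<Rightarrow> 'w \<Rightarrow> nat) \<Rightarrow> (real \<Rightarrow> 'w \<Rightarrow> nat)
   \<Rightarrow> (real \<Rightarrow> 'w \<Rightarrow> (nat \<Rightarrow> real))
   \<Rightarrow> (real \<Rightarrow> 'w \<Rightarrow> 'a) \<Rightarrow> 'w \<Rightarrow> real" where
  "density_alpha S n T lam Q N Z Mp act \<omega> =
     (\<Prod>i\<in>{1..S}. \<Prod>j\<in>{1..S}-{i}. \<Prod>k\<in>{0..n}.
        exp (integral {0..T} (\<lambda>s. (1 - Q s k (Mp s \<omega>) (act s \<omega>) i j) * (if Z s \<omega> = k then 1 else 0)))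
        * (\<Prod>s\<in>jump_times (\<lambda>r. N (NX i k j) r \<omega>) T.
             Q s k (lft (\<lambda>r. Mp r \<omega>) s) (act s \<omega>) i j * (if lft (\<lambda>r. Z r \<omega>) s = k then 1 else 0)
             + (if lft (\<lambda>r. Z r \<omega>) s \<noteq> k then 1 else 0)))
   * (\<Prod>l\<in>{1..n}.
        exp (integral {0..T} (\<lambda>s. (1 - lam l s (Mp s \<omega>)) * (if Z s \<omega> = l - 1 then 1 else 0)))
        * (\<Prod>s\<in>jump_times (\<lambda>r. N (NZ l) r \<omega>) T.
             lam l s (lft (\<lambda>r. Mp r \<omega>) s) * (if lft (\<lambda>r. Z r \<omega>) s = l - 1 then 1 else 0)
             + (if lft (\<lambda>r. Z r \<omega>) s \<noteq> l - 1 then 1 else 0)))"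

end

theory Submission imports Defs begin

text \<open>
  The shock noises are independent of the initial state and of the noises driving the spontaneous
  transitions, and off a null set \<open>X\<close> is a path functional of \<open>U\<^sub>T\<close> and the latter. Freezing the
  shock times at a fixed value \<open>u\<close> leaves a jump chain with predictable rates in a deterministic
  environment, and the density of the changed measure factorises into a function of \<open>U\<^sub>T\<close> and the
  exponential martingale of the frozen chain, whose expectation is one. Hence both conditional
  probabilities are \<open>p t (U t)\<close>, where \<open>p t u j\<close> is the weighted probability that the frozen chain
  is in state \<open>j\<close>; it depends on \<open>u\<close> only through the shocks up to time \<open>t\<close>. The compensation
  formula for the Poisson noises gives the Kolmogorov equation for \<open>p\<close> between shocks, and at a shock
  the chain is relabelled by \<open>J\<close>.
\<close>

section \<open>Counting paths\<close>

text \<open>Three obstacles shape the development. The shock times are random while the chain is run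
  with them held fixed, so every frozen quantity must be measurable jointly in the shock vector
  \<open>u\<close> and the path; \<open>u\<close> is therefore adjoined as a coordinate known at
  time 0. Next, \<open>X\<close> is given only as a solution of a pathwise equation, without
  adaptedness. The chain is rebuilt as an explicit fold over event times, and expectations involve
  only a predictable version of its left limit; simultaneous jumps, where the fold has no meaning,
  are null. Finally, the shock counter agrees with a functional of the shock noises only off a null
  set that involves all noises, so measurability and independence are transported modulo null sets.
  The expectation of the exponential martingale is computed with unit-rate compensators: the
  \<open>1\<close> in \<open>1 - Q\<close> cancels the compensator of the jump terms and the
  generator remains. Domination comes from clamping the rates at a constant \<open>QB\<close>, which
  bounds the weight by a multiple of \<open>QB\<close> to the number of jumps, integrable for
  Poisson noises.\<close>

definition counting_path :: "(real \<Rightarrow> nat) \<Rightarrow> bool" where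
  "counting_path f \<longleftrightarrow> f 0 = 0 \<and> mono_on {0..} f \<and> (\<forall>t\<ge>0. continuous (at_right t) f)"

lemma lft_eqI:
  assumes "0 < s" "a < s" "\<And>r. a < r \<Longrightarrow> r < s \<Longrightarrow> f r = v"
  shows "lft f s = v"
proof -
  have "(f \<longlongrightarrow> v) (at_left s)"
    by (rule tendsto_eventually) (use assms in \<open>auto simp: eventually_at_left intro!: exI[of _ a]\<close>)
  then have "Lim (at_left s) f = v"
    by (intro tendsto_Lim) auto
  then show ?thesis using assms(1) by (simp add: lft_def)
qed

lemma counting_path_mono: "counting_path f \<Longrightarrow> 0 \<le> a \<Longrightarrow> a \<le> b \<Longrightarrow> f a \<le> f b"
  unfolding counting_path_def by (auto intro: mono_onD[of "{0..}" f])

text \<open>A monotone path with values in the naturals is bounded by \<open>f s\<close> on [0,s),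
  hence takes finitely many values there; the largest one is attained and kept until
  \<open>s\<close>. Left limits are thereby handled by choosing a time instead of by
  topology.\<close>

lemma counting_path_left:
  assumes f: "counting_path f" and s: "0 < s"
  obtains a where "0 \<le> a" "a < s" "\<And>r. a \<le> r \<Longrightarrow> r < s \<Longrightarrow> f r = lft f s"
proof -
  have fin: "finite (f ` {0..<s})"
    by (rule finite_subset[of _ "{..f s}"]) (use counting_path_mono[OF f] in auto)
  have ne: "f ` {0..<s} \<noteq> {}" using s by auto
  from Max_in[OF fin ne] obtain a where a: "0 \<le> a" "a < s" "Max (f ` {0..<s}) = f a"
    by auto
  have eq: "f r = f a" if "a \<le> r" "r < s" for r
    using Max_ge[OF fin, of "f r"] counting_path_mono[OF f, of a r] a that by fastforce
  have "lft f s = f a" by (rule lft_eqI[OF s a(2)]) (auto intro!: eq)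
  with eq a that show ?thesis by metis
qed

lemma counting_path_left_value:
  assumes "counting_path f" "0 < s"
  obtains a where "0 \<le> a" "a < s" "f a = lft f s"
proof (rule counting_path_left[OF assms])
  fix a assume "0 \<le> a" "a < s" "\<And>r. a \<le> r \<Longrightarrow> r < s \<Longrightarrow> f r = lft f s"
  then show thesis using that[of a] by simp
qed

lemma counting_path_right:
  assumes f: "counting_path f" and s: "0 \<le> s"
  obtains b where "s < b" "\<And>r. s \<le> r \<Longrightarrow> r < b \<Longrightarrow> f r = f s"
proof -
  have "(f \<longlongrightarrow> f s) (at_right s)"
    using f s by (auto simp: counting_path_def continuous_within)
  then have "eventually (\<lambda>r. f r = f s) (at_right s)"
    by (simp add: tendsto_discrete)
  then obtain b where "b > s" "\<And>r. s < r \<Longrightarrow> r < b \<Longrightarrow> f r = f s"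
    by (auto simp: eventually_at_right_field)
  then show ?thesis using that[of b] by (metis order_le_less)
qed

lemma lft_counting_path_le:
  assumes "counting_path f" "0 < s" shows "lft f s \<le> f s"
  by (metis assms counting_path_left counting_path_mono less_eq_real_def order_refl)

lemma le_lft_counting_path:
  assumes "counting_path f" "0 \<le> a" "a < s" shows "f a \<le> lft f s"
proof -
  obtain b where b: "0 \<le> b" "b < s" "\<And>r. b \<le> r \<Longrightarrow> r < s \<Longrightarrow> f r = lft f s"
    using counting_path_left[OF assms(1), of s] assms by auto
  then show ?thesis
    using counting_path_mono[OF assms(1), of a "max a b"] assms by fastforce
qed

lemma counting_path_no_jump:
  assumes f: "counting_path f" and "0 \<le> a" "a < s" "s \<le> t" "f a = f t"
  shows "lft f s = f s"
  using le_lft_counting_path[OF f, of a s] lft_counting_path_le[OF f, of s]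
    counting_path_mono[OF f, of s t] assms by auto

text \<open>The last jump up to time \<open>t\<close> happens at the first time where the value \<open>f t\<close> is attained.\<close>
lemma counting_path_last_jump:
  assumes f: "counting_path f" and "0 \<le> a" "a \<le> t" "f a \<noteq> f t"
  obtains s where "a < s" "s \<le> t" "f s = f t" "lft f s < f s" "\<And>r. 0 \<le> r \<Longrightarrow> r < s \<Longrightarrow> f r < f t"
proof -
  define A where "A = {r. 0 \<le> r \<and> f r \<ge> f t}"
  define s where "s = Inf A"
  have tA: "t \<in> A" using assms by (auto simp: A_def)
  have bdd: "bdd_below A" by (auto simp: A_def intro!: bdd_belowI[of _ 0])
  have s0: "0 \<le> s" unfolding s_def using tA by (intro cInf_greatest) (auto simp: A_def)
  have st: "s \<le> t" unfolding s_def by (rule cInf_lower[OF tA bdd])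
  obtain b where b: "s < b" "\<And>r. s \<le> r \<Longrightarrow> r < b \<Longrightarrow> f r = f s"
    using counting_path_right[OF f s0] by metis
  have "\<exists>r\<in>A. r < b" using b(1) tA bdd unfolding s_def by (subst (asm) cInf_less_iff) auto
  then obtain r where r: "r \<in> A" "r < b" by auto
  then have "s \<le> r" unfolding s_def using bdd by (auto intro: cInf_lower)
  then have fs: "f s \<ge> f t" using b(2)[of r] r by (simp add: A_def)
  with counting_path_mono[OF f s0 st] have fs: "f s = f t" by simp
  have less: "f r < f t" if "0 \<le> r" "r < s" for r
  proof (rule ccontr)
    assume "\<not> f r < f t"
    then have "r \<in> A" using that by (auto simp: A_def)
    then have "s \<le> r" unfolding s_def by (rule cInf_lower[OF _ bdd])
    then show False using that by simp
  qed
  have "f a < f t" using counting_path_mono[OF f, of a t] assms by simp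
  then have as: "a < s" using counting_path_mono[OF f s0, of a] fs by (cases "a < s") auto
  then have "0 < s" using assms by simp
  then obtain c where "0 \<le> c" "c < s" "f c = lft f s"
    using counting_path_left_value[OF f, of s] by blast
  then have "lft f s < f s" using less[of c] fs by simp
  then show ?thesis using that as st fs less by blast
qed

lemma counting_path_eq_iff:
  assumes f: "counting_path f" and "0 \<le> a" "a \<le> t"
  shows "f a = f t \<longleftrightarrow> (\<forall>s. a < s \<and> s \<le> t \<longrightarrow> lft f s = f s)"
proof
  show "f a = f t \<Longrightarrow> \<forall>s. a < s \<and> s \<le> t \<longrightarrow> lft f s = f s"
    using counting_path_no_jump[OF f] assms by blast
  show "\<forall>s. a < s \<and> s \<le> t \<longrightarrow> lft f s = f s \<Longrightarrow> f a = f t"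
    using counting_path_last_jump[OF assms] by (metis less_irrefl)
qed

lemma counting_path_sum:
  assumes "finite I" "\<And>c. c \<in> I \<Longrightarrow> counting_path (f c)"
  shows "counting_path (\<lambda>t. \<Sum>c\<in>I. f c t)"
  unfolding counting_path_def
proof (intro conjI allI impI)
  show "(\<Sum>c\<in>I. f c 0) = 0" using assms by (auto simp: counting_path_def)
  show "mono_on {0..} (\<lambda>t. \<Sum>c\<in>I. f c t)"
    by (intro mono_onI sum_mono) (use assms counting_path_mono in auto)
  show "continuous (at_right t) (\<lambda>t. \<Sum>c\<in>I. f c t)" if "0 \<le> t" for t
    using assms that unfolding counting_path_def
    by (intro continuous_sum) auto
qed

lemma lft_sum:
  assumes "finite I" "\<And>c. c \<in> I \<Longrightarrow> counting_path (f c)" "0 < s"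
  shows "lft (\<lambda>t. \<Sum>c\<in>I. f c t) s = (\<Sum>c\<in>I. lft (f c) s)"
proof -
  have "\<forall>c\<in>I. \<exists>a. 0 \<le> a \<and> a < s \<and> (\<forall>r. a \<le> r \<and> r < s \<longrightarrow> f c r = lft (f c) s)"
    using assms counting_path_left by metis
  then obtain a where a: "\<And>c. c \<in> I \<Longrightarrow> a c < s \<and> (\<forall>r. a c \<le> r \<and> r < s \<longrightarrow> f c r = lft (f c) s)"
    by metis
  let ?a = "Max (insert 0 (a ` I))"
  have "?a < s" using assms a by auto
  moreover have "a c \<le> ?a" if "c \<in> I" for c using assms that by (intro Max_ge) auto
  ultimately have "f c r = lft (f c) s" if "c \<in> I" "?a < r" "r < s" for c r
    using a[OF that(1)] that by (meson less_imp_le order_trans)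
  then show ?thesis
    using \<open>?a < s\<close> by (intro lft_eqI[OF assms(3), of ?a] sum.cong refl) auto
qed

text \<open>Real time is not well-founded, but the value \<open>f r\<close> is: the proof is strong
  induction on the number of counts so far. The event case may use \<open>Q\<close> on all of
  [t0,s), because every earlier time has a smaller count than \<open>s\<close>.\<close>

lemma counting_path_induct [consumes 3, case_names start const event]:
  assumes f: "counting_path f" and t0: "0 \<le> t0" "t0 \<le> t"
    and start: "Q t0"
    and const: "\<And>a r. t0 \<le> a \<Longrightarrow> a < r \<Longrightarrow> r \<le> t \<Longrightarrow> f a = f r \<Longrightarrow> Q a \<Longrightarrow> Q r"
    and event: "\<And>a s. t0 \<le> a \<Longrightarrow> a < s \<Longrightarrow> s \<le> t \<Longrightarrow> lft f s < f s \<Longrightarrow>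
        (\<And>r. a \<le> r \<Longrightarrow> r < s \<Longrightarrow> f r = lft f s) \<Longrightarrow> (\<And>r. t0 \<le> r \<Longrightarrow> r < s \<Longrightarrow> Q r) \<Longrightarrow> Q s"
  shows "Q t"
proof -
  have "Q r" if "t0 \<le> r" "r \<le> t" for r
    using that
  proof (induction "f r" arbitrary: r rule: less_induct)
    case less
    show ?case
    proof (cases "f t0 = f r")
      case True
      then show ?thesis using const[of t0 r] start less.prems by (cases "t0 = r") auto
    next
      case False
      obtain s where s: "t0 < s" "s \<le> r" "f s = f r" "lft f s < f s"
        "\<And>r'. 0 \<le> r' \<Longrightarrow> r' < s \<Longrightarrow> f r' < f r"
        using counting_path_last_jump[OF f t0(1) less.prems(1) False] by blast
      obtain a where a: "0 \<le> a" "a < s" "\<And>r. a \<le> r \<Longrightarrow> r < s \<Longrightarrow> f r = lft f s"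
        using counting_path_left[OF f, of s] s t0 by auto
      have "Q s"
      proof (rule event[of "max a t0" s])
        show "\<And>r. t0 \<le> r \<Longrightarrow> r < s \<Longrightarrow> Q r"
          using less.hyps s t0 less.prems by auto
      qed (use s a less.prems in auto)
      then show ?thesis using const[of s r] s less.prems by (cases "s = r") auto
    qed
  qed
  then show ?thesis using t0 by auto
qed

text \<open>The generalised inverse of the path. If the level \<open>l\<close> is never reached this
  is the infimum of the empty set, so the lemmas ask for \<open>l \<le> f t\<close> at some
  \<open>t\<close>.\<close>

definition nth_jump :: "(real \<Rightarrow> nat) \<Rightarrow> nat \<Rightarrow> real" where
  "nth_jump f l = Inf {r. 0 \<le> r \<and> l \<le> f r}"

lemma nth_jump:
  assumes f: "counting_path f" and l: "1 \<le> l" "l \<le> f t" "0 \<le> t"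
  shows nth_jump_pos: "0 < nth_jump f l" and nth_jump_le: "nth_jump f l \<le> t"
    and nth_jump_ge: "l \<le> f (nth_jump f l)"
    and nth_jump_less: "\<And>r. 0 \<le> r \<Longrightarrow> r < nth_jump f l \<Longrightarrow> f r < l"
    and nth_jump_lft: "lft f (nth_jump f l) < l"
proof -
  define A where "A = {r. 0 \<le> r \<and> l \<le> f r}"
  define s where "s = nth_jump f l"
  have sI: "s = Inf A" by (simp add: s_def A_def nth_jump_def)
  have tA: "t \<in> A" using assms by (auto simp: A_def)
  have bdd: "bdd_below A" by (auto simp: A_def intro!: bdd_belowI[of _ 0])
  have s0: "0 \<le> s" unfolding sI using tA by (intro cInf_greatest) (auto simp: A_def)
  show st: "nth_jump f l \<le> t" unfolding s_def[symmetric] sI by (rule cInf_lower[OF tA bdd])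
  obtain b where b: "s < b" "\<And>r. s \<le> r \<Longrightarrow> r < b \<Longrightarrow> f r = f s"
    using counting_path_right[OF f s0] by metis
  have "\<exists>r\<in>A. r < b" using b(1) tA bdd unfolding sI by (subst (asm) cInf_less_iff) auto
  then obtain r where r: "r \<in> A" "r < b" by auto
  then have "s \<le> r" unfolding sI using bdd by (auto intro: cInf_lower)
  then show ge: "l \<le> f (nth_jump f l)" using b(2)[of r] r by (simp add: A_def s_def)
  show less: "f r < l" if "0 \<le> r" "r < nth_jump f l" for r
  proof (rule ccontr)
    assume "\<not> f r < l"
    then have "r \<in> A" using that by (auto simp: A_def)
    then have "s \<le> r" unfolding sI by (rule cInf_lower[OF _ bdd])
    then show False using that by (simp add: s_def)
  qed
  have "f 0 = 0" using f by (simp add: counting_path_def)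
  then have "s \<noteq> 0" using ge l by (auto simp: s_def)
  then show pos: "0 < nth_jump f l" using s0 by (simp add: s_def)
  show "lft f (nth_jump f l) < l"
  proof -
    obtain a where "0 \<le> a" "a < nth_jump f l" "f a = lft f (nth_jump f l)"
      using counting_path_left_value[OF f pos] by blast
    then show ?thesis using less[of a] by simp
  qed
qed

text \<open>The Galois connection between levels and times. It reduces an event about the random
  jump time to an event about the path at a deterministic time, which is how jump times become
  measurable.\<close>

lemma nth_jump_le_iff:
  assumes f: "counting_path f" and "1 \<le> l" "l \<le> f t" "0 \<le> t" "0 \<le> r"
  shows "nth_jump f l \<le> r \<longleftrightarrow> l \<le> f r"
  using nth_jump[OF assms(1-4)] counting_path_mono[OF f, of "nth_jump f l" r] assms
  by (meson le_trans less_imp_le not_le)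

definition unit_jumps :: "(real \<Rightarrow> nat) \<Rightarrow> real \<Rightarrow> bool" where
  "unit_jumps f t \<longleftrightarrow> (\<forall>s. 0 < s \<and> s \<le> t \<longrightarrow> f s \<le> Suc (lft f s))"

text \<open>The open interval matters: this condition is decided by the path strictly before
  \<open>t\<close> and can therefore be built into a predictable process.\<close>

definition unit_jumps_before :: "(real \<Rightarrow> nat) \<Rightarrow> real \<Rightarrow> bool" where
  "unit_jumps_before f t \<longleftrightarrow> (\<forall>s. 0 < s \<and> s < t \<longrightarrow> f s \<le> Suc (lft f s))"

text \<open>Unit jumps force the value at the \<open>l\<close>-th jump time to be exactly
  \<open>l\<close>, which gives injectivity. A sum or product over the random set of jump times is
  thereby traded for one over an initial segment of the naturals, whose terms can be proved
  measurable one at a time.\<close>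

lemma bij_betw_nth_jump:
  assumes f: "counting_path f" and u: "unit_jumps_before f t" and t: "0 < t"
  shows "bij_betw (nth_jump f) {1..lft f t} {s. 0 < s \<and> s < t \<and> f s \<noteq> lft f s}"
proof -
  obtain a where a: "0 \<le> a" "a < t" "f a = lft f t"
    using counting_path_left_value[OF f t] by blast
  have *: "0 < nth_jump f l \<and> nth_jump f l \<le> a \<and> lft f (nth_jump f l) = l - 1 \<and> f (nth_jump f l) = l"
    if "l \<in> {1..lft f t}" for l
  proof -
    have l: "1 \<le> l" "l \<le> f a" using that a by auto
    note nj = nth_jump[OF f l a(1)]
    have "f (nth_jump f l) \<le> Suc (lft f (nth_jump f l))"
      using u nj a by (auto simp: unit_jumps_before_def)
    then show ?thesis using nj by auto
  qed
  have "inj_on (nth_jump f) {1..lft f t}"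
    by (metis (no_types, lifting) * inj_onI)
  moreover have "s \<in> nth_jump f ` {1..lft f t}" if s: "0 < s" "s < t" "f s \<noteq> lft f s" for s
  proof
    have l: "lft f s < f s" using lft_counting_path_le[OF f s(1)] s by simp
    have ft: "f s \<le> lft f t" using le_lft_counting_path[OF f] s by simp
    show "f s \<in> {1..lft f t}" using l ft by simp
    have "nth_jump f (f s) \<le> s" using l s by (intro nth_jump_le[OF f]) auto
    moreover have "\<not> nth_jump f (f s) < s"
    proof
      assume "nth_jump f (f s) < s"
      moreover have "f s \<le> f (nth_jump f (f s))" "0 < nth_jump f (f s)"
        using l s nth_jump[OF f, of "f s" s] by auto
      ultimately show False using le_lft_counting_path[OF f, of "nth_jump f (f s)" s] l by simp
    qed
    ultimately show "s = nth_jump f (f s)" by simp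
  qed
  ultimately show ?thesis using * a by (force simp: bij_betw_def)
qed

text \<open>The path is injective on its jump times, since a jump at a later time lifts it strictly
  above every earlier value, and its values are bounded by \<open>f t\<close>.\<close>

lemma finite_jumps:
  assumes f: "counting_path f"
  shows "finite {s. 0 < s \<and> s \<le> t \<and> f s \<noteq> lft f s}" (is "finite ?J")
proof -
  have "inj_on f ?J"
  proof (rule linorder_inj_onI)
    fix x y assume "x < y" "x \<in> ?J" "y \<in> ?J"
    then show "f x \<noteq> f y"
      using counting_path_no_jump[OF f, of x y y] by auto
  qed auto
  moreover have "f ` ?J \<subseteq> {..f t}" using counting_path_mono[OF f] by auto
  ultimately show ?thesis by (meson finite_atMost finite_imageD finite_subset)
qed

section \<open>Jump chains driven by a finite family of counting paths\<close>

definition total_count :: "'i set \<Rightarrow> ('i \<Rightarrow> real \<Rightarrow> nat) \<Rightarrow> real \<Rightarrow> nat" where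
  "total_count I N t = (\<Sum>c\<in>I. N c t)"

definition event_times :: "'i set \<Rightarrow> ('i \<Rightarrow> real \<Rightarrow> nat) \<Rightarrow> real set" where
  "event_times I N = {s. 0 < s \<and> (\<exists>c\<in>I. N c s \<noteq> lft (N c) s)}"

text \<open>Unspecified when several paths jump together. This is why measurability and evolution of
  the chain are stated on paths whose superposition has unit jumps.\<close>

definition mark :: "'i set \<Rightarrow> ('i \<Rightarrow> real \<Rightarrow> nat) \<Rightarrow> real \<Rightarrow> 'i" where
  "mark I N s = (THE c. c \<in> I \<and> N c s \<noteq> lft (N c) s)"

text \<open>The time set is a parameter so that the state at \<open>t\<close> and its left limit are
  instances of one definition, with \<open>{..t}\<close> and \<open>{..<t}\<close>, and no limit has
  to be taken.\<close>

definition chain_on :: "'i set \<Rightarrow> ('i \<Rightarrow> real \<Rightarrow> nat) \<Rightarrow> ('i \<Rightarrow> real \<Rightarrow> nat \<Rightarrow> nat) \<Rightarrow> nat \<Rightarrow> real set \<Rightarrow> nat" where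
  "chain_on I N act x A = fold (\<lambda>s. act (mark I N s) s) (sorted_list_of_set (event_times I N \<inter> A)) x"

abbreviation chain where "chain I N act x t \<equiv> chain_on I N act x {..t}"
abbreviation chain_left where "chain_left I N act x t \<equiv> chain_on I N act x {..<t}"

lemma sorted_list_of_set_insert_greatest:
  assumes "finite A" "\<And>x. x \<in> A \<Longrightarrow> x < (b::'a::linorder)"
  shows "sorted_list_of_set (insert b A) = sorted_list_of_set A @ [b]"
  by (rule sorted_list_of_set_unique[THEN iffD1])
    (use assms in \<open>auto simp: sorted_wrt_append card_insert_if strict_sorted_iff\<close>)

locale counting_family =
  fixes I :: "'i set" and N :: "'i \<Rightarrow> real \<Rightarrow> nat"
  assumes fin: "finite I" and cp: "\<And>c. c \<in> I \<Longrightarrow> counting_path (N c)"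
begin

lemma counting_path_total: "counting_path (total_count I N)"
  using counting_path_sum[OF fin cp] by (simp add: total_count_def[abs_def])

lemma lft_total: "0 < s \<Longrightarrow> lft (total_count I N) s = (\<Sum>c\<in>I. lft (N c) s)"
  using lft_sum[OF fin cp] by (simp add: total_count_def[abs_def])

lemma total_jump_iff: "0 < s \<Longrightarrow> total_count I N s \<noteq> lft (total_count I N) s \<longleftrightarrow> s \<in> event_times I N"
proof
  assume s: "0 < s"
  show "total_count I N s \<noteq> lft (total_count I N) s \<Longrightarrow> s \<in> event_times I N"
    using s unfolding lft_total[OF s] by (auto simp: total_count_def event_times_def intro!: sum.cong)
  assume "s \<in> event_times I N"
  then obtain c where c: "c \<in> I" "N c s \<noteq> lft (N c) s" by (auto simp: event_times_def)
  have "(\<Sum>c\<in>I. lft (N c) s) < (\<Sum>c\<in>I. N c s)"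
    using c lft_counting_path_le[OF cp s]
    by (intro sum_strict_mono_ex1[OF fin]) (auto intro!: bexI[of _ c] simp: le_neq_implies_less)
  then show "total_count I N s \<noteq> lft (total_count I N) s" unfolding lft_total[OF s] by (simp add: total_count_def)
qed

lemma finite_events: "finite (event_times I N \<inter> {..t})" "finite (event_times I N \<inter> {..<t})"
proof -
  have "event_times I N \<inter> {..t} \<subseteq> {s. 0 < s \<and> s \<le> t \<and> total_count I N s \<noteq> lft (total_count I N) s}"
    using total_jump_iff by (auto simp: event_times_def)
  then show 1: "finite (event_times I N \<inter> {..t})"
    using finite_jumps[OF counting_path_total] by (rule finite_subset)
  show "finite (event_times I N \<inter> {..<t})"
    by (rule finite_subset[OF _ 1]) auto
qed

lemma no_events_iff:
  assumes "0 \<le> a" "a \<le> t"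
  shows "total_count I N a = total_count I N t \<longleftrightarrow> event_times I N \<inter> {a<..t} = {}"
proof -
  have "total_count I N a = total_count I N t \<longleftrightarrow> (\<forall>s. a < s \<and> s \<le> t \<longrightarrow> lft (total_count I N) s = total_count I N s)"
    by (rule counting_path_eq_iff[OF counting_path_total assms])
  also have "\<dots> \<longleftrightarrow> event_times I N \<inter> {a<..t} = {}"
    using total_jump_iff assms(1) by (auto simp: set_eq_iff) (metis le_less_trans)+
  finally show ?thesis .
qed

lemma total_eq_component:
  assumes "0 \<le> a" "a \<le> t" "total_count I N a = total_count I N t" "c \<in> I"
  shows "N c a = N c t"
proof (rule ccontr)
  assume "N c a \<noteq> N c t"
  then have "(\<Sum>c\<in>I. N c a) < (\<Sum>c\<in>I. N c t)"
    using counting_path_mono[OF cp, of _ a t] assms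
    by (intro sum_strict_mono_ex1[OF fin]) (auto intro!: bexI[of _ c] simp: le_neq_implies_less)
  then show False using assms by (simp add: total_count_def)
qed

lemma chain_cong:
  assumes "0 \<le> a" "a \<le> t" "total_count I N a = total_count I N t"
  shows "chain I N act x t = chain I N act x a"
proof -
  have "event_times I N \<inter> {..t} = event_times I N \<inter> {..a}"
    using no_events_iff[OF assms(1,2)] assms by fastforce
  then show ?thesis by (simp add: chain_on_def)
qed

lemma chain_left_eq:
  assumes "0 \<le> a" "a < s" "total_count I N a = lft (total_count I N) s"
  shows "chain_left I N act x s = chain I N act x a"
proof -
  have no: "r \<notin> event_times I N" if "a < r" "r < s" for r
  proof -
    have "total_count I N r = total_count I N a"
      using le_lft_counting_path[OF counting_path_total, of r s]
        counting_path_mono[OF counting_path_total, of a r] assms that by simp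
    then show ?thesis using no_events_iff[of a r] assms that by auto
  qed
  have "event_times I N \<inter> {..<s} = event_times I N \<inter> {..a}"
    using no assms(2) by (auto intro: leI)
  then show ?thesis by (simp add: chain_on_def)
qed

lemma chain_event:
  assumes "s \<in> event_times I N"
  shows "chain I N act x s = act (mark I N s) s (chain_left I N act x s)"
proof -
  have "event_times I N \<inter> {..s} = insert s (event_times I N \<inter> {..<s})" using assms by auto
  then have "sorted_list_of_set (event_times I N \<inter> {..s}) = sorted_list_of_set (event_times I N \<inter> {..<s}) @ [s]"
    using sorted_list_of_set_insert_greatest[OF finite_events(2), of s s] by auto
  then show ?thesis by (simp add: chain_on_def)
qed

lemma chain_no_event:
  assumes "s \<notin> event_times I N"
  shows "chain I N act x s = chain_left I N act x s"
proof -
  have "event_times I N \<inter> {..s} = event_times I N \<inter> {..<s}" using assms by (auto simp: order_le_less)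
  then show ?thesis by (simp add: chain_on_def)
qed

lemma chain_0: "t \<le> 0 \<Longrightarrow> chain I N act x t = x"
proof -
  assume "t \<le> 0"
  then have "event_times I N \<inter> {..t} = {}" by (auto simp: event_times_def)
  then show ?thesis by (simp add: chain_on_def)
qed

text \<open>All components move upwards, so a total increase of at most one leaves room for a single
  component, and that one moves by exactly one.\<close>

lemma unit_event:
  assumes "0 < s" "total_count I N s \<le> Suc (lft (total_count I N) s)" "c \<in> I" "N c s \<noteq> lft (N c) s"
  shows "N c s = Suc (lft (N c) s)" "\<And>d. d \<in> I \<Longrightarrow> d \<noteq> c \<Longrightarrow> N d s = lft (N d) s" "mark I N s = c"
    and "total_count I N s = Suc (lft (total_count I N) s)"
proof -
  have le: "lft (N d) s \<le> N d s" if "d \<in> I" for d using lft_counting_path_le[OF cp[OF that] assms(1)] .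
  have *: "(\<Sum>d\<in>I. N d s) = N c s + (\<Sum>d\<in>I-{c}. N d s)"
    "(\<Sum>d\<in>I. lft (N d) s) = lft (N c) s + (\<Sum>d\<in>I-{c}. lft (N d) s)"
    using fin assms by (auto simp: sum.remove)
  have ge: "(\<Sum>d\<in>I-{c}. lft (N d) s) \<le> (\<Sum>d\<in>I-{c}. N d s)" by (intro sum_mono le) auto
  note S = assms(2)[unfolded lft_total[OF assms(1)] total_count_def *]
  show 1: "N c s = Suc (lft (N c) s)" using S ge le[OF assms(3)] assms(4) by linarith
  then have eq: "(\<Sum>d\<in>I-{c}. lft (N d) s) = (\<Sum>d\<in>I-{c}. N d s)" using S ge by linarith
  show 2: "N d s = lft (N d) s" if "d \<in> I" "d \<noteq> c" for d
  proof (rule ccontr)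
    assume "N d s \<noteq> lft (N d) s"
    then have "(\<Sum>d\<in>I-{c}. lft (N d) s) < (\<Sum>d\<in>I-{c}. N d s)"
      using that le fin by (intro sum_strict_mono_ex1) (auto intro!: bexI[of _ d] simp: le_neq_implies_less)
    then show False using eq by simp
  qed
  show "mark I N s = c" unfolding mark_def using assms 2 by (intro the_equality) auto
  show "total_count I N s = Suc (lft (total_count I N) s)" unfolding lft_total[OF assms(1)] total_count_def * using eq 1 by simp
qed

lemma unit_component:
  assumes "unit_jumps (total_count I N) t" "c \<in> I" shows "unit_jumps (N c) t"
  unfolding unit_jumps_def
proof (intro allI impI)
  fix s assume s: "0 < s \<and> s \<le> t"
  show "N c s \<le> Suc (lft (N c) s)"
    using unit_event(1)[of s c] assms s unfolding unit_jumps_def by (metis le_SucI order_refl)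
qed

lemma nth_jump_eqI:
  assumes "c \<in> I" "0 < s" "s \<le> t" "N c s \<noteq> lft (N c) s" "N c s = N c t"
  shows "nth_jump (N c) (N c t) = s"
proof -
  note f = cp[OF assms(1)]
  have l: "lft (N c) s < N c s" using lft_counting_path_le[OF f assms(2)] assms by simp
  then have "nth_jump (N c) (N c s) \<le> s" using assms by (intro nth_jump_le[OF f]) auto
  moreover have "\<not> nth_jump (N c) (N c s) < s"
  proof
    assume "nth_jump (N c) (N c s) < s"
    moreover have "N c s \<le> N c (nth_jump (N c) (N c s))" "0 < nth_jump (N c) (N c s)"
      using l assms nth_jump[OF f, of "N c s" s] by auto
    ultimately show False using le_lft_counting_path[OF f, of "nth_jump (N c) (N c s)" s] l by simp
  qed
  ultimately show ?thesis using assms by simp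
qed

text \<open>Expresses the state at \<open>t\<close> by the state at an earlier deterministic time
  and the time of the latest jump of one channel. This is the recursion on which measurability of
  the chain rests.\<close>

lemma single_event:
  assumes "0 \<le> a" "a < t" "total_count I N t = Suc (total_count I N a)" "c \<in> I" "N c a < N c t"
  shows "chain I N act x t = act c (nth_jump (N c) (N c t)) (chain I N act x a)"
    and "unit_jumps (total_count I N) a \<Longrightarrow> unit_jumps (total_count I N) t"
proof -
  let ?K = "total_count I N"
  note K = counting_path_total
  obtain s where s: "a < s" "s \<le> t" "?K s = ?K t" "lft ?K s < ?K s"
    using counting_path_last_jump[OF K assms(1), of t] assms by auto
  have lK: "lft ?K s = ?K a" using le_lft_counting_path[OF K assms(1) s(1)] s assms by simp
  have Nct: "N c s = N c t" using total_eq_component[of s t c] assms s by simp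
  obtain r where r: "a \<le> r" "r < s" "N c r = lft (N c) s"
  proof -
    obtain r where r: "0 \<le> r" "r < s" "\<And>r'. r \<le> r' \<Longrightarrow> r' < s \<Longrightarrow> N c r' = lft (N c) s"
      using counting_path_left[OF cp[OF assms(4)], of s] assms s by auto
    then show ?thesis using that[of "max a r"] s by simp
  qed
  have "?K r = ?K a"
    using le_lft_counting_path[OF K, of r s] lK counting_path_mono[OF K assms(1) r(1)] r assms by simp
  then have "N c a = N c r" using total_eq_component[of a r c] r assms by simp
  then have jump: "N c s \<noteq> lft (N c) s" using r Nct assms by simp
  have s0: "0 < s" using assms s by simp
  have unit: "?K s \<le> Suc (lft ?K s)" using lK s assms by simp
  have "chain I N act x t = chain I N act x s" using chain_cong[of s t] s s0 by simp
  also have "\<dots> = act c s (chain_left I N act x s)"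
    using chain_event[of s] unit_event(3)[OF s0 unit assms(4) jump] assms(4) jump s0
    by (auto simp: event_times_def)
  also have "\<dots> = act c s (chain I N act x a)" using chain_left_eq[OF assms(1) s(1)] lK by simp
  finally show "chain I N act x t = act c (nth_jump (N c) (N c t)) (chain I N act x a)"
    using nth_jump_eqI[OF assms(4) s0 s(2) jump Nct] by simp
  assume u: "unit_jumps ?K a"
  show "unit_jumps ?K t" unfolding unit_jumps_def
  proof (intro allI impI)
    fix r assume r: "0 < r \<and> r \<le> t"
    show "?K r \<le> Suc (lft ?K r)"
    proof (cases "r \<le> a")
      case False
      then show ?thesis using le_lft_counting_path[OF K assms(1), of r] counting_path_mono[OF K, of r t]
          r assms by simp
    qed (use u r in \<open>auto simp: unit_jumps_def\<close>)
  qed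
qed

text \<open>Supplies the earlier time for \<open>single_event\<close>, chosen rational so that a
  countable union over all candidates is possible.\<close>

lemma last_event:
  assumes "0 \<le> t" "unit_jumps (total_count I N) t" "total_count I N t = Suc m"
  obtains a c where "a \<in> \<rat>" "0 \<le> a" "a < t" "c \<in> I" "total_count I N a = m" "N c a < N c t"
    "unit_jumps (total_count I N) a"
proof -
  let ?K = "total_count I N"
  note K = counting_path_total
  have "?K 0 = 0" using K by (simp add: counting_path_def)
  then obtain s where s: "0 < s" "s \<le> t" "?K s = ?K t" "lft ?K s < ?K s"
    using counting_path_last_jump[OF K order_refl assms(1)] assms by auto
  have lK: "lft ?K s = m" using s assms by (force simp: unit_jumps_def)
  obtain b where b: "0 \<le> b" "b < s" "\<And>r. b \<le> r \<Longrightarrow> r < s \<Longrightarrow> ?K r = lft ?K s"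
    using counting_path_left[OF K s(1)] by metis
  obtain a where a: "a \<in> \<rat>" "b < a" "a < s" using Rats_dense_in_real[OF b(2)] by auto
  have Ka: "?K a = m" using b(3)[of a] a lK by simp
  obtain c where c: "c \<in> I" "N c s \<noteq> lft (N c) s"
    using total_jump_iff[OF s(1)] s(4) by (auto simp: event_times_def)
  have "N c a \<le> lft (N c) s" using le_lft_counting_path[OF cp[OF c(1)], of a s] a b by simp
  also have "\<dots> < N c s" using lft_counting_path_le[OF cp[OF c(1)] s(1)] c(2) by simp
  also have "N c s \<le> N c t" using counting_path_mono[OF cp[OF c(1)]] s by simp
  finally have "N c a < N c t" .
  then show ?thesis using that[of a c] a b c Ka s assms by (auto simp: unit_jumps_def)
qed

end

section \<open>Predictability\<close>

lemma measurable_count_space_natI: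
  assumes "\<And>j::nat. {x \<in> space M. f x = j} \<in> sets M"
  shows "f \<in> measurable M (count_space UNIV)"
  by (subst measurable_count_space_eq2_countable)
    (use assms in \<open>auto simp: vimage_def Int_def conj_commute\<close>)

lemma borel_measurable_natI: "f \<in> measurable M (count_space (UNIV::nat set)) \<Longrightarrow> f \<in> borel_measurable M"
  using measurable_compose[of f M "count_space UNIV" "\<lambda>x. x" borel] by simp

text \<open>Half-lines \<open>{a<..}\<close> replace the usual intervals (a,b]: they generate the
  same sigma-algebra, and their products with events known at \<open>a\<close> are stable under
  intersection. Time 0 lies outside the space, so initial values are treated separately.\<close>

definition predictable :: "(real \<Rightarrow> 'x measure) \<Rightarrow> 'x set \<Rightarrow> (real \<times> 'x) measure" where
  "predictable F Om = sigma ({0<..} \<times> Om) {{a<..} \<times> B | a B. 0 \<le> a \<and> B \<in> sets (F a)}"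

locale filtration =
  fixes F :: "real \<Rightarrow> 'x measure" and Om :: "'x set"
  assumes space_F: "\<And>a. space (F a) = Om"
    and mono_F: "\<And>a b. 0 \<le> a \<Longrightarrow> a \<le> b \<Longrightarrow> sets (F a) \<subseteq> sets (F b)"
begin

abbreviation "Pr \<equiv> predictable F Om"

lemma measurable_F_mono: "0 \<le> a \<Longrightarrow> a \<le> b \<Longrightarrow> f \<in> measurable (F a) M \<Longrightarrow> f \<in> measurable (F b) M"
  using mono_F[of a b] space_F by (auto simp: measurable_def)

lemma generators_subset: "{{a<..} \<times> B | a B. 0 \<le> a \<and> B \<in> sets (F a)} \<subseteq> Pow ({0<..} \<times> Om)"
  using sets.sets_into_space space_F by fastforce

lemma space_Pr: "space Pr = {0<..} \<times> Om"
  unfolding predictable_def by (simp add: space_measure_of[OF generators_subset])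

lemma sets_Pr: "sets Pr = sigma_sets ({0<..} \<times> Om) {{a<..} \<times> B | a B. 0 \<le> a \<and> B \<in> sets (F a)}"
  unfolding predictable_def by (simp add: sets_measure_of[OF generators_subset])

lemma rect_in_Pr: "0 \<le> a \<Longrightarrow> B \<in> sets (F a) \<Longrightarrow> {a<..} \<times> B \<in> sets Pr"
  unfolding sets_Pr by (intro sigma_sets.Basic) auto

lemma measurable_into_Pr:
  assumes "f \<in> space M \<rightarrow> {0<..} \<times> Om"
    and "\<And>a B. 0 \<le> a \<Longrightarrow> B \<in> sets (F a) \<Longrightarrow> f -` ({a<..} \<times> B) \<inter> space M \<in> sets M"
  shows "f \<in> measurable M Pr"
  unfolding predictable_def
  by (rule measurable_measure_of[OF generators_subset assms(1)]) (use assms(2) in auto)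

lemma measurable_fst_Pr: "fst \<in> borel_measurable Pr"
proof (subst borel_measurable_iff_greater, intro allI)
  fix a :: real
  have "{w \<in> space Pr. a < fst w} = (if 0 \<le> a then {a<..} \<times> Om else space Pr)"
    by (auto simp: space_Pr)
  then show "{w \<in> space Pr. a < fst w} \<in> sets Pr"
    using rect_in_Pr[of a Om] sets.top[of "F a"] by (auto simp: space_F)
qed

lemma measurable_snd_Pr: "snd \<in> measurable Pr (F 0)"
proof (rule measurableI)
  fix B assume B: "B \<in> sets (F 0)"
  have "snd -` B \<inter> space Pr = {0<..} \<times> B"
    using sets.sets_into_space[OF B] by (auto simp: space_Pr space_F)
  then show "snd -` B \<inter> space Pr \<in> sets Pr" using rect_in_Pr[of 0 B] B by simp
qed (auto simp: space_Pr space_F)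

lemma measurable_Pr_F0:
  assumes "f \<in> measurable (borel \<Otimes>\<^sub>M F 0) M" shows "f \<in> measurable Pr M"
proof -
  have "(\<lambda>w. (fst w, snd w)) \<in> measurable Pr (borel \<Otimes>\<^sub>M F 0)"
    by (intro measurable_Pair measurable_fst_Pr measurable_snd_Pr)
  from measurable_compose[OF this assms] show ?thesis by simp
qed

text \<open>A predictable process evaluated at a random time bounded by \<open>t\<close> is known at time \<open>t\<close>;
  the random time itself need only be known at time \<open>t\<close>.\<close>
lemma measurable_eval_Pr:
  assumes s: "s \<in> borel_measurable (F t)" and "\<And>w. w \<in> Om \<Longrightarrow> 0 < s w \<and> s w \<le> t"
  shows "(\<lambda>w. (s w, w)) \<in> measurable (F t) Pr"
proof (rule measurable_into_Pr)
  show "(\<lambda>w. (s w, w)) \<in> space (F t) \<rightarrow> {0<..} \<times> Om" using assms by (auto simp: space_F)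
  fix a B assume a: "0 \<le> a" and B: "B \<in> sets (F a)"
  show "(\<lambda>w. (s w, w)) -` ({a<..} \<times> B) \<inter> space (F t) \<in> sets (F t)"
  proof (cases "a \<le> t")
    case True
    then have "B \<in> sets (F t)" using mono_F[OF a True] B by auto
    moreover have "{w \<in> space (F t). a < s w} \<in> sets (F t)" using s by measurable
    moreover have "(\<lambda>w. (s w, w)) -` ({a<..} \<times> B) \<inter> space (F t) = B \<inter> {w \<in> space (F t). a < s w}"
      using sets.sets_into_space[OF B] by (auto simp: space_F)
    ultimately show ?thesis by (metis sets.Int)
  next
    case False
    then have "(\<lambda>w. (s w, w)) -` ({a<..} \<times> B) \<inter> space (F t) = {}"
      using assms(2) by (fastforce simp: space_F)
    then show ?thesis by simp
  qed
qed

lemma measurable_section_Pr: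
  assumes "0 < t" shows "(\<lambda>w. (t, w)) \<in> measurable (F t) Pr"
  using measurable_eval_Pr[of "\<lambda>_. t" t] assms by simp

text \<open>What is known at an earlier time \<open>r\<close> is also known at \<open>s\<close>, so
  moving a point back in time is a measurable map of the predictable space. Outside 0 < r < s the
  auxiliary map \<open>g\<close> keeps the point, and the indicator removes it from the
  integral.\<close>

lemma measurable_integral_Pr:
  fixes f :: "real \<times> 'x \<Rightarrow> real"
  assumes f: "f \<in> borel_measurable Pr"
  shows "(\<lambda>(s, w). LBINT r:{0<..<s}. f (r, w)) \<in> borel_measurable Pr"
proof -
  define g :: "(real \<times> 'x) \<times> real \<Rightarrow> real \<times> 'x"
    where "g = (\<lambda>(w, r). if 0 < r \<and> r < fst w then (r, snd w) else w)"
  have "g \<in> measurable (Pr \<Otimes>\<^sub>M lborel) Pr"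
  proof (rule measurable_into_Pr)
    show "g \<in> space (Pr \<Otimes>\<^sub>M lborel) \<rightarrow> {0<..} \<times> Om"
      by (auto simp: g_def space_pair_measure space_Pr split: if_splits)
    fix a B assume a: "0 \<le> a" and B: "B \<in> sets (F a)"
    note [measurable] = rect_in_Pr[OF a B] measurable_fst_Pr
    have "g -` ({a<..} \<times> B) \<inter> space (Pr \<Otimes>\<^sub>M lborel) =
      {x \<in> space (Pr \<Otimes>\<^sub>M lborel). (0 < snd x \<and> snd x < fst (fst x) \<longrightarrow> a < snd x) \<and> fst x \<in> {a<..} \<times> B}"
      using a by (auto simp: g_def space_pair_measure space_Pr split: if_splits prod.splits)
    also have "\<dots> \<in> sets (Pr \<Otimes>\<^sub>M lborel)" by measurable
    finally show "g -` ({a<..} \<times> B) \<inter> space (Pr \<Otimes>\<^sub>M lborel) \<in> sets (Pr \<Otimes>\<^sub>M lborel)" .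
  qed
  note [measurable] = this f measurable_fst_Pr
  have "case_prod (\<lambda>w r. indicator {r. 0 < r \<and> r < fst w} r *\<^sub>R f (g (w, r))) \<in> borel_measurable (Pr \<Otimes>\<^sub>M lborel)"
    unfolding indicator_def by measurable
  from lborel.borel_measurable_lebesgue_integral[of
      "\<lambda>w r. indicator {r. 0 < r \<and> r < fst w} r *\<^sub>R f (g (w, r))", OF this]
  have "(\<lambda>w. LBINT r. indicator {r. 0 < r \<and> r < fst w} r *\<^sub>R f (g (w, r))) \<in> borel_measurable Pr"
    by simp
  also have "(\<lambda>w. LBINT r. indicator {r. 0 < r \<and> r < fst w} r *\<^sub>R f (g (w, r))) =
    (\<lambda>(s, w). LBINT r:{0<..<s}. f (r, w))"
    unfolding set_lebesgue_integral_def
    by (auto simp: g_def fun_eq_iff indicator_def intro!: Bochner_Integration.integral_cong)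
  finally show ?thesis .
qed

end

text \<open>Actions, rates and the initial state are known at time 0 once the current state is
  given; all later randomness enters through the driving paths. The channels in \<open>C\<close>
  carry rates and are reweighted later, those in \<open>I - C\<close> only act on the state.\<close>

locale driven_chain = filtration F Om
  for F :: "real \<Rightarrow> 'x measure" and Om :: "'x set" +
  fixes I C :: "'i set" and N :: "'i \<Rightarrow> real \<Rightarrow> 'x \<Rightarrow> nat"
    and act :: "'i \<Rightarrow> real \<Rightarrow> nat \<Rightarrow> 'x \<Rightarrow> nat"
    and q :: "'i \<Rightarrow> real \<Rightarrow> nat \<Rightarrow> 'x \<Rightarrow> real"
    and x0 :: "'x \<Rightarrow> nat"
  assumes fin: "finite I" and CI: "C \<subseteq> I"
    and cp: "\<And>c w. c \<in> I \<Longrightarrow> w \<in> Om \<Longrightarrow> counting_path (\<lambda>t. N c t w)"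
    and adapted: "\<And>c t. c \<in> I \<Longrightarrow> 0 \<le> t \<Longrightarrow> N c t \<in> measurable (F t) (count_space UNIV)"
    and act_meas: "\<And>c i. c \<in> I \<Longrightarrow> (\<lambda>(s, w). act c s i w) \<in> measurable (borel \<Otimes>\<^sub>M F 0) (count_space UNIV)"
    and q_meas: "\<And>c i. c \<in> C \<Longrightarrow> (\<lambda>(s, w). q c s i w) \<in> borel_measurable (borel \<Otimes>\<^sub>M F 0)"
    and x0_meas: "x0 \<in> measurable (F 0) (count_space UNIV)"
begin

abbreviation "paths w \<equiv> (\<lambda>c t. N c t w)"
abbreviation "K t w \<equiv> total_count I (paths w) t"
abbreviation "X t w \<equiv> chain I (paths w) (\<lambda>c s x. act c s x w) (x0 w) t"
abbreviation "XL t w \<equiv> chain_left I (paths w) (\<lambda>c s x. act c s x w) (x0 w) t"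

lemma counting_family: "w \<in> Om \<Longrightarrow> counting_family I (paths w)"
  by (rule counting_family.intro) (auto intro: fin cp)

lemma K_meas: "0 \<le> t \<Longrightarrow> K t \<in> measurable (F t) (count_space UNIV)"
  unfolding total_count_def[abs_def] using adapted by (intro measurable_sum_nat) auto

text \<open>For \<open>r < t\<close> the jump has occurred by \<open>r\<close> exactly if
  \<open>l\<close> is at most the count at \<open>r\<close>. The level \<open>l\<close> may be
  random and known only at \<open>t\<close>. The default \<open>t\<close> keeps the time in (0,t],
  where predictable processes can be evaluated.\<close>

lemma last_jump_meas:
  assumes c: "c \<in> I" and t: "0 < t"
    and l: "l \<in> measurable (F t) (count_space UNIV)"
  shows "(\<lambda>w. if 1 \<le> l w \<and> l w \<le> N c t w then nth_jump (\<lambda>t. N c t w) (l w) else t) \<in> borel_measurable (F t)"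
    (is "?f \<in> _")
proof (subst borel_measurable_iff_le, intro allI)
  fix r :: real
  have *: "?f w \<le> r \<longleftrightarrow> (if t \<le> r then True else 0 \<le> r \<and> 1 \<le> l w \<and> l w \<le> N c r w)" if "w \<in> Om" for w
  proof (cases "1 \<le> l w \<and> l w \<le> N c t w")
    case True
    then have lw: "1 \<le> l w" "l w \<le> N c t w" by auto
    note nth_jump[OF cp[OF c that] lw(1), of t] nth_jump_le_iff[OF cp[OF c that] lw(1), of t r]
    with True t show ?thesis by (auto simp: not_le)
  next
    case False
    then have "\<not> (0 \<le> r \<and> r < t \<and> 1 \<le> l w \<and> l w \<le> N c r w)"
      using counting_path_mono[OF cp[OF c that], of r t] by fastforce
    with False show ?thesis by auto
  qed
  have "{w \<in> space (F t). ?f w \<le> r} =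
    (if t \<le> r then space (F t) else if 0 \<le> r then {w \<in> space (F t). 1 \<le> l w \<and> l w \<le> N c r w} else {})"
    using * by (simp add: space_F cong: conj_cong)
  moreover have "{w \<in> space (F t). 1 \<le> l w \<and> l w \<le> N c r w} \<in> sets (F t)" if "0 \<le> r" "r < t"
  proof -
    have [measurable]: "N c r \<in> measurable (F t) (count_space UNIV)"
      using measurable_F_mono[OF _ _ adapted[OF c]] that by simp
    note [measurable] = l borel_measurable_natI[OF l] borel_measurable_natI[OF this]
    show ?thesis by measurable
  qed
  ultimately show "{w \<in> space (F t). ?f w \<le> r} \<in> sets (F t)" by auto
qed

text \<open>Induction on the number \<open>m\<close> of events. A rational time just before the last
  event separates it from the others, so the event at \<open>t\<close> is a countable union of
  events at an earlier time followed by a single update.\<close>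

lemma X_sets:
  assumes "0 \<le> t"
  shows "{w \<in> Om. unit_jumps (total_count I (paths w)) t \<and> K t w = m \<and> X t w = j} \<in> sets (F t)"
  using assms
proof (induction m arbitrary: t j)
  case 0
  have "{w \<in> Om. unit_jumps (total_count I (paths w)) t \<and> K t w = 0 \<and> X t w = j} =
    {w \<in> space (F t). K t w = 0 \<and> x0 w = j}"
  proof -
    have "X t w = x0 w \<and> unit_jumps (total_count I (paths w)) t" if w: "w \<in> Om" "K t w = 0" for w
    proof -
      interpret counting_family I "paths w" by (rule counting_family[OF w(1)])
      have "K 0 w = K t w" using w counting_path_total by (simp add: counting_path_def)
      then have "K s w = 0" if "0 < s" "s \<le> t" for s
        using counting_path_mono[OF counting_path_total, of s t] that w by simp
      then have "unit_jumps (total_count I (paths w)) t" by (simp add: unit_jumps_def)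
      then show ?thesis using chain_cong[of 0 t] chain_0[of 0] 0 \<open>K 0 w = K t w\<close> by simp
    qed
    then show ?thesis by (auto simp: space_F)
  qed
  also have "\<dots> \<in> sets (F t)"
  proof -
    note [measurable] = K_meas[OF 0] measurable_F_mono[OF order_refl 0 x0_meas]
    show ?thesis by measurable
  qed
  finally show ?case .
next
  case (Suc m)
  \<comment> \<open>The conditional has the shape of \<open>last_jump_meas\<close> with the level
    \<open>N c t w\<close>.\<close>
  define th where "th c w = (if 1 \<le> N c t w \<and> N c t w \<le> N c t w then nth_jump (\<lambda>t. N c t w) (N c t w) else t)" for c w
  define A where "A a i = {w \<in> Om. unit_jumps (total_count I (paths w)) a \<and> K a w = m \<and> X a w = i}" for a i
  define B where "B a i c = {w \<in> space (F t). K t w = Suc m \<and> N c a w < N c t w \<and> act c (th c w) i w = j}" for a i c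
  have eq: "{w \<in> Om. unit_jumps (total_count I (paths w)) t \<and> K t w = Suc m \<and> X t w = j} =
    (\<Union>a\<in>{a\<in>\<rat>. 0 \<le> a \<and> a < t}. \<Union>i. \<Union>c\<in>I. A a i \<inter> B a i c)" (is "?L = ?R")
  proof (intro set_eqI iffI)
    fix w assume "w \<in> ?L"
    then have w: "w \<in> Om" "unit_jumps (total_count I (paths w)) t" "K t w = Suc m" "X t w = j" by auto
    interpret counting_family I "paths w" by (rule counting_family[OF w(1)])
    obtain a c where a: "a \<in> \<rat>" "0 \<le> a" "a < t" "c \<in> I" "K a w = m" "N c a w < N c t w"
      "unit_jumps (total_count I (paths w)) a"
      using last_event[OF Suc.prems w(2,3)] by blast
    have "w \<in> A a (X a w) \<inter> B a (X a w) c"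
      using a w single_event(1)[of a t c "\<lambda>c s x. act c s x w" "x0 w"]
      by (auto simp: A_def B_def th_def space_F)
    then show "w \<in> ?R" using a by blast
  next
    fix w assume "w \<in> ?R"
    then obtain a i c where a: "a \<in> \<rat>" "0 \<le> a" "a < t" "c \<in> I" "w \<in> A a i" "w \<in> B a i c" by blast
    then have w: "w \<in> Om" by (simp add: A_def)
    interpret counting_family I "paths w" by (rule counting_family[OF w])
    show "w \<in> ?L"
      using a w single_event[of a t c] by (auto simp: A_def B_def th_def)
  qed
  have "countable {a\<in>\<rat>. 0 \<le> a \<and> a < t}" using countable_rat by (rule countable_subset[rotated]) auto
  moreover have "A a i \<inter> B a i c \<in> sets (F t)" if a: "a \<in> \<rat>" "0 \<le> a" "a < t" and c: "c \<in> I" for a i c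
  proof -
    have "A a i \<in> sets (F t)"
      using Suc.IH[of a i] a mono_F[of a t] by (auto simp: A_def)
    moreover have "B a i c \<in> sets (F t)"
    proof -
      have [measurable]: "th c \<in> borel_measurable (F t)"
        unfolding th_def using a c by (intro last_jump_meas adapted) auto
      have "(\<lambda>w. (th c w, w)) \<in> measurable (F t) (borel \<Otimes>\<^sub>M F 0)"
        using measurable_F_mono[of 0 t "\<lambda>w. w" "F 0"] Suc.prems by (intro measurable_Pair) auto
      from measurable_compose[OF this act_meas[OF c, of i]]
      have [measurable]: "(\<lambda>w. act c (th c w) i w) \<in> measurable (F t) (count_space UNIV)" by simp
      have [measurable]: "N c a \<in> measurable (F t) (count_space UNIV)" "N c t \<in> measurable (F t) (count_space UNIV)"
        "K t \<in> measurable (F t) (count_space UNIV)"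
        using measurable_F_mono[OF a(2) _ adapted[OF c a(2)]] a adapted[OF c Suc.prems] K_meas[OF Suc.prems] by auto
      note [measurable] = this[THEN borel_measurable_natI]
      show ?thesis unfolding B_def by measurable
    qed
    ultimately show ?thesis by (rule sets.Int)
  qed
  then have 1: "(\<Union>c\<in>I. A a i \<inter> B a i c) \<in> sets (F t)" if "a \<in> {a\<in>\<rat>. 0 \<le> a \<and> a < t}" for a i
    using that by (intro sets.finite_UN fin) auto
  have 2: "(\<Union>i. \<Union>c\<in>I. A a i \<inter> B a i c) \<in> sets (F t)" if "a \<in> {a\<in>\<rat>. 0 \<le> a \<and> a < t}" for a
    using 1[OF that] by (intro sets.countable_UN) blast
  show ?case unfolding eq
    by (rule sets.countable_UN'[OF \<open>countable _\<close> image_subsetI[OF 2]])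
qed

definition good_left :: "real \<Rightarrow> 'x \<Rightarrow> bool" where
  "good_left s w \<longleftrightarrow> unit_jumps_before (total_count I (paths w)) s"

text \<open>The predictable version of the left limit of the chain. After a simultaneous jump the
  fold depends on unspecified marks, hence the default value on such paths.\<close>

definition Y :: "real \<Rightarrow> 'x \<Rightarrow> nat" where
  "Y s w = (if good_left s w then XL s w else 0)"

text \<open>The left limit at \<open>s\<close> is \<open>j\<close> if the state is \<open>j\<close>
  at some rational \<open>a < s\<close> and no event occurs strictly between \<open>a\<close> and
  \<open>s\<close>. The second condition is predictable as a complement: an event before
  \<open>s\<close> is detected at some rational \<open>b < s\<close> and so belongs to a generating
  rectangle starting at \<open>b\<close>.\<close>

lemma Y_sets: "{x \<in> space Pr. good_left (fst x) (snd x) \<and> XL (fst x) (snd x) = j} \<in> sets Pr"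
proof -
  define A where "A a = {w \<in> Om. unit_jumps (total_count I (paths w)) a \<and> X a w = j}" for a
  define B where "B a b = {w \<in> space (F b). K a w < K b w}" for a b
  define D where "D = {a\<in>\<rat>. (0::real) \<le> a}"
  have D: "countable D" unfolding D_def using countable_rat by (rule countable_subset[rotated]) auto
  have A: "A a \<in> sets (F a)" if "0 \<le> a" for a
  proof -
    have "A a = (\<Union>m. {w \<in> Om. unit_jumps (total_count I (paths w)) a \<and> K a w = m \<and> X a w = j})"
      by (auto simp: A_def)
    then show ?thesis using X_sets[OF that] by auto
  qed
  have B: "B a b \<in> sets (F b)" if "0 \<le> a" "a \<le> b" for a b
  proof -
    have [measurable]: "K a \<in> measurable (F b) (count_space UNIV)" "K b \<in> measurable (F b) (count_space UNIV)"
      using that K_meas measurable_F_mono[OF that K_meas] by auto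
    note [measurable] = this[THEN borel_measurable_natI]
    show ?thesis unfolding B_def by measurable
  qed
  have "{x \<in> space Pr. good_left (fst x) (snd x) \<and> XL (fst x) (snd x) = j} =
    (\<Union>a\<in>D. {a<..} \<times> A a - (\<Union>b\<in>{b\<in>D. a \<le> b}. {b<..} \<times> B a b))" (is "?L = ?R")
  proof (intro set_eqI iffI)
    fix x assume "x \<in> ?L"
    then obtain s w where x: "x = (s, w)" "0 < s" "w \<in> Om" "good_left s w" "XL s w = j"
      by (cases x) (auto simp: space_Pr)
    interpret counting_family I "paths w" by (rule counting_family[OF x(3)])
    obtain a' where a': "0 \<le> a'" "a' < s"
      "\<And>r. a' \<le> r \<Longrightarrow> r < s \<Longrightarrow> K r w = lft (total_count I (paths w)) s"
      using counting_path_left[OF counting_path_total x(2)] by metis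
    obtain a where a: "a \<in> \<rat>" "a' < a" "a < s" using Rats_dense_in_real[OF a'(2)] by auto
    have "w \<in> A a" using x a a' chain_left_eq[of a s]
      by (auto simp: A_def good_left_def unit_jumps_def unit_jumps_before_def)
    moreover have "w \<notin> B a b" if "a \<le> b" "b < s" for b
      using a'(3)[of a] a'(3)[of b] a that by (simp add: B_def)
    ultimately show "x \<in> ?R" using a a' x by (auto simp: D_def intro!: bexI[of _ a])
  next
    fix x assume "x \<in> ?R"
    then obtain a where a: "a \<in> \<rat>" "0 \<le> a" "x \<in> {a<..} \<times> A a" "\<And>b. b \<in> \<rat> \<Longrightarrow> a \<le> b \<Longrightarrow> x \<notin> {b<..} \<times> B a b"
      by (force simp: D_def)
    obtain s w where x: "x = (s, w)" "a < s" "w \<in> A a" using a(3) by auto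
    then have w: "w \<in> Om" by (simp add: A_def)
    interpret counting_family I "paths w" by (rule counting_family[OF w])
    let ?K = "total_count I (paths w)"
    have s: "0 < s" using a x by simp
    obtain a' where a': "0 \<le> a'" "a' < s" "\<And>r. a' \<le> r \<Longrightarrow> r < s \<Longrightarrow> K r w = lft ?K s"
      using counting_path_left[OF counting_path_total s] by metis
    obtain b where b: "b \<in> \<rat>" "max a a' < b" "b < s" using Rats_dense_in_real[of "max a a'" s] a' x by auto
    have "\<not> K a w < K b w" using a(4)[OF b(1)] b x w by (simp add: B_def space_F)
    moreover have "K a w \<le> K b w" using counting_path_mono[OF counting_path_total a(2)] b by simp
    ultimately have eq: "?K a = lft ?K s" using a'(3)[of b] b by simp
    have "?K r = ?K a" if "a < r" "r < s" for r
      using le_lft_counting_path[OF counting_path_total, of r s]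
        counting_path_mono[OF counting_path_total, of a r] that a eq by simp
    moreover have "?K a \<le> lft ?K r" if "a < r" for r
      using le_lft_counting_path[OF counting_path_total a(2) that] .
    ultimately have *: "?K r \<le> Suc (lft ?K r)" if "a < r" "r < s" for r
      using that by (metis le_SucI)
    have "good_left s w"
      unfolding good_left_def unit_jumps_before_def
    proof (intro allI impI)
      fix r assume "0 < r \<and> r < s"
      then show "?K r \<le> Suc (lft ?K r)"
        using *[of r] x by (cases "r \<le> a") (auto simp: A_def unit_jumps_def)
    qed
    then show "x \<in> ?L" using x w s chain_left_eq[OF a(2) x(2) eq] by (auto simp: space_Pr A_def)
  qed
  also have "\<dots> \<in> sets Pr"
  proof (rule sets.countable_UN'[OF D], rule image_subsetI, rule sets.Diff)
    fix a assume a: "a \<in> D"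
    then show "{a<..} \<times> A a \<in> sets Pr" by (intro rect_in_Pr A) (auto simp: D_def)
    have "countable {b \<in> D. a \<le> b}" using D by (rule countable_subset[rotated]) auto
    then show "(\<Union>b\<in>{b\<in>D. a \<le> b}. {b<..} \<times> B a b) \<in> sets Pr"
      using a by (intro sets.countable_UN' image_subsetI rect_in_Pr B) (auto simp: D_def)
  qed
  finally show ?thesis .
qed

lemma Y_meas: "(\<lambda>(s, w). Y s w) \<in> measurable Pr (count_space UNIV)"
proof (rule measurable_count_space_natI)
  fix j
  let ?A = "\<lambda>j. {x \<in> space Pr. good_left (fst x) (snd x) \<and> XL (fst x) (snd x) = j}"
  have "{x \<in> space Pr. (case x of (s, w) \<Rightarrow> Y s w) = j} =
     ?A j \<union> (if j = 0 then space Pr - (\<Union>j. ?A j) else {})"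
    by (auto simp: Y_def split: if_splits)
  then show "{x \<in> space Pr. (case x of (s, w) \<Rightarrow> Y s w) = j} \<in> sets Pr"
    using Y_sets by auto
qed

definition rate :: "'i \<Rightarrow> real \<Rightarrow> 'x \<Rightarrow> real" where
  "rate c s w = q c s (Y s w) w"

lemma rate_meas: "c \<in> C \<Longrightarrow> (\<lambda>(s, w). rate c s w) \<in> borel_measurable Pr"
proof -
  assume c: "c \<in> C"
  have "(\<lambda>x. (\<lambda>i x. q c (fst x) i (snd x)) (case x of (s, w) \<Rightarrow> Y s w) x) \<in> borel_measurable Pr"
  proof (rule measurable_compose_countable[OF _ Y_meas])
    show "(\<lambda>x. q c (fst x) i (snd x)) \<in> borel_measurable Pr" for i
      using measurable_Pr_F0[OF q_meas[OF c, of i]] by (simp add: case_prod_beta')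
  qed
  then show ?thesis by (simp add: rate_def case_prod_beta')
qed

text \<open>The exponential martingale that turns unit intensities into \<open>rate\<close>, taken
  strictly before \<open>s\<close> so that it is predictable. Its jumps are enumerated by level,
  which allows a proof of measurability factor by factor.\<close>

definition Dm :: "real \<Rightarrow> 'x \<Rightarrow> real" where
  "Dm s w = (\<Prod>c\<in>C. exp (LBINT r:{0<..<s}. 1 - rate c r w) *
     (\<Prod>l\<in>{1..lft (\<lambda>t. N c t w) s}. rate c (nth_jump (\<lambda>t. N c t w) l) w))"

text \<open>The left limit has reached \<open>l\<close> exactly if the path has done so at some
  earlier rational time. The event \<open>B\<close> has to be known at \<open>a\<close> only where
  the level is already reached, so it may speak about the \<open>l\<close>-th jump time.\<close>

lemma lft_sets:
  assumes c: "c \<in> I" and B: "\<And>a. 0 < a \<Longrightarrow> B \<inter> {w \<in> Om. l \<le> N c a w} \<in> sets (F a)"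
  shows "{x \<in> space Pr. l \<le> lft (\<lambda>t. N c t (snd x)) (fst x) \<and> snd x \<in> B} \<in> sets Pr"
proof -
  define D where "D = {a\<in>\<rat>. (0::real) < a}"
  have D: "countable D" unfolding D_def using countable_rat by (rule countable_subset[rotated]) auto
  have "{x \<in> space Pr. l \<le> lft (\<lambda>t. N c t (snd x)) (fst x) \<and> snd x \<in> B} =
    (\<Union>a\<in>D. {a<..} \<times> (B \<inter> {w \<in> Om. l \<le> N c a w}))" (is "?L = ?R")
  proof (intro set_eqI iffI)
    fix x assume "x \<in> ?L"
    then obtain s w where x: "x = (s, w)" "0 < s" "w \<in> Om" "l \<le> lft (\<lambda>t. N c t w) s" "w \<in> B"
      by (cases x) (auto simp: space_Pr)
    obtain a' where a': "0 \<le> a'" "a' < s" "\<And>r. a' \<le> r \<Longrightarrow> r < s \<Longrightarrow> N c r w = lft (\<lambda>t. N c t w) s"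
      using counting_path_left[OF cp[OF c x(3)] x(2)] by metis
    obtain a where a: "a \<in> \<rat>" "a' < a" "a < s" using Rats_dense_in_real[OF a'(2)] by auto
    then show "x \<in> ?R" using x a' by (auto simp: D_def intro!: bexI[of _ a])
  next
    fix x assume "x \<in> ?R"
    then show "x \<in> ?L"
      using le_lft_counting_path[OF cp[OF c]] by (auto simp: D_def space_Pr)
        (metis le_trans less_imp_le)+
  qed
  also have "\<dots> \<in> sets Pr"
    using D B by (intro sets.countable_UN') (auto simp: D_def intro!: rect_in_Pr)
  finally show ?thesis .
qed

lemma lft_meas:
  assumes c: "c \<in> I"
  shows "(\<lambda>x. lft (\<lambda>t. N c t (snd x)) (fst x)) \<in> measurable Pr (count_space UNIV)"
proof (rule measurable_count_space_natI)
  fix j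
  have B: "{x \<in> space Pr. l \<le> lft (\<lambda>t. N c t (snd x)) (fst x) \<and> snd x \<in> Om} \<in> sets Pr" for l
  proof (rule lft_sets[OF c])
    fix a :: real assume "0 < a"
    then have [measurable]: "N c a \<in> measurable (F a) (count_space UNIV)" using adapted[OF c] by simp
    have "Om \<inter> {w \<in> Om. l \<le> N c a w} = {w \<in> space (F a). l \<le> N c a w}" by (auto simp: space_F)
    also have "\<dots> \<in> sets (F a)" by measurable
    finally show "Om \<inter> {w \<in> Om. l \<le> N c a w} \<in> sets (F a)" .
  qed
  have "{x \<in> space Pr. lft (\<lambda>t. N c t (snd x)) (fst x) = j} =
    {x \<in> space Pr. j \<le> lft (\<lambda>t. N c t (snd x)) (fst x) \<and> snd x \<in> Om} -
    {x \<in> space Pr. Suc j \<le> lft (\<lambda>t. N c t (snd x)) (fst x) \<and> snd x \<in> Om}"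
    by (auto simp: space_Pr)
  then show "{x \<in> space Pr. lft (\<lambda>t. N c t (snd x)) (fst x) = j} \<in> sets Pr" using B by auto
qed

lemma jump_rate_meas:
  assumes c: "c \<in> C" and l: "1 \<le> l"
  shows "(\<lambda>x. if l \<le> lft (\<lambda>t. N c t (snd x)) (fst x)
      then rate c (nth_jump (\<lambda>t. N c t (snd x)) l) (snd x) else 1) \<in> borel_measurable Pr" (is "?f \<in> _")
proof (rule measurableI)
  have cI: "c \<in> I" using c CI by auto
  fix B :: "real set" assume B: "B \<in> sets borel"
  define V where "V = {w. rate c (nth_jump (\<lambda>t. N c t w) l) w \<in> B}"
  let ?L = "\<lambda>A. {x \<in> space Pr. l \<le> lft (\<lambda>t. N c t (snd x)) (fst x) \<and> snd x \<in> A}"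
  note [measurable] = lft_meas[OF cI]
  have "?L V \<in> sets Pr"
  proof (rule lft_sets[OF cI])
    fix a :: real assume a: "0 < a"
    define th where "th w = (if 1 \<le> l \<and> l \<le> N c a w then nth_jump (\<lambda>t. N c t w) l else a)" for w
    have th: "th \<in> borel_measurable (F a)"
      unfolding th_def by (rule last_jump_meas[OF cI a]) simp
    have "(\<lambda>w. (th w, w)) \<in> measurable (F a) Pr"
      using nth_jump[OF cp[OF cI] l] a by (intro measurable_eval_Pr[OF th]) (auto simp: th_def)
    from measurable_compose[OF this rate_meas[OF c]]
    have [measurable]: "(\<lambda>w. rate c (th w) w) \<in> borel_measurable (F a)" by simp
    have [measurable]: "N c a \<in> measurable (F a) (count_space UNIV)" using adapted[OF cI] a by simp
    have "V \<inter> {w \<in> Om. l \<le> N c a w} = {w \<in> space (F a). l \<le> N c a w \<and> rate c (th w) w \<in> B}"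
      using l by (auto simp: V_def th_def space_F)
    also have "\<dots> \<in> sets (F a)" using B by measurable
    finally show "V \<inter> {w \<in> Om. l \<le> N c a w} \<in> sets (F a)" .
  qed
  moreover have "{x \<in> space Pr. \<not> l \<le> lft (\<lambda>t. N c t (snd x)) (fst x)} \<in> sets Pr" by measurable
  moreover have "?f -` B \<inter> space Pr =
    ?L V \<union> (if 1 \<in> B then {x \<in> space Pr. \<not> l \<le> lft (\<lambda>t. N c t (snd x)) (fst x)} else {})"
    by (auto simp: V_def split: if_splits)
  ultimately show "?f -` B \<inter> space Pr \<in> sets Pr" by auto
qed auto

text \<open>The number of factors is random. For a fixed number of factors the terms beyond the
  current level are set to one; the random length is then inserted as a countable parameter.\<close>

lemma Dm_meas: "(\<lambda>(s, w). Dm s w) \<in> borel_measurable Pr"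
proof -
  have "(\<lambda>x. exp (LBINT r:{0<..<fst x}. 1 - rate c r (snd x)) *
     (\<Prod>l\<in>{1..lft (\<lambda>t. N c t (snd x)) (fst x)}. rate c (nth_jump (\<lambda>t. N c t (snd x)) l) (snd x)))
     \<in> borel_measurable Pr" if c: "c \<in> C" for c
  proof -
    have cI: "c \<in> I" using c CI by auto
    have "(\<lambda>x. 1 - (case x of (s, w) \<Rightarrow> rate c s w)) \<in> borel_measurable Pr"
      using rate_meas[OF c] by measurable
    from measurable_integral_Pr[OF this]
    have 1: "(\<lambda>x. LBINT r:{0<..<fst x}. 1 - rate c r (snd x)) \<in> borel_measurable Pr"
      by (simp add: case_prod_beta')
    let ?f = "\<lambda>m x. \<Prod>l\<in>{1..m}. if l \<le> lft (\<lambda>t. N c t (snd x)) (fst x)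
        then rate c (nth_jump (\<lambda>t. N c t (snd x)) l) (snd x) else 1"
    have "?f m \<in> borel_measurable Pr" for m
      by (rule borel_measurable_prod) (rule jump_rate_meas[OF c], simp)
    from measurable_compose_countable[of ?f, OF this lft_meas[OF cI]]
    have "(\<lambda>x. ?f (lft (\<lambda>t. N c t (snd x)) (fst x)) x) \<in> borel_measurable Pr" .
    then have "(\<lambda>x. \<Prod>l\<in>{1..lft (\<lambda>t. N c t (snd x)) (fst x)}.
        rate c (nth_jump (\<lambda>t. N c t (snd x)) l) (snd x)) \<in> borel_measurable Pr"
      by (rule measurable_cong[THEN iffD1, rotated]) (auto intro!: prod.cong)
    then show ?thesis
      by (intro borel_measurable_times measurable_compose[OF 1 borel_measurable_exp])
  qed
  then show ?thesis unfolding Dm_def by (simp add: case_prod_beta')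
qed

end

section \<open>Families of independent unit Poisson processes\<close>

lemma (in prob_space) nn_integral_nat_valued:
  assumes [measurable]: "f \<in> measurable M (count_space (UNIV::nat set))"
  shows "(\<integral>\<^sup>+w. g (f w) \<partial>M) = (\<Sum>k. g k * emeasure M {w \<in> space M. f w = k})"
proof -
  have "(\<integral>\<^sup>+w. g (f w) \<partial>M) = (\<integral>\<^sup>+w. (\<Sum>k. g k * indicator {w \<in> space M. f w = k} w) \<partial>M)"
  proof (rule nn_integral_cong)
    fix w assume "w \<in> space M"
    then have "(\<Sum>k. g k * indicator {w \<in> space M. f w = k} w) = (\<Sum>k\<in>{f w}. g k * indicator {w \<in> space M. f w = k} w)"
      by (intro suminf_finite) auto
    then show "g (f w) = (\<Sum>k. g k * indicator {w \<in> space M. f w = k} w)"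
      using \<open>w \<in> space M\<close> by simp
  qed
  also have "\<dots> = (\<Sum>k. \<integral>\<^sup>+w. g k * indicator {w \<in> space M. f w = k} w \<partial>M)"
    by (rule nn_integral_suminf) measurable
  finally show ?thesis by (simp add: nn_integral_cmult_indicator)
qed

lemma suminf_ennreal_sums:
  assumes "f sums x" "\<And>k. 0 \<le> f k"
  shows "(\<Sum>k. ennreal (f k)) = ennreal x"
  using assms by (metis suminf_ennreal2 sums_summable sums_unique)

lemma exp_series_times_sums:
  fixes x y :: real
  shows "(\<lambda>k. y ^ k * (x ^ k / fact k * exp (- x))) sums exp (y * x - x)"
proof -
  have "(\<lambda>k. ((y * x) ^ k /\<^sub>R fact k) * exp (- x)) sums (exp (y * x) * exp (- x))"
    by (intro sums_mult2 exp_converges)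
  then show ?thesis by (simp add: exp_add[symmetric] power_mult_distrib field_simps)
qed

lemma poisson_mean_sums:
  fixes x :: real
  shows "(\<lambda>k. real k * (x ^ k / fact k * exp (- x))) sums x"
proof -
  have "(\<lambda>k. (x ^ k /\<^sub>R fact k) * (x * exp (- x))) sums (exp x * (x * exp (- x)))"
    by (intro sums_mult2 exp_converges)
  also have "exp x * (x * exp (- x)) = x"
    by (simp add: exp_minus)
  also have "(\<lambda>k. (x ^ k /\<^sub>R fact k) * (x * exp (- x))) =
    (\<lambda>k. real (Suc k) * (x ^ Suc k / fact (Suc k) * exp (- x)))"
    by (rule ext) (simp add: divide_simps del: of_nat_Suc)
  finally show ?thesis
    using sums_Suc[of "\<lambda>k. real k * (x ^ k / fact k * exp (- x))" x] by simp
qed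

locale poisson_family = prob_space P for P :: "'w measure" +
  fixes C :: "'i set" and N :: "'i \<Rightarrow> real \<Rightarrow> 'w \<Rightarrow> nat" and X0 :: "'w \<Rightarrow> nat"
  assumes finC: "finite C"
    and pois: "\<And>c. c \<in> C \<Longrightarrow> unit_poisson_process P (N c)"
    and X0_meas: "X0 \<in> measurable P (count_space UNIV)"
    and indep: "indep_vars (\<lambda>_. PiM UNIV (\<lambda>_::real. count_space (UNIV::nat set)))
         (\<lambda>c \<omega>. case c of None \<Rightarrow> (\<lambda>_. X0 \<omega>) | Some c' \<Rightarrow> (\<lambda>t. N c' t \<omega>))
         (insert None (Some ` C))"
begin

lemma N_meas [measurable]: "c \<in> C \<Longrightarrow> N c t \<in> measurable P (count_space UNIV)"
  using pois by (auto simp: unit_poisson_process_def)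

lemma cp: "c \<in> C \<Longrightarrow> w \<in> space P \<Longrightarrow> counting_path (\<lambda>t. N c t w)"
  using pois by (auto simp: unit_poisson_process_def counting_path_def)

lemma prob_increment:
  "c \<in> C \<Longrightarrow> 0 \<le> s \<Longrightarrow> s \<le> t \<Longrightarrow>
    prob {w \<in> space P. N c t w - N c s w = k} = (t - s) ^ k / fact k * exp (- (t - s))"
  using pois[of c] unfolding unit_poisson_process_def by blast

lemma increment_meas: "c \<in> C \<Longrightarrow> (\<lambda>w. N c t w - N c s w) \<in> measurable P (count_space UNIV)"
  by measurable

definition G :: "real \<Rightarrow> 'w measure" where
  "G a = sigma (space P) ({X0 -` B \<inter> space P | B. True} \<union>
     {N c s -` B \<inter> space P | c s B. c \<in> C \<and> 0 \<le> s \<and> s \<le> a})"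

lemma space_G [simp]: "space (G a) = space P"
  unfolding G_def by (rule space_measure_of) auto

lemma sets_G: "sets (G a) = sigma_sets (space P) ({X0 -` B \<inter> space P | B. True} \<union>
     {N c s -` B \<inter> space P | c s B. c \<in> C \<and> 0 \<le> s \<and> s \<le> a})"
  unfolding G_def by (rule sets_measure_of) auto

lemma sets_G_subset: "sets (G a) \<subseteq> sets P"
  unfolding sets_G
proof (rule sets.sigma_sets_subset, safe)
  show "X0 -` B \<inter> space P \<in> sets P" for B using X0_meas by (auto dest: measurable_sets)
  show "c \<in> C \<Longrightarrow> N c s -` B \<inter> space P \<in> sets P" for c s B
    using N_meas[of c s] by (auto dest: measurable_sets)
qed

lemma filtration_G: "filtration G (space P)"
proof
  fix a b :: real assume "a \<le> b"
  then show "sets (G a) \<subseteq> sets (G b)"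
    unfolding sets_G by (intro sigma_sets_mono' Un_mono order_refl) (blast intro: order_trans)
qed simp

lemma N_adapted:
  assumes "c \<in> C" "0 \<le> t" shows "N c t \<in> measurable (G t) (count_space UNIV)"
proof (rule measurableI)
  show "N c t -` B \<inter> space (G t) \<in> sets (G t)" for B
    unfolding sets_G space_G using assms by (intro sigma_sets.Basic UnI2) blast
qed simp

lemma X0_adapted: "X0 \<in> measurable (G a) (count_space UNIV)"
  by (intro measurableI) (auto simp: sets_G intro!: sigma_sets.Basic)

abbreviation "noise_var \<equiv> (\<lambda>c \<omega>. case c of None \<Rightarrow> (\<lambda>_. X0 \<omega>) | Some c' \<Rightarrow> (\<lambda>t. N c' t \<omega>))"
abbreviation "path_space \<equiv> PiM UNIV (\<lambda>_::real. count_space (UNIV::nat set))"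

text \<open>Generated by whole paths rather than by values at single times, because the independence
  hypothesis is phrased for path-valued variables. The initial state is the constant path with index
  \<open>None\<close>.\<close>

definition noise_sigma :: "'i option set \<Rightarrow> 'w measure" where
  "noise_sigma D = sigma (space P) (\<Union>d\<in>D. {noise_var d -` A \<inter> space P | A. A \<in> sets path_space})"

lemma space_noise_sigma [simp]: "space (noise_sigma D) = space P"
  unfolding noise_sigma_def by (rule space_measure_of) auto

lemma sets_noise_sigma: "sets (noise_sigma D) =
    sigma_sets (space P) (\<Union>d\<in>D. {noise_var d -` A \<inter> space P | A. A \<in> sets path_space})"
  unfolding noise_sigma_def by (rule sets_measure_of) auto

lemma noise_sigma_indep:
  assumes "D \<inter> D' = {}" "D \<subseteq> insert None (Some ` C)" "D' \<subseteq> insert None (Some ` C)"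
  shows "indep_set (sets (noise_sigma D)) (sets (noise_sigma D'))"
proof -
  let ?E = "\<lambda>d. {noise_var d -` A \<inter> space P | A. A \<in> sets path_space}"
  have "indep_sets ?E (insert None (Some ` C))"
    using indep unfolding indep_vars_def2 by simp
  then have 1: "indep_sets ?E (\<Union>b\<in>UNIV. case_bool D D' b)"
    by (rule indep_sets_mono_index[rotated]) (use assms in \<open>auto split: bool.splits\<close>)
  have 2: "Int_stable (?E d)" for d
  proof (rule Int_stableI)
    fix a b assume "a \<in> ?E d" "b \<in> ?E d"
    then obtain A B where AB: "A \<in> sets path_space" "B \<in> sets path_space"
      "a = noise_var d -` A \<inter> space P" "b = noise_var d -` B \<inter> space P" by blast
    then have "a \<inter> b = noise_var d -` (A \<inter> B) \<inter> space P" by auto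
    then show "a \<inter> b \<in> ?E d" using AB sets.Int by blast
  qed
  have "indep_sets (\<lambda>b. sigma_sets (space P) (\<Union>d\<in>case_bool D D' b. ?E d)) UNIV"
    by (rule indep_sets_collect_sigma[OF 1 2])
      (use assms in \<open>auto simp: disjoint_family_on_def split: bool.splits\<close>)
  then show ?thesis unfolding indep_set_def sets_noise_sigma
    by (rule indep_sets_mono_sets) (auto split: bool.splits)
qed

lemma noise_sigma_sets:
  assumes "D \<subseteq> insert None (Some ` C)" shows "sets (noise_sigma D) \<subseteq> sets P"
  using noise_sigma_indep[of D "{}"] assms by (simp add: indep_sets2_eq)

lemma N_noise_meas: "Some c \<in> D \<Longrightarrow> N c s \<in> measurable (noise_sigma D) (count_space UNIV)"
proof (rule measurableI)
  fix B :: "nat set" assume D: "Some c \<in> D"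
  have "(\<lambda>f. f s) -` B \<inter> space path_space \<in> sets path_space"
    by (rule measurable_sets[OF measurable_component_singleton]) auto
  then have "noise_var (Some c) -` ((\<lambda>f. f s) -` B \<inter> space path_space) \<inter> space P \<in> sets (noise_sigma D)"
    unfolding sets_noise_sigma using D by (intro sigma_sets.Basic) blast
  also have "noise_var (Some c) -` ((\<lambda>f. f s) -` B \<inter> space path_space) \<inter> space P = N c s -` B \<inter> space P"
    by (auto simp: space_PiM)
  finally show "N c s -` B \<inter> space (noise_sigma D) \<in> sets (noise_sigma D)" by simp
qed simp

lemma X0_noise_meas: "None \<in> D \<Longrightarrow> X0 \<in> measurable (noise_sigma D) (count_space UNIV)"
proof (rule measurableI)
  fix B :: "nat set" assume D: "None \<in> D"
  have "(\<lambda>f. f 0) -` B \<inter> space path_space \<in> sets path_space"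
    by (rule measurable_sets[OF measurable_component_singleton]) auto
  then have "noise_var None -` ((\<lambda>f. f 0) -` B \<inter> space path_space) \<inter> space P \<in> sets (noise_sigma D)"
    unfolding sets_noise_sigma using D by (intro sigma_sets.Basic) blast
  also have "noise_var None -` ((\<lambda>f. f 0) -` B \<inter> space path_space) \<inter> space P = X0 -` B \<inter> space P"
    by (auto simp: space_PiM)
  finally show "X0 -` B \<inter> space (noise_sigma D) \<in> sets (noise_sigma D)" by simp
qed simp

text \<open>Only consecutive increments along a finite grid are independent by hypothesis. The grid
  used is made of 0, the points of \<open>S\<close>, \<open>a\<close> and \<open>t\<close>: past
  values are telescoping sums of the first \<open>r\<close> increments, and the increment from
  \<open>a\<close> to \<open>t\<close> is the last one.\<close>

lemma increment_indep_past:
  fixes f :: "real \<Rightarrow> nat" and k :: nat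
  assumes c: "c \<in> C" and a: "0 \<le> a" "a < t" and S: "finite S" "S \<subseteq> {0..a}"
  defines "A \<equiv> {w \<in> space P. \<forall>s\<in>S. N c s w = f s}" and "B \<equiv> {w \<in> space P. N c t w - N c a w = k}"
  shows "prob (A \<inter> B) = prob A * prob B"
proof -
  define us where "us = sorted_list_of_set (insert 0 (insert a S))"
  define r where "r = length us - 1"
  have us: "set us = insert 0 (insert a S)" "sorted us" "distinct us" using S
    unfolding us_def by (simp_all add: set_sorted_list_of_set del: sorted_list_of_set_insert_remove)
  then have len: "length us = Suc r" unfolding r_def by (cases us) auto
  have sorted: "sorted_wrt (<) us" using us strict_sorted_iff by blast
  have nth_mono: "us ! i \<le> us ! j" if "i \<le> j" "j \<le> r" for i j
    using us(2) that len by (simp add: sorted_nth_mono)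
  have us0: "us ! 0 = 0"
  proof -
    obtain i where "i < length us" "us ! i = 0" using us(1) by (metis in_set_conv_nth insertI1)
    then have "us ! 0 \<le> 0" using nth_mono[of 0 i] len by simp
    moreover have "us ! 0 \<in> set us" using len by (intro nth_mem) simp
    then have "0 \<le> us ! 0" using us(1) S a by auto
    ultimately show ?thesis by simp
  qed
  have usr: "us ! r = a"
  proof -
    obtain i where "i < length us" "us ! i = a" using us(1) by (metis in_set_conv_nth insertCI)
    then have "a \<le> us ! r" using nth_mono[of i r] len by simp
    moreover have "us ! r \<in> set us" using len by (intro nth_mem) simp
    then have "us ! r \<le> a" using us(1) S a by auto
    ultimately show ?thesis by simp
  qed
  let ?X = "\<lambda>i w. N c ((us @ [t]) ! Suc i) w - N c ((us @ [t]) ! i) w"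
  have "sorted_wrt (<) (us @ [t])" using sorted us(1) S a by (force simp: sorted_wrt_append)
  moreover have "\<forall>x\<in>set (us @ [t]). 0 \<le> x" using us(1) S a by auto
  ultimately have "indep_vars (\<lambda>_. count_space UNIV) ?X {..<length (us @ [t]) - 1}"
    using pois[OF c] unfolding unit_poisson_process_def by blast
  then have ind: "indep_vars (\<lambda>_. count_space UNIV) ?X {..<Suc r}" using len by simp
  define L where "L = (\<lambda>b. if b then {..<r} else {r})"
  have ind2: "indep_vars (\<lambda>b. PiM (L b) (\<lambda>_. count_space UNIV)) (\<lambda>b w. restrict (\<lambda>i. ?X i w) (L b)) UNIV"
    by (rule indep_vars_restrict[OF ind]) (auto simp: L_def disjoint_family_on_def)
  have tele: "N c (us ! p) w = (\<Sum>i<p. ?X i w)" if "p \<le> r" "w \<in> space P" for p w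
    using that(1)
  proof (induction p)
    case 0 then show ?case using cp[OF c that(2)] us0 by (simp add: counting_path_def)
  next
    case (Suc p)
    have "0 \<le> us ! p" using nth_mono[of 0 p] us0 Suc by simp
    then have "N c (us ! p) w \<le> N c (us ! Suc p) w"
      using counting_path_mono[OF cp[OF c that(2)], of "us ! p" "us ! Suc p"]
        nth_mono[of p "Suc p"] Suc.prems by simp
    then show ?case using Suc len by (simp add: nth_append)
  qed
  define A' where "A' = (\<lambda>b. if b then {g \<in> space (PiM {..<r} (\<lambda>_. count_space (UNIV::nat set))).
      \<forall>p\<in>{p. p \<le> r \<and> us ! p \<in> S}. (\<Sum>i<p. g i) = f (us ! p)}
    else {g \<in> space (PiM {r} (\<lambda>_. count_space (UNIV::nat set))). g r = k})"
  have A': "A' b \<in> sets (PiM (L b) (\<lambda>_. count_space UNIV))" for b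
  proof (cases b)
    case True
    have [measurable]: "(\<lambda>g. \<Sum>i<p. g i) \<in> measurable (PiM {..<r} (\<lambda>_. count_space (UNIV::nat set))) (count_space UNIV)"
      if "p \<le> r" for p
      using that by (intro measurable_sum_nat measurable_component_singleton) auto
    have "{g \<in> space (PiM {..<r} (\<lambda>_. count_space (UNIV::nat set))). (\<Sum>i<p. g i) = f (us ! p)}
      \<in> sets (PiM {..<r} (\<lambda>_. count_space (UNIV::nat set)))" if "p \<le> r" for p
      using that by measurable
    then have "{g \<in> space (PiM {..<r} (\<lambda>_. count_space (UNIV::nat set))).
        \<forall>p\<in>{p. p \<le> r \<and> us ! p \<in> S}. (\<Sum>i<p. g i) = f (us ! p)} \<in> sets (PiM {..<r} (\<lambda>_. count_space UNIV))"
      by (intro sets.sets_Collect_finite_All) auto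
    then show ?thesis using True by (simp add: A'_def L_def)
  next
    case False
    have "{g \<in> space (PiM {r} (\<lambda>_. count_space (UNIV::nat set))). g r = k} \<in> sets (PiM {r} (\<lambda>_. count_space UNIV))"
      by measurable
    then show ?thesis using False by (simp add: A'_def L_def)
  qed
  have pre: "(\<lambda>w. restrict (\<lambda>i. ?X i w) (L b)) -` A' b \<inter> space P = (if b then A else B)" for b
  proof (cases b)
    case True
    have "(\<forall>p\<in>{p. p \<le> r \<and> us ! p \<in> S}. N c (us ! p) w = f (us ! p)) \<longleftrightarrow> (\<forall>s\<in>S. N c s w = f s)" for w
    proof -
      have "\<exists>p\<le>r. us ! p = s" if "s \<in> S" for s
        using us(1) len that by (metis in_set_conv_nth insertCI less_Suc_eq_le)
      then show ?thesis by (metis (mono_tags, lifting) mem_Collect_eq)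
    qed
    moreover have "(\<lambda>w. restrict (\<lambda>i. ?X i w) (L b)) -` A' b \<inter> space P =
      {w\<in>space P. \<forall>p\<in>{p. p \<le> r \<and> us ! p \<in> S}. N c (us ! p) w = f (us ! p)}"
      using True by (auto simp: A'_def L_def space_PiM tele)
    ultimately show ?thesis using True by (simp add: A_def)
  next
    case False
    then show ?thesis using len usr by (auto simp: A'_def L_def space_PiM B_def nth_append)
  qed
  have "prob (\<Inter>b\<in>UNIV. (\<lambda>w. restrict (\<lambda>i. ?X i w) (L b)) -` A' b \<inter> space P) =
    (\<Prod>b\<in>UNIV. prob ((\<lambda>w. restrict (\<lambda>i. ?X i w) (L b)) -` A' b \<inter> space P))"
    by (rule indep_varsD[OF ind2]) (use A' in auto)
  then show ?thesis unfolding pre by (simp add: UNIV_bool Int_commute mult.commute)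
qed

text \<open>The past mixes the path of \<open>c\<close> with all other noises. Events that fix
  finitely many past values of \<open>c\<close> and meet an event of the other noises are stable
  under intersection, and their sigma-algebra contains \<open>G a\<close>. On them the claim splits
  into independence of the noises and independence of increments of \<open>c\<close>.\<close>

lemma increment_indep:
  assumes c: "c \<in> C" and a: "0 \<le> a" "a \<le> t" and A: "A \<in> sets (G a)"
  shows "prob (A \<inter> {w \<in> space P. N c t w - N c a w = k}) = prob A * prob {w \<in> space P. N c t w - N c a w = k}"
proof (cases "a = t")
  case True
  have "A \<inter> space P = A" using sets.sets_into_space[OF A] by auto
  then show ?thesis using True prob_space by (cases "k = 0") auto
next
  case False
  then have at: "a < t" using a by simp
  define B where "B = {w \<in> space P. N c t w - N c a w = k}"
  have B: "B \<in> sets P" unfolding B_def using c by measurable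
  define rest where "rest = insert None (Some ` C) - {Some c}"
  define E where "E S f = {w \<in> space P. \<forall>s\<in>S. N c s w = f s}" for S f
  define Q where "Q = {E S f \<inter> A2 | S f A2. finite S \<and> S \<subseteq> {0..a} \<and> A2 \<in> sets (noise_sigma rest)}"
  have indc: "indep_set (sets (noise_sigma {Some c})) (sets (noise_sigma rest))"
    using c by (intro noise_sigma_indep) (auto simp: rest_def)
  note [measurable] = N_noise_meas[of c "{Some c}", simplified]
  have E_sig [measurable]: "E S f \<in> sets (noise_sigma {Some c})" if "finite S" for S f
  proof -
    have "{w \<in> space (noise_sigma {Some c}). \<forall>s\<in>S. N c s w = f s} \<in> sets (noise_sigma {Some c})"
      by (rule sets.sets_Collect_finite_All[OF _ that]) measurable
    then show ?thesis by (simp add: E_def)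
  qed
  have B_sig: "B \<in> sets (noise_sigma {Some c})"
  proof -
    have "{w \<in> space (noise_sigma {Some c}). N c t w - N c a w = k} \<in> sets (noise_sigma {Some c})"
      by measurable
    then show ?thesis by (simp add: B_def)
  qed
  have prod: "prob (A1 \<inter> A2) = prob A1 * prob A2"
    if "A1 \<in> sets (noise_sigma {Some c})" "A2 \<in> sets (noise_sigma rest)" for A1 A2
    using indc that unfolding indep_sets2_eq by blast
  have rest_sub: "sets (noise_sigma rest) \<subseteq> sets P" "sets (noise_sigma {Some c}) \<subseteq> sets P"
    using c by (auto intro!: noise_sigma_sets simp: rest_def)
  have "indep_set Q {B}" unfolding indep_sets2_eq
  proof (intro conjI ballI)
    show "Q \<subseteq> events" using rest_sub E_sig unfolding Q_def by (auto intro!: sets.Int)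
    show "{B} \<subseteq> events" using B by simp
    fix q b assume "q \<in> Q" "b \<in> {B}"
    then obtain S f A2 where q: "q = E S f \<inter> A2" "finite S" "S \<subseteq> {0..a}" "A2 \<in> sets (noise_sigma rest)"
      and b: "b = B" unfolding Q_def by blast
    have "prob (q \<inter> b) = prob ((E S f \<inter> B) \<inter> A2)" unfolding q b by (intro arg_cong[where f=prob]) auto
    also have "\<dots> = prob (E S f \<inter> B) * prob A2"
      using E_sig[OF q(2)] B_sig q by (intro prod) auto
    also have "prob (E S f \<inter> B) = prob (E S f) * prob B"
      unfolding E_def B_def by (rule increment_indep_past[OF c a(1) at q(2,3)])
    also have "prob (E S f) * prob B * prob A2 = prob (E S f \<inter> A2) * prob B"
      using prod[OF E_sig[OF q(2)] q(4)] by simp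
    finally show "prob (q \<inter> b) = prob q * prob b" unfolding q b .
  qed
  moreover have "Int_stable Q"
  proof (rule Int_stableI)
    fix q1 q2 assume "q1 \<in> Q" "q2 \<in> Q"
    then obtain S1 f1 A1 S2 f2 A2 where q: "q1 = E S1 f1 \<inter> A1" "finite S1" "S1 \<subseteq> {0..a}" "A1 \<in> sets (noise_sigma rest)"
      "q2 = E S2 f2 \<inter> A2" "finite S2" "S2 \<subseteq> {0..a}" "A2 \<in> sets (noise_sigma rest)"
      unfolding Q_def by blast
    define f where "f s = (if s \<in> S1 then f1 s else f2 s)" for s
    show "q1 \<inter> q2 \<in> Q"
    proof (cases "\<forall>s\<in>S1 \<inter> S2. f1 s = f2 s")
      case True
      then have "E S1 f1 \<inter> E S2 f2 = E (S1 \<union> S2) f" by (auto simp: E_def f_def)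
      then have "q1 \<inter> q2 = E (S1 \<union> S2) f \<inter> (A1 \<inter> A2)" using q by auto
      then show ?thesis unfolding Q_def using q by blast
    next
      case False
      then have "E S1 f1 \<inter> E S2 f2 = {}" by (auto simp: E_def)
      then have "q1 \<inter> q2 = E S1 f1 \<inter> {}" using q by auto
      then show ?thesis unfolding Q_def using q by blast
    qed
  qed
  ultimately have "indep_set (sigma_sets (space P) Q) (sigma_sets (space P) {B})"
    by (intro indep_set_sigma_sets) (auto simp: Int_stable_def)
  moreover have "A \<in> sigma_sets (space P) Q"
  proof -
    have gen: "N c s -` D \<inter> space P \<in> sigma_sets (space P) Q" if "0 \<le> s" "s \<le> a" for s D
    proof -
      have "N c s -` D \<inter> space P = (\<Union>k\<in>D. E {s} (\<lambda>_. k) \<inter> space P)" by (auto simp: E_def)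
      moreover have Q: "E {s} (\<lambda>_. k) \<inter> space P \<in> Q" for k
        unfolding Q_def using that sets.top[of "noise_sigma rest"] by force
      have "(\<Union>k\<in>D. E {s} (\<lambda>_. k) \<inter> space P) \<in> sigma_sets (space P) Q"
        by (rule sigma_sets_UNION) (use Q in \<open>auto intro: sigma_sets.Basic\<close>)
      ultimately show ?thesis by simp
    qed
    have rest: "A2 \<in> sigma_sets (space P) Q" if "A2 \<in> sets (noise_sigma rest)" for A2
    proof -
      have "A2 = E {} (\<lambda>_. 0) \<inter> A2" using sets.sets_into_space[OF that] by (auto simp: E_def)
      then have "A2 \<in> Q" unfolding Q_def using that by blast
      then show ?thesis by auto
    qed
    have "sets (G a) \<subseteq> sigma_sets (space P) Q"
      unfolding sets_G
    proof (rule sigma_sets_mono, safe)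
      fix D show "X0 -` D \<inter> space P \<in> sigma_sets (space P) Q"
        using measurable_sets[OF X0_noise_meas[of rest], of D] by (intro rest) (auto simp: rest_def)
    next
      fix d s D assume d: "d \<in> C" "0 \<le> s" "s \<le> a"
      show "N d s -` D \<inter> space P \<in> sigma_sets (space P) Q"
      proof (cases "d = c")
        case False
        then show ?thesis
          using measurable_sets[OF N_noise_meas[of d rest s], of D] d by (intro rest) (auto simp: rest_def)
      qed (use gen d in auto)
    qed
    then show ?thesis using A by auto
  qed
  ultimately show ?thesis unfolding indep_sets2_eq B_def[symmetric] by auto
qed

text \<open>The compensation formula on a generating rectangle: the increment is independent of
  \<open>A\<close> and has mean \<open>t - a\<close>.\<close>

lemma nn_integral_increment:
  assumes c: "c \<in> C" and a: "0 \<le> a" "a \<le> t" and A: "A \<in> sets (G a)"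
  shows "(\<integral>\<^sup>+w. indicator A w * of_nat (N c t w - N c a w) \<partial>P) = emeasure P A * ennreal (t - a)"
proof -
  have AP [measurable]: "A \<in> sets P" using A sets_G_subset by auto
  note [measurable] = increment_meas[OF c, of t a]
  let ?I = "\<lambda>k. {w \<in> space P. N c t w - N c a w = k}"
  have [measurable]: "?I k \<in> sets P" for k by measurable
  define f where "f w = (if w \<in> A then N c t w - N c a w else 0)" for w
  have f: "f \<in> measurable P (count_space UNIV)" unfolding f_def by measurable
  have "(\<integral>\<^sup>+w. indicator A w * of_nat (N c t w - N c a w) \<partial>P) = (\<integral>\<^sup>+w. of_nat (f w) \<partial>P)"
    by (intro nn_integral_cong) (auto simp: f_def)
  also have "\<dots> = (\<Sum>k. of_nat k * emeasure P {w \<in> space P. f w = k})"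
    by (rule nn_integral_nat_valued[OF f])
  also have "\<dots> = (\<Sum>k. emeasure P A * ennreal (real k * ((t - a) ^ k / fact k * exp (- (t - a)))))"
  proof (rule suminf_cong)
    fix k
    show "of_nat k * emeasure P {w \<in> space P. f w = k} =
      emeasure P A * ennreal (real k * ((t - a) ^ k / fact k * exp (- (t - a))))"
    proof (cases "k = 0")
      case False
      then have "{w \<in> space P. f w = k} = A \<inter> ?I k"
        using sets.sets_into_space[OF AP] by (auto simp: f_def)
      then have "emeasure P {w \<in> space P. f w = k} = ennreal (prob A * ((t - a) ^ k / fact k * exp (- (t - a))))"
        using increment_indep[OF c a A] prob_increment[OF c a] by (simp add: emeasure_eq_measure)
      then show ?thesis using a
        by (simp add: emeasure_eq_measure ennreal_mult'[symmetric] ennreal_of_nat_eq_real_of_nat ac_simps)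
    qed simp
  qed
  also have "\<dots> = emeasure P A * ennreal (t - a)"
    by (subst ennreal_suminf_cmult, subst suminf_ennreal_sums[OF poisson_mean_sums]) (use a in auto)
  finally show ?thesis .
qed

lemma increment_at_least:
  assumes c: "c \<in> C" and a: "0 \<le> s" "s \<le> t"
  shows "prob {w \<in> space P. 1 \<le> N c t w - N c s w} \<le> t - s"
    and "prob {w \<in> space P. 2 \<le> N c t w - N c s w} \<le> (t - s)\<^sup>2"
proof -
  let ?h = "t - s"
  let ?I = "\<lambda>k. {w \<in> space P. N c t w - N c s w = k}"
  note [measurable] = increment_meas[OF c, of t s]
  have I [measurable]: "?I k \<in> sets P" for k by measurable
  have "prob {w \<in> space P. 1 \<le> N c t w - N c s w} = prob (space P - ?I 0)"
    by (intro arg_cong[where f=prob]) auto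
  also have "\<dots> = 1 - exp (- ?h)" unfolding prob_compl[OF I] prob_increment[OF c a] by simp
  also have "\<dots> \<le> ?h" using exp_ge_add_one_self[of "- ?h"] by linarith
  finally show "prob {w \<in> space P. 1 \<le> N c t w - N c s w} \<le> t - s" .
  have "prob {w \<in> space P. 2 \<le> N c t w - N c s w} = prob (space P - (?I 0 \<union> ?I 1))"
    by (intro arg_cong[where f=prob]) auto
  also have "\<dots> = 1 - (prob (?I 0) + prob (?I 1))"
    by (subst prob_compl[OF sets.Un[OF I I]], subst finite_measure_Union[OF I I]) auto
  also have "\<dots> = 1 - (1 + ?h) * exp (- ?h)"
    using prob_increment[OF c a, of 0] prob_increment[OF c a, of 1] by (simp add: algebra_simps)
  \<comment> \<open>From exp(-h) >= 1 - h. A quadratic bound suffices, because a grid of mesh h has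
    only about 1/h cells.\<close>
  also have "\<dots> \<le> 1 - (1 + ?h) * (1 - ?h)"
    using exp_ge_add_one_self[of "- ?h"] a by (intro diff_left_mono mult_left_mono) linarith+
  also have "\<dots> = ?h\<^sup>2" by (simp add: power2_eq_square algebra_simps)
  finally show "prob {w \<in> space P. 2 \<le> N c t w - N c s w} \<le> (t - s)\<^sup>2" .
qed

lemma increments_both:
  assumes c: "c \<in> C" "d \<in> C" "c \<noteq> d" and a: "0 \<le> s" "s \<le> t"
  shows "prob {w \<in> space P. 1 \<le> N c t w - N c s w \<and> 1 \<le> N d t w - N d s w} \<le> (t - s)\<^sup>2"
proof -
  let ?A = "\<lambda>c. {w \<in> space P. 1 \<le> N c t w - N c s w}"
  have A: "?A e \<in> sets (noise_sigma {Some e})" for e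
  proof -
    note [measurable] = N_noise_meas[of e "{Some e}", simplified]
    have "{w \<in> space (noise_sigma {Some e}). 1 \<le> N e t w - N e s w} \<in> sets (noise_sigma {Some e})" by measurable
    then show ?thesis by simp
  qed
  have "indep_set (sets (noise_sigma {Some c})) (sets (noise_sigma {Some d}))"
    using c by (intro noise_sigma_indep) auto
  then have "prob (?A c \<inter> ?A d) = prob (?A c) * prob (?A d)"
    using A[of c] A[of d] unfolding indep_sets2_eq by blast
  also have "\<dots> \<le> (t - s) * (t - s)"
    using increment_at_least(1)[OF _ a] c a by (intro mult_mono) auto
  also have "?A c \<inter> ?A d = {w \<in> space P. 1 \<le> N c t w - N c s w \<and> 1 \<le> N d t w - N d s w}" by auto
  finally show ?thesis by (simp add: power2_eq_square)
qed

text \<open>A jump at \<open>t\<close> shows up as an increment over every interval (t - h, t], and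
  such an increment has probability at most h.\<close>

lemma AE_no_jump_at:
  assumes c: "c \<in> C" and t: "0 < t"
  shows "AE w in P. lft (\<lambda>r. N c r w) t = N c t w"
proof -
  define h where "h m = t / real (Suc m)" for m
  have h: "0 < h m" "h m \<le> t" for m using t by (auto simp: h_def field_simps)
  define B where "B m = {w \<in> space P. 1 \<le> N c t w - N c (t - h m) w}" for m
  have [measurable]: "B m \<in> sets P" for m
    unfolding B_def using increment_meas[OF c, of t "t - h m"] by measurable
  have "prob (\<Inter>m. B m) \<le> h m" for m
  proof -
    have "prob (\<Inter>m. B m) \<le> prob (B m)" by (intro finite_measure_mono) auto
    also have "\<dots> \<le> h m" using increment_at_least(1)[OF c, of "t - h m" t] h[of m] by (simp add: B_def)
    finally show ?thesis .
  qed
  moreover have "h \<longlonglongrightarrow> 0"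
    unfolding h_def by (rule LIMSEQ_Suc[OF lim_const_over_n])
  ultimately have "prob (\<Inter>m. B m) \<le> 0"
    by (intro tendsto_lowerbound[of h 0 sequentially]) auto
  then have "AE w in P. w \<notin> (\<Inter>m. B m)"
    by (intro AE_not_in) (auto simp: null_sets_def emeasure_eq_measure measure_le_0_iff)
  moreover have "AE w in P. w \<in> space P" by simp
  ultimately show ?thesis
  proof eventually_elim
    fix w assume "w \<notin> (\<Inter>m. B m)" and w: "w \<in> space P"
    then obtain m where "\<not> 1 \<le> N c t w - N c (t - h m) w" by (auto simp: B_def)
    then have "N c t w \<le> N c (t - h m) w" by simp
    moreover have "N c (t - h m) w \<le> lft (\<lambda>r. N c r w) t"
      using h[of m] le_lft_counting_path[OF cp[OF c w]] by simp
    ultimately show "lft (\<lambda>r. N c r w) t = N c t w"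
      using lft_counting_path_le[OF cp[OF c w] t] by simp
  qed
qed

text \<open>The interval is cut into m + 1 cells. A simultaneous jump puts two jumps into one cell,
  from the same channel or from two different ones; either has probability at most the square of the
  cell length, so the union bound is of order 1/(m + 1).\<close>

lemma AE_unit_jumps:
  assumes T: "0 \<le> T"
  shows "AE w in P. unit_jumps (total_count C (\<lambda>c t. N c t w)) T"
proof -
  define g where "g m i = T * real i / real (Suc m)" for m i
  define B where "B m i c d = (if c = d then {w \<in> space P. 2 \<le> N c (g m (Suc i)) w - N c (g m i) w}
     else {w \<in> space P. 1 \<le> N c (g m (Suc i)) w - N c (g m i) w \<and> 1 \<le> N d (g m (Suc i)) w - N d (g m i) w})" for m i c d
  define A where "A m = (\<Union>c\<in>C. \<Union>d\<in>C. \<Union>i\<in>{..m}. B m i c d)" for m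
  have g: "0 \<le> g m i" "g m i \<le> g m (Suc i)" "g m (Suc i) - g m i = T / real (Suc m)" for m i
  proof -
    show "g m (Suc i) - g m i = T / real (Suc m)"
      by (simp add: g_def diff_divide_distrib[symmetric] right_diff_distrib[symmetric])
    moreover have "0 \<le> T / real (Suc m)" using T by simp
    ultimately show "g m i \<le> g m (Suc i)" by linarith
    show "0 \<le> g m i" using T by (simp add: g_def)
  qed
  have B: "B m i c d \<in> sets P" "prob (B m i c d) \<le> (T / real (Suc m))\<^sup>2" if "c \<in> C" "d \<in> C" for m i c d
  proof -
    note [measurable] = increment_meas[OF that(1), of "g m (Suc i)" "g m i"]
       increment_meas[OF that(2), of "g m (Suc i)" "g m i"]
    have "{w \<in> space P. 2 \<le> N c (g m (Suc i)) w - N c (g m i) w} \<in> sets P"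
      "{w \<in> space P. 1 \<le> N c (g m (Suc i)) w - N c (g m i) w \<and> 1 \<le> N d (g m (Suc i)) w - N d (g m i) w} \<in> sets P"
      by measurable
    then show "B m i c d \<in> sets P" unfolding B_def by simp
    show "prob (B m i c d) \<le> (T / real (Suc m))\<^sup>2"
      using increment_at_least(2)[OF that(1) g(1,2), of m i] increments_both[OF that _ g(1,2), of m i]
      unfolding B_def g(3) by auto
  qed
  have A: "A m \<in> sets P" for m unfolding A_def using finC B by (intro sets.finite_UN) auto
  have "prob (\<Inter>m. A m) \<le> (real (card C))\<^sup>2 * T\<^sup>2 / real (Suc m)" for m
  proof -
    have "prob (\<Inter>m. A m) \<le> prob (A m)" using A by (intro finite_measure_mono) auto
    also have "\<dots> \<le> (\<Sum>c\<in>C. prob (\<Union>d\<in>C. \<Union>i\<in>{..m}. B m i c d))"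
      unfolding A_def using finC B by (intro finite_measure_subadditive_finite image_subsetI sets.finite_UN) auto
    also have "\<dots> \<le> (\<Sum>c\<in>C. \<Sum>d\<in>C. prob (\<Union>i\<in>{..m}. B m i c d))"
      using finC B by (intro sum_mono finite_measure_subadditive_finite image_subsetI sets.finite_UN) auto
    also have "\<dots> \<le> (\<Sum>c\<in>C. \<Sum>d\<in>C. \<Sum>i\<in>{..m}. prob (B m i c d))"
      using B by (intro sum_mono finite_measure_subadditive_finite) auto
    also have "\<dots> \<le> (\<Sum>c\<in>C. \<Sum>d\<in>C. \<Sum>i\<in>{..m}. (T / real (Suc m))\<^sup>2)"
      using B by (intro sum_mono) auto
    also have "\<dots> = (real (card C))\<^sup>2 * T\<^sup>2 / real (Suc m)"
      by (simp add: power2_eq_square divide_simps del: of_nat_Suc)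
    finally show ?thesis .
  qed
  moreover have "(\<lambda>m. (real (card C))\<^sup>2 * T\<^sup>2 / real (Suc m)) \<longlonglongrightarrow> 0"
    by (rule LIMSEQ_Suc[OF lim_const_over_n])
  ultimately have "prob (\<Inter>m. A m) \<le> 0"
    by (intro tendsto_lowerbound[of _ 0 sequentially]) auto
  then have "AE w in P. w \<notin> (\<Inter>m. A m)"
    using A by (intro AE_not_in) (auto simp: null_sets_def emeasure_eq_measure measure_le_0_iff)
  moreover have "AE w in P. w \<in> space P" by simp
  ultimately show ?thesis
  proof eventually_elim
    fix w assume "w \<notin> (\<Inter>m. A m)" and w: "w \<in> space P"
    then obtain m where m: "w \<notin> A m" by auto
    interpret cf: counting_family C "\<lambda>c t. N c t w" by standard (use finC cp w in auto)
    let ?K = "total_count C (\<lambda>c t. N c t w)"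
    show "unit_jumps ?K T" unfolding unit_jumps_def
    proof (intro allI impI)
      fix s assume s: "0 < s \<and> s \<le> T"
      then have T0: "0 < T" by simp
      \<comment> \<open>The cell (g m i, g m (Suc i)] that contains \<open>s\<close>; cells are
        closed on the right, hence the ceiling minus one.\<close>
      define i where "i = nat \<lceil>s * real (Suc m) / T\<rceil> - 1"
      have ceil: "0 < \<lceil>s * real (Suc m) / T\<rceil>" using s T0 by simp
      then have i1: "real (Suc i) = \<lceil>s * real (Suc m) / T\<rceil>" by (simp add: i_def)
      then have "s * real (Suc m) / T \<le> real (Suc i)" by linarith
      then have sle: "s \<le> g m (Suc i)" using T0 by (simp add: g_def field_simps)
      have "real i < s * real (Suc m) / T" using i1 by simp linarith
      then have lts: "g m i < s" using T0 by (simp add: g_def field_simps)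
      have "s * real (Suc m) / T \<le> real (Suc m)"
        using mult_right_mono[of s T "real (Suc m)"] s T0 by (simp add: divide_le_eq mult.commute)
      then have "\<lceil>s * real (Suc m) / T\<rceil> \<le> int (Suc m)" by (simp add: ceiling_le_iff)
      then have im: "i \<le> m" using ceil by (simp add: i_def)
      have inc: "N c s w - lft (\<lambda>r. N c r w) s \<le> N c (g m (Suc i)) w - N c (g m i) w" if "c \<in> C" for c
        using counting_path_mono[OF cp[OF that w], of s "g m (Suc i)"] s sle
          le_lft_counting_path[OF cp[OF that w] g(1) lts] by simp
      show "?K s \<le> Suc (lft ?K s)"
      proof (rule ccontr)
        assume "\<not> ?K s \<le> Suc (lft ?K s)"
        then have big: "(\<Sum>c\<in>C. lft (\<lambda>t. N c t w) s) + 2 \<le> (\<Sum>c\<in>C. N c s w)"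
          using cf.lft_total[of s] s by (simp add: total_count_def)
        then obtain c where c: "c \<in> C" "lft (\<lambda>t. N c t w) s < N c s w"
          using sum_mono[of C "\<lambda>c. N c s w" "\<lambda>c. lft (\<lambda>t. N c t w) s"] by force
        have "\<exists>d\<in>C. d \<noteq> c \<and> lft (\<lambda>t. N d t w) s < N d s w" if "\<not> 2 \<le> N c s w - lft (\<lambda>t. N c t w) s"
        proof (rule ccontr)
          assume "\<not> ?thesis"
          then have "(\<Sum>d\<in>C-{c}. N d s w) \<le> (\<Sum>d\<in>C-{c}. lft (\<lambda>t. N d t w) s)"
            by (intro sum_mono) force
          then show False using big that c finC by (simp add: sum.remove)
        qed
        then obtain d where d: "d \<in> C" "d = c \<longrightarrow> 2 \<le> N c s w - lft (\<lambda>t. N c t w) s"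
          "d \<noteq> c \<longrightarrow> lft (\<lambda>t. N d t w) s < N d s w" using c by blast
        have "w \<in> B m i c d" using inc[OF c(1)] inc[OF d(1)] c d w by (auto simp: B_def)
        then show False using m c(1) d(1) im by (auto simp: A_def)
      qed
    qed
  qed
qed

text \<open>The weights grow at most geometrically in the numbers of jumps, so this moment, finite
  for every base \<open>b\<close>, provides the integrable majorant. Independence reduces it to a
  single Poisson variable.\<close>

lemma exponential_moment:
  assumes "0 \<le> t" "0 \<le> (b::real)"
  shows "(\<integral>\<^sup>+w. ennreal (\<Prod>c\<in>C. b ^ N c t w) \<partial>P) < \<infinity>"
proof -
  have one: "(\<integral>\<^sup>+w. ennreal (b ^ N c t w) \<partial>P) < \<infinity>" if c: "c \<in> C" for c
  proof -
    have "{w \<in> space P. N c t w = k} = {w \<in> space P. N c t w - N c 0 w = k}" for k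
      using cp[OF c] by (auto simp: counting_path_def)
    then have "emeasure P {w \<in> space P. N c t w = k} = ennreal (t ^ k / fact k * exp (- t))" for k
      using prob_increment[OF c order_refl assms(1)] by (simp add: emeasure_eq_measure)
    then have "(\<integral>\<^sup>+w. ennreal (b ^ N c t w) \<partial>P) = (\<Sum>k. ennreal (b ^ k * (t ^ k / fact k * exp (- t))))"
      using assms by (subst nn_integral_nat_valued[OF N_meas[OF c]]) (simp add: ennreal_mult'[symmetric])
    also have "\<dots> = ennreal (exp (b * t - t))"
      by (rule suminf_ennreal_sums[OF exp_series_times_sums]) (use assms in auto)
    finally show ?thesis by simp
  qed
  let ?Y = "\<lambda>d w. ennreal (case d of None \<Rightarrow> 1 | Some c \<Rightarrow> b ^ N c t w)"
  have "indep_vars (\<lambda>_. borel) (\<lambda>d w. (\<lambda>f. ennreal (b ^ f t)) (noise_var d w)) (Some ` C)"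
    by (rule indep_vars_compose2[OF indep_vars_subset[OF indep]]) auto
  then have ind: "indep_vars (\<lambda>_. borel) ?Y (Some ` C)"
    by (rule indep_vars_cong[THEN iffD1, rotated -1]) auto
  have "(\<integral>\<^sup>+w. (\<Prod>d\<in>Some ` C. ?Y d w) \<partial>P) = (\<Prod>d\<in>Some ` C. \<integral>\<^sup>+w. ?Y d w \<partial>P)"
    by (rule indep_vars_nn_integral[OF _ ind]) (use finC in auto)
  also have "(\<integral>\<^sup>+w. (\<Prod>d\<in>Some ` C. ?Y d w) \<partial>P) = (\<integral>\<^sup>+w. ennreal (\<Prod>c\<in>C. b ^ N c t w) \<partial>P)"
    using assms by (simp add: prod.reindex prod_ennreal)
  also have "(\<Prod>d\<in>Some ` C. \<integral>\<^sup>+w. ?Y d w \<partial>P) = (\<Prod>c\<in>C. \<integral>\<^sup>+w. ennreal (b ^ N c t w) \<partial>P)"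
    by (simp add: prod.reindex)
  also have "\<dots> < \<infinity>" using one finC by (induction C rule: infinite_finite_induct) (auto simp: ennreal_mult_less_top)
  finally show ?thesis .
qed

section \<open>Compensation formula for predictable integrands\<close>

sublocale filtration G "space P"
  by (rule filtration_G)

text \<open>The default 1 is a positive time, which keeps the point inside the predictable space,
  and \<open>max 1 T\<close> bounds both cases of the conditional.\<close>

lemma jump_point_measurable:
  assumes c: "c \<in> C" and T: "0 \<le> T"
  shows "(\<lambda>w. (if 1 \<le> l \<and> l \<le> N c T w then nth_jump (\<lambda>t. N c t w) l else 1, w)) \<in> measurable P Pr"
proof -
  let ?t = "max 1 T"
  let ?s = "\<lambda>w. if 1 \<le> l \<and> l \<le> N c T w then nth_jump (\<lambda>t. N c t w) l else 1"
  have bd: "0 < ?s w \<and> ?s w \<le> ?t" if "w \<in> space P" for w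
    using nth_jump[OF cp[OF c that], of l T] T by auto
  have "?s \<in> borel_measurable (G ?t)"
  proof (subst borel_measurable_iff_le, intro allI)
    fix r :: real
    have "{w \<in> space (G ?t). ?s w \<le> r} = (if 0 \<le> r then {w \<in> space (G ?t).
      (1 \<le> l \<and> l \<le> N c T w \<and> l \<le> N c (min r T) w) \<or> (\<not> (1 \<le> l \<and> l \<le> N c T w) \<and> 1 \<le> r)} else {})"
    proof -
      have "?s w \<le> r \<longleftrightarrow> 0 \<le> r \<and> ((1 \<le> l \<and> l \<le> N c T w \<and> l \<le> N c (min r T) w) \<or>
          (\<not> (1 \<le> l \<and> l \<le> N c T w) \<and> 1 \<le> r))" if w: "w \<in> space P" for w
      proof (cases "0 \<le> r")
        case False
        then show ?thesis using bd[OF w] by auto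
      next
        case r: True
        show ?thesis
        proof (cases "1 \<le> l \<and> l \<le> N c T w")
          case True
          then have l: "1 \<le> l" "l \<le> N c T w" by auto
          have "nth_jump (\<lambda>t. N c t w) l \<le> r \<longleftrightarrow> l \<le> N c r w"
            by (rule nth_jump_le_iff[OF cp[OF c w] l T r])
          moreover have "l \<le> N c (min r T) w \<longleftrightarrow> l \<le> N c r w"
            using l counting_path_mono[OF cp[OF c w] T, of r] by (auto simp: min_def)
          ultimately show ?thesis using True l r by simp
        next
          case False
          then show ?thesis using r by auto
        qed
      qed
      then have "{w \<in> space P. ?s w \<le> r} = {w \<in> space P. 0 \<le> r \<and> ((1 \<le> l \<and> l \<le> N c T w \<and> l \<le> N c (min r T) w) \<or>
          (\<not> (1 \<le> l \<and> l \<le> N c T w) \<and> 1 \<le> r))}" by blast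
      then show ?thesis unfolding space_G by (cases "0 \<le> r") (simp_all only: if_True if_False simp_thms Collect_empty_eq empty_def)
    qed
    moreover have "{w \<in> space (G ?t).
      (1 \<le> l \<and> l \<le> N c T w \<and> l \<le> N c (min r T) w) \<or> (\<not> (1 \<le> l \<and> l \<le> N c T w) \<and> 1 \<le> r)} \<in> sets (G ?t)"
      if "0 \<le> r"
    proof -
      have [measurable]: "N c (min r T) \<in> measurable (G ?t) (count_space UNIV)"
        "N c T \<in> measurable (G ?t) (count_space UNIV)"
        using measurable_F_mono[OF _ _ N_adapted[OF c, of "min r T"], of ?t]
          measurable_F_mono[OF T _ N_adapted[OF c T], of ?t] T that by simp_all
      note [measurable] = this[THEN borel_measurable_natI]
      show ?thesis by measurable
    qed
    ultimately show "{w \<in> space (G ?t). ?s w \<le> r} \<in> sets (G ?t)"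
      by (cases "0 \<le> r") (simp_all only: if_True if_False sets.empty_sets)
  qed
  from measurable_eval_Pr[OF this bd] have "(\<lambda>w. (?s w, w)) \<in> measurable (G ?t) Pr" by simp
  then show "(\<lambda>w. (?s w, w)) \<in> measurable P Pr"
    using sets_G_subset[of ?t] by (auto simp: measurable_def)
qed

lemma product_point_measurable:
  "(\<lambda>(s, w). (if 0 < s then s else 1, w)) \<in> measurable (lborel \<Otimes>\<^sub>M P) Pr" (is "?sig \<in> _")
proof (rule measurable_into_Pr)
  fix a B assume "0 \<le> a" and B: "B \<in> sets (G a)"
  then have [measurable]: "B \<in> sets P" using sets_G_subset by auto
  have "?sig -` ({a<..} \<times> B) \<inter> space (lborel \<Otimes>\<^sub>M P) =
    {x \<in> space (lborel \<Otimes>\<^sub>M P). a < (if 0 < fst x then fst x else 1) \<and> snd x \<in> B}"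
    by auto
  also have "\<dots> \<in> sets (lborel \<Otimes>\<^sub>M P)" by measurable
  finally show "?sig -` ({a<..} \<times> B) \<inter> space (lborel \<Otimes>\<^sub>M P) \<in> sets (lborel \<Otimes>\<^sub>M P)" .
qed (auto simp: space_pair_measure)

text \<open>Both sides are integrals against measures on the predictable sigma-algebra:
  \<open>M1\<close> is the image of counting measure times \<open>P\<close> under the jump points up
  to \<open>T\<close>, and \<open>M2\<close> is Lebesgue measure times \<open>P\<close> on (0,T].
  They agree on the generating rectangles, which form a pi-system, hence everywhere.\<close>

theorem compensation:
  assumes c: "c \<in> C" and T: "0 \<le> T" and f: "f \<in> borel_measurable (predictable G (space P))"
  shows "(\<integral>\<^sup>+w. (\<Sum>l\<in>{1..N c T w}. f (nth_jump (\<lambda>t. N c t w) l, w)) \<partial>P) =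
    (\<integral>\<^sup>+x. f x * indicator {0<..T} (fst x) \<partial>(lborel \<Otimes>\<^sub>M P))"
proof -
  define Ind where "Ind = (\<lambda>(l, w). 1 \<le> l \<and> l \<le> N c T w)"
  define tau where "tau = (\<lambda>(l, w). (if Ind (l, w) then nth_jump (\<lambda>t. N c t w) l else 1, w))"
  define M1 where "M1 = distr (density (count_space UNIV \<Otimes>\<^sub>M P) (\<lambda>x. indicator {x. Ind x} x)) Pr tau"
  define sig where "sig = (\<lambda>(s::real, w::'w). (if 0 < s then s else 1, w))"
  define M2 where "M2 = distr (density (lborel \<Otimes>\<^sub>M P) (\<lambda>x. indicator {0<..T} (fst x))) Pr sig"
  have Ind [measurable]: "Measurable.pred (count_space UNIV \<Otimes>\<^sub>M P) Ind"
    by (rule measurable_pair_measure_countable1) (use c in \<open>auto simp: Ind_def\<close>)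
  have tau [measurable]: "tau \<in> measurable (count_space UNIV \<Otimes>\<^sub>M P) Pr"
  proof (rule measurable_pair_measure_countable1)
    fix l :: nat
    show "(\<lambda>w. tau (l, w)) \<in> measurable P Pr"
      using jump_point_measurable[OF c T, of l] by (simp add: tau_def Ind_def)
  qed simp
  have sig [measurable]: "sig \<in> measurable (lborel \<Otimes>\<^sub>M P) Pr"
    unfolding sig_def by (rule product_point_measurable)
  interpret CP: pair_sigma_finite "count_space (UNIV::nat set)" P
    by (intro pair_sigma_finite.intro sigma_finite_measure_count_space sigma_finite_measure_axioms)
  interpret LP: pair_sigma_finite lborel P
    by (intro pair_sigma_finite.intro lborel.sigma_finite_measure_axioms sigma_finite_measure_axioms)
  have int1: "(\<integral>\<^sup>+x. g x \<partial>M1) = (\<integral>\<^sup>+w. (\<Sum>l\<in>{1..N c T w}. g (nth_jump (\<lambda>t. N c t w) l, w)) \<partial>P)"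
    if [measurable]: "g \<in> borel_measurable Pr" for g :: "real \<times> 'w \<Rightarrow> ennreal"
  proof -
    have "(\<integral>\<^sup>+x. g x \<partial>M1) = (\<integral>\<^sup>+x. indicator {x. Ind x} x * g (tau x) \<partial>(count_space UNIV \<Otimes>\<^sub>M P))"
      unfolding M1_def by (simp add: nn_integral_distr nn_integral_density)
    also have "\<dots> = (\<integral>\<^sup>+w. \<integral>\<^sup>+l. indicator {x. Ind x} (l, w) * g (tau (l, w)) \<partial>count_space UNIV \<partial>P)"
      by (rule CP.nn_integral_snd[symmetric]) measurable
    also have "\<dots> = (\<integral>\<^sup>+w. (\<Sum>l\<in>{1..N c T w}. g (nth_jump (\<lambda>t. N c t w) l, w)) \<partial>P)"
    proof (rule nn_integral_cong)
      fix w
      have "(\<Sum>l. indicator {x. Ind x} (l, w) * g (tau (l, w))) =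
        (\<Sum>l\<in>{1..N c T w}. indicator {x. Ind x} (l, w) * g (tau (l, w)))"
        by (rule suminf_finite) (auto simp: Ind_def)
      also have "\<dots> = (\<Sum>l\<in>{1..N c T w}. g (nth_jump (\<lambda>t. N c t w) l, w))"
        by (rule sum.cong) (auto simp: Ind_def tau_def)
      finally show "(\<integral>\<^sup>+l. indicator {x. Ind x} (l, w) * g (tau (l, w)) \<partial>count_space UNIV) =
        (\<Sum>l\<in>{1..N c T w}. g (nth_jump (\<lambda>t. N c t w) l, w))"
        by (simp add: nn_integral_count_space_nat)
    qed
    finally show ?thesis .
  qed
  have int2: "(\<integral>\<^sup>+x. g x \<partial>M2) = (\<integral>\<^sup>+x. g x * indicator {0<..T} (fst x) \<partial>(lborel \<Otimes>\<^sub>M P))"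
    if [measurable]: "g \<in> borel_measurable Pr" for g :: "real \<times> 'w \<Rightarrow> ennreal"
  proof -
    have "(\<integral>\<^sup>+x. g x \<partial>M2) = (\<integral>\<^sup>+x. indicator {0<..T} (fst x) * g (sig x) \<partial>(lborel \<Otimes>\<^sub>M P))"
      unfolding M2_def by (simp add: nn_integral_distr nn_integral_density)
    also have "\<dots> = (\<integral>\<^sup>+x. g x * indicator {0<..T} (fst x) \<partial>(lborel \<Otimes>\<^sub>M P))"
      by (intro nn_integral_cong) (auto simp: sig_def indicator_def)
    finally show ?thesis .
  qed
  have rect: "emeasure M1 E = ennreal (T - a) * emeasure P B \<and> emeasure M2 E = ennreal (T - a) * emeasure P B"
    if a: "0 \<le> a" and B: "B \<in> sets (G a)" and E: "E = {a<..} \<times> B" for E a B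
  proof
    have BP [measurable]: "B \<in> sets P" using B sets_G_subset by auto
    have EP [measurable]: "E \<in> sets Pr" unfolding E by (rule rect_in_Pr[OF a B])
    have EM: "E \<in> sets M1" "E \<in> sets M2" using EP by (simp_all add: M1_def M2_def)
    have "emeasure M1 E = (\<integral>\<^sup>+w. (\<Sum>l\<in>{1..N c T w}. indicator E (nth_jump (\<lambda>t. N c t w) l, w)) \<partial>P)"
      using int1[of "indicator E"] EM by simp
    \<comment> \<open>Cutting \<open>a\<close> at \<open>T\<close> makes the increment zero for
      rectangles that start after \<open>T\<close>; there \<open>ennreal (T - a)\<close> is zero as
      well.\<close>
    also have "\<dots> = (\<integral>\<^sup>+w. indicator B w * of_nat (N c T w - N c (min a T) w) \<partial>P)"
    proof (rule nn_integral_cong)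
      fix w assume w: "w \<in> space P"
      have "(\<Sum>l\<in>{1..N c T w}. indicator E (nth_jump (\<lambda>t. N c t w) l, w) :: ennreal) =
        (\<Sum>l\<in>{1..N c T w}. if N c (min a T) w < l then indicator B w else 0)"
      proof (rule sum.cong[OF refl])
        fix l assume l: "l \<in> {1..N c T w}"
        have "nth_jump (\<lambda>t. N c t w) l \<le> min a T \<longleftrightarrow> l \<le> N c (min a T) w"
          using l a T by (intro nth_jump_le_iff[OF cp[OF c w], where t=T]) auto
        moreover have "nth_jump (\<lambda>t. N c t w) l \<le> T"
          using l T by (intro nth_jump_le[OF cp[OF c w]]) auto
        ultimately have "a < nth_jump (\<lambda>t. N c t w) l \<longleftrightarrow> N c (min a T) w < l" by (auto simp: not_le[symmetric])
        then show "(indicator E (nth_jump (\<lambda>t. N c t w) l, w) :: ennreal) = (if N c (min a T) w < l then indicator B w else 0)"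
          by (auto simp: E indicator_def)
      qed
      also have "\<dots> = (\<Sum>l\<in>{N c (min a T) w<..N c T w}. indicator B w)"
        by (intro sum.mono_neutral_cong_right) auto
      finally show "(\<Sum>l\<in>{1..N c T w}. indicator E (nth_jump (\<lambda>t. N c t w) l, w) :: ennreal) =
        indicator B w * of_nat (N c T w - N c (min a T) w)" by (simp add: mult.commute)
    qed
    also have "\<dots> = ennreal (T - a) * emeasure P B"
    proof (cases "a \<le> T")
      case True
      then show ?thesis using nn_integral_increment[OF c a True B] by (simp add: min_absorb1 mult.commute)
    next
      case False
      then show ?thesis by (simp add: min_absorb2 ennreal_neg)
    qed
    finally show "emeasure M1 E = ennreal (T - a) * emeasure P B" .
    have "emeasure M2 E = (\<integral>\<^sup>+x. indicator E x * indicator {0<..T} (fst x) \<partial>(lborel \<Otimes>\<^sub>M P))"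
      using int2[of "indicator E"] EM by simp
    also have "\<dots> = (\<integral>\<^sup>+x. indicator ({a<..T} \<times> B) x \<partial>(lborel \<Otimes>\<^sub>M P))"
      using a by (intro nn_integral_cong) (auto simp: E indicator_def)
    also have "\<dots> = ennreal (T - a) * emeasure P B"
      by (cases "a \<le> T") (simp_all add: emeasure_pair_measure_Times ennreal_neg)
    finally show "emeasure M2 E = ennreal (T - a) * emeasure P B" .
  qed
  have "M1 = M2"
  proof (rule measure_eqI_generator_eq)
    let ?E = "{{a<..} \<times> B | a B. 0 \<le> a \<and> B \<in> sets (G a)}"
    show "Int_stable ?E"
    proof (rule Int_stableI, clarify)
      fix a B a' B' assume *: "0 \<le> a" "B \<in> sets (G a)" "0 \<le> a'" "B' \<in> sets (G a')"
      have "({a<..} \<times> B) \<inter> ({a'<..} \<times> B') = {max a a'<..} \<times> (B \<inter> B')" by auto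
      moreover have "B \<in> sets (G (max a a'))" "B' \<in> sets (G (max a a'))"
        using * mono_F[of a "max a a'"] mono_F[of a' "max a a'"] by auto
      ultimately show "\<exists>a'' B''. ({a<..} \<times> B) \<inter> ({a'<..} \<times> B') = {a''<..} \<times> B'' \<and> 0 \<le> a'' \<and> B'' \<in> sets (G a'')"
        using * by (intro exI[of _ "max a a'"] exI[of _ "B \<inter> B'"]) auto
    qed
    show "?E \<subseteq> Pow ({0<..} \<times> space P)" by (rule generators_subset)
    show "emeasure M1 E = emeasure M2 E" if "E \<in> ?E" for E using that rect by auto
    show "sets M1 = sigma_sets ({0<..} \<times> space P) ?E" by (simp add: M1_def sets_Pr)
    show "sets M2 = sigma_sets ({0<..} \<times> space P) ?E" by (simp add: M2_def sets_Pr)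
    show "range (\<lambda>_::nat. {0<..} \<times> space P) \<subseteq> ?E"
      using sets.top[of "G 0"] by force
    show "emeasure M1 ({0<..} \<times> space P) \<noteq> \<infinity>"
      using rect[of 0 "space P" "{0<..} \<times> space P"] sets.top[of "G 0"] by (auto simp: emeasure_space_1)
  qed auto
  then show ?thesis using int1[OF f] int2[OF f] by simp
qed

lemma borel_measurable_product:
  fixes f :: "real \<times> 'w \<Rightarrow> real"
  assumes "f \<in> borel_measurable Pr"
  shows "(\<lambda>x. indicator {0<..t} (fst x) * f x) \<in> borel_measurable (lborel \<Otimes>\<^sub>M P)"
proof -
  note [measurable] = measurable_compose[OF product_point_measurable assms]
  have "(\<lambda>x. indicator {0<..t} (fst x) * f (case x of (s, w) \<Rightarrow> (if 0 < s then s else 1, w))) \<in> borel_measurable (lborel \<Otimes>\<^sub>M P)"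
    by measurable
  then show ?thesis
    by (rule measurable_cong[THEN iffD1, rotated]) (auto simp: indicator_def)
qed

lemma compensation_real:
  fixes f :: "real \<times> 'w \<Rightarrow> real"
  assumes c: "c \<in> C" and T: "0 \<le> T" and f: "f \<in> borel_measurable Pr"
    and nonneg: "\<And>x. 0 \<le> f x"
    and int: "integrable (lborel \<Otimes>\<^sub>M P) (\<lambda>x. indicator {0<..T} (fst x) * f x)"
  shows "integrable P (\<lambda>w. \<Sum>l\<in>{1..N c T w}. f (nth_jump (\<lambda>t. N c t w) l, w))"
    and "(LINT w|P. (\<Sum>l\<in>{1..N c T w}. f (nth_jump (\<lambda>t. N c t w) l, w))) =
      (LINT x|(lborel \<Otimes>\<^sub>M P). indicator {0<..T} (fst x) * f x)"
proof -
  let ?g = "\<lambda>w. \<Sum>l\<in>{1..N c T w}. f (nth_jump (\<lambda>t. N c t w) l, w)"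
  let ?h = "\<lambda>m w. \<Sum>l\<in>{1..m}. f (if 1 \<le> l \<and> l \<le> N c T w then nth_jump (\<lambda>t. N c t w) l else 1, w)"
  have "?h m \<in> borel_measurable P" for m
    by (intro borel_measurable_sum measurable_compose[OF jump_point_measurable[OF c T] f])
  from measurable_compose_countable[of ?h, OF this N_meas[OF c]]
  have "(\<lambda>w. ?h (N c T w) w) \<in> borel_measurable P" .
  then have g: "?g \<in> borel_measurable P"
    by (rule measurable_cong[THEN iffD1, rotated]) (auto intro!: sum.cong)
  have "(\<integral>\<^sup>+w. ennreal (?g w) \<partial>P) = (\<integral>\<^sup>+w. (\<Sum>l\<in>{1..N c T w}. ennreal (f (nth_jump (\<lambda>t. N c t w) l, w))) \<partial>P)"
    using nonneg by (intro nn_integral_cong) (simp add: sum_ennreal)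
  also have "\<dots> = (\<integral>\<^sup>+x. ennreal (f x) * indicator {0<..T} (fst x) \<partial>(lborel \<Otimes>\<^sub>M P))"
    by (rule compensation[OF c T]) (use f in measurable)
  also have "\<dots> = (\<integral>\<^sup>+x. ennreal (indicator {0<..T} (fst x) * f x) \<partial>(lborel \<Otimes>\<^sub>M P))"
    by (intro nn_integral_cong) (auto simp: indicator_def)
  also have "\<dots> = ennreal (LINT x|(lborel \<Otimes>\<^sub>M P). indicator {0<..T} (fst x) * f x)"
    by (rule nn_integral_eq_integral[OF int]) (use nonneg in auto)
  finally have eq: "(\<integral>\<^sup>+w. ennreal (?g w) \<partial>P) = ennreal (LINT x|(lborel \<Otimes>\<^sub>M P). indicator {0<..T} (fst x) * f x)" .
  have "has_bochner_integral P ?g (LINT x|(lborel \<Otimes>\<^sub>M P). indicator {0<..T} (fst x) * f x)"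
    by (rule has_bochner_integral_nn_integral[OF g _ _ eq])
      (use nonneg in \<open>auto intro!: sum_nonneg integral_nonneg_AE\<close>)
  then show "integrable P ?g" "(LINT w|P. ?g w) = (LINT x|(lborel \<Otimes>\<^sub>M P). indicator {0<..T} (fst x) * f x)"
    by (auto simp: has_bochner_integral_iff)
qed

end

section \<open>Evolution of weighted chains\<close>

lemma bounded_measurable_set_integrable:
  fixes f :: "real \<Rightarrow> real"
  assumes "f \<in> borel_measurable borel" "\<And>r. \<bar>f r\<bar> \<le> M"
  shows "set_integrable lborel {a<..<b} f"
  unfolding set_integrable_def
proof (rule integrableI_bounded_set_indicator[where B=M])
  show "emeasure lborel {a<..<b} < \<infinity>" by (cases "a \<le> b") auto
qed (use assms in auto)

lemma set_integral_bound:
  fixes f :: "real \<Rightarrow> real"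
  assumes "f \<in> borel_measurable borel" "\<And>r. a < r \<Longrightarrow> r < b \<Longrightarrow> \<bar>f r\<bar> \<le> M" "a \<le> b"
  shows "\<bar>LBINT r:{a<..<b}. f r\<bar> \<le> M * (b - a)"
proof -
  have "\<bar>LBINT r:{a<..<b}. f r\<bar> = norm (LBINT r. indicator {a<..<b} r * f r)"
    by (simp add: set_lebesgue_integral_def)
  also have "\<dots> \<le> (LBINT r. indicator {a<..<b} r * M)"
  proof (rule order_trans[OF integral_norm_bound integral_mono])
    show "integrable lborel (\<lambda>r. norm (indicator {a<..<b} r * f r))"
      using assms
      by (intro integrable_norm integrableI_bounded_set[where A="{a<..<b}" and B=M]) (auto simp: indicator_def)
    show "integrable lborel (\<lambda>r. indicator {a<..<b} r * M)" using assms by simp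
    show "norm (indicator {a<..<b} r * f r) \<le> indicator {a<..<b} r * M" for r
      using assms by (auto simp: indicator_def)
  qed
  also have "\<dots> = M * (b - a)" using assms by simp
  finally show ?thesis .
qed

lemma set_integral_split:
  fixes f :: "real \<Rightarrow> real"
  assumes "f \<in> borel_measurable borel" "\<And>r. \<bar>f r\<bar> \<le> M" "a \<le> b" "b \<le> c"
  shows "(LBINT r:{a<..<c}. f r) = (LBINT r:{a<..<b}. f r) + (LBINT r:{b<..<c}. f r)"
proof -
  have "(LBINT r:{a<..<c}. f r) = (LBINT r:{a<..<b} \<union> {b<..<c}. f r)"
    unfolding set_lebesgue_integral_def
    by (rule integral_cong_AE) (use assms AE_lborel_singleton[of b] in \<open>auto simp: indicator_def\<close>)
  also have "\<dots> = (LBINT r:{a<..<b}. f r) + (LBINT r:{b<..<c}. f r)"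
    by (rule set_integral_Un) (auto intro!: bounded_measurable_set_integrable[OF assms(1,2)])
  finally show ?thesis .
qed

lemma exp_diff_le:
  fixes x y L :: real
  assumes "x \<le> L" "y \<le> L" shows "\<bar>exp x - exp y\<bar> \<le> exp L * \<bar>x - y\<bar>"
proof -
  have *: "\<bar>exp x - exp y\<bar> \<le> exp L * \<bar>x - y\<bar>" if xy: "x < y" "y \<le> L" for x y
  proof -
    obtain z where "x < z" "z < y" "exp y - exp x = (y - x) * exp z"
      using MVT2[OF xy(1), of exp exp] by (auto intro: DERIV_exp)
    moreover have "(y - x) * exp z \<le> (y - x) * exp L" using \<open>z < y\<close> xy by simp
    ultimately show ?thesis using xy by (simp add: mult.commute)
  qed
  show ?thesis
    using *[of x y] *[of y x] assms by (cases x y rule: linorder_cases) (auto simp: abs_minus_commute)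
qed

text \<open>Difference quotients are at most |M| |y - x|, so the derivative vanishes throughout the
  interval.\<close>

lemma quadratic_modulus_constant:
  fixes f :: "real \<Rightarrow> real"
  assumes "a \<le> b" "\<And>x y. a \<le> x \<Longrightarrow> x \<le> y \<Longrightarrow> y \<le> b \<Longrightarrow> \<bar>f y - f x\<bar> \<le> M * (y - x)\<^sup>2"
  shows "f a = f b"
proof -
  have "(f has_field_derivative 0) (at x within {a..b})" if x: "x \<in> {a..b}" for x
    unfolding has_field_derivative_iff
  proof (rule Lim_null_comparison)
    have "norm ((f y - f x) / (y - x)) \<le> \<bar>M\<bar> * \<bar>y - x\<bar>" if y: "y \<in> {a..b}" "y \<noteq> x" for y
    proof -
      have "\<bar>f y - f x\<bar> \<le> M * (y - x)\<^sup>2"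
        using assms(2)[of x y] assms(2)[of y x] x y
        by (cases "x \<le> y") (auto simp: abs_minus_commute power2_commute)
      also have "\<dots> \<le> \<bar>M\<bar> * \<bar>y - x\<bar> * \<bar>y - x\<bar>"
        by (simp add: power2_eq_square[symmetric] mult.assoc abs_mult_self_eq mult_right_mono flip: abs_mult)
      finally show ?thesis using y by (simp add: divide_le_eq abs_divide)
    qed
    then show "\<forall>\<^sub>F y in at x within {a..b}. norm ((f y - f x) / (y - x)) \<le> \<bar>M\<bar> * \<bar>y - x\<bar>"
      by (auto simp: eventually_at_filter)
    show "((\<lambda>y. \<bar>M\<bar> * \<bar>y - x\<bar>) \<longlongrightarrow> 0) (at x within {a..b})"
      by (auto intro!: tendsto_eq_intros)
  qed
  then obtain k where "\<And>x. x \<in> {a..b} \<Longrightarrow> f x = k"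
    using has_field_derivative_zero_constant[of "{a..b}" f] by auto
  then show ?thesis using assms(1) by simp
qed

text \<open>The exponent need not be differentiable everywhere; the difference of both sides has a
  quadratic modulus of continuity instead.\<close>
lemma exp_integral:
  fixes k :: "real \<Rightarrow> real"
  assumes k: "k \<in> borel_measurable borel" "\<And>r. \<bar>k r\<bar> \<le> M" and ab: "0 \<le> a" "a \<le> b"
  defines "F \<equiv> (\<lambda>t. LBINT r:{0<..<t}. k r)"
  shows "exp (F b) - exp (F a) = (LBINT r:{a<..<b}. exp (F r) * k r)"
proof -
  have M0: "0 \<le> M" using k(2)[of 0] by simp
  define L where "L = M * b"
  have Fdiff: "F y - F x = (LBINT r:{x<..<y}. k r)" if "0 \<le> x" "x \<le> y" for x y
    unfolding F_def using set_integral_split[OF k that] by simp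
  have Flip: "\<bar>F y - F x\<bar> \<le> M * (y - x)" if "0 \<le> x" "x \<le> y" for x y
    unfolding Fdiff[OF that] by (rule set_integral_bound[OF k(1)]) (use k that in auto)
  have F0: "F t = 0" if "t \<le> 0" for t using that by (simp add: F_def set_lebesgue_integral_def)
  have FL: "F x \<le> L" if "x \<le> b" for x
  proof (cases "0 \<le> x")
    case True
    have "M * x \<le> L" using that M0 by (simp add: L_def mult_left_mono)
    then show ?thesis using Flip[of 0 x] F0[of 0] True by simp
  next
    case False then show ?thesis using F0[of x] M0 ab by (simp add: L_def)
  qed
  \<comment> \<open>The exponent is stopped at \<open>b\<close> so that \<open>g\<close> is bounded
    on the whole line; on (0,b) it is the integrand of the claim.\<close>
  define g where "g r = exp (F (min r b)) * k r" for r
  have Fmeas: "F \<in> borel_measurable borel"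
  proof -
    have "(\<lambda>(t, r). indicator {r. 0 < r \<and> r < t} r *\<^sub>R k r) \<in> borel_measurable (borel \<Otimes>\<^sub>M lborel)"
      using k(1) unfolding indicator_def by measurable
    from lborel.borel_measurable_lebesgue_integral[of "\<lambda>t r. indicator {r. 0 < r \<and> r < t} r *\<^sub>R k r", OF this]
    show ?thesis unfolding F_def set_lebesgue_integral_def
      by (simp add: indicator_def greaterThanLessThan_def greaterThan_def lessThan_def Int_def)
  qed
  have g: "g \<in> borel_measurable borel" unfolding g_def using Fmeas k(1) by measurable
  have gM: "\<bar>g r\<bar> \<le> exp L * M" for r
    unfolding g_def abs_mult using k(2)[of r] FL[of "min r b"] by (intro mult_mono) auto
  define H where "H t = exp (F t) - (LBINT r:{0<..<t}. g r)" for t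
  have "H 0 = H b" "H 0 = H a"
  proof -
    \<comment> \<open>One half of the constant comes from replacing the mean value
      \<open>exp z\<close> by \<open>exp (F x)\<close>, the other from replacing
      \<open>exp (F r)\<close> by \<open>exp (F x)\<close> under the integral.\<close>
    have mod: "\<bar>H y - H x\<bar> \<le> (2 * exp L * M\<^sup>2) * (y - x)\<^sup>2" if xy: "0 \<le> x" "x \<le> y" "y \<le> b" for x y
    proof -
      let ?d = "F y - F x"
      obtain z where z: "min (F x) (F y) \<le> z" "z \<le> max (F x) (F y)" "exp (F y) - exp (F x) = ?d * exp z"
      proof (cases "F x" "F y" rule: linorder_cases)
        case less
        then obtain z where "F x < z" "z < F y" "exp (F y) - exp (F x) = ?d * exp z"
          using MVT2[OF less, of exp exp] by (auto intro: DERIV_exp)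
        then show ?thesis using that[of z] by auto
      next
        case equal then show ?thesis using that[of "F x"] by simp
      next
        case greater
        then obtain z where "F y < z" "z < F x" "exp (F x) - exp (F y) = (F x - F y) * exp z"
          using MVT2[OF greater, of exp exp] by (auto intro: DERIV_exp)
        then show ?thesis using that[of z] by (auto simp: algebra_simps)
      qed
      have "H y - H x = ?d * exp z - (LBINT r:{x<..<y}. g r)"
        unfolding H_def using set_integral_split[OF g gM xy(1,2)] z(3) by simp
      also have "?d * exp z = ?d * (exp z - exp (F x)) + exp (F x) * ?d" by (simp add: algebra_simps)
      also have "exp (F x) * ?d = (LBINT r:{x<..<y}. exp (F x) * k r)"
        unfolding Fdiff[OF xy(1,2)] by simp
      also have "?d * (exp z - exp (F x)) + (LBINT r:{x<..<y}. exp (F x) * k r) - (LBINT r:{x<..<y}. g r) =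
        ?d * (exp z - exp (F x)) + (LBINT r:{x<..<y}. exp (F x) * k r - g r)"
        by (subst set_integral_diff(2))
          (auto intro!: bounded_measurable_set_integrable[OF g gM] set_integrable_mult_right
            bounded_measurable_set_integrable[OF k])
      finally have eq: "H y - H x = ?d * (exp z - exp (F x)) + (LBINT r:{x<..<y}. exp (F x) * k r - g r)" .
      have "\<bar>exp z - exp (F x)\<bar> \<le> exp L * \<bar>z - F x\<bar>"
        using z FL[of x] FL[of y] xy by (intro exp_diff_le) auto
      also have "\<bar>z - F x\<bar> \<le> \<bar>?d\<bar>" using z by auto
      finally have e1: "\<bar>exp z - exp (F x)\<bar> \<le> exp L * (M * (y - x))"
        using Flip[OF xy(1,2)] by (smt (verit) exp_gt_zero mult_left_mono)
      have "\<bar>?d * (exp z - exp (F x))\<bar> \<le> (M * (y - x)) * (exp L * (M * (y - x)))"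
        unfolding abs_mult using Flip[OF xy(1,2)] e1 by (intro mult_mono) auto
      moreover have "\<bar>LBINT r:{x<..<y}. exp (F x) * k r - g r\<bar> \<le> (exp L * (M * (y - x)) * M) * (y - x)"
      proof (rule set_integral_bound)
        show "(\<lambda>r. exp (F x) * k r - g r) \<in> borel_measurable borel" using g k(1) by measurable
        fix r assume r: "x < r" "r < y"
        have "\<bar>exp (F x) * k r - g r\<bar> = \<bar>exp (F x) - exp (F r)\<bar> * \<bar>k r\<bar>"
          using r xy by (simp add: g_def abs_mult[symmetric] algebra_simps)
        also have "\<dots> \<le> (exp L * (M * (y - x))) * M"
        proof (rule mult_mono)
          have "\<bar>exp (F x) - exp (F r)\<bar> \<le> exp L * \<bar>F x - F r\<bar>"
            using FL r xy by (intro exp_diff_le) auto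
          also have "\<bar>F x - F r\<bar> \<le> M * (r - x)" using Flip[of x r] r xy by (simp add: abs_minus_commute)
          also have "M * (r - x) \<le> M * (y - x)" using r M0 by (intro mult_left_mono) auto
          finally show "\<bar>exp (F x) - exp (F r)\<bar> \<le> exp L * (M * (y - x))" by simp
        qed (use k(2) M0 xy in auto)
        finally show "\<bar>exp (F x) * k r - g r\<bar> \<le> exp L * (M * (y - x)) * M" .
      qed (use xy in auto)
      ultimately show ?thesis unfolding eq by (simp add: power2_eq_square algebra_simps)
    qed
    show "H 0 = H b" by (rule quadratic_modulus_constant[OF _ mod]) (use ab in auto)
    show "H 0 = H a" by (rule quadratic_modulus_constant[OF _ mod]) (use ab in auto)
  qed
  then have "exp (F b) - exp (F a) = (LBINT r:{0<..<b}. g r) - (LBINT r:{0<..<a}. g r)"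
    by (simp add: H_def)
  also have "\<dots> = (LBINT r:{a<..<b}. g r)" using set_integral_split[OF g gM ab] by simp
  also have "\<dots> = (LBINT r:{a<..<b}. exp (F r) * k r)"
    by (rule set_lebesgue_integral_cong) (auto simp: g_def)
  finally show ?thesis .
qed

lemma set_integral_half_open:
  fixes f :: "real \<Rightarrow> real"
  assumes "f \<in> borel_measurable borel" "\<And>r. \<bar>f r\<bar> \<le> M"
  shows "(LBINT r:{a<..b}. f r) = (LBINT r:{a<..<b}. f r)" "set_integrable lborel {a<..b} f"
proof -
  show "(LBINT r:{a<..b}. f r) = (LBINT r:{a<..<b}. f r)"
    unfolding set_lebesgue_integral_def
    by (rule integral_cong_AE) (use assms AE_lborel_singleton[of b] in \<open>auto simp: indicator_def\<close>)
  show "set_integrable lborel {a<..b} f"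
    unfolding set_integrable_def
  proof (rule integrableI_bounded_set_indicator[where B=M])
    show "emeasure lborel {a<..b} < \<infinity>" by (cases "a \<le> b") auto
  qed (use assms in auto)
qed

locale weighted_path = counting_family I N
  for I :: "'i set" and N :: "'i \<Rightarrow> real \<Rightarrow> nat" +
  fixes C :: "'i set" and act :: "'i \<Rightarrow> real \<Rightarrow> nat \<Rightarrow> nat" and x :: nat
    and f :: "'i \<Rightarrow> real \<Rightarrow> real" and B :: real
  assumes CI: "C \<subseteq> I"
    and f_meas: "\<And>c. c \<in> C \<Longrightarrow> f c \<in> borel_measurable borel"
    and f_bd: "\<And>c r. c \<in> C \<Longrightarrow> 0 \<le> f c r \<and> f c r \<le> B"
begin

abbreviation "X t \<equiv> chain I N act x t"
abbreviation "XL t \<equiv> chain_left I N act x t"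

definition kap :: "real \<Rightarrow> real" where "kap r = (\<Sum>c\<in>C. 1 - f c r)"

definition jumps :: "'i \<Rightarrow> real set \<Rightarrow> real set" where
  "jumps c A = {s \<in> A. 0 < s \<and> N c s \<noteq> lft (N c) s}"

definition expo :: "real \<Rightarrow> real" where "expo t = exp (LBINT r:{0<..<t}. kap r)"

definition W :: "real \<Rightarrow> real" where
  "W t = expo t * (\<Prod>c\<in>C. \<Prod>s\<in>jumps c {..t}. f c s)"

text \<open>The factor of a jump at \<open>t\<close> itself is left out. This is the version that
  the predictable \<open>Dm\<close> represents; \<open>W\<close> and \<open>WL\<close> differ only
  if a channel of \<open>C\<close> jumps at \<open>t\<close>.\<close>

definition WL :: "real \<Rightarrow> real" where
  "WL t = expo t * (\<Prod>c\<in>C. \<Prod>s\<in>jumps c {..<t}. f c s)"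

lemma kap: "kap \<in> borel_measurable borel" "\<bar>kap r\<bar> \<le> real (card C) * (1 + \<bar>B\<bar>)"
proof -
  show "kap \<in> borel_measurable borel" unfolding kap_def using f_meas by measurable
  have "\<bar>kap r\<bar> \<le> (\<Sum>c\<in>C. 1 + \<bar>B\<bar>)"
    unfolding kap_def
  proof (rule order_trans[OF sum_abs sum_mono])
    fix c assume "c \<in> C"
    from f_bd[OF this, of r] show "\<bar>1 - f c r\<bar> \<le> 1 + \<bar>B\<bar>" by linarith
  qed
  then show "\<bar>kap r\<bar> \<le> real (card C) * (1 + \<bar>B\<bar>)" by simp
qed

lemma finite_jumps_set:
  assumes "c \<in> I" "A \<subseteq> {..t}" shows "finite (jumps c A)"
  by (rule finite_subset[OF _ finite_jumps[OF cp[OF assms(1)], of t]]) (use assms in \<open>auto simp: jumps_def\<close>)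

lemma jumps_mark:
  assumes "0 < s" "total_count I N s \<le> Suc (lft (total_count I N) s)" "c \<in> I"
  shows "N c s \<noteq> lft (N c) s \<longleftrightarrow> s \<in> event_times I N \<and> mark I N s = c"
proof
  assume "N c s \<noteq> lft (N c) s"
  then show "s \<in> event_times I N \<and> mark I N s = c"
    using unit_event(3)[OF assms(1,2,3)] assms by (auto simp: event_times_def)
next
  assume *: "s \<in> event_times I N \<and> mark I N s = c"
  then obtain d where "d \<in> I" "N d s \<noteq> lft (N d) s" by (auto simp: event_times_def)
  then show "N c s \<noteq> lft (N c) s" using unit_event(3)[OF assms(1,2), of d] * by auto
qed

text \<open>The only possible event is at the right end \<open>s\<close>. Before it the weight
  drifts, which gives the integral. An event in \<open>C\<close> multiplies the weight by
  \<open>f\<close> and moves the state, which gives the jump term; an event outside \<open>C\<close>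
  leaves the weight alone and, by \<open>inv\<close>, also \<open>\<phi>\<close> of the
  state.\<close>

lemma step:
  assumes a: "0 \<le> a" "a < s" and const: "\<And>v. a \<le> v \<Longrightarrow> v < s \<Longrightarrow> total_count I N v = total_count I N a"
    and unit: "total_count I N s \<le> Suc (lft (total_count I N) s)"
    and inv: "s \<in> event_times I N \<Longrightarrow> mark I N s \<notin> C \<Longrightarrow> \<phi> (X s) = \<phi> (XL s)"
  shows "W s * \<phi> (X s) = W a * \<phi> (X a)
      + (\<Sum>c\<in>C. \<Sum>r\<in>jumps c {a<..s}. WL r * (f c r * \<phi> (act c r (XL r)) - \<phi> (XL r)))
      + (LBINT r:{a<..s}. WL r * \<phi> (XL r) * kap r)"
    and "set_integrable lborel {a<..s} (\<lambda>r. WL r * \<phi> (XL r) * kap r)"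
proof -
  let ?R = "\<Prod>c\<in>C. \<Prod>s\<in>jumps c {..a}. f c s"
  define M where "M = real (card C) * (1 + \<bar>B\<bar>)"
  have s0: "0 < s" using a by simp
  have nj: "lft (N c) v = N c v" if "c \<in> I" "a < v" "v < s" for c v
  proof -
    have "N c a = N c v" using total_eq_component[of a v c] const[of v] that a by simp
    then show ?thesis using counting_path_no_jump[OF cp[OF that(1)], of a v v] that a by simp
  qed
  have jL: "jumps c {..<v} = jumps c {..a}" if "c \<in> C" "a < v" "v \<le> s" for c v
  proof -
    have "c \<in> I" using that CI by auto
    then have "r \<le> a" if "r \<in> jumps c {..<v}" for r
      using nj[of c r] that \<open>v \<le> s\<close> by (cases "r \<le> a") (auto simp: jumps_def)
    then show ?thesis using that by (auto simp: jumps_def)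
  qed
  have WLv: "WL v = expo v * ?R" if "a < v" "v \<le> s" for v
    unfolding WL_def using jL that by (simp cong: prod.cong)
  have XLv: "XL v = X a" if v: "a < v" "v \<le> s" for v
  proof -
    have "lft (total_count I N) v = total_count I N a"
      by (rule lft_eqI[of v a]) (use v a in \<open>auto intro!: const\<close>)
    then show ?thesis using chain_left_eq[OF a(1) v(1)] by simp
  qed
  have intE: "expo s - expo a = (LBINT r:{a<..s}. expo r * kap r)" "set_integrable lborel {a<..s} (\<lambda>r. expo r * kap r)"
  proof -
    define g where "g r = expo (min r s) * kap r" for r
    have em: "expo \<in> borel_measurable borel"
    proof -
      have "(\<lambda>(t, r). indicator {r. 0 < r \<and> r < t} r *\<^sub>R kap r) \<in> borel_measurable (borel \<Otimes>\<^sub>M lborel)"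
        using kap(1) unfolding indicator_def by measurable
      from lborel.borel_measurable_lebesgue_integral[of "\<lambda>t r. indicator {r. 0 < r \<and> r < t} r *\<^sub>R kap r", OF this]
      have [measurable]: "(\<lambda>t. LBINT r:{0<..<t}. kap r) \<in> borel_measurable borel"
        unfolding set_lebesgue_integral_def
        by (simp add: indicator_def greaterThanLessThan_def greaterThan_def lessThan_def Int_def)
      show ?thesis unfolding expo_def by measurable
    qed
    have gm: "g \<in> borel_measurable borel" unfolding g_def using em kap(1) by measurable
    have M0: "0 \<le> M" by (simp add: M_def)
    have "expo v \<le> exp (M * s)" if "v \<le> s" for v
    proof (cases "0 \<le> v")
      case True
      have "(LBINT r:{0<..<v}. kap r) \<le> M * (v - 0)"
        using set_integral_bound[OF kap(1), of 0 v M] kap(2) True by (simp add: M_def)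
      also have "\<dots> \<le> M * s" using that M0 by (simp add: mult_left_mono)
      finally show ?thesis by (simp add: expo_def)
    next
      case False
      then show ?thesis using M0 s0 by (simp add: expo_def set_lebesgue_integral_def)
    qed
    then have gb: "\<bar>g r\<bar> \<le> exp (M * s) * M" for r
      unfolding g_def abs_mult using kap(2)[of r] by (intro mult_mono) (auto simp: M_def expo_def)
    have cong: "(LBINT r:A. expo r * kap r) = (LBINT r:A. g r)"
      "set_integrable lborel A (\<lambda>r. expo r * kap r) = set_integrable lborel A g" if "A \<subseteq> {..s}" "A \<in> sets lborel" for A
      unfolding set_lebesgue_integral_def set_integrable_def using that
      by (intro Bochner_Integration.integral_cong Bochner_Integration.integrable_cong refl;
          force simp: g_def indicator_def min_def)+
    have "expo s - expo a = (LBINT r:{a<..<s}. expo r * kap r)"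
      unfolding expo_def by (rule exp_integral[OF kap]) (use a in auto)
    also have "\<dots> = (LBINT r:{a<..<s}. g r)" by (rule cong(1)) auto
    also have "\<dots> = (LBINT r:{a<..s}. g r)" by (rule set_integral_half_open(1)[OF gm gb, symmetric])
    also have "\<dots> = (LBINT r:{a<..s}. expo r * kap r)" by (rule cong(1)[symmetric]) auto
    finally show "expo s - expo a = (LBINT r:{a<..s}. expo r * kap r)" .
    show "set_integrable lborel {a<..s} (\<lambda>r. expo r * kap r)"
      by (subst cong(2)) (auto intro: set_integral_half_open(2)[OF gm gb])
  qed
  have Geq: "WL r * \<phi> (XL r) * kap r = (?R * \<phi> (X a)) * (expo r * kap r)" if "r \<in> {a<..s}" for r
    using WLv[of r] XLv[of r] that by simp
  have "set_integrable lborel {a<..s} (\<lambda>r. (?R * \<phi> (X a)) * (expo r * kap r))"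
    by (intro set_integrable_mult_right intE)
  then show "set_integrable lborel {a<..s} (\<lambda>r. WL r * \<phi> (XL r) * kap r)"
    by (rule set_integrable_cong[THEN iffD1, rotated -1]) (auto simp: Geq)
  have I1: "(LBINT r:{a<..s}. WL r * \<phi> (XL r) * kap r) = (?R * \<phi> (X a)) * (expo s - expo a)"
    unfolding intE(1) set_integral_mult_right[symmetric]
    by (rule set_lebesgue_integral_cong) (auto simp: Geq)
  have Wa: "W a = expo a * ?R" by (simp add: W_def)
  have ws: "WL s = expo s * ?R" "XL s = X a" using WLv[of s] XLv[of s] a by auto
  have js: "jumps c {a<..s} = (if s \<in> event_times I N \<and> mark I N s = c then {s} else {})"
    "jumps c {..s} = jumps c {..a} \<union> jumps c {a<..s}" if "c \<in> C" for c
  proof -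
    have cI: "c \<in> I" using that CI by auto
    have "jumps c {a<..s} = (if N c s \<noteq> lft (N c) s then {s} else {})"
    proof -
      have "v = s" if "v \<in> jumps c {a<..s}" for v
        using nj[OF cI, of v] that by (cases "v < s") (auto simp: jumps_def)
      moreover have "s \<in> jumps c {a<..s} \<longleftrightarrow> N c s \<noteq> lft (N c) s" using a by (auto simp: jumps_def)
      ultimately show ?thesis by (metis (no_types, lifting) empty_iff equals0I insert_iff subsetI subset_antisym)
    qed
    then show "jumps c {a<..s} = (if s \<in> event_times I N \<and> mark I N s = c then {s} else {})"
      using jumps_mark[OF s0 unit cI] by simp
    show "jumps c {..s} = jumps c {..a} \<union> jumps c {a<..s}" using a by (auto simp: jumps_def)
  qed
  have prod: "(\<Prod>r\<in>jumps c {..s}. f c r) = (\<Prod>r\<in>jumps c {..a}. f c r) *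
     (if s \<in> event_times I N \<and> mark I N s = c then f c s else 1)" if "c \<in> C" for c
  proof -
    have "c \<in> I" using that CI by auto
    have "(\<Prod>r\<in>jumps c {..s}. f c r) = (\<Prod>r\<in>jumps c {..a}. f c r) * (\<Prod>r\<in>jumps c {a<..s}. f c r)"
      unfolding js(2)[OF that]
    proof (rule prod.union_disjoint)
      show "finite (jumps c {..a})" "finite (jumps c {a<..s})"
        by (rule finite_jumps_set[OF \<open>c \<in> I\<close>, of _ s], use a in force)+
    qed (auto simp: jumps_def)
    then show ?thesis using js(1)[OF that] by simp
  qed
  have finC: "finite C" using CI fin by (rule finite_subset)
  have Ws: "W s = expo s * ?R * (if s \<in> event_times I N \<and> mark I N s \<in> C then f (mark I N s) s else 1)"
  proof -
    have "(\<Prod>c\<in>C. \<Prod>r\<in>jumps c {..s}. f c r) =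
      ?R * (\<Prod>c\<in>C. if s \<in> event_times I N \<and> mark I N s = c then f c s else 1)"
      using prod by (simp add: prod.distrib cong: prod.cong)
    also have "(\<Prod>c\<in>C. if s \<in> event_times I N \<and> mark I N s = c then f c s else 1) =
      (if s \<in> event_times I N \<and> mark I N s \<in> C then f (mark I N s) s else 1)"
      using finC by (cases "s \<in> event_times I N") (auto simp: prod.delta)
    finally show ?thesis unfolding W_def by simp
  qed
  have sumJ: "(\<Sum>c\<in>C. \<Sum>r\<in>jumps c {a<..s}. WL r * (f c r * \<phi> (act c r (XL r)) - \<phi> (XL r))) =
    (if s \<in> event_times I N \<and> mark I N s \<in> C
     then WL s * (f (mark I N s) s * \<phi> (act (mark I N s) s (XL s)) - \<phi> (XL s)) else 0)"
  proof -
    have "(\<Sum>c\<in>C. \<Sum>r\<in>jumps c {a<..s}. WL r * (f c r * \<phi> (act c r (XL r)) - \<phi> (XL r))) =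
      (\<Sum>c\<in>C. if mark I N s = c then (if s \<in> event_times I N then WL s * (f c s * \<phi> (act c s (XL s)) - \<phi> (XL s)) else 0) else 0)"
      by (intro sum.cong refl) (simp add: js(1))
    then show ?thesis using finC by (auto simp: sum.delta)
  qed
  have Xs: "X s = (if s \<in> event_times I N then act (mark I N s) s (XL s) else XL s)"
    using chain_event[of s] chain_no_event[of s] by auto
  show "W s * \<phi> (X s) = W a * \<phi> (X a)
      + (\<Sum>c\<in>C. \<Sum>r\<in>jumps c {a<..s}. WL r * (f c r * \<phi> (act c r (XL r)) - \<phi> (XL r)))
      + (LBINT r:{a<..s}. WL r * \<phi> (XL r) * kap r)"
  proof (cases "s \<in> event_times I N \<and> mark I N s \<in> C")
    case True
    then show ?thesis unfolding sumJ I1 Ws Wa using ws Xs by (simp add: algebra_simps)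
  next
    case False
    then have "\<phi> (X s) = \<phi> (XL s)" using inv Xs by (cases "s \<in> event_times I N") auto
    then show ?thesis unfolding sumJ I1 Ws Wa using ws False by (auto simp: algebra_simps)
  qed
qed

theorem evolution:
  assumes s: "0 \<le> s" "s \<le> t" and unit: "unit_jumps (total_count I N) t"
    and inv: "\<And>r. r \<in> event_times I N \<Longrightarrow> s < r \<Longrightarrow> r \<le> t \<Longrightarrow> mark I N r \<notin> C \<Longrightarrow> \<phi> (X r) = \<phi> (XL r)"
  shows "W t * \<phi> (X t) = W s * \<phi> (X s)
      + (\<Sum>c\<in>C. \<Sum>r\<in>jumps c {s<..t}. WL r * (f c r * \<phi> (act c r (XL r)) - \<phi> (XL r)))
      + (LBINT r:{s<..t}. WL r * \<phi> (XL r) * kap r)"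
proof -
  let ?J = "\<lambda>A. \<Sum>c\<in>C. \<Sum>r\<in>jumps c A. WL r * (f c r * \<phi> (act c r (XL r)) - \<phi> (XL r))"
  let ?g = "\<lambda>r. WL r * \<phi> (XL r) * kap r"
  \<comment> \<open>Integrability is carried through the induction, since the integrals over
    adjacent intervals are added with its help.\<close>
  let ?Q = "\<lambda>t. W t * \<phi> (X t) = W s * \<phi> (X s) + ?J {s<..t} + (LBINT r:{s<..t}. ?g r) \<and> set_integrable lborel {s<..t} ?g"
  note K = counting_path_total
  have join: "?Q r" if a: "s \<le> a" "a < r" "r \<le> t" and Qa: "?Q a"
    and const: "\<And>v. a \<le> v \<Longrightarrow> v < r \<Longrightarrow> total_count I N v = total_count I N a" for a r
  proof -
    have U: "total_count I N r \<le> Suc (lft (total_count I N) r)" using unit a s by (auto simp: unit_jumps_def)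
    have st: "W r * \<phi> (X r) = W a * \<phi> (X a) + ?J {a<..r} + (LBINT r:{a<..r}. ?g r)"
      "set_integrable lborel {a<..r} ?g"
      using step[of a r \<phi>, OF _ a(2) const U] inv[of r] a s by auto
    have un: "{s<..r} = {s<..a} \<union> {a<..r}" using a by auto
    have J: "?J {s<..r} = ?J {s<..a} + ?J {a<..r}"
    proof -
      have "(\<Sum>v\<in>jumps c {s<..r}. g v) = (\<Sum>v\<in>jumps c {s<..a}. g v) + (\<Sum>v\<in>jumps c {a<..r}. g v)"
        if "c \<in> C" for c and g :: "real \<Rightarrow> real"
      proof -
        have "c \<in> I" using that CI by auto
        moreover have "jumps c {s<..r} = jumps c {s<..a} \<union> jumps c {a<..r}" using a by (auto simp: jumps_def)
        moreover have "finite (jumps c {s<..a})"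
          by (rule finite_jumps_set[OF \<open>c \<in> I\<close>, of _ r]) (use a in auto)
        moreover have "finite (jumps c {a<..r})"
          by (rule finite_jumps_set[OF \<open>c \<in> I\<close>, of _ r]) auto
        moreover have "jumps c {s<..a} \<inter> jumps c {a<..r} = {}" by (auto simp: jumps_def)
        ultimately show ?thesis by (simp add: sum.union_disjoint)
      qed
      then show ?thesis by (simp add: sum.distrib)
    qed
    have "(LBINT r:{s<..r}. ?g r) = (LBINT r:{s<..a}. ?g r) + (LBINT r:{a<..r}. ?g r)"
      unfolding un using Qa st(2) by (intro set_integral_Un) auto
    moreover have "set_integrable lborel {s<..r} ?g"
      unfolding un using Qa st(2) by (intro set_integrable_Un) auto
    ultimately show ?thesis using st Qa J by simp
  qed
  have "?Q t"
  proof (rule counting_path_induct[OF K s, where Q="?Q"])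
    show "?Q s" by (simp add: set_lebesgue_integral_def jumps_def set_integrable_def)
  next
    fix a r assume r: "s \<le> a" "a < r" "r \<le> t" and eq: "total_count I N a = total_count I N r" and Qa: "?Q a"
    have "total_count I N v = total_count I N a" if "a \<le> v" "v < r" for v
      using counting_path_mono[OF K, of a v] counting_path_mono[OF K, of v r] r eq that s by auto
    then show "?Q r" by (intro join[OF r Qa])
  next
    fix a r assume r: "s \<le> a" "a < r" "r \<le> t"
      and eq: "\<And>v. a \<le> v \<Longrightarrow> v < r \<Longrightarrow> total_count I N v = lft (total_count I N) r"
      and Q: "\<And>v. s \<le> v \<Longrightarrow> v < r \<Longrightarrow> ?Q v"
    have "total_count I N v = total_count I N a" if "a \<le> v" "v < r" for v
      using eq[of v] eq[of a] that r(2) by simp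
    then show "?Q r" by (intro join[OF r Q[OF r(1,2)]])
  qed
  then show ?thesis by blast
qed

end

section \<open>Expected evolution in a fixed environment\<close>

lemma (in filtration) path_measurable:
  assumes w: "w \<in> Om" and f: "f \<in> measurable Pr M" and k: "k \<in> space M"
  shows "(\<lambda>r. if 0 < r then f (r, w) else k) \<in> measurable borel M"
proof -
  have "(\<lambda>r. (if 0 < r then r else 1, w)) \<in> measurable borel Pr"
  proof (rule measurable_into_Pr)
    fix a B assume "0 \<le> a" "B \<in> sets (F a)"
    have "(\<lambda>r. (if 0 < r then r else 1, w)) -` ({a<..} \<times> B) \<inter> space borel =
      (if w \<in> B then {r. a < (if 0 < r then r else 1)} else {})" by auto
    also have "\<dots> \<in> sets borel" by simp
    finally show "(\<lambda>r. (if 0 < r then r else 1, w)) -` ({a<..} \<times> B) \<inter> space borel \<in> sets borel" .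
  qed (use w in auto)
  note [measurable] = measurable_compose[OF this f]
  have "(\<lambda>r. if 0 < r then f (if 0 < r then r else 1, w) else k) \<in> measurable borel M"
    using k by measurable
  then show ?thesis by (rule measurable_cong[THEN iffD1, rotated]) simp
qed

text \<open>A variable known at \<open>s\<close> becomes a predictable process once it is switched
  on strictly after \<open>s\<close>.\<close>

lemma (in filtration) measurable_after_Pr:
  assumes s: "0 \<le> s" and h: "h \<in> borel_measurable (F s)"
  shows "(\<lambda>x. if s < fst x then h (snd x) else (0::real)) \<in> borel_measurable Pr" (is "?f \<in> _")
proof (rule measurableI)
  fix B :: "real set" assume B: "B \<in> sets borel"
  have hB: "h -` B \<inter> space (F s) \<in> sets (F s)" using h B by (rule measurable_sets)
  have "?f -` B \<inter> space Pr = {s<..} \<times> (h -` B \<inter> space (F s)) \<union> (if 0 \<in> B then space Pr - {s<..} \<times> Om else {})"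
    using s by (auto simp: space_Pr space_F split: if_splits)
  moreover have "{s<..} \<times> Om \<in> sets Pr" using rect_in_Pr[OF s sets.top] by (simp add: space_F)
  ultimately show "?f -` B \<inter> space Pr \<in> sets Pr" using rect_in_Pr[OF s hB] by auto
qed auto

locale fixed_env =
  poisson_family P C N X0 + ch: driven_chain "poisson_family.G P C N X0" "space P" I C N' act q X0
  for P :: "'w measure" and C :: "'i set" and N X0 and I :: "'i set" and N' act q +
  fixes B T :: real
  assumes NN: "\<And>c. c \<in> C \<Longrightarrow> N' c = N c"
    and q_bd: "\<And>c s x w. c \<in> C \<Longrightarrow> 0 \<le> q c s x w \<and> q c s x w \<le> B"
    and B1: "1 \<le> B" and T: "0 < T"
    and unit: "AE w in P. unit_jumps (total_count I (\<lambda>c t. N' c t w)) T"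
begin

lemma rate_bd: "c \<in> C \<Longrightarrow> 0 \<le> ch.rate c s w \<and> ch.rate c s w \<le> B"
  unfolding ch.rate_def by (rule q_bd)

abbreviation "pathrate w \<equiv> (\<lambda>c r. if 0 < r then ch.rate c r w else 1)"

lemma pathrate_meas: "c \<in> C \<Longrightarrow> w \<in> space P \<Longrightarrow> pathrate w c \<in> borel_measurable borel"
  using path_measurable[OF _ ch.rate_meas, of w c 1] by (simp cong: if_cong)

lemma weighted_path:
  assumes "w \<in> space P"
  shows "weighted_path I (ch.paths w) C (pathrate w) B"
proof -
  interpret counting_family I "ch.paths w" by (rule ch.counting_family[OF assms])
  show ?thesis
    by unfold_locales (use ch.CI pathrate_meas[OF _ assms] rate_bd B1 in auto)
qed

lemma Dm_at_0: "w \<in> space P \<Longrightarrow> ch.Dm 0 w = 1"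
  using cp NN by (simp add: ch.Dm_def lft_def counting_path_def set_lebesgue_integral_def)

text \<open>\<open>WL\<close> multiplies over actual jump times and \<open>Dm\<close> over levels.
  The two index sets correspond because each component inherits unit jumps from the
  superposition.\<close>

lemma WL_eq_Dm:
  assumes w: "w \<in> space P" and u: "unit_jumps (total_count I (ch.paths w)) T" and t: "0 \<le> t" "t \<le> T"
  shows "weighted_path.WL (ch.paths w) C (pathrate w) t = ch.Dm t w"
proof -
  interpret wp: weighted_path I "ch.paths w" C "\<lambda>c s x. act c s x w" "X0 w" "pathrate w" B
    by (rule weighted_path[OF w])
  have finC: "finite C" by (rule finite_subset[OF ch.CI ch.fin])
  have set_int: "set_integrable lborel {0<..<t} (\<lambda>r. 1 - pathrate w c r)" if "c \<in> C" for c
  proof (rule bounded_measurable_set_integrable[where M="1 + B"])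
    show "(\<lambda>r. 1 - pathrate w c r) \<in> borel_measurable borel" using pathrate_meas[OF that w] by simp
    show "\<bar>1 - pathrate w c r\<bar> \<le> 1 + B" for r using rate_bd[OF that, of r w] B1 by auto
  qed
  have "(LBINT r:{0<..<t}. \<Sum>c\<in>C. 1 - pathrate w c r) = (\<Sum>c\<in>C. LBINT r:{0<..<t}. 1 - pathrate w c r)"
    unfolding set_lebesgue_integral_def scaleR_sum_right
    by (rule Bochner_Integration.integral_sum) (use set_int in \<open>auto simp: set_integrable_def\<close>)
  then have "wp.expo t = exp (\<Sum>c\<in>C. LBINT r:{0<..<t}. 1 - pathrate w c r)"
    unfolding wp.expo_def wp.kap_def by simp
  also have "\<dots> = (\<Prod>c\<in>C. exp (LBINT r:{0<..<t}. 1 - ch.rate c r w))"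
    unfolding exp_sum[OF finC]
    by (intro prod.cong refl arg_cong[where f=exp] set_lebesgue_integral_cong) auto
  finally have expo: "wp.expo t = (\<Prod>c\<in>C. exp (LBINT r:{0<..<t}. 1 - ch.rate c r w))" .
  have "(\<Prod>s\<in>wp.jumps c {..<t}. pathrate w c s) =
    (\<Prod>l\<in>{1..lft (\<lambda>t. N' c t w) t}. ch.rate c (nth_jump (\<lambda>t. N' c t w) l) w)" if c: "c \<in> C" for c
  proof (cases "t = 0")
    case True
    then show ?thesis using cp[OF c w] NN[OF c] by (auto simp: wp.jumps_def lft_def counting_path_def)
  next
    case False
    have cI: "c \<in> I" using c ch.CI by auto
    have ub: "unit_jumps_before (\<lambda>t. N' c t w) t"
      using wp.unit_component[OF u cI] t by (auto simp: unit_jumps_def unit_jumps_before_def)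
    have "(\<Prod>l\<in>{1..lft (\<lambda>t. N' c t w) t}. pathrate w c (nth_jump (\<lambda>t. N' c t w) l)) =
      (\<Prod>s\<in>{s. 0 < s \<and> s < t \<and> N' c s w \<noteq> lft (\<lambda>t. N' c t w) s}. pathrate w c s)"
      using False t by (intro prod.reindex_bij_betw bij_betw_nth_jump[OF wp.cp[OF cI] ub]) auto
    also have "{s. 0 < s \<and> s < t \<and> N' c s w \<noteq> lft (\<lambda>t. N' c t w) s} = wp.jumps c {..<t}"
      by (auto simp: wp.jumps_def)
    finally have eq: "(\<Prod>l\<in>{1..lft (\<lambda>t. N' c t w) t}. pathrate w c (nth_jump (\<lambda>t. N' c t w) l)) =
      (\<Prod>s\<in>wp.jumps c {..<t}. pathrate w c s)" .
    have "pathrate w c (nth_jump (\<lambda>t. N' c t w) l) = ch.rate c (nth_jump (\<lambda>t. N' c t w) l) w"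
      if "l \<in> {1..lft (\<lambda>t. N' c t w) t}" for l
    proof -
      have "lft (\<lambda>t. N' c t w) t \<le> N' c t w"
        using lft_counting_path_le[OF wp.cp[OF cI], of t] False t by simp
      then have "0 < nth_jump (\<lambda>t. N' c t w) l"
        using that t by (intro nth_jump_pos[OF wp.cp[OF cI], of l t]) auto
      then show ?thesis by simp
    qed
    then show ?thesis using eq by simp
  qed
  then show ?thesis unfolding wp.WL_def expo ch.Dm_def by (simp add: prod.distrib)
qed

lemma Y_eq_XL:
  assumes "unit_jumps (total_count I (ch.paths w)) T" "t \<le> T"
  shows "ch.Y t w = ch.XL t w"
  using assms by (auto simp: ch.Y_def ch.good_left_def unit_jumps_def unit_jumps_before_def)

text \<open>Each channel contributes an exponent of at most (1 + B) t and a factor of at most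
  \<open>B\<close> per jump. Since \<open>B\<close> is at least one, its powers increase with the
  count, so the count at \<open>t\<close> covers all earlier times.\<close>

definition bound :: "real \<Rightarrow> 'w \<Rightarrow> real" where
  "bound t w = exp ((1 + B) * t) ^ card C * (\<Prod>c\<in>C. B ^ N c t w)"

lemma Dm_nonneg: "0 \<le> ch.Dm s w"
  unfolding ch.Dm_def using rate_bd by (intro prod_nonneg ballI mult_nonneg_nonneg) auto

lemma Dm_bound:
  assumes w: "w \<in> space P" and s: "0 \<le> s" "s \<le> t"
  shows "ch.Dm s w \<le> bound t w"
proof -
  have "ch.Dm s w \<le> (\<Prod>c\<in>C. exp ((1 + B) * t) * B ^ N c t w)"
    unfolding ch.Dm_def
  proof (intro prod_mono conjI mult_mono)
    fix c assume c: "c \<in> C"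
    have "(LBINT r:{0<..<s}. 1 - ch.rate c r w) = (LBINT r:{0<..<s}. 1 - pathrate w c r)"
      by (rule set_lebesgue_integral_cong) auto
    also have "\<bar>\<dots>\<bar> \<le> (1 + B) * (s - 0)"
    proof (rule set_integral_bound)
      show "(\<lambda>r. 1 - pathrate w c r) \<in> borel_measurable borel" using pathrate_meas[OF c w] by simp
      show "\<bar>1 - pathrate w c r\<bar> \<le> 1 + B" for r using rate_bd[OF c, of r w] B1 by auto
    qed (use s in auto)
    also have "\<dots> \<le> (1 + B) * t" using s B1 by (simp add: mult_left_mono)
    finally show "exp (LBINT r:{0<..<s}. 1 - ch.rate c r w) \<le> exp ((1 + B) * t)" by simp
    have lt: "lft (\<lambda>t. N' c t w) s \<le> N c t w"
    proof (cases "s = 0")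
      case True
      then show ?thesis using cp[OF c w] NN[OF c] by (simp add: lft_def counting_path_def)
    next
      case False
      then show ?thesis using lft_counting_path_le[OF cp[OF c w], of s]
        counting_path_mono[OF cp[OF c w], of s t] s NN[OF c] by simp
    qed
    have "(\<Prod>l\<in>{1..lft (\<lambda>t. N' c t w) s}. ch.rate c (nth_jump (\<lambda>t. N' c t w) l) w) \<le>
      (\<Prod>l\<in>{1..lft (\<lambda>t. N' c t w) s}. B)"
      using rate_bd[OF c] by (intro prod_mono) auto
    also have "\<dots> \<le> B ^ N c t w" using lt B1 by (simp add: power_increasing)
    finally show "(\<Prod>l\<in>{1..lft (\<lambda>t. N' c t w) s}. ch.rate c (nth_jump (\<lambda>t. N' c t w) l) w) \<le> B ^ N c t w" .
  qed (use rate_bd B1 in \<open>auto intro!: prod_nonneg mult_nonneg_nonneg\<close>)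
  then show ?thesis by (simp add: bound_def prod.distrib)
qed

lemma bound_nonneg: "0 \<le> bound t w"
  unfolding bound_def using B1 by (intro mult_nonneg_nonneg prod_nonneg) auto

lemma integrable_bound_P: "0 \<le> t \<Longrightarrow> integrable P (bound t)"
proof (rule integrableI_bounded)
  assume t: "0 \<le> t"
  show "bound t \<in> borel_measurable P" unfolding bound_def by measurable
  have "(\<integral>\<^sup>+w. ennreal (norm (bound t w)) \<partial>P) =
    (\<integral>\<^sup>+w. ennreal (exp ((1 + B) * t) ^ card C) * ennreal (\<Prod>c\<in>C. B ^ N c t w) \<partial>P)"
    using bound_nonneg B1 by (intro nn_integral_cong) (simp add: bound_def ennreal_mult' prod_nonneg abs_mult)
  also have "\<dots> = ennreal (exp ((1 + B) * t) ^ card C) * (\<integral>\<^sup>+w. ennreal (\<Prod>c\<in>C. B ^ N c t w) \<partial>P)"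
    by (rule nn_integral_cmult) measurable
  also have "\<dots> < \<infinity>" using exponential_moment[OF t, of B] B1 by (simp add: ennreal_mult_less_top)
  finally show "(\<integral>\<^sup>+w. ennreal (norm (bound t w)) \<partial>P) < \<infinity>" .
qed

lemma integrable_product_bound:
  assumes "0 \<le> t" shows "integrable (lborel \<Otimes>\<^sub>M P) (\<lambda>x. indicator {0<..t} (fst x) * bound t (snd x))"
proof (rule integrableI_bounded)
  interpret LP: pair_sigma_finite lborel P
    by (intro pair_sigma_finite.intro lborel.sigma_finite_measure_axioms sigma_finite_measure_axioms)
  have [measurable]: "bound t \<in> borel_measurable P" unfolding bound_def by measurable
  show "(\<lambda>x. indicator {0<..t} (fst x) * bound t (snd x)) \<in> borel_measurable (lborel \<Otimes>\<^sub>M P)" by measurable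
  have "(\<integral>\<^sup>+x. ennreal (norm (indicator {0<..t} (fst x) * bound t (snd x))) \<partial>(lborel \<Otimes>\<^sub>M P)) =
    (\<integral>\<^sup>+r. \<integral>\<^sup>+w. indicator {0<..t} r * ennreal (bound t w) \<partial>P \<partial>lborel)"
    by (subst nn_integral_fst[symmetric])
      (auto simp: abs_mult bound_nonneg indicator_def intro!: nn_integral_cong)
  also have "\<dots> = (\<integral>\<^sup>+r. indicator {0<..t} r * (\<integral>\<^sup>+w. ennreal (bound t w) \<partial>P) \<partial>lborel)"
    by (intro nn_integral_cong nn_integral_cmult) measurable
  also have "\<dots> = emeasure lborel {0<..t} * (\<integral>\<^sup>+w. ennreal (bound t w) \<partial>P)"
    by (simp add: nn_integral_multc)
  also have "\<dots> < \<infinity>"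
    using integrable_bound_P[OF assms] assms
    by (auto simp: ennreal_mult_less_top integrable_iff_bounded bound_nonneg)
  finally show "(\<integral>\<^sup>+x. ennreal (norm (indicator {0<..t} (fst x) * bound t (snd x))) \<partial>(lborel \<Otimes>\<^sub>M P)) < \<infinity>" .
qed

lemma Dm_meas_at: "0 \<le> t \<Longrightarrow> ch.Dm t \<in> borel_measurable P"
proof (cases "t = 0")
  case True
  have "ch.Dm 0 \<in> borel_measurable P \<longleftrightarrow> (\<lambda>_. 1::real) \<in> borel_measurable P"
    by (rule measurable_cong) (rule Dm_at_0)
  then show ?thesis using True by simp
next
  case False
  assume "0 \<le> t"
  then have "ch.Dm t \<in> borel_measurable (G t)"
    using measurable_compose[OF measurable_section_Pr ch.Dm_meas, of t] False by simp
  then show ?thesis using sets_G_subset[of t] by (auto simp: measurable_def)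
qed

lemma Y_meas_G: "0 \<le> t \<Longrightarrow> ch.Y t \<in> measurable (G t) (count_space UNIV)"
proof (cases "t = 0")
  case True
  have "ch.Y 0 \<in> measurable (G 0) (count_space UNIV) \<longleftrightarrow> X0 \<in> measurable (G 0) (count_space UNIV)"
  proof (rule measurable_cong)
    fix w
    have "event_times I (ch.paths w) \<inter> {..<0} = {}" by (auto simp: event_times_def)
    then show "ch.Y 0 w = X0 w"
      by (simp add: ch.Y_def ch.good_left_def unit_jumps_before_def chain_on_def)
  qed
  then show ?thesis using X0_adapted True by simp
next
  case False
  assume "0 \<le> t"
  then show ?thesis
    using measurable_compose[OF measurable_section_Pr ch.Y_meas, of t] False by simp
qed

lemma Y_meas_at: "0 \<le> t \<Longrightarrow> ch.Y t \<in> measurable P (count_space UNIV)"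
  using Y_meas_G[of t] sets_G_subset[of t] by (auto simp: measurable_def)

lemma integrable_Dm_times:
  assumes t: "0 \<le> t" and g: "g \<in> borel_measurable P" "\<And>w. \<bar>g w\<bar> \<le> (M::real)"
  shows "integrable P (\<lambda>w. ch.Dm t w * g w)"
proof (rule Bochner_Integration.integrable_bound)
  have M0: "0 \<le> M" using g(2) abs_ge_zero order_trans by blast
  show "integrable P (\<lambda>w. bound t w * M)" using integrable_bound_P[OF t] by simp
  show "(\<lambda>w. ch.Dm t w * g w) \<in> borel_measurable P" using Dm_meas_at[OF t] g by simp
  show "AE w in P. norm (ch.Dm t w * g w) \<le> norm (bound t w * M)"
    using Dm_bound[OF _ t, of _ t] Dm_nonneg bound_nonneg[of t] g(2) M0
    by (intro AE_I2) (auto simp: abs_mult intro!: mult_mono)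
qed

text \<open>The pathwise evolution is integrated. Compensating the jump terms at unit rate gives U -
  V for each channel, the drift of the exponential gives V - R; \<open>V\<close> cancels and the
  generator term U - R is left. The factor \<open>h\<close> makes the statement conditional on the
  past of \<open>s\<close>. The maps \<open>xs\<close> and \<open>xt\<close> absorb a relabelling of
  the state at the end points, so that only the left limit \<open>Y\<close> occurs under the
  integral.\<close>

theorem expected_evolution:
  assumes s: "0 \<le> s" "s \<le> t" "t \<le> T"
    and h: "h \<in> borel_measurable (G s)" "\<And>w. 0 \<le> h w \<and> h w \<le> 1"
    and \<phi>: "\<And>i::nat. 0 \<le> \<phi> i \<and> \<phi> i \<le> (1::real)"
    and xs: "AE w in P. ch.X s w = xs (ch.Y s w)" and xt: "AE w in P. ch.X t w = xt (ch.Y t w)"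
    and inv: "AE w in P. \<forall>r\<in>event_times I (ch.paths w). s < r \<and> r \<le> t \<and> mark I (ch.paths w) r \<notin> C
        \<longrightarrow> \<phi> (ch.X r w) = \<phi> (ch.XL r w)"
  defines "g \<equiv> (\<lambda>r w. h w * ch.Dm r w * (\<Sum>c\<in>C. ch.rate c r w * (\<phi> (act c r (ch.Y r w) w) - \<phi> (ch.Y r w))))"
  shows "(\<integral>w. h w * ch.Dm t w * \<phi> (xt (ch.Y t w)) \<partial>P) =
      (\<integral>w. h w * ch.Dm s w * \<phi> (xs (ch.Y s w)) \<partial>P) + (LBINT r:{s<..t}. \<integral>w. g r w \<partial>P)"
    and "set_integrable lborel {s<..t} (\<lambda>r. \<integral>w. g r w \<partial>P)"
proof -
  interpret LP: pair_sigma_finite lborel P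
    by (intro pair_sigma_finite.intro lborel.sigma_finite_measure_axioms sigma_finite_measure_axioms)
  have t0: "0 \<le> t" using s by simp
  \<comment> \<open>Switching \<open>h\<close> on after \<open>s\<close> makes it predictable and at
    the same time restricts all integrals from (0,t] to (s,t].\<close>
  define hI where "hI x = (if s < fst x then h (snd x) else 0)" for x :: "real \<times> 'w"
  \<comment> \<open>The integrand is split into the nonnegative pieces \<open>V\<close>,
    \<open>U\<close> and \<open>R\<close>, the form that \<open>compensation_real\<close>
    accepts.\<close>
  define V where "V x = hI x * ch.Dm (fst x) (snd x) * \<phi> (ch.Y (fst x) (snd x))" for x
  define U where "U c x = hI x * ch.Dm (fst x) (snd x) * ch.rate c (fst x) (snd x) *
    \<phi> (act c (fst x) (ch.Y (fst x) (snd x)) (snd x))" for c x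
  define R where "R c x = hI x * ch.Dm (fst x) (snd x) * ch.rate c (fst x) (snd x) *
    \<phi> (ch.Y (fst x) (snd x))" for c x
  have hI: "hI \<in> borel_measurable Pr" "0 \<le> hI x" "hI x \<le> 1" for x
    using measurable_after_Pr[OF s(1) h(1)] h(2) by (auto simp: hI_def[abs_def])
  have Ym: "(\<lambda>x. ch.Y (fst x) (snd x)) \<in> measurable Pr (count_space UNIV)"
    using ch.Y_meas by (simp add: case_prod_beta')
  have Dm: "(\<lambda>x. ch.Dm (fst x) (snd x)) \<in> borel_measurable Pr"
    using ch.Dm_meas by (simp add: case_prod_beta')
  have rate: "(\<lambda>x. ch.rate c (fst x) (snd x)) \<in> borel_measurable Pr" if "c \<in> C" for c
    using ch.rate_meas[OF that] by (simp add: case_prod_beta')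
  have phiY: "(\<lambda>x. \<phi> (ch.Y (fst x) (snd x))) \<in> borel_measurable Pr"
    by (rule measurable_compose[OF Ym]) simp
  have phiact: "(\<lambda>x. \<phi> (act c (fst x) (ch.Y (fst x) (snd x)) (snd x))) \<in> borel_measurable Pr" if c: "c \<in> C" for c
  proof -
    have cI: "c \<in> I" using c ch.CI by auto
    have "(\<lambda>x. \<phi> (act c (fst x) i (snd x))) \<in> borel_measurable Pr" for i
      using measurable_compose[OF measurable_Pr_F0[OF ch.act_meas[OF cI, of i]], of \<phi> borel]
      by (simp add: case_prod_beta')
    from measurable_compose_countable[of "\<lambda>i x. \<phi> (act c (fst x) i (snd x))", OF this Ym]
    show ?thesis .
  qed
  have Vm: "V \<in> borel_measurable Pr" unfolding V_def using hI Dm phiY by measurable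
  have Um: "U c \<in> borel_measurable Pr" if "c \<in> C" for c
    unfolding U_def using hI Dm phiact[OF that] rate[OF that] by measurable
  have Rm: "R c \<in> borel_measurable Pr" if "c \<in> C" for c
    unfolding R_def using hI Dm phiY rate[OF that] by measurable
  have nonneg: "0 \<le> V x" "c \<in> C \<Longrightarrow> 0 \<le> U c x" "c \<in> C \<Longrightarrow> 0 \<le> R c x" for x c
    unfolding V_def U_def R_def using hI Dm_nonneg rate_bd \<phi> by (auto intro!: mult_nonneg_nonneg)
  have bd: "V x \<le> B * bound t (snd x)" "c \<in> C \<Longrightarrow> U c x \<le> B * bound t (snd x)" "c \<in> C \<Longrightarrow> R c x \<le> B * bound t (snd x)"
    if x: "fst x \<in> {0<..t}" "snd x \<in> space P" for x c
  proof -
    have D: "ch.Dm (fst x) (snd x) \<le> bound t (snd x)" using Dm_bound[of "snd x" "fst x" t] x by auto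
    have main: "hI x * ch.Dm (fst x) (snd x) * a * b \<le> B * bound t (snd x)" if "0 \<le> a" "a \<le> B" "0 \<le> b" "b \<le> 1" for a b
    proof -
      let ?p = "hI x * ch.Dm (fst x) (snd x)" and ?b = "bound t (snd x)"
      have p: "?p \<le> 1 * ?b" "0 \<le> ?p"
        using hI(2)[of x] mult_mono[OF hI(3)[of x] D] Dm_nonneg[of "fst x" "snd x"] by auto
      have pa: "?p * a \<le> (1 * ?b) * B" "0 \<le> ?p * a"
        using p that bound_nonneg[of t "snd x"] B1 by (auto intro!: mult_mono[of ?p])
      then have "?p * a * b \<le> ((1 * ?b) * B) * 1"
        by (rule_tac mult_mono) (use that bound_nonneg[of t "snd x"] B1 in auto)
      then show ?thesis by (simp add: mult.commute)
    qed
    show "V x \<le> B * bound t (snd x)" using main[of 1] B1 \<phi> by (simp add: V_def)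
    show "c \<in> C \<Longrightarrow> U c x \<le> B * bound t (snd x)" unfolding U_def using rate_bd \<phi> by (intro main) auto
    show "c \<in> C \<Longrightarrow> R c x \<le> B * bound t (snd x)" unfolding R_def using rate_bd \<phi> by (intro main) auto
  qed
  have int: "integrable (lborel \<Otimes>\<^sub>M P) (\<lambda>x. indicator {0<..t} (fst x) * f x)"
    if f: "f \<in> borel_measurable Pr" "\<And>x. 0 \<le> f x" "\<And>x. fst x \<in> {0<..t} \<Longrightarrow> snd x \<in> space P \<Longrightarrow> f x \<le> B * bound t (snd x)"
    for f :: "real \<times> 'w \<Rightarrow> real"
  proof (rule Bochner_Integration.integrable_bound)
    show "integrable (lborel \<Otimes>\<^sub>M P) (\<lambda>x. B * (indicator {0<..t} (fst x) * bound t (snd x)))"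
      using integrable_product_bound[OF t0] by simp
    show "(\<lambda>x. indicator {0<..t} (fst x) * f x) \<in> borel_measurable (lborel \<Otimes>\<^sub>M P)"
      by (rule borel_measurable_product[OF f(1)])
    show "AE x in lborel \<Otimes>\<^sub>M P. norm (indicator {0<..t} (fst x) * f x) \<le> norm (B * (indicator {0<..t} (fst x) * bound t (snd x)))"
      using f(2,3) bound_nonneg[of t] B1
      by (intro AE_I2) (auto simp: indicator_def space_pair_measure abs_mult)
  qed
  have intV: "integrable (lborel \<Otimes>\<^sub>M P) (\<lambda>x. indicator {0<..t} (fst x) * V x)"
    using int[OF Vm] nonneg bd by blast
  have intU: "integrable (lborel \<Otimes>\<^sub>M P) (\<lambda>x. indicator {0<..t} (fst x) * U c x)" if "c \<in> C" for c
    using int[OF Um[OF that]] nonneg bd that by blast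
  have intR: "integrable (lborel \<Otimes>\<^sub>M P) (\<lambda>x. indicator {0<..t} (fst x) * R c x)" if "c \<in> C" for c
    using int[OF Rm[OF that]] nonneg bd that by blast
  define JU where "JU c w = (\<Sum>l\<in>{1..N c t w}. U c (nth_jump (\<lambda>t. N c t w) l, w))" for c w
  define JV where "JV c w = (\<Sum>l\<in>{1..N c t w}. V (nth_jump (\<lambda>t. N c t w) l, w))" for c w
  let ?I = "\<lambda>f. \<integral>x. indicator {0<..t} (fst x) * f x \<partial>(lborel \<Otimes>\<^sub>M P)"
  have JU: "integrable P (JU c)" "(\<integral>w. JU c w \<partial>P) = ?I (U c)" if "c \<in> C" for c
    using compensation_real[OF that t0 Um[OF that] nonneg(2)[OF that] intU[OF that]] by (auto simp: JU_def[abs_def])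
  have JV: "integrable P (JV c)" "(\<integral>w. JV c w \<partial>P) = ?I V" if "c \<in> C" for c
    using compensation_real[OF that t0 Vm nonneg(1) intV] by (auto simp: JV_def[abs_def])
  define K where "K x = (\<Sum>c\<in>C. indicator {0<..t} (fst x) * V x - indicator {0<..t} (fst x) * R c x)" for x
  have intK: "integrable (lborel \<Otimes>\<^sub>M P) K"
    unfolding K_def using intV intR by (intro Bochner_Integration.integrable_sum Bochner_Integration.integrable_diff) auto
  define L where "L w = (\<integral>r. K (r, w) \<partial>lborel)" for w
  have L: "integrable P L" "(\<integral>w. L w \<partial>P) = (\<Sum>c\<in>C. ?I V - ?I (R c))"
  proof -
    have intK': "integrable (lborel \<Otimes>\<^sub>M P) (case_prod (\<lambda>r w. K (r, w)))" using intK by simp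
    show "integrable P L" using LP.integrable_snd[OF intK'] by (simp add: L_def[abs_def])
    have "(\<integral>w. L w \<partial>P) = (\<integral>x. K x \<partial>(lborel \<Otimes>\<^sub>M P))" using LP.integral_snd[OF intK'] by (simp add: L_def[abs_def])
    also have "\<dots> = (\<Sum>c\<in>C. ?I V - ?I (R c))"
      unfolding K_def using intV intR by (simp add: Bochner_Integration.integral_diff)
    finally show "(\<integral>w. L w \<partial>P) = (\<Sum>c\<in>C. ?I V - ?I (R c))" .
  qed
  have finC: "finite C" by (rule finC)
  have nojump: "AE w in P. \<forall>c\<in>C. 0 < r \<longrightarrow> lft (\<lambda>v. N c v w) r = N c r w" for r
    using AE_no_jump_at[of _ r] finC by (cases "0 < r") (auto simp: AE_finite_all)
  have path: "AE w in P. h w * ch.Dm t w * \<phi> (xt (ch.Y t w)) =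
    h w * ch.Dm s w * \<phi> (xs (ch.Y s w)) + (\<Sum>c\<in>C. JU c w - JV c w) + L w"
    using AE_space unit xs xt inv nojump[of s] nojump[of t]
  proof eventually_elim
    fix w
    assume w: "w \<in> space P" and u: "unit_jumps (total_count I (ch.paths w)) T"
      and xs: "ch.X s w = xs (ch.Y s w)" and xt: "ch.X t w = xt (ch.Y t w)"
      and inv: "\<forall>r\<in>event_times I (ch.paths w). s < r \<and> r \<le> t \<and> mark I (ch.paths w) r \<notin> C \<longrightarrow> \<phi> (ch.X r w) = \<phi> (ch.XL r w)"
      and ns: "\<forall>c\<in>C. 0 < s \<longrightarrow> lft (\<lambda>v. N c v w) s = N c s w" and nt: "\<forall>c\<in>C. 0 < t \<longrightarrow> lft (\<lambda>v. N c v w) t = N c t w"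
    interpret wp: weighted_path I "ch.paths w" C "\<lambda>c s x. act c s x w" "X0 w" "pathrate w" B
      by (rule weighted_path[OF w])
    have WL: "wp.WL r = ch.Dm r w" if "0 \<le> r" "r \<le> T" for r by (rule WL_eq_Dm[OF w u that])
    have YX: "ch.Y r w = ch.XL r w" if "r \<le> T" for r by (rule Y_eq_XL[OF u that])
    have Wr: "wp.W r = ch.Dm r w" if r: "0 \<le> r" "r \<le> T" "\<forall>c\<in>C. 0 < r \<longrightarrow> lft (\<lambda>v. N c v w) r = N c r w" for r
    proof -
      have "wp.jumps c {..r} = wp.jumps c {..<r}" if "c \<in> C" for c
        using r(3) that NN by (auto simp: wp.jumps_def order_le_less)
      then show ?thesis using WL[OF r(1,2)] by (simp add: wp.W_def wp.WL_def cong: prod.cong)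
    qed
    have ut: "unit_jumps (total_count I (ch.paths w)) t" using u s by (auto simp: unit_jumps_def)
    have ev: "wp.W t * \<phi> (ch.X t w) = wp.W s * \<phi> (ch.X s w)
      + (\<Sum>c\<in>C. \<Sum>r\<in>wp.jumps c {s<..t}. wp.WL r * (pathrate w c r * \<phi> (act c r (ch.XL r w) w) - \<phi> (ch.XL r w)))
      + (LBINT r:{s<..t}. wp.WL r * \<phi> (ch.XL r w) * wp.kap r)"
      by (rule wp.evolution[OF s(1,2) ut]) (use inv in blast)
    have "h w * (\<Sum>r\<in>wp.jumps c {s<..t}. wp.WL r * (pathrate w c r * \<phi> (act c r (ch.XL r w) w) - \<phi> (ch.XL r w))) =
      JU c w - JV c w" if c: "c \<in> C" for c
    proof (cases "t = 0")
      case True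
      then show ?thesis using s cp[OF c w] by (simp add: wp.jumps_def JU_def JV_def counting_path_def)
    next
      case False
      then have t: "0 < t" using t0 by simp
      have cI: "c \<in> I" using c ch.CI by auto
      have ub: "unit_jumps_before (\<lambda>t. N c t w) t"
        using wp.unit_component[OF ut cI] NN[OF c] by (auto simp: unit_jumps_def unit_jumps_before_def)
      have lft: "lft (\<lambda>v. N c v w) t = N c t w" using nt c t by simp
      have J: "{r. 0 < r \<and> r < t \<and> N c r w \<noteq> lft (\<lambda>t. N c t w) r} = wp.jumps c {0<..t}"
        using lft NN[OF c] by (auto simp: wp.jumps_def order_le_less)
      have fin: "finite (wp.jumps c {0<..t})" by (rule wp.finite_jumps_set[OF cI, of _ t]) auto
      have "JU c w - JV c w = (\<Sum>l\<in>{1..lft (\<lambda>v. N c v w) t}.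
          (\<lambda>r. U c (r, w) - V (r, w)) (nth_jump (\<lambda>t. N c t w) l))"
        unfolding lft by (simp add: JU_def JV_def sum_subtractf)
      also have "\<dots> = (\<Sum>r\<in>wp.jumps c {0<..t}. U c (r, w) - V (r, w))"
        unfolding J[symmetric] by (rule sum.reindex_bij_betw[OF bij_betw_nth_jump[OF cp[OF c w] ub t]])
      also have "\<dots> = (\<Sum>r\<in>wp.jumps c {s<..t}. U c (r, w) - V (r, w))"
        using fin s by (intro sum.mono_neutral_right) (auto simp: wp.jumps_def U_def V_def hI_def)
      also have "\<dots> = (\<Sum>r\<in>wp.jumps c {s<..t}. h w * (wp.WL r * (pathrate w c r * \<phi> (act c r (ch.XL r w) w) - \<phi> (ch.XL r w))))"
      proof (rule sum.cong[OF refl])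
        fix r assume "r \<in> wp.jumps c {s<..t}"
        then have r: "s < r" "r \<le> t" "0 < r" by (auto simp: wp.jumps_def)
        then show "U c (r, w) - V (r, w) = h w * (wp.WL r * (pathrate w c r * \<phi> (act c r (ch.XL r w) w) - \<phi> (ch.XL r w)))"
          using WL[of r] YX[of r] s by (simp add: U_def V_def hI_def algebra_simps)
      qed
      finally show ?thesis by (simp add: sum_distrib_left)
    qed
    then have 1: "h w * (\<Sum>c\<in>C. \<Sum>r\<in>wp.jumps c {s<..t}. wp.WL r * (pathrate w c r * \<phi> (act c r (ch.XL r w) w) - \<phi> (ch.XL r w))) =
      (\<Sum>c\<in>C. JU c w - JV c w)" by (simp add: sum_distrib_left)
    have "h w * (LBINT r:{s<..t}. wp.WL r * \<phi> (ch.XL r w) * wp.kap r) =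
      (LBINT r:{s<..t}. h w * (wp.WL r * \<phi> (ch.XL r w) * wp.kap r))" by simp
    also have "\<dots> = L w"
      unfolding set_lebesgue_integral_def L_def
    proof (rule Bochner_Integration.integral_cong[OF refl])
      fix r :: real
      show "indicator {s<..t} r *\<^sub>R (h w * (wp.WL r * \<phi> (ch.XL r w) * wp.kap r)) = K (r, w)"
      proof (cases "r \<in> {s<..t}")
        case True
        then show ?thesis using WL[of r] YX[of r] s
          by (simp add: K_def V_def R_def hI_def wp.kap_def sum_distrib_left sum_distrib_right algebra_simps)
      next
        case False
        then show ?thesis by (auto simp: K_def V_def R_def hI_def indicator_def)
      qed
    qed
    finally have 2: "h w * (LBINT r:{s<..t}. wp.WL r * \<phi> (ch.XL r w) * wp.kap r) = L w" .
    have "h w * ch.Dm t w * \<phi> (xt (ch.Y t w)) = h w * (wp.W t * \<phi> (ch.X t w))"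
      using Wr[OF t0 s(3) nt] xt by simp
    also have "\<dots> = h w * (wp.W s * \<phi> (ch.X s w)) + (\<Sum>c\<in>C. JU c w - JV c w) + L w"
      unfolding ev distrib_left 1 2 ..
    finally show "h w * ch.Dm t w * \<phi> (xt (ch.Y t w)) =
      h w * ch.Dm s w * \<phi> (xs (ch.Y s w)) + (\<Sum>c\<in>C. JU c w - JV c w) + L w"
      using Wr[OF s(1) _ ns] s xs by simp
  qed
  have hP: "h \<in> borel_measurable P" using h(1) sets_G_subset[of s] by (auto simp: measurable_def)
  have intD: "integrable P (\<lambda>w. h w * ch.Dm r w * \<phi> (y (ch.Y r w)))" if r: "0 \<le> r" for r y
  proof -
    have [measurable]: "(\<lambda>w. \<phi> (y (ch.Y r w))) \<in> borel_measurable P"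
      by (rule measurable_compose[OF Y_meas_at[OF r]]) simp
    have "integrable P (\<lambda>w. ch.Dm r w * (h w * \<phi> (y (ch.Y r w))))"
      using hP h(2) \<phi> by (intro integrable_Dm_times[OF r, where M=1]) (auto simp: abs_mult mult_le_one)
    then show ?thesis by (simp add: ac_simps)
  qed
  have "(\<integral>w. h w * ch.Dm t w * \<phi> (xt (ch.Y t w)) \<partial>P) =
    (\<integral>w. h w * ch.Dm s w * \<phi> (xs (ch.Y s w)) + (\<Sum>c\<in>C. JU c w - JV c w) + L w \<partial>P)"
    by (rule integral_cong_AE[OF _ _ path])
      (use intD[OF t0, of xt] intD[OF s(1), of xs] JU(1) JV(1) L(1) in \<open>auto intro!: borel_measurable_add borel_measurable_sum\<close>)
  also have "\<dots> = (\<integral>w. h w * ch.Dm s w * \<phi> (xs (ch.Y s w)) \<partial>P) + (\<Sum>c\<in>C. ?I (U c) - ?I V) + (\<Sum>c\<in>C. ?I V - ?I (R c))"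
    using intD[OF s(1), of xs] JU JV L by (simp add: Bochner_Integration.integral_diff)
  finally have main: "(\<integral>w. h w * ch.Dm t w * \<phi> (xt (ch.Y t w)) \<partial>P) =
    (\<integral>w. h w * ch.Dm s w * \<phi> (xs (ch.Y s w)) \<partial>P) + (\<Sum>c\<in>C. ?I (U c) - ?I (R c))"
    by (simp add: sum.distrib[symmetric])
  define E where "E x = (\<Sum>c\<in>C. indicator {0<..t} (fst x) * U c x - indicator {0<..t} (fst x) * R c x)" for x
  have "integrable (lborel \<Otimes>\<^sub>M P) E"
    unfolding E_def using intU intR by (intro Bochner_Integration.integrable_sum Bochner_Integration.integrable_diff) auto
  then have intE: "integrable (lborel \<Otimes>\<^sub>M P) (case_prod (\<lambda>r w. E (r, w)))" by simp
  have Eg: "E (r, w) = indicator {s<..t} r * g r w" for r w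
  proof (cases "r \<in> {s<..t}")
    case True
    then show ?thesis using s
      by (simp add: E_def U_def R_def hI_def g_def sum_distrib_left algebra_simps)
  next
    case False
    then show ?thesis by (auto simp: E_def U_def R_def hI_def indicator_def)
  qed
  have "(\<Sum>c\<in>C. ?I (U c) - ?I (R c)) = (\<integral>x. E x \<partial>(lborel \<Otimes>\<^sub>M P))"
    unfolding E_def using intU intR by (simp add: Bochner_Integration.integral_diff)
  also have "\<dots> = (\<integral>x. (case x of (r, w) \<Rightarrow> E (r, w)) \<partial>(lborel \<Otimes>\<^sub>M P))" by simp
  also have "\<dots> = (\<integral>r. \<integral>w. E (r, w) \<partial>P \<partial>lborel)"
    by (rule LP.integral_fst[OF intE, symmetric])
  also have "\<dots> = (LBINT r:{s<..t}. \<integral>w. g r w \<partial>P)"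
    unfolding set_lebesgue_integral_def Eg by (intro Bochner_Integration.integral_cong) auto
  finally show "(\<integral>w. h w * ch.Dm t w * \<phi> (xt (ch.Y t w)) \<partial>P) =
      (\<integral>w. h w * ch.Dm s w * \<phi> (xs (ch.Y s w)) \<partial>P) + (LBINT r:{s<..t}. \<integral>w. g r w \<partial>P)"
    using main by simp
  show "set_integrable lborel {s<..t} (\<lambda>r. \<integral>w. g r w \<partial>P)"
    using LP.integrable_fst[OF intE] unfolding set_integrable_def Eg by simp
qed

end

section \<open>The chain in a frozen shock environment\<close>

text \<open>If \<open>u\<close> is the final vector of shock times, this is the vector seen just
  before \<open>s\<close>, and \<open>trunc\<close> is the one seen at \<open>s\<close>; shocks
  still to come have the entry -1.\<close>

definition trunc_left :: "nat \<Rightarrow> (nat \<Rightarrow> real) \<Rightarrow> real \<Rightarrow> nat \<Rightarrow> real" where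
  "trunc_left n u s = (\<lambda>k. if k \<in> {1..n} then (if u k < s then u k else -1) else 0)"

definition trunc :: "nat \<Rightarrow> (nat \<Rightarrow> real) \<Rightarrow> real \<Rightarrow> nat \<Rightarrow> real" where
  "trunc n u s = (\<lambda>k. if k \<in> {1..n} then (if u k \<le> s then u k else -1) else 0)"

text \<open>The values of the shock-time process off a null set: unlike in \<open>Uset\<close>, shock times are positive and distinct.\<close>
definition shock_seq :: "nat \<Rightarrow> real \<Rightarrow> (nat \<Rightarrow> real) \<Rightarrow> nat \<Rightarrow> bool" where
  "shock_seq n T u m \<longleftrightarrow> m \<le> n \<and> (\<forall>k. k \<notin> {1..n} \<longrightarrow> u k = 0) \<and> (\<forall>k\<in>{1..m}. 0 < u k \<and> u k \<le> T) \<and>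
     (\<forall>k\<in>{1..m}. \<forall>l\<in>{1..m}. k < l \<longrightarrow> u k < u l) \<and> (\<forall>k\<in>{m<..n}. u k = -1)"

text \<open>Shock times increase with their index, so a downward closed condition selects an initial
  segment of the shocks. It serves both truncations, with strict and with weak inequality.\<close>

lemma shock_seq_threshold:
  assumes "shock_seq n T u m"
    and down: "\<And>x y::real. x < y \<Longrightarrow> Q y \<Longrightarrow> Q x"
  obtains m' where "m' \<le> m" "\<And>k. k \<in> {1..m} \<Longrightarrow> Q (u k) \<longleftrightarrow> k \<le> m'"
proof -
  define K where "K = {k\<in>{1..m}. Q (u k)}"
  define m' where "m' = (if K \<noteq> {} then Max K else 0)"
  have fin: "finite K" by (simp add: K_def)
  have *: "m' \<in> K \<and> (\<forall>k\<in>K. k \<le> m')" if "K \<noteq> {}"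
    using that Max_in[OF fin] Max_ge[OF fin] by (simp add: m'_def)
  show ?thesis
  proof (rule that[of m'])
    show "m' \<le> m" using * by (cases "K = {}") (auto simp: m'_def K_def)
    fix k assume k: "k \<in> {1..m}"
    show "Q (u k) \<longleftrightarrow> k \<le> m'"
    proof
      assume "Q (u k)" then have "k \<in> K" using k by (simp add: K_def)
      then show "k \<le> m'" using * by blast
    next
      assume km: "k \<le> m'"
      then have "K \<noteq> {}" using k by (auto simp: m'_def)
      with * have m: "m' \<in> {1..m}" "Q (u m')" by (auto simp: K_def)
      show "Q (u k)"
      proof (cases "k = m'")
        case False
        then have "u k < u m'" using assms(1) k m km unfolding shock_seq_def by (meson le_neq_implies_less)
        then show ?thesis using down m by blast
      qed (use m in simp)
    qed
  qed
qed

lemma shock_seq_cut: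
  assumes u: "shock_seq n T u m" and m': "m' \<le> m"
    and v: "\<And>k. k \<in> {1..n} \<Longrightarrow> v k = (if k \<le> m' then u k else -1)" "\<And>k. k \<notin> {1..n} \<Longrightarrow> v k = 0"
    and t: "0 \<le> t" "t \<le> T" "\<And>k. k \<in> {1..m'} \<Longrightarrow> u k \<le> t"
  shows "(t, v) \<in> TS n T" "Zof n v = m'" "shock_seq n T v m'"
proof -
  have mn: "m' \<le> n" using u m' by (auto simp: shock_seq_def)
  show ss: "shock_seq n T v m'" using u m' mn v unfolding shock_seq_def by auto
  have "v k \<le> v (Suc k)" if "k \<in> {1..<m'}" for k
    using ss that unfolding shock_seq_def by (metis Suc_leI Suc_le_lessD atLeastAtMost_iff atLeastLessThan_iff lessI less_imp_le_nat less_eq_real_def le_SucI)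
  then have "v \<in> Uset n T" using ss mn unfolding Uset_def shock_seq_def by (auto intro!: exI[of _ m'] simp: less_imp_le)
  moreover have "v k \<le> t" if "k \<in> {1..n}" for k using v(1)[OF that] t that by auto
  ultimately show "(t, v) \<in> TS n T" using t by (auto simp: TS_def)
  have "0 \<le> v k \<longleftrightarrow> k \<le> m'" if "k \<in> {1..n}" for k
    using ss that unfolding shock_seq_def by (cases "k \<le> m'") (auto simp: less_imp_le)
  then have "{k \<in> {1..n}. 0 \<le> v k} = {1..m'}" using mn by auto
  then show "Zof n v = m'" by (simp add: Zof_def)
qed

lemma trunc_left_shock_seq:
  assumes u: "shock_seq n T u m" and t: "0 \<le> t" "t \<le> T"
  shows "(t, trunc_left n u t) \<in> TS n T" "\<exists>m'. shock_seq n T (trunc_left n u t) m'"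
proof -
  obtain m' where m': "m' \<le> m" "\<And>k. k \<in> {1..m} \<Longrightarrow> u k < t \<longleftrightarrow> k \<le> m'"
    using shock_seq_threshold[OF u, of "\<lambda>x. x < t"] by (metis less_trans)
  have v: "trunc_left n u t k = (if k \<le> m' then u k else -1)" if "k \<in> {1..n}" for k
    using that m'(1) m'(2)[of k] u by (cases "k \<le> m") (auto simp: trunc_left_def shock_seq_def)
  have t3: "u k \<le> t" if "k \<in> {1..m'}" for k using m'(1) m'(2)[of k] that by auto
  note c = shock_seq_cut[OF u m'(1) v _ t t3]
  show "(t, trunc_left n u t) \<in> TS n T" by (rule c(1)) (auto simp: trunc_left_def)
  have "shock_seq n T (trunc_left n u t) m'" by (rule c(3)) (auto simp: trunc_left_def)
  then show "\<exists>m'. shock_seq n T (trunc_left n u t) m'" by blast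
qed

lemma trunc_shock_seq:
  assumes u: "shock_seq n T u m" and t: "0 \<le> t" "t \<le> T"
  shows "(t, trunc n u t) \<in> TS n T" "\<exists>m'. shock_seq n T (trunc n u t) m'"
proof -
  obtain m' where m': "m' \<le> m" "\<And>k. k \<in> {1..m} \<Longrightarrow> u k \<le> t \<longleftrightarrow> k \<le> m'"
    using shock_seq_threshold[OF u, of "\<lambda>x. x \<le> t"] by (metis less_imp_le order_trans)
  have v: "trunc n u t k = (if k \<le> m' then u k else -1)" if "k \<in> {1..n}" for k
    using that m'(1) m'(2)[of k] u by (cases "k \<le> m") (auto simp: trunc_def shock_seq_def)
  have t3: "u k \<le> t" if "k \<in> {1..m'}" for k using m'(1) m'(2)[of k] that by auto
  note c = shock_seq_cut[OF u m'(1) v _ t t3]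
  show "(t, trunc n u t) \<in> TS n T" by (rule c(1)) (auto simp: trunc_def)
  have "shock_seq n T (trunc n u t) m'" by (rule c(3)) (auto simp: trunc_def)
  then show "\<exists>m'. shock_seq n T (trunc n u t) m'" by blast
qed

lemma coordinate_measurable: "(\<lambda>u::nat \<Rightarrow> real. u k) \<in> borel_measurable borel"
  by (intro borel_measurable_continuous_onI continuous_on_product_coordinates)

lemma trunc_left_measurable:
  assumes "f \<in> borel_measurable M" "g \<in> borel_measurable M"
  shows "(\<lambda>x. trunc_left n (f x) (g x)) \<in> borel_measurable M"
proof (rule measurable_coordinatewise_then_product)
  fix k
  have [measurable]: "(\<lambda>x. f x k) \<in> borel_measurable M"
    by (rule measurable_compose[OF assms(1) coordinate_measurable])
  note [measurable] = assms(2)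
  show "(\<lambda>x. trunc_left n (f x) (g x) k) \<in> borel_measurable M"
    unfolding trunc_left_def by measurable
qed

lemma trunc_measurable:
  assumes "f \<in> borel_measurable M" "g \<in> borel_measurable M"
  shows "(\<lambda>x. trunc n (f x) (g x)) \<in> borel_measurable M"
proof (rule measurable_coordinatewise_then_product)
  fix k
  have [measurable]: "(\<lambda>x. f x k) \<in> borel_measurable M"
    by (rule measurable_compose[OF assms(1) coordinate_measurable])
  note [measurable] = assms(2)
  show "(\<lambda>x. trunc n (f x) (g x) k) \<in> borel_measurable M"
    unfolding trunc_def by measurable
qed

lemma Zof_measurable: "Zof n \<in> measurable borel (count_space UNIV)"
proof -
  have "Zof n = (\<lambda>u. \<Sum>k\<in>{1..n}. if 0 \<le> u k then 1 else 0)"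
    by (auto simp: Zof_def fun_eq_iff sum.If_cases Int_def)
  moreover have "(\<lambda>u::nat \<Rightarrow> real. if 0 \<le> u k then 1 else (0::nat)) \<in> measurable borel (count_space UNIV)" for k
  proof -
    note [measurable] = coordinate_measurable
    show ?thesis by measurable
  qed
  ultimately show ?thesis by simp
qed

lemma measurable_borel_Pair:
  fixes f :: "'x \<Rightarrow> 'b::second_countable_topology" and g :: "'x \<Rightarrow> 'c::second_countable_topology"
  assumes "f \<in> borel_measurable M" "g \<in> borel_measurable M"
  shows "(\<lambda>x. (f x, g x)) \<in> borel_measurable M"
  using assms by (rule borel_measurable_Pair)

locale frozen_model = prob_space P for P :: "'w measure" +
  fixes S n :: nat and T :: real and A :: "'a::euclidean_space set"
    and Q :: "real \<Rightarrow> nat \<Rightarrow> (nat \<Rightarrow> real) \<Rightarrow> 'a \<Rightarrow> nat \<Rightarrow> nat \<Rightarrow> real"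
    and J :: "nat \<Rightarrow> real \<Rightarrow> (nat \<Rightarrow> real) \<Rightarrow> nat"
    and X0 :: "'w \<Rightarrow> nat"
    and N :: "noise \<Rightarrow> real \<Rightarrow> 'w \<Rightarrow> nat"
    and mu :: "real \<Rightarrow> (nat \<Rightarrow> real) \<Rightarrow> (nat \<Rightarrow> real)"
    and alpha :: "real \<Rightarrow> (nat \<Rightarrow> real) \<Rightarrow> nat \<Rightarrow> 'a"
  assumes T_pos: "0 < T"
    and Q_intens: "\<forall>t\<in>{0..T}. \<forall>k\<le>n. \<forall>m\<in>prob_simplex S. \<forall>a\<in>A.
         (\<forall>i\<in>{1..S}. \<forall>j\<in>{1..S}. i \<noteq> j \<longrightarrow> 0 \<le> Q t k m a i j) \<and>
         (\<forall>i\<in>{1..S}. (\<Sum>j=1..S. Q t k m a i j) = 0)"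
    and Q_bdd: "\<forall>k\<le>n. \<forall>i\<in>{1..S}. \<forall>j\<in>{1..S}. \<exists>C. \<forall>t\<in>{0..T}. \<forall>m\<in>prob_simplex S. \<forall>a\<in>A.
         \<bar>Q t k m a i j\<bar> \<le> C"
    and Q_meas: "\<forall>k i j. (\<lambda>(t, m, a). Q t k m a i j) \<in> borel_measurable borel"
    and J_range: "\<forall>i\<in>{1..S}. \<forall>t\<in>{0..T}. \<forall>m\<in>prob_simplex S. J i t m \<in> {1..S}"
    and J_meas: "\<forall>i. (\<lambda>(t, m). J i t m) \<in> measurable borel (count_space UNIV)"
    and X0_meas: "X0 \<in> measurable P (count_space UNIV)"
    and X0_range: "\<forall>\<omega>\<in>space P. X0 \<omega> \<in> {1..S}"
    and N_poisson: "\<forall>c\<in>noise_idx S n. unit_poisson_process P (N c)"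
    and indep: "indep_vars (\<lambda>_. PiM UNIV (\<lambda>_::real. count_space (UNIV::nat set)))
         (\<lambda>c \<omega>. case c of None \<Rightarrow> (\<lambda>_. X0 \<omega>) | Some c' \<Rightarrow> (\<lambda>t. N c' t \<omega>))
         (insert None (Some ` noise_idx S n))"
    and mu_range: "\<forall>(t, u)\<in>TS n T. mu t u \<in> prob_simplex S"
    and mu_meas: "(\<lambda>(t, u). mu t u) \<in> borel_measurable borel"
    and alpha_meas: "\<forall>i. (\<lambda>(t, u). alpha t u i) \<in> borel_measurable borel"
    and alpha_range: "\<forall>(t, u)\<in>TS n T. \<forall>i\<in>{1..S}. alpha t u i \<in> A"
begin

definition states :: "(nat \<times> nat \<times> nat) set" where
  "states = {(i, k, j). i \<in> {1..S} \<and> j \<in> {1..S} \<and> i \<noteq> j \<and> k \<le> n}"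

definition NXs :: "noise set" where
  "NXs = (\<lambda>(i, k, j). NX i k j) ` states"

lemma finite_states: "finite states"
  by (rule finite_subset[of _ "{1..S} \<times> {..n} \<times> {1..S}"]) (auto simp: states_def)

lemma NXs_iff: "NX i k j \<in> NXs \<longleftrightarrow> i \<in> {1..S} \<and> j \<in> {1..S} \<and> i \<noteq> j \<and> k \<le> n" "NZ k \<notin> NXs"
  by (force simp: NXs_def states_def)+

lemma noise_idx_eq: "noise_idx S n = NXs \<union> NZ ` {1..n}"
proof (rule set_eqI)
  fix c show "c \<in> noise_idx S n \<longleftrightarrow> c \<in> NXs \<union> NZ ` {1..n}"
    by (cases c) (simp_all add: noise_idx_def NXs_iff image_iff)
qed

lemma finite_noise: "finite (noise_idx S n)" "finite NXs"
  unfolding noise_idx_eq NXs_def using finite_states by auto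

sublocale all: poisson_family P "noise_idx S n" N X0
  by unfold_locales (use finite_noise N_poisson X0_meas indep in auto)

sublocale poisson_family P NXs N X0
proof
  show "indep_vars (\<lambda>_. PiM UNIV (\<lambda>_::real. count_space (UNIV::nat set)))
         (\<lambda>c \<omega>. case c of None \<Rightarrow> (\<lambda>_. X0 \<omega>) | Some c' \<Rightarrow> (\<lambda>t. N c' t \<omega>)) (insert None (Some ` NXs))"
    by (rule indep_vars_subset[OF indep]) (auto simp: noise_idx_eq)
qed (use finite_noise N_poisson X0_meas in \<open>auto simp: noise_idx_eq\<close>)

lemma bound_exists: "\<exists>B\<ge>1. \<forall>k\<le>n. \<forall>i\<in>{1..S}. \<forall>j\<in>{1..S}. \<forall>t\<in>{0..T}. \<forall>m\<in>prob_simplex S. \<forall>a\<in>A. Q t k m a i j \<le> B"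
proof -
  obtain Cf where Cf: "\<And>k i j t m a. k \<le> n \<Longrightarrow> i \<in> {1..S} \<Longrightarrow> j \<in> {1..S} \<Longrightarrow> t \<in> {0..T} \<Longrightarrow>
      m \<in> prob_simplex S \<Longrightarrow> a \<in> A \<Longrightarrow> \<bar>Q t k m a i j\<bar> \<le> Cf k i j"
    using Q_bdd by metis
  define F where "F = insert 1 ((\<lambda>(k, i, j). Cf k i j) ` ({..n} \<times> {1..S} \<times> {1..S}))"
  have fin: "finite F" by (auto simp: F_def)
  show ?thesis
  proof (intro exI[of _ "Max F"] conjI allI impI ballI)
    show "1 \<le> Max F" by (rule Max_ge[OF fin]) (auto simp: F_def)
    fix k i j t m a
    assume *: "k \<le> n" "i \<in> {1..S}" "j \<in> {1..S}" "t \<in> {0..T}" "m \<in> prob_simplex S" "a \<in> A"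
    have "Q t k m a i j \<le> Cf k i j" using Cf[OF *] by linarith
    also have "\<dots> \<le> Max F" using * by (intro Max_ge[OF fin]) (force simp: F_def)
    finally show "Q t k m a i j \<le> Max F" .
  qed
qed

definition QB :: real where
  "QB = (SOME B. 1 \<le> B \<and> (\<forall>k\<le>n. \<forall>i\<in>{1..S}. \<forall>j\<in>{1..S}. \<forall>t\<in>{0..T}. \<forall>m\<in>prob_simplex S. \<forall>a\<in>A. Q t k m a i j \<le> B))"

lemma QB: "1 \<le> QB" "\<And>k i j t m a. k \<le> n \<Longrightarrow> i \<in> {1..S} \<Longrightarrow> j \<in> {1..S} \<Longrightarrow> t \<in> {0..T} \<Longrightarrow>
    m \<in> prob_simplex S \<Longrightarrow> a \<in> A \<Longrightarrow> Q t k m a i j \<le> QB"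
  using someI_ex[OF bound_exists, folded QB_def] by blast+

text \<open>The path of \<open>NZ k\<close> counts the accepted \<open>k\<close>-th shock and not
  the jumps of the Poisson noise of that index. The guard \<open>0 < u k\<close> makes it start at
  zero for every vector \<open>u\<close>.\<close>

definition Nf :: "noise \<Rightarrow> real \<Rightarrow> (nat \<Rightarrow> real) \<Rightarrow> 'w \<Rightarrow> nat" where
  "Nf c t u w = (case c of NX i k j \<Rightarrow> N (NX i k j) t w | NZ k \<Rightarrow> if 0 < u k \<and> u k \<le> t then 1 else 0)"

definition actf :: "noise \<Rightarrow> real \<Rightarrow> nat \<Rightarrow> (nat \<Rightarrow> real) \<Rightarrow> nat" where
  "actf c s x u = (case c of NX i k j \<Rightarrow> if x = i \<and> Zof n (trunc_left n u s) = k then j else x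
     | NZ k \<Rightarrow> J x s (mu s (trunc_left n u s)))"

text \<open>The clamping is immaterial for admissible \<open>u\<close>; it makes the rates bounded for every \<open>u\<close>.\<close>
definition qf :: "noise \<Rightarrow> real \<Rightarrow> nat \<Rightarrow> (nat \<Rightarrow> real) \<Rightarrow> real" where
  "qf c s x u = (case c of NX i k j \<Rightarrow> if Zof n (trunc_left n u s) = k
     then max 0 (min QB (Q s k (mu s (trunc_left n u s)) (alpha s (trunc_left n u s) x) i j)) else 1
     | NZ k \<Rightarrow> 1)"

lemma qf_bd: "0 \<le> qf c s x u" "qf c s x u \<le> QB"
  using QB(1) by (auto simp: qf_def split: noise.splits)

lemma Nf_NXs: "c \<in> NXs \<Longrightarrow> Nf c t u w = N c t w"
  by (auto simp: NXs_def Nf_def)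

lemma counting_path_Nf:
  assumes "c \<in> noise_idx S n" "w \<in> space P" shows "counting_path (\<lambda>t. Nf c t u w)"
proof (cases c)
  case (NX i k j)
  then show ?thesis using all.cp[OF assms] by (simp add: Nf_def)
next
  case (NZ k)
  have "continuous (at_right t) (\<lambda>s. if 0 < u k \<and> u k \<le> s then 1 else (0::nat))" for t
    unfolding continuous_within
  proof (rule tendsto_eventually)
    show "\<forall>\<^sub>F s in at_right t. (if 0 < u k \<and> u k \<le> s then 1 else (0::nat)) = (if 0 < u k \<and> u k \<le> t then 1 else 0)"
    proof (cases "u k \<le> t")
      case True
      then show ?thesis by (auto simp: eventually_at_right_field intro!: exI[of _ "t + 1"])
    next
      case False
      then show ?thesis by (auto simp: eventually_at_right_field intro!: exI[of _ "u k"])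
    qed
  qed
  then show ?thesis using NZ by (auto simp: Nf_def counting_path_def mono_on_def)
qed

lemma mu_trunc_measurable:
  assumes "f \<in> borel_measurable M" "g \<in> borel_measurable M"
  shows "(\<lambda>x. mu (g x) (trunc_left n (f x) (g x))) \<in> borel_measurable M"
  using measurable_compose[OF measurable_borel_Pair[OF assms(2) trunc_left_measurable[OF assms]] mu_meas]
  by simp

lemma actf_measurable:
  assumes f: "f \<in> borel_measurable M" and g: "g \<in> borel_measurable M"
  shows "(\<lambda>x. actf c (g x) i (f x)) \<in> measurable M (count_space UNIV)"
proof (cases c)
  case (NX i' k j)
  have [measurable]: "(\<lambda>x. Zof n (trunc_left n (f x) (g x))) \<in> measurable M (count_space UNIV)"
    by (rule measurable_compose[OF trunc_left_measurable[OF f g] Zof_measurable])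
  show ?thesis unfolding actf_def NX noise.case by measurable
next
  case (NZ k)
  have "(\<lambda>x. (g x, mu (g x) (trunc_left n (f x) (g x)))) \<in> borel_measurable M"
    by (intro measurable_borel_Pair g mu_trunc_measurable f)
  from measurable_compose[OF this J_meas[rule_format, of i]] show ?thesis
    by (simp add: actf_def NZ)
qed

lemma qf_measurable:
  assumes f: "f \<in> borel_measurable M" and g: "g \<in> borel_measurable M"
  shows "(\<lambda>x. qf c (g x) i (f x)) \<in> borel_measurable M"
proof (cases c)
  case (NX i' k j)
  have [measurable]: "(\<lambda>x. Zof n (trunc_left n (f x) (g x))) \<in> measurable M (count_space UNIV)"
    by (rule measurable_compose[OF trunc_left_measurable[OF f g] Zof_measurable])
  have al: "(\<lambda>x. alpha (g x) (trunc_left n (f x) (g x)) i) \<in> borel_measurable M"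
    using measurable_compose[OF measurable_borel_Pair[OF g trunc_left_measurable[OF f g]] alpha_meas[rule_format, of i]]
    by simp
  have "(\<lambda>x. (g x, mu (g x) (trunc_left n (f x) (g x)), alpha (g x) (trunc_left n (f x) (g x)) i)) \<in> borel_measurable M"
    by (intro measurable_borel_Pair g mu_trunc_measurable f al)
  from measurable_compose[OF this Q_meas[rule_format, of k i' j]]
  have [measurable]: "(\<lambda>x. Q (g x) k (mu (g x) (trunc_left n (f x) (g x))) (alpha (g x) (trunc_left n (f x) (g x)) i) i' j) \<in> borel_measurable M"
    by simp
  show ?thesis unfolding qf_def NX noise.case by measurable
next
  case (NZ k)
  then show ?thesis by (simp add: qf_def)
qed

abbreviation "Om2 \<equiv> (UNIV :: (nat \<Rightarrow> real) set) \<times> space P"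
abbreviation "G2 a \<equiv> (borel :: (nat \<Rightarrow> real) measure) \<Otimes>\<^sub>M G a"

sublocale pr: driven_chain G2 Om2 "noise_idx S n" NXs "\<lambda>c t x. Nf c t (fst x) (snd x)"
  "\<lambda>c s i x. actf c s i (fst x)" "\<lambda>c s i x. qf c s i (fst x)" "\<lambda>x. X0 (snd x)"
proof
  show "space (G2 a) = Om2" for a by (simp add: space_pair_measure)
  show "sets (G2 a) \<subseteq> sets (G2 b)" if "0 \<le> a" "a \<le> b" for a b
  proof -
    have "{X \<times> Y | X Y. X \<in> sets borel \<and> Y \<in> sets (G a)} \<subseteq> {X \<times> Y | X Y. X \<in> sets (borel :: (nat \<Rightarrow> real) measure) \<and> Y \<in> sets (G b)}"
      using mono_F[OF that] by blast
    then show ?thesis unfolding sets_pair_measure by (simp add: sigma_sets_mono')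
  qed
  show "finite (noise_idx S n)" "NXs \<subseteq> noise_idx S n" by (auto simp: finite_noise noise_idx_eq)
  show "counting_path (\<lambda>t. Nf c t (fst x) (snd x))" if "c \<in> noise_idx S n" "x \<in> Om2" for c x
    using counting_path_Nf[OF that(1)] that(2) by auto
  show "(\<lambda>x. Nf c t (fst x) (snd x)) \<in> measurable (G2 t) (count_space UNIV)" if c: "c \<in> noise_idx S n" and t: "0 \<le> t" for c t
  proof (cases c)
    case (NX i k j)
    then have "c \<in> NXs" using c by (auto simp: noise_idx_eq)
    from measurable_compose[OF measurable_snd N_adapted[OF this t]] show ?thesis
      using Nf_NXs[OF \<open>c \<in> NXs\<close>] by simp
  next
    case (NZ k)
    have [measurable]: "(\<lambda>x. fst x k) \<in> borel_measurable (G2 t)"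
      by (rule measurable_compose[OF measurable_fst coordinate_measurable])
    show ?thesis unfolding Nf_def NZ noise.case by measurable
  qed
  show "(\<lambda>(s, x). actf c s i (fst x)) \<in> measurable (borel \<Otimes>\<^sub>M G2 0) (count_space UNIV)" for c i
    unfolding case_prod_beta' by (rule actf_measurable) measurable
  show "(\<lambda>(s, x). qf c s i (fst x)) \<in> borel_measurable (borel \<Otimes>\<^sub>M G2 0)" for c i
    unfolding case_prod_beta' by (rule qf_measurable) measurable
  show "(\<lambda>x. X0 (snd x)) \<in> measurable (G2 0) (count_space UNIV)"
    by (rule measurable_compose[OF measurable_snd X0_adapted])
qed

end

section \<open>Weighted state masses as functions of the shock vector\<close>

context frozen_model
begin

text \<open>The passage from the left limit to the state at \<open>t\<close>. Keeping it apart from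
  the chain makes the state at \<open>t\<close> a function of the predictable
  \<open>Y\<close>.\<close>

definition XS :: "real \<Rightarrow> (nat \<Rightarrow> real) \<Rightarrow> nat \<Rightarrow> nat" where
  "XS t u i = (if 0 < t \<and> (\<exists>k\<in>{1..n}. u k = t) then J i t (mu t (trunc_left n u t)) else i)"

text \<open>The weighted mass of the left limit at \<open>i\<close>. The function \<open>p\<close>
  is its image under \<open>XS\<close>, hence the weighted mass of the state at \<open>t\<close>
  itself.\<close>

definition pm :: "real \<Rightarrow> (nat \<Rightarrow> real) \<Rightarrow> nat \<Rightarrow> real" where
  "pm t u i = (\<integral>w. pr.Dm t (u, w) * (if pr.Y t (u, w) = i then 1 else 0) \<partial>P)"

definition p :: "real \<Rightarrow> (nat \<Rightarrow> real) \<Rightarrow> nat \<Rightarrow> real" where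
  "p t u j = (\<Sum>i=1..S. pm t u i * (if XS t u i = j then 1 else 0))"

lemma lft_Nf_NZ: "0 < s \<Longrightarrow> lft (\<lambda>t. Nf (NZ k) t u w) s = (if 0 < u k \<and> u k < s then 1 else 0)"
  by (cases "0 < u k \<and> u k < s") (auto simp: Nf_def intro!: lft_eqI[of s "if u k < s then u k else 0"])

lemma pr_Y_0: "pr.Y 0 x = X0 (snd x)"
proof -
  have "event_times (noise_idx S n) (pr.paths x) \<inter> {..<0} = {}" by (auto simp: event_times_def)
  then show ?thesis by (simp add: pr.Y_def pr.good_left_def unit_jumps_before_def chain_on_def)
qed

lemma pr_Dm_0: "x \<in> Om2 \<Longrightarrow> pr.Dm 0 x = 1"
  using cp by (auto simp: pr.Dm_def lft_def counting_path_def set_lebesgue_integral_def Nf_NXs)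

lemma pr_Y_meas:
  assumes "0 \<le> t" shows "pr.Y t \<in> measurable (G2 t) (count_space UNIV)"
proof (cases "t = 0")
  case True
  have "(\<lambda>x. X0 (snd x)) \<in> measurable (G2 0) (count_space UNIV)"
    by (rule measurable_compose[OF measurable_snd X0_adapted])
  then show ?thesis using True by (simp add: pr_Y_0[abs_def])
next
  case False
  then show ?thesis using measurable_compose[OF pr.measurable_section_Pr pr.Y_meas, of t] assms by simp
qed

lemma pr_Dm_meas:
  assumes "0 \<le> t" shows "pr.Dm t \<in> borel_measurable (G2 t)"
proof (cases "t = 0")
  case True
  have "pr.Dm 0 \<in> borel_measurable (G2 0) \<longleftrightarrow> (\<lambda>_. 1::real) \<in> borel_measurable (G2 0)"
    by (rule measurable_cong) (auto simp: space_pair_measure pr_Dm_0)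
  then show ?thesis using True by simp
next
  case False
  then show ?thesis using measurable_compose[OF pr.measurable_section_Pr pr.Dm_meas, of t] assms by simp
qed

lemma measurable_G2_P: "f \<in> measurable (G2 t) M \<Longrightarrow> f \<in> measurable (borel \<Otimes>\<^sub>M P) M"
proof -
  assume f: "f \<in> measurable (G2 t) M"
  have "(\<lambda>w. w) \<in> measurable P (G t)" using sets_G_subset[of t] by (auto simp: measurable_def sets.Int_space_eq2)
  then have "(\<lambda>x. (fst x, snd x)) \<in> measurable (borel \<Otimes>\<^sub>M P) (G2 t)"
    by (intro measurable_Pair measurable_fst measurable_compose[OF measurable_snd]) auto
  from measurable_compose[OF this f] show ?thesis by simp
qed

lemma XS_measurable:
  assumes f: "f \<in> borel_measurable M"
  shows "(\<lambda>x. XS t (f x) i) \<in> measurable M (count_space UNIV)"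
proof -
  have [measurable]: "(\<lambda>x. f x k) \<in> borel_measurable M" for k
    by (rule measurable_compose[OF f coordinate_measurable])
  have [measurable]: "(\<lambda>x. J i t (mu t (trunc_left n (f x) t))) \<in> measurable M (count_space UNIV)"
    using actf_measurable[OF f, of "\<lambda>_. t" "NZ 0" i] by (simp add: actf_def)
  show ?thesis unfolding XS_def by measurable
qed

text \<open>Needed for \<open>p\<close> to be a version of a conditional probability; it is a
  parametrised integral, so joint measurability in \<open>u\<close> and the path is what
  counts.\<close>

lemma p_measurable:
  assumes "0 \<le> t" shows "(\<lambda>u. p t u j) \<in> borel_measurable borel"
proof -
  have "(\<lambda>u. pm t u i) \<in> borel_measurable borel" for i
  proof -
    note [measurable] = measurable_G2_P[OF pr_Dm_meas[OF assms]] measurable_G2_P[OF pr_Y_meas[OF assms]]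
    have "(\<lambda>(u, w). pr.Dm t (u, w) * (if pr.Y t (u, w) = i then 1 else 0)) \<in> borel_measurable (borel \<Otimes>\<^sub>M P)"
      unfolding case_prod_beta' prod.collapse by measurable
    from borel_measurable_lebesgue_integral[OF this] show ?thesis by (simp add: pm_def)
  qed
  moreover have "(\<lambda>u. XS t u i) \<in> measurable borel (count_space UNIV)" for i
    by (rule XS_measurable) simp
  ultimately show ?thesis unfolding p_def by measurable
qed

text \<open>The frozen chain up to time \<open>t\<close> only sees the shocks before \<open>t\<close>.\<close>
lemma frozen_cong:
  assumes w: "w \<in> space P" and t: "0 \<le> t"
    and L: "\<And>r. r \<le> t \<Longrightarrow> trunc_left n u r = trunc_left n v r"
    and k: "\<And>k r. k \<in> {1..n} \<Longrightarrow> r < t \<Longrightarrow> (0 < u k \<and> u k \<le> r) = (0 < v k \<and> v k \<le> r)"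
  shows "r \<le> t \<Longrightarrow> pr.Y r (u, w) = pr.Y r (v, w)" "pr.Dm t (u, w) = pr.Dm t (v, w)"
proof -
  have N: "Nf c r u w = Nf c r v w" if "c \<in> noise_idx S n" "r < t" for c r
  proof (cases c)
    case (NZ l)
    then have "l \<in> {1..n}" using that by (auto simp: noise_idx_eq NXs_iff)
    then show ?thesis using NZ k[of l r] that by (simp add: Nf_def)
  qed (simp add: Nf_def)
  have lft: "lft (\<lambda>t. Nf c t u w) r = lft (\<lambda>t. Nf c t v w) r" if c: "c \<in> noise_idx S n" and r: "r \<le> t" "0 < r" for c r
  proof (cases c)
    case (NX i k j)
    then show ?thesis by (simp add: Nf_def)
  next
    case (NZ l)
    then have l: "l \<in> {1..n}" using c by (auto simp: noise_idx_eq NXs_iff)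
    have "(0 < u l \<and> u l < r) = (0 < v l \<and> v l < r)"
      using k[OF l, of "u l"] k[OF l, of "v l"] r by force
    then show ?thesis using NZ lft_Nf_NZ[OF r(2)] by simp
  qed
  have act: "actf c r x u = actf c r x v" if "r \<le> t" for c r x
    using L[OF that] by (auto simp: actf_def split: noise.splits)
  show Y: "pr.Y r (u, w) = pr.Y r (v, w)" if r: "r \<le> t" for r
  proof -
    let ?u = "\<lambda>c t. Nf c t u w" and ?v = "\<lambda>c t. Nf c t v w" and ?I = "noise_idx S n"
    have jump: "(?u c s \<noteq> lft (?u c) s) = (?v c s \<noteq> lft (?v c) s)" if "c \<in> ?I" "0 < s" "s < r" for c s
      using N[OF that(1), of s] lft[OF that(1), of s] that r by simp
    have ev: "event_times ?I ?u \<inter> {..<r} = event_times ?I ?v \<inter> {..<r}"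
      using jump by (auto simp: event_times_def)
    have mark: "mark ?I ?u s = mark ?I ?v s" if "0 < s" "s < r" for s
      unfolding mark_def using jump[OF _ that] by (intro arg_cong[where f=The] ext) blast
    have tot: "total_count ?I ?u s = total_count ?I ?v s" if "s < r" for s
      unfolding total_count_def using N that r by (intro sum.cong) auto
    \<comment> \<open>The two totals agree on a left neighbourhood of \<open>s\<close>, so they have
      the same candidates for a left limit and the same \<open>Lim\<close>.\<close>
    have ltot: "lft (total_count ?I ?u) s = lft (total_count ?I ?v) s" if "0 < s" "s < r" for s
    proof -
      have "eventually (\<lambda>x. total_count ?I ?u x = total_count ?I ?v x) (at_left s)"
        using that tot by (auto simp: eventually_at_left intro!: exI[of _ "s - 1"])
      then have "(total_count ?I ?u \<longlongrightarrow> l) (at_left s) = (total_count ?I ?v \<longlongrightarrow> l) (at_left s)" for l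
        by (rule tendsto_cong)
      then show ?thesis using that by (simp add: lft_def Topological_Spaces.Lim_def)
    qed
    have good: "unit_jumps_before (total_count ?I ?u) r = unit_jumps_before (total_count ?I ?v) r"
      unfolding unit_jumps_before_def using tot ltot by (metis (no_types, lifting))
    have fold: "fold (\<lambda>s x. actf (mark ?I ?u s) s x u) xs x = fold (\<lambda>s x. actf (mark ?I ?v s) s x v) xs x"
      if "set xs \<subseteq> event_times ?I ?v \<inter> {..<r}" for xs x
    proof (rule fold_cong[OF refl refl])
      fix s assume "s \<in> set xs"
      then have "0 < s" "s < r" using that by (auto simp: event_times_def)
      then show "(\<lambda>x. actf (mark ?I ?u s) s x u) = (\<lambda>x. actf (mark ?I ?v s) s x v)"
        using mark[of s] act[of s] r by (simp add: fun_eq_iff)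
    qed
    have "finite (event_times ?I ?v \<inter> {..<r})"
      using counting_family.finite_events(2)[OF pr.counting_family[of "(v, w)"]] w by simp
    then have "set (sorted_list_of_set (event_times ?I ?v \<inter> {..<r})) \<subseteq> event_times ?I ?v \<inter> {..<r}"
      by simp
    from fold[OF this] show ?thesis
      by (simp add: pr.Y_def pr.good_left_def good chain_on_def ev)
  qed
  have rate: "pr.rate c r (u, w) = pr.rate c r (v, w)" if "r \<le> t" for c r
  proof -
    have "qf c r x u = qf c r x v" for x using L[OF that] by (auto simp: qf_def split: noise.splits)
    then show ?thesis using Y[OF that] by (simp add: pr.rate_def)
  qed
  have "(LBINT r:{0<..<t}. 1 - pr.rate c r (u, w)) = (LBINT r:{0<..<t}. 1 - pr.rate c r (v, w))" for c
    by (rule set_lebesgue_integral_cong) (auto simp: rate)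
  moreover have "(\<Prod>l\<in>{1..lft (\<lambda>t. N c t w) t}. pr.rate c (nth_jump (\<lambda>t. N c t w) l) (u, w)) =
    (\<Prod>l\<in>{1..lft (\<lambda>t. N c t w) t}. pr.rate c (nth_jump (\<lambda>t. N c t w) l) (v, w))"
    if c: "c \<in> NXs" and t: "0 < t" for c
  proof (rule prod.cong[OF refl])
    fix l assume "l \<in> {1..lft (\<lambda>t. N c t w) t}"
    moreover have "lft (\<lambda>t. N c t w) t \<le> N c t w" using lft_counting_path_le[OF cp[OF c w] t] .
    ultimately have "nth_jump (\<lambda>t. N c t w) l \<le> t" using t by (intro nth_jump_le[OF cp[OF c w]]) auto
    then show "pr.rate c (nth_jump (\<lambda>t. N c t w) l) (u, w) = pr.rate c (nth_jump (\<lambda>t. N c t w) l) (v, w)"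
      by (rule rate)
  qed
  ultimately show "pr.Dm t (u, w) = pr.Dm t (v, w)"
    using w t pr_Dm_0[of "(u, w)"] pr_Dm_0[of "(v, w)"]
    by (cases "t = 0") (auto simp: pr.Dm_def Nf_NXs intro!: prod.cong)
qed

end

section \<open>One admissible shock vector: martingale property and Kolmogorov equation\<close>

locale frozen_env = frozen_model P S n T A Q J X0 N mu alpha
  for P :: "'w measure" and S n T and A :: "'a::euclidean_space set" and Q J X0 N mu alpha +
  fixes u :: "nat \<Rightarrow> real" and m :: nat
  assumes u: "shock_seq n T u m"
begin

lemma trunc_left_TS: "0 \<le> s \<Longrightarrow> s \<le> T \<Longrightarrow> (s, trunc_left n u s) \<in> TS n T"
  by (rule trunc_left_shock_seq[OF u])

lemma mu_simplex: "0 \<le> s \<Longrightarrow> s \<le> T \<Longrightarrow> mu s (trunc_left n u s) \<in> prob_simplex S"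
  using mu_range trunc_left_TS by fastforce

lemma alpha_A: "0 \<le> s \<Longrightarrow> s \<le> T \<Longrightarrow> i \<in> {1..S} \<Longrightarrow> alpha s (trunc_left n u s) i \<in> A"
  using alpha_range trunc_left_TS by fastforce

lemma shock_distinct: "k \<in> {1..n} \<Longrightarrow> l \<in> {1..n} \<Longrightarrow> 0 < u k \<Longrightarrow> u k = u l \<Longrightarrow> k = l"
  using u unfolding shock_seq_def
  by (metis atLeastAtMost_iff greaterThanAtMost_iff less_irrefl linorder_neqE_nat neg_less_0_iff_less
      not_le_imp_less not_less_iff_gr_or_eq zero_less_one)

lemma unit_frozen:
  assumes w: "w \<in> space P" and un: "unit_jumps (total_count NXs (\<lambda>c t. N c t w)) T"
    and nj: "\<And>c k. c \<in> NXs \<Longrightarrow> k \<in> {1..n} \<Longrightarrow> 0 < u k \<Longrightarrow> lft (\<lambda>t. N c t w) (u k) = N c (u k) w"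
  shows "unit_jumps (total_count (noise_idx S n) (\<lambda>c t. Nf c t u w)) T"
  unfolding unit_jumps_def
proof (intro allI impI)
  fix s assume s: "0 < s \<and> s \<le> T"
  then have s0: "0 < s" by simp
  interpret all: counting_family "noise_idx S n" "\<lambda>c t. Nf c t u w"
    by standard (auto simp: finite_noise counting_path_Nf[OF _ w])
  interpret nx: counting_family NXs "\<lambda>c t. N c t w"
    by standard (auto simp: finite_noise cp[OF _ w])
  have split: "(\<Sum>c\<in>noise_idx S n. f c) = (\<Sum>c\<in>NXs. f c) + (\<Sum>k\<in>{1..n}. f (NZ k))" for f :: "noise \<Rightarrow> nat"
    unfolding noise_idx_eq using finite_noise
    by (subst sum.union_disjoint) (auto simp: NXs_iff sum.reindex inj_on_def)
  let ?n = "total_count NXs (\<lambda>c t. N c t w)"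
  have K: "total_count (noise_idx S n) (\<lambda>c t. Nf c t u w) s =
    ?n s + (\<Sum>k\<in>{1..n}. if 0 < u k \<and> u k \<le> s then 1 else 0)"
    unfolding total_count_def split by (simp add: Nf_NXs) (simp add: Nf_def)
  have LK: "lft (total_count (noise_idx S n) (\<lambda>c t. Nf c t u w)) s =
    lft ?n s + (\<Sum>k\<in>{1..n}. if 0 < u k \<and> u k < s then 1 else 0)"
    unfolding all.lft_total[OF s0] nx.lft_total[OF s0] split by (simp add: Nf_NXs lft_Nf_NZ[OF s0])
  show "total_count (noise_idx S n) (\<lambda>c t. Nf c t u w) s \<le> Suc (lft (total_count (noise_idx S n) (\<lambda>c t. Nf c t u w)) s)"
  proof (cases "\<exists>k\<in>{1..n}. u k = s")
    case False
    then have "(\<Sum>k\<in>{1..n}. if 0 < u k \<and> u k \<le> s then 1 else 0) = (\<Sum>k\<in>{1..n}. if 0 < u k \<and> u k < s then 1 else (0::nat))"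
      by (intro sum.cong) (auto simp: order_le_less)
    then show ?thesis unfolding K LK using un s by (simp add: unit_jumps_def)
  next
    case True
    then obtain k where k: "k \<in> {1..n}" "u k = s" by auto
    have "?n s = lft ?n s" unfolding nx.lft_total[OF s0] using nj[OF _ k(1)] k s0 by (simp add: total_count_def)
    moreover have "(\<Sum>l\<in>{1..n}. if 0 < u l \<and> u l \<le> s then 1 else 0) \<le>
      (\<Sum>l\<in>{1..n}. (if 0 < u l \<and> u l < s then 1 else 0) + (if l = k then 1 else (0::nat)))"
    proof (rule sum_mono)
      fix l assume l: "l \<in> {1..n}"
      show "(if 0 < u l \<and> u l \<le> s then 1 else 0) \<le> (if 0 < u l \<and> u l < s then 1 else 0) + (if l = k then 1 else (0::nat))"
        using shock_distinct[OF k(1) l] k(2) s0 by (cases "u l" s rule: linorder_cases) auto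
    qed
    moreover have "(\<Sum>l\<in>{1..n}. (if 0 < u l \<and> u l < s then 1 else 0) + (if l = k then 1 else (0::nat))) =
      Suc (\<Sum>l\<in>{1..n}. if 0 < u l \<and> u l < s then 1 else 0)"
      using k(1) by (simp add: sum.distrib)
    ultimately show ?thesis unfolding K LK by linarith
  qed
qed

lemma AE_no_NX_jump: "AE w in P. \<forall>c\<in>NXs. 0 < t \<longrightarrow> lft (\<lambda>r. N c r w) t = N c t w"
  using AE_no_jump_at[of _ t] finite_noise by (cases "0 < t") (auto simp: AE_finite_all)

lemma AE_unit: "AE w in P. unit_jumps (total_count (noise_idx S n) (\<lambda>c t. Nf c t u w)) T"
proof -
  have "AE w in P. \<forall>k\<in>{1..n}. \<forall>c\<in>NXs. 0 < u k \<longrightarrow> lft (\<lambda>r. N c r w) (u k) = N c (u k) w"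
    using AE_no_NX_jump by (simp add: AE_finite_all)
  moreover have "AE w in P. unit_jumps (total_count NXs (\<lambda>c t. N c t w)) T"
    using AE_unit_jumps T_pos by simp
  ultimately show ?thesis using AE_space
    by eventually_elim (rule unit_frozen, auto)
qed

sublocale fe: fixed_env P NXs N X0 "noise_idx S n" "\<lambda>c t w. Nf c t u w"
  "\<lambda>c s x w. actf c s x u" "\<lambda>c s x w. qf c s x u" QB T
proof unfold_locales
  show "finite (noise_idx S n)" "NXs \<subseteq> noise_idx S n" by (auto simp: finite_noise noise_idx_eq)
  show "counting_path (\<lambda>t. Nf c t u w)" if "c \<in> noise_idx S n" "w \<in> space P" for c w
    by (rule counting_path_Nf[OF that])
  show "(\<lambda>w. Nf c t u w) \<in> measurable (G t) (count_space UNIV)" if c: "c \<in> noise_idx S n" and t: "0 \<le> t" for c t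
  proof (cases c)
    case (NX i k j)
    then have "c \<in> NXs" using c by (auto simp: noise_idx_eq)
    then show ?thesis using N_adapted[OF \<open>c \<in> NXs\<close> t] Nf_NXs by simp
  qed (simp add: Nf_def)
  show "(\<lambda>(s, w). actf c s i u) \<in> measurable (borel \<Otimes>\<^sub>M G 0) (count_space UNIV)" for c i
    unfolding case_prod_beta' by (rule actf_measurable) measurable
  show "(\<lambda>(s, w). qf c s i u) \<in> borel_measurable (borel \<Otimes>\<^sub>M G 0)" for c i
    unfolding case_prod_beta' by (rule qf_measurable) measurable
  show "X0 \<in> measurable (G 0) (count_space UNIV)" by (rule X0_adapted)
  show "(\<lambda>t w. Nf c t u w) = N c" if "c \<in> NXs" for c using Nf_NXs[OF that] by (auto simp: fun_eq_iff)
  show "0 \<le> qf c s x u \<and> qf c s x u \<le> QB" for c s x using qf_bd by auto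
  show "1 \<le> QB" by (rule QB)
  show "0 < T" by (rule T_pos)
  show "AE w in P. unit_jumps (total_count (noise_idx S n) (\<lambda>c t. Nf c t u w)) T" by (rule AE_unit)
qed

lemma fe_eq: "fe.ch.Y t w = pr.Y t (u, w)" "fe.ch.rate c t w = pr.rate c t (u, w)" "fe.ch.Dm t w = pr.Dm t (u, w)"
proof -
  show Y: "fe.ch.Y t w = pr.Y t (u, w)" for t
    by (simp add: fe.ch.Y_def pr.Y_def fe.ch.good_left_def pr.good_left_def)
  show R: "fe.ch.rate c t w = pr.rate c t (u, w)" for c t
    by (simp add: fe.ch.rate_def pr.rate_def Y)
  show "fe.ch.Dm t w = pr.Dm t (u, w)"
    by (simp add: fe.ch.Dm_def pr.Dm_def R)
qed

lemma actf_range: "c \<in> noise_idx S n \<Longrightarrow> 0 \<le> s \<Longrightarrow> s \<le> T \<Longrightarrow> x \<in> {1..S} \<Longrightarrow> actf c s x u \<in> {1..S}"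
  using J_range mu_simplex by (cases c) (auto simp: actf_def noise_idx_eq NXs_iff)

abbreviation "fpaths w \<equiv> (\<lambda>c t. Nf c t u w)"

lemma fold_invariant: "(\<And>s x. s \<in> set xs \<Longrightarrow> x \<in> R \<Longrightarrow> f s x \<in> R) \<Longrightarrow> x \<in> R \<Longrightarrow> fold f xs x \<in> R"
  by (induction xs arbitrary: x) auto

lemma event_mark:
  assumes w: "w \<in> space P" and un: "unit_jumps (total_count (noise_idx S n) (fpaths w)) T"
    and r: "r \<in> event_times (noise_idx S n) (fpaths w)" "r \<le> T"
  shows "mark (noise_idx S n) (fpaths w) r \<in> noise_idx S n"
    "Nf (mark (noise_idx S n) (fpaths w) r) r u w \<noteq> lft (\<lambda>t. Nf (mark (noise_idx S n) (fpaths w) r) t u w) r"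
proof -
  interpret counting_family "noise_idx S n" "fpaths w" by (rule fe.ch.counting_family[OF w])
  obtain c where c: "c \<in> noise_idx S n" "Nf c r u w \<noteq> lft (\<lambda>t. Nf c t u w) r" and r0: "0 < r"
    using r by (auto simp: event_times_def)
  have "mark (noise_idx S n) (fpaths w) r = c"
    using un r r0 by (intro unit_event(3)[OF r0 _ c]) (auto simp: unit_jumps_def)
  then show "mark (noise_idx S n) (fpaths w) r \<in> noise_idx S n"
    "Nf (mark (noise_idx S n) (fpaths w) r) r u w \<noteq> lft (\<lambda>t. Nf (mark (noise_idx S n) (fpaths w) r) t u w) r"
    using c by auto
qed

lemma chain_range:
  assumes w: "w \<in> space P" and un: "unit_jumps (total_count (noise_idx S n) (fpaths w)) T"
    and E: "E \<subseteq> {..T}" "finite (event_times (noise_idx S n) (fpaths w) \<inter> E)"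
  shows "chain_on (noise_idx S n) (fpaths w) (\<lambda>c s x. actf c s x u) (X0 w) E \<in> {1..S}"
  unfolding chain_on_def
proof (rule fold_invariant)
  show "X0 w \<in> {1..S}" using X0_range w by blast
  fix s x assume "s \<in> set (sorted_list_of_set (event_times (noise_idx S n) (fpaths w) \<inter> E))" and x: "x \<in> {1..S}"
  then have s: "s \<in> event_times (noise_idx S n) (fpaths w)" "s \<le> T" using E by auto
  then show "actf (mark (noise_idx S n) (fpaths w) s) s x u \<in> {1..S}"
    using event_mark(1)[OF w un s] x by (intro actf_range) (auto simp: event_times_def)
qed

lemma Y_range_path:
  assumes w: "w \<in> space P" and un: "unit_jumps (total_count (noise_idx S n) (fpaths w)) T" and t: "t \<le> T"
  shows "pr.Y t (u, w) \<in> {1..S}"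
proof -
  interpret counting_family "noise_idx S n" "fpaths w" by (rule fe.ch.counting_family[OF w])
  show ?thesis unfolding fe_eq(1)[symmetric] fe.Y_eq_XL[OF un t]
    by (rule chain_range[OF w un]) (use t finite_events in auto)
qed

lemma Y_range: "t \<le> T \<Longrightarrow> AE w in P. pr.Y t (u, w) \<in> {1..S}"
  using AE_space AE_unit by eventually_elim (rule Y_range_path)

lemma shock_event:
  assumes w: "w \<in> space P" and un: "unit_jumps (total_count (noise_idx S n) (fpaths w)) T"
    and r: "r \<in> event_times (noise_idx S n) (fpaths w)" "r \<le> T"
    and mk: "mark (noise_idx S n) (fpaths w) r \<notin> NXs"
  shows "\<exists>k\<in>{1..n}. u k = r"
proof -
  note em = event_mark[OF w un r]
  then obtain k where k: "k \<in> {1..n}" "mark (noise_idx S n) (fpaths w) r = NZ k"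
    using mk by (auto simp: noise_idx_eq)
  have "0 < r" using r by (auto simp: event_times_def)
  then have "u k = r" using em(2) unfolding k(2) lft_Nf_NZ[OF \<open>0 < r\<close>] by (auto simp: Nf_def split: if_splits)
  then show ?thesis using k by blast
qed

text \<open>The Poisson noises do not jump at \<open>t\<close>, so the only possible event there is
  a shock.\<close>

lemma chain_XS:
  assumes w: "w \<in> space P" and un: "unit_jumps (total_count (noise_idx S n) (fpaths w)) T"
    and t: "0 \<le> t" "t \<le> T" and nj: "\<forall>c\<in>NXs. 0 < t \<longrightarrow> lft (\<lambda>r. N c r w) t = N c t w"
  shows "fe.ch.X t w = XS t u (fe.ch.XL t w)"
proof -
  interpret counting_family "noise_idx S n" "fpaths w" by (rule fe.ch.counting_family[OF w])
  show ?thesis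
  proof (cases "0 < t \<and> (\<exists>k\<in>{1..n}. u k = t)")
    case True
    then obtain k where k: "k \<in> {1..n}" "u k = t" "0 < t" by auto
    have c: "NZ k \<in> noise_idx S n" using k by (auto simp: noise_idx_eq)
    have j: "Nf (NZ k) t u w \<noteq> lft (\<lambda>t. Nf (NZ k) t u w) t"
      unfolding lft_Nf_NZ[OF k(3)] using k by (simp add: Nf_def)
    have "mark (noise_idx S n) (fpaths w) t = NZ k"
      using un t by (intro unit_event(3)[OF k(3) _ c j]) (auto simp: unit_jumps_def k(3))
    moreover have "t \<in> event_times (noise_idx S n) (fpaths w)" using c j k by (auto simp: event_times_def)
    ultimately show ?thesis using chain_event[of t] True by (simp add: actf_def XS_def)
  next
    case False
    have "t \<notin> event_times (noise_idx S n) (fpaths w)"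
    proof
      assume ev: "t \<in> event_times (noise_idx S n) (fpaths w)"
      then have t0: "0 < t" by (auto simp: event_times_def)
      have "mark (noise_idx S n) (fpaths w) t \<in> NXs" using shock_event[OF w un ev t(2)] False t0 by blast
      then show False using event_mark(2)[OF w un ev t(2)] nj t0 by (simp add: Nf_NXs)
    qed
    moreover have "XS t u i = i" for i using False by (auto simp: XS_def)
    ultimately show ?thesis using chain_no_event by simp
  qed
qed

lemma AE_chain_XS:
  assumes t: "0 \<le> t" "t \<le> T" shows "AE w in P. fe.ch.X t w = XS t u (fe.ch.Y t w)"
  using AE_space AE_unit AE_no_NX_jump[of t]
proof eventually_elim
  case (elim w)
  then show ?case using chain_XS[OF _ _ t] fe.Y_eq_XL[of w t] t by simp
qed

text \<open>The sum over states that defines \<open>p\<close> collapses because the left limit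
  almost surely is one of the states 1 to \<open>S\<close>.\<close>

lemma p_eq:
  assumes t: "0 \<le> t" "t \<le> T"
  shows "p t u j = (\<integral>w. pr.Dm t (u, w) * (if XS t u (pr.Y t (u, w)) = j then 1 else 0) \<partial>P)"
proof -
  note [measurable] = fe.Y_meas_at[OF t(1), unfolded fe_eq] fe.Dm_meas_at[OF t(1), unfolded fe_eq]
  have int: "integrable P (\<lambda>w. pr.Dm t (u, w) * g (pr.Y t (u, w)))" if "\<And>i. \<bar>g i\<bar> \<le> (1::real)" for g
  proof -
    have "(\<lambda>w. g (pr.Y t (u, w))) \<in> borel_measurable P"
      by (rule measurable_compose[of _ _ "count_space UNIV"]) measurable
    then show ?thesis using fe.integrable_Dm_times[OF t(1), unfolded fe_eq, of "\<lambda>w. g (pr.Y t (u, w))" 1] that by auto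
  qed
  have "(\<integral>w. pr.Dm t (u, w) * (if XS t u (pr.Y t (u, w)) = j then 1 else 0) \<partial>P) =
    (\<integral>w. (\<Sum>i=1..S. pr.Dm t (u, w) * ((if pr.Y t (u, w) = i then 1 else 0) * (if XS t u i = j then 1 else 0))) \<partial>P)"
  proof (rule integral_cong_AE)
    show "AE w in P. pr.Dm t (u, w) * (if XS t u (pr.Y t (u, w)) = j then 1 else 0) =
      (\<Sum>i=1..S. pr.Dm t (u, w) * ((if pr.Y t (u, w) = i then 1 else 0) * (if XS t u i = j then 1 else 0)))"
      using Y_range[OF t(2)]
    proof eventually_elim
      case (elim w)
      have "(\<Sum>i=1..S. pr.Dm t (u, w) * ((if pr.Y t (u, w) = i then 1 else 0) * (if XS t u i = j then 1 else 0))) =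
        (\<Sum>i=1..S. if i = pr.Y t (u, w) then pr.Dm t (u, w) * (if XS t u i = j then 1 else 0) else 0)"
        by (intro sum.cong) auto
      also have "\<dots> = pr.Dm t (u, w) * (if XS t u (pr.Y t (u, w)) = j then 1 else 0)"
        using elim by simp
      finally show ?case ..
    qed
  qed (auto intro!: borel_measurable_integrable int)
  also have "\<dots> = (\<Sum>i=1..S. \<integral>w. pr.Dm t (u, w) * ((if pr.Y t (u, w) = i then 1 else 0) * (if XS t u i = j then 1 else 0)) \<partial>P)"
    by (rule Bochner_Integration.integral_sum) (rule int, simp)
  also have "\<dots> = p t u j" unfolding p_def pm_def by (intro sum.cong refl) auto
  finally show ?thesis ..
qed

text \<open>The martingale property of the weight: for constant \<open>\<phi>\<close> the generator
  term vanishes, and \<open>h\<close> is the indicator of an event known at \<open>t\<close>. The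
  weight at the terminal time may therefore replace the weight at \<open>t\<close>.\<close>

lemma p_eq_T:
  assumes t: "0 \<le> t" "t \<le> T"
  shows "(\<integral>w. pr.Dm T (u, w) * (if XS t u (pr.Y t (u, w)) = j then 1 else 0) \<partial>P) = p t u j"
proof -
  define h where "h w = (if XS t u (fe.ch.Y t w) = j then 1 else (0::real))" for w
  have h: "h \<in> borel_measurable (G t)" unfolding h_def
    by (rule measurable_compose[OF fe.Y_meas_G[OF t(1)]]) simp
  have "(\<integral>w. h w * fe.ch.Dm T w * 1 \<partial>P) = (\<integral>w. h w * fe.ch.Dm t w * 1 \<partial>P) +
    (LBINT r:{t<..T}. \<integral>w. h w * fe.ch.Dm r w * (\<Sum>c\<in>NXs. fe.ch.rate c r w * (1 - 1)) \<partial>P)"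
    by (rule fe.expected_evolution(1)[OF t order_refl h _ _ AE_chain_XS[OF t] AE_chain_XS[OF _ order_refl]])
      (use T_pos in \<open>auto simp: h_def\<close>)
  then show ?thesis using p_eq[OF t, of j] by (simp add: h_def fe_eq mult.commute)
qed

text \<open>The same argument with trivial \<open>h\<close>, started at time 0, where the weight is
  one.\<close>

lemma total_mass: "(\<integral>w. pr.Dm T (u, w) \<partial>P) = 1"
proof -
  have "(\<integral>w. 1 * fe.ch.Dm T w * 1 \<partial>P) = (\<integral>w. 1 * fe.ch.Dm 0 w * 1 \<partial>P) +
    (LBINT r:{0<..T}. \<integral>w. 1 * fe.ch.Dm r w * (\<Sum>c\<in>NXs. fe.ch.rate c r w * (1 - 1)) \<partial>P)"
    by (rule fe.expected_evolution(1)[OF order_refl _ order_refl _ _ _ AE_chain_XS[OF order_refl] AE_chain_XS[OF _ order_refl]])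
      (use T_pos in auto)
  also have "(\<integral>w. 1 * fe.ch.Dm 0 w * 1 \<partial>P) = (\<integral>w. 1 \<partial>P)"
    by (rule Bochner_Integration.integral_cong) (auto simp: fe.Dm_at_0)
  finally show ?thesis by (simp add: fe_eq prob_space)
qed

text \<open>Only channels that leave the current state \<open>i\<close> in the current regime
  contribute. For \<open>j\<close> different from \<open>i\<close> they give the entry itself; for
  \<open>j = i\<close> every such channel contributes minus its rate, and the zero row sum turns the
  total into the diagonal entry. Along an admissible \<open>u\<close> the clamping in
  \<open>qf\<close> has no effect.\<close>

lemma generator:
  assumes r: "0 \<le> r" "r \<le> T" and i: "i \<in> {1..S}" and j: "j \<in> {1..S}"
  shows "(\<Sum>c\<in>NXs. qf c r i u * ((if actf c r i u = j then 1 else 0) - (if i = j then 1 else 0))) =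
    Q r (Zof n (trunc_left n u r)) (mu r (trunc_left n u r)) (alpha r (trunc_left n u r) i) i j"
proof -
  let ?k = "Zof n (trunc_left n u r)"
  let ?Q = "\<lambda>i' j'. Q r ?k (mu r (trunc_left n u r)) (alpha r (trunc_left n u r) i) i' j'"
  have kn: "?k \<le> n" unfolding Zof_def using card_mono[of "{1..n}"] by (metis (no_types, lifting) card_atLeastAtMost diff_Suc_1 finite_atLeastAtMost mem_Collect_eq subsetI)
  note m = mu_simplex[OF r] and a = alpha_A[OF r i]
  have nonneg: "0 \<le> ?Q i' j'" if "i' \<in> {1..S}" "j' \<in> {1..S}" "i' \<noteq> j'" for i' j'
    using Q_intens r kn m a that by auto
  have le: "?Q i' j' \<le> QB" if "i' \<in> {1..S}" "j' \<in> {1..S}" for i' j'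
    using QB(2)[OF kn that _ m a] r by simp
  have row: "(\<Sum>j'=1..S. ?Q i j') = 0" using Q_intens r kn m a i by auto
  let ?d = "\<lambda>j'. (if j' = j then 1 else 0) - (if i = j then 1 else (0::real))"
  have "(\<Sum>c\<in>NXs. qf c r i u * ((if actf c r i u = j then 1 else 0) - (if i = j then 1 else 0))) =
    (\<Sum>(i', k, j')\<in>states. if i' = i \<and> k = ?k then ?Q i j' * ?d j' else 0)"
  proof -
    have "(\<Sum>c\<in>NXs. qf c r i u * ((if actf c r i u = j then 1 else 0) - (if i = j then 1 else 0))) =
      (\<Sum>x\<in>states. (\<lambda>c. qf c r i u * ((if actf c r i u = j then 1 else 0) - (if i = j then 1 else 0)))
         ((\<lambda>(i, k, j). NX i k j) x))"
      unfolding NXs_def by (subst sum.reindex) (auto simp: inj_on_def)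
    also have "\<dots> = (\<Sum>(i', k, j')\<in>states. if i' = i \<and> k = ?k then ?Q i j' * ?d j' else 0)"
    proof (rule sum.cong[OF refl])
      fix x assume "x \<in> states"
      then obtain i' k j' where x: "x = (i', k, j')" "i' \<in> {1..S}" "j' \<in> {1..S}" "i' \<noteq> j'" by (auto simp: states_def)
      have "max 0 (min QB (?Q i' j')) = ?Q i' j'" using nonneg[OF x(2-4)] le[OF x(2,3)] by simp
      then show "(\<lambda>c. qf c r i u * ((if actf c r i u = j then 1 else 0) - (if i = j then 1 else 0))) ((\<lambda>(i, k, j). NX i k j) x) =
        (case x of (i', k, j') \<Rightarrow> if i' = i \<and> k = ?k then ?Q i j' * ?d j' else 0)"
        unfolding x(1) by (cases "i' = i"; cases "k = ?k") (auto simp: qf_def actf_def)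
    qed
    finally show ?thesis .
  qed
  also have "\<dots> = (\<Sum>(i', k, j')\<in>(\<lambda>j'. (i, ?k, j')) ` ({1..S} - {i}). ?Q i j' * ?d j')"
    using finite_states i kn by (intro sum.mono_neutral_cong_right) (auto simp: states_def)
  also have "\<dots> = (\<Sum>j'\<in>{1..S} - {i}. ?Q i j' * ?d j')"
    by (subst sum.reindex) (auto simp: inj_on_def)
  also have "\<dots> = ?Q i j"
  proof (cases "i = j")
    case True
    have "(\<Sum>j'\<in>{1..S} - {i}. ?Q i j' * ?d j') = - (\<Sum>j'\<in>{1..S} - {i}. ?Q i j')"
      unfolding sum_negf[symmetric] using True by (intro sum.cong) auto
    also have "\<dots> = ?Q i i" using row sum.remove[of "{1..S}" i "?Q i"] i by simp
    finally show ?thesis using True by simp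
  next
    case False
    have "(\<Sum>j'\<in>{1..S} - {i}. ?Q i j' * ?d j') = (\<Sum>j'\<in>{1..S} - {i}. if j' = j then ?Q i j' else 0)"
      using False by (intro sum.cong) auto
    then show ?thesis using False j by simp
  qed
  finally show ?thesis .
qed

text \<open>The expected evolution with \<open>\<phi>\<close> the indicator of \<open>j\<close> and
  \<open>h\<close> equal to one. Without a shock in (s,t] every event there comes from a reweighted
  channel, and \<open>p\<close> coincides with \<open>pm\<close>.\<close>

lemma p_evolution:
  assumes s: "0 \<le> s" "s \<le> t" "t \<le> T" and no: "\<And>k. k \<in> {1..n} \<Longrightarrow> \<not> (s < u k \<and> u k \<le> t)" and j: "j \<in> {1..S}"
  defines "g \<equiv> (\<lambda>r. \<Sum>i=1..S. p r u i * Q r (Zof n (trunc_left n u r)) (mu r (trunc_left n u r)) (alpha r (trunc_left n u r) i) i j)"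
  shows "p t u j - p s u j = (LBINT r:{s<..t}. g r)" "set_integrable lborel {s<..t} g"
proof -
  define \<phi> where "\<phi> i = (if i = j then 1 else (0::real))" for i :: nat
  define G' where "G' r = (\<integral>w. 1 * fe.ch.Dm r w * (\<Sum>c\<in>NXs. fe.ch.rate c r w * (\<phi> (actf c r (fe.ch.Y r w) u) - \<phi> (fe.ch.Y r w))) \<partial>P)" for r
  have inv: "AE w in P. \<forall>r\<in>event_times (noise_idx S n) (fpaths w). s < r \<and> r \<le> t \<and> mark (noise_idx S n) (fpaths w) r \<notin> NXs
        \<longrightarrow> \<phi> (fe.ch.X r w) = \<phi> (fe.ch.XL r w)"
    using AE_space AE_unit
  proof eventually_elim
    case (elim w)
    show ?case
    proof (intro ballI impI)
      fix r assume r: "r \<in> event_times (noise_idx S n) (fpaths w)"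
        "s < r \<and> r \<le> t \<and> mark (noise_idx S n) (fpaths w) r \<notin> NXs"
      then have "\<exists>k\<in>{1..n}. u k = r" using s by (intro shock_event[OF elim]) auto
      then show "\<phi> (fe.ch.X r w) = \<phi> (fe.ch.XL r w)" using no r by auto
    qed
  qed
  have ev: "(\<integral>w. 1 * fe.ch.Dm t w * \<phi> (XS t u (fe.ch.Y t w)) \<partial>P) =
      (\<integral>w. 1 * fe.ch.Dm s w * \<phi> (XS s u (fe.ch.Y s w)) \<partial>P) + (LBINT r:{s<..t}. G' r)"
    "set_integrable lborel {s<..t} G'"
    unfolding G'_def
    using fe.expected_evolution[OF s, of "\<lambda>_. 1" \<phi> "XS s u" "XS t u", OF _ _ _ AE_chain_XS AE_chain_XS inv] s
    by (auto simp: \<phi>_def)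
  have Gg: "G' r = g r" if r: "r \<in> {s<..t}" for r
  proof -
    have rT: "0 \<le> r" "r \<le> T" using r s by auto
    note [measurable] = fe.Y_meas_at[OF rT(1)] fe.Dm_meas_at[OF rT(1)]
    have "XS r u i = i" for i using no r by (auto simp: XS_def)
    then have pr: "p r u i = pm r u i" if "i \<in> {1..S}" for i
      using that by (simp add: p_def if_distrib sum.delta cong: if_cong)
    let ?q = "\<lambda>i. Q r (Zof n (trunc_left n u r)) (mu r (trunc_left n u r)) (alpha r (trunc_left n u r) i) i j"
    have int: "integrable P (\<lambda>w. fe.ch.Dm r w * ((if fe.ch.Y r w = i then 1 else 0) * ?q i))" for i
      by (rule fe.integrable_Dm_times[OF rT(1), where M="\<bar>?q i\<bar>"]) auto
    have "G' r = (\<integral>w. (\<Sum>i=1..S. fe.ch.Dm r w * ((if fe.ch.Y r w = i then 1 else 0) * ?q i)) \<partial>P)"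
      unfolding G'_def
    proof (rule integral_cong_AE)
      have "(\<lambda>w. fe.ch.rate c r w) \<in> borel_measurable P" if "c \<in> NXs" for c
        unfolding fe.ch.rate_def by (rule measurable_compose[OF fe.Y_meas_at[OF rT(1)]]) simp
      moreover have "(\<lambda>w. \<phi> (actf c r (fe.ch.Y r w) u)) \<in> borel_measurable P" "(\<lambda>w. \<phi> (fe.ch.Y r w)) \<in> borel_measurable P" for c
        by (rule measurable_compose[OF fe.Y_meas_at[OF rT(1)]], simp)+
      ultimately show "(\<lambda>w. 1 * fe.ch.Dm r w * (\<Sum>c\<in>NXs. fe.ch.rate c r w * (\<phi> (actf c r (fe.ch.Y r w) u) - \<phi> (fe.ch.Y r w)))) \<in> borel_measurable P"
        by measurable
      show "AE w in P. 1 * fe.ch.Dm r w * (\<Sum>c\<in>NXs. fe.ch.rate c r w * (\<phi> (actf c r (fe.ch.Y r w) u) - \<phi> (fe.ch.Y r w))) =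
        (\<Sum>i=1..S. fe.ch.Dm r w * ((if fe.ch.Y r w = i then 1 else 0) * ?q i))"
        using Y_range[OF rT(2)]
      proof eventually_elim
        case (elim w)
        then have y: "fe.ch.Y r w \<in> {1..S}" by (simp add: fe_eq)
        have "(\<Sum>i=1..S. fe.ch.Dm r w * ((if fe.ch.Y r w = i then 1 else 0) * ?q i)) =
          (\<Sum>i=1..S. if i = fe.ch.Y r w then fe.ch.Dm r w * ?q i else 0)" by (intro sum.cong) auto
        also have "\<dots> = fe.ch.Dm r w * ?q (fe.ch.Y r w)" using y by simp
        also have "?q (fe.ch.Y r w) = (\<Sum>c\<in>NXs. fe.ch.rate c r w * (\<phi> (actf c r (fe.ch.Y r w) u) - \<phi> (fe.ch.Y r w)))"
          unfolding fe.ch.rate_def \<phi>_def by (rule generator[OF rT y j, symmetric])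
        finally show ?case by simp
      qed
    qed measurable
    also have "\<dots> = (\<Sum>i=1..S. \<integral>w. fe.ch.Dm r w * ((if fe.ch.Y r w = i then 1 else 0) * ?q i) \<partial>P)"
      by (rule Bochner_Integration.integral_sum) (rule int)
    also have "\<dots> = (\<Sum>i=1..S. pm r u i * ?q i)"
      unfolding pm_def fe_eq by (intro sum.cong refl) (simp flip: mult.assoc)
    also have "\<dots> = g r" unfolding g_def using pr by simp
    finally show ?thesis .
  qed
  have "p t u j - p s u j = (LBINT r:{s<..t}. G' r)"
    using ev(1) p_eq[of t j] p_eq[of s j] s by (simp add: \<phi>_def fe_eq)
  also have "\<dots> = (LBINT r:{s<..t}. g r)"
    by (rule set_lebesgue_integral_cong) (auto simp: Gg)
  finally show "p t u j - p s u j = (LBINT r:{s<..t}. g r)" .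
  show "set_integrable lborel {s<..t} g"
    using ev(2) by (rule set_integrable_cong[THEN iffD1, rotated -1]) (auto simp: Gg)
qed

lemma p_nonneg: "0 \<le> t \<Longrightarrow> t \<le> T \<Longrightarrow> 0 \<le> p t u j"
  unfolding p_def pm_def using fe.Dm_nonneg[unfolded fe_eq]
  by (intro sum_nonneg mult_nonneg_nonneg integral_nonneg_AE) auto

lemma integrable_Dm_T:
  assumes "g \<in> borel_measurable P" "\<And>w. \<bar>g w\<bar> \<le> (M::real)"
  shows "integrable P (\<lambda>w. pr.Dm T (u, w) * g w)"
  using fe.integrable_Dm_times[OF _ assms, unfolded fe_eq] T_pos by simp

end

section \<open>Paths of the shock counter, the shock times and the state process\<close>

lemma pint_step:
  assumes f: "counting_path f" and a: "0 \<le> a" "a < s" and const: "\<And>v. a \<le> v \<Longrightarrow> v < s \<Longrightarrow> f v = f a"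
  shows "pint g f s = pint g f a + (if f s \<noteq> lft f s then g s * (real (f s) - real (lft f s)) else 0)"
proof -
  let ?J = "\<lambda>t. {s. 0 < s \<and> s \<le> t \<and> f s \<noteq> lft f s}"
  have "r \<notin> ?J s" if "a < r" "r < s" for r
    using counting_path_no_jump[OF f a(1), of r r] const[of r] that by auto
  then have "?J s = ?J a \<union> (if f s \<noteq> lft f s then {s} else {})"
    using a by (auto simp: not_less order_le_less) (metis linorder_neqE_linordered_idom)+
  then show ?thesis unfolding pint_def using finite_jumps[OF f, of a] a by (auto simp: sum.insert_if)
qed

lemma pint_0: "pint g f 0 = 0"
proof -
  have "{s. 0 < s \<and> s \<le> (0::real) \<and> f s \<noteq> lft f s} = {}" by auto
  then show ?thesis unfolding pint_def by (simp only: sum.empty)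
qed

lemma shock_seq_Zof: "shock_seq n T u m \<Longrightarrow> Zof n u = m"
proof -
  assume u: "shock_seq n T u m"
  have "0 \<le> u k \<longleftrightarrow> k \<le> m" if "k \<in> {1..n}" for k
    using u that unfolding shock_seq_def by (cases "k \<le> m") (auto simp: less_imp_le)
  then have "{k \<in> {1..n}. 0 \<le> u k} = {1..m}" using u by (auto simp: shock_seq_def)
  then show ?thesis by (simp add: Zof_def)
qed

lemma shock_seq_nonneg_iff: "shock_seq n T u m \<Longrightarrow> k \<in> {1..n} \<Longrightarrow> 0 < u k \<longleftrightarrow> k \<le> m"
  unfolding shock_seq_def by (cases "k \<le> m") auto

lemma shock_seq_neg: "shock_seq n T u m \<Longrightarrow> k \<in> {1..n} \<Longrightarrow> \<not> 0 < u k \<Longrightarrow> u k = -1"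
  unfolding shock_seq_def by (cases "k \<le> m") auto

lemma trunc_self:
  assumes "shock_seq n T u m" "\<And>k. k \<in> {1..n} \<Longrightarrow> u k \<le> t" shows "trunc n u t = u"
  using assms by (auto simp: trunc_def shock_seq_def fun_eq_iff)

text \<open>Finitely many shocks precede \<open>t\<close>, so the truncation at \<open>r\<close> no
  longer changes once \<open>r\<close> has passed the last of them. The 0 inserted into the maximum
  covers the case without earlier shocks.\<close>

lemma lft_trunc:
  assumes "0 < t" "\<And>r. 0 < r \<Longrightarrow> r < t \<Longrightarrow> f r = trunc n u r" shows "lft f t = trunc_left n u t"
proof -
  let ?a = "Max (insert 0 {u k | k. k \<in> {1..n} \<and> u k < t})"
  have fin: "finite (insert 0 {u k | k. k \<in> {1..n} \<and> u k < t})" by simp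
  have "?a < t" using assms fin by (subst Max_less_iff) auto
  moreover have "f r = trunc_left n u t" if "?a < r" "r < t" for r
  proof -
    have "0 < r" using that Max_ge[OF fin, of 0] by simp
    moreover have "u k \<le> r \<longleftrightarrow> u k < t" if "k \<in> {1..n}" for k
      using Max_ge[OF fin, of "u k"] \<open>?a < r\<close> \<open>r < t\<close> that by fastforce
    ultimately show ?thesis using assms(2)[of r] that by (auto simp: trunc_def trunc_left_def fun_eq_iff)
  qed
  ultimately show ?thesis by (rule lft_eqI[OF assms(1)])
qed

locale shock_model = frozen_model P S n T A Q J X0 N mu alpha
  for P :: "'w measure" and S n T and A :: "'a::euclidean_space set" and Q J X0 N mu alpha +
  fixes lam :: "nat \<Rightarrow> real \<Rightarrow> (nat \<Rightarrow> real) \<Rightarrow> real"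
    and Z :: "real \<Rightarrow> 'w \<Rightarrow> nat" and X :: "real \<Rightarrow> 'w \<Rightarrow> int"
  assumes lam_pos: "\<forall>k\<in>{1..n}. \<forall>t\<in>{0..T}. \<forall>m\<in>prob_simplex S. 0 < lam k t m"
    and lam_bdd: "\<forall>k\<in>{1..n}. \<exists>C. \<forall>t\<in>{0..T}. \<forall>m\<in>prob_simplex S. lam k t m \<le> C"
    and lam_meas: "\<forall>k. (\<lambda>(t, m). lam k t m) \<in> borel_measurable borel"
    and Z_eq: "\<forall>\<omega>\<in>space P. \<forall>t\<in>{0..T}. real (Z t \<omega>) =
         (\<Sum>k=1..n. pint (\<lambda>s. if lft (\<lambda>r. Z r \<omega>) s = k - 1 then 1 else 0) (\<lambda>r. N (NZ k) r \<omega>) t)"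
    and Z_meas: "\<forall>t\<in>{0..T}. Z t \<in> measurable P (count_space UNIV)"
    and U_meas: "\<forall>t\<in>{0..T}. Uproc n N Z t \<in> borel_measurable P"
    and mu_regular: "regular_TS n T mu"
    and X_eq: "\<forall>\<omega>\<in>space P. \<forall>t\<in>{0..T}. real_of_int (X t \<omega>) = real (X0 \<omega>)
         + (\<Sum>i=1..S. \<Sum>j\<in>{1..S}-{i}. \<Sum>k=0..n.
              pint (\<lambda>s. (if lft (\<lambda>r. X r \<omega>) s = int i \<and> lft (\<lambda>r. Z r \<omega>) s = k then 1 else 0)
                         * (real j - real i)) (\<lambda>r. N (NX i k j) r \<omega>) t)
         + (\<Sum>i=1..S. \<Sum>k=1..n.
              pint (\<lambda>s. (if lft (\<lambda>r. X r \<omega>) s = int i \<and> lft (\<lambda>r. Z r \<omega>) s = k - 1 then 1 else 0)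
                         * (real (J i s (lft (\<lambda>r. mu r (Uproc n N Z r \<omega>)) s)) - real i)) (\<lambda>r. N (NZ k) r \<omega>) t)"
    and X_meas: "\<forall>t\<in>{0..T}. X t \<in> measurable P (count_space UNIV)"
begin

abbreviation "U \<equiv> Uproc n N Z"

lemma sum_states: "(\<Sum>i=1..S. \<Sum>j\<in>{1..S}-{i}. \<Sum>k=0..n. f i j k) = (\<Sum>(i, k, j)\<in>states. f i j k :: real)"
proof -
  have "(\<Sum>i=1..S. \<Sum>j\<in>{1..S}-{i}. \<Sum>k=0..n. f i j k) =
    (\<Sum>(i, j, k)\<in>(SIGMA i:{1..S}. SIGMA j:{1..S}-{i}. {0..n}). f i j k)"
    by (simp add: sum.Sigma)
  also have "\<dots> = (\<Sum>(i, k, j)\<in>states. f i j k)"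
    by (rule sum.reindex_bij_witness[of _ "\<lambda>(i, k, j). (i, j, k)" "\<lambda>(i, j, k). (i, k, j)"]) (auto simp: states_def)
  finally show ?thesis .
qed

lemma prod_states: "(\<Prod>i=1..S. \<Prod>j\<in>{1..S}-{i}. \<Prod>k=0..n. f i j k) = (\<Prod>(i, k, j)\<in>states. f i j k :: real)"
proof -
  have "(\<Prod>i=1..S. \<Prod>j\<in>{1..S}-{i}. \<Prod>k=0..n. f i j k) =
    (\<Prod>(i, j, k)\<in>(SIGMA i:{1..S}. SIGMA j:{1..S}-{i}. {0..n}). f i j k)"
    by (simp add: prod.Sigma)
  also have "\<dots> = (\<Prod>(i, k, j)\<in>states. f i j k)"
    by (rule prod.reindex_bij_witness[of _ "\<lambda>(i, k, j). (i, j, k)" "\<lambda>(i, j, k). (i, k, j)"]) (auto simp: states_def)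
  finally show ?thesis .
qed

end

section \<open>Shock counter and shock times along a path without simultaneous jumps\<close>

locale good_path = shock_model P S n T A Q J X0 N mu alpha lam Z X
  for P :: "'w measure" and S n T and A :: "'a::euclidean_space set" and Q J X0 N mu alpha lam Z X +
  fixes w :: 'w
  assumes w: "w \<in> space P" and unit: "unit_jumps (total_count (noise_idx S n) (\<lambda>c t. N c t w)) T"
begin

abbreviation "K \<equiv> total_count (noise_idx S n) (\<lambda>c t. N c t w)"

sublocale cf: counting_family "noise_idx S n" "\<lambda>c t. N c t w"
  by standard (auto simp: finite_noise all.cp[OF _ w])

lemma NZ_idx: "k \<in> {1..n} \<Longrightarrow> NZ k \<in> noise_idx S n"
  by (auto simp: noise_idx_eq)

lemma N_const:
  assumes "0 \<le> a" "a < s" "\<And>v. a \<le> v \<Longrightarrow> v < s \<Longrightarrow> K v = K a" "c \<in> noise_idx S n" "a \<le> v" "v < s"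
  shows "N c v w = N c a w"
  using cf.total_eq_component[of a v c] assms(1,4-6) assms(3)[OF assms(5,6)] by simp

abbreviation "jmp c s \<equiv> N c s w \<noteq> lft (\<lambda>t. N c t w) s"

lemma jump_size: "0 < s \<Longrightarrow> s \<le> T \<Longrightarrow> c \<in> noise_idx S n \<Longrightarrow> jmp c s \<Longrightarrow> real (N c s w) - real (lft (\<lambda>t. N c t w) s) = 1"
  using cf.unit_event(1)[of s c] unit by (simp add: unit_jumps_def)

lemma jump_unique: "0 < s \<Longrightarrow> s \<le> T \<Longrightarrow> c \<in> noise_idx S n \<Longrightarrow> d \<in> noise_idx S n \<Longrightarrow> jmp c s \<Longrightarrow> jmp d s \<Longrightarrow> c = d"
  using cf.unit_event(2)[of s c d] unit unfolding unit_jumps_def by blast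

lemma pint_local:
  assumes "0 \<le> a" "a < s" "s \<le> T" "\<And>v. a \<le> v \<Longrightarrow> v < s \<Longrightarrow> K v = K a" "c \<in> noise_idx S n"
  shows "pint g (\<lambda>r. N c r w) s = pint g (\<lambda>r. N c r w) a + (if jmp c s then g s else 0)"
proof -
  have "pint g (\<lambda>r. N c r w) s = pint g (\<lambda>r. N c r w) a +
    (if jmp c s then g s * (real (N c s w) - real (lft (\<lambda>r. N c r w) s)) else 0)"
    by (rule pint_step[OF all.cp[OF assms(5) w] assms(1,2)]) (rule N_const[OF assms(1,2,4,5)])
  then show ?thesis using jump_size[of s c] assms by simp
qed

lemma jump_not_const:
  assumes "0 \<le> a" "a < s" "s \<le> T" "\<And>v. a \<le> v \<Longrightarrow> v < s \<Longrightarrow> K v = K a" "K a = K s" "c \<in> noise_idx S n"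
  shows "\<not> jmp c s"
proof -
  have "N c a w = N c s w" using cf.total_eq_component[of a s c] assms by auto
  then show ?thesis using counting_path_no_jump[OF all.cp[OF assms(6) w] assms(1,2), of s] by simp
qed

lemma Z_local:
  assumes "0 \<le> a" "a < s" "s \<le> T" "\<And>v. a \<le> v \<Longrightarrow> v < s \<Longrightarrow> K v = K a"
  shows "real (Z s w) = real (Z a w) + (\<Sum>k=1..n. if jmp (NZ k) s \<and> lft (\<lambda>r. Z r w) s = k - 1 then 1 else 0)"
proof -
  have "real (Z s w) = (\<Sum>k=1..n. pint (\<lambda>s. if lft (\<lambda>r. Z r w) s = k - 1 then 1 else 0) (\<lambda>r. N (NZ k) r w) a
     + (if jmp (NZ k) s \<and> lft (\<lambda>r. Z r w) s = k - 1 then 1 else 0))"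
    using Z_eq w assms by (subst Z_eq[rule_format, OF w]) (auto intro!: sum.cong simp: pint_local[OF assms NZ_idx])
  also have "\<dots> = real (Z a w) + (\<Sum>k=1..n. if jmp (NZ k) s \<and> lft (\<lambda>r. Z r w) s = k - 1 then 1 else 0)"
    using Z_eq[rule_format, OF w, of a] assms by (simp add: sum.distrib)
  finally show ?thesis .
qed

lemma U_local:
  assumes "0 \<le> a" "a < s" "s \<le> T" "\<And>v. a \<le> v \<Longrightarrow> v < s \<Longrightarrow> K v = K a"
  shows "U s w k = U a w k + (if k \<in> {1..n} \<and> jmp (NZ k) s \<and> lft (\<lambda>r. Z r w) s = k - 1 then s + 1 else 0)"
  using pint_local[OF assms NZ_idx, of k] by (auto simp: Uproc_def)

lemma const_below:
  assumes "0 \<le> a" "a < s" "s \<le> T" "\<And>v. a \<le> v \<Longrightarrow> v < s \<Longrightarrow> K v = K a" "a \<le> v" "v < s"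
  shows "Z v w = Z a w" "U v w = U a w"
proof -
  have "Z v w = Z a w \<and> U v w = U a w"
  proof (cases "v = a")
    case False
    then have av: "a < v" using assms(5) by simp
    have c: "K r = K a" if "a \<le> r" "r < v" for r using assms(4)[of r] assms(6) that by simp
    have vT: "v \<le> T" using assms(3,6) by simp
    have nj: "\<not> jmp c v" if "c \<in> noise_idx S n" for c
      using assms(4)[OF assms(5,6)] by (intro jump_not_const[OF assms(1) av vT c _ that]) auto
    have "real (Z v w) = real (Z a w)" using Z_local[OF assms(1) av vT c] nj[OF NZ_idx] by simp
    moreover have "U v w k = U a w k" for k using U_local[OF assms(1) av vT c, of k] nj[OF NZ_idx] by auto
    ultimately show ?thesis by auto
  qed simp
  then show "Z v w = Z a w" "U v w = U a w" by auto
qed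

lemma lft_Z_local:
  assumes "0 \<le> a" "a < s" "s \<le> T" "\<And>v. a \<le> v \<Longrightarrow> v < s \<Longrightarrow> K v = K a"
  shows "lft (\<lambda>r. Z r w) s = Z a w"
proof (rule lft_eqI[of s a])
  show "Z r w = Z a w" if "a < r" "r < s" for r
    using const_below(1)[OF assms, of r] that by simp
qed (use assms(1,2) in auto)

text \<open>The invariant that ties the counter to the shock vector. Its last clause says that the
  whole past of \<open>U\<close> can be read off its present value, which allows the path of
  \<open>U\<close> to be replaced by its terminal value.\<close>

definition Ginv :: "real \<Rightarrow> bool" where
  "Ginv t \<longleftrightarrow> (\<exists>m. shock_seq n T (U t w) m \<and> Z t w = m) \<and> (\<forall>k\<in>{1..n}. U t w k \<le> t) \<and>
     (\<forall>r. 0 \<le> r \<and> r \<le> t \<longrightarrow> U r w = trunc n (U t w) r)"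

lemma GinvD:
  "Ginv t \<Longrightarrow> \<exists>m. shock_seq n T (U t w) m \<and> Z t w = m"
  "Ginv t \<Longrightarrow> k \<in> {1..n} \<Longrightarrow> U t w k \<le> t"
  "Ginv t \<Longrightarrow> 0 \<le> r \<Longrightarrow> r \<le> t \<Longrightarrow> U r w = trunc n (U t w) r"
  unfolding Ginv_def by blast+

text \<open>With \<open>m\<close> shocks so far only a jump of \<open>NZ (Suc m)\<close> is
  accepted; it raises the corresponding coordinate from -1 by \<open>s + 1\<close> to
  \<open>s\<close>. The indicators in the integrals ignore all other shock noises.\<close>

lemma Ginv_step:
  assumes a: "0 \<le> a" "a < s" "s \<le> T" and const: "\<And>v. a \<le> v \<Longrightarrow> v < s \<Longrightarrow> K v = K a" and Ga: "Ginv a"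
  shows "Ginv s"
proof -
  obtain m where m: "shock_seq n T (U a w) m" "Z a w = m" using GinvD(1)[OF Ga] by blast
  have le: "U a w k \<le> a" if "k \<in> {1..n}" for k using GinvD(2)[OF Ga that] .
  have tr: "U r w = trunc n (U a w) r" if "0 \<le> r" "r \<le> a" for r using GinvD(3)[OF Ga that] .
  note lz = lft_Z_local[OF a const] and cb = const_below[OF a const]
  have tr': "U r w = trunc n (U a w) r" if "0 \<le> r" "r < s" for r
  proof (cases "r \<le> a")
    case False
    then have "trunc n (U a w) r = U a w" using le by (intro trunc_self[OF m(1)]) force
    then show ?thesis using cb(2)[of r] False that by simp
  next
    case True
    then show ?thesis using tr[of r] that(1) by blast
  qed
  show ?thesis
  proof (cases "Suc m \<le> n \<and> jmp (NZ (Suc m)) s")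
    case True
    have "(\<Sum>k=1..n. if jmp (NZ k) s \<and> m = k - 1 then 1 else 0) = (\<Sum>k=1..n. if k = Suc m then 1 else (0::real))"
      using True by (intro sum.cong) auto
    then have Zs: "Z s w = Suc m" using Z_local[OF a const] lz m(2) True by simp
    have Us: "U s w k = (if k = Suc m then s else U a w k)" for k
    proof -
      have "U a w (Suc m) = -1" using m(1) True by (auto simp: shock_seq_def)
      then show ?thesis using U_local[OF a const, of k] lz m(2) True by auto
    qed
    have ss: "shock_seq n T (U s w) (Suc m)"
      unfolding shock_seq_def
    proof (intro conjI ballI impI allI)
      show "Suc m \<le> n" using True by simp
      show "U s w k = 0" if "k \<notin> {1..n}" for k using that m(1) True by (auto simp: Us shock_seq_def)
      show "0 < U s w k" "U s w k \<le> T" if "k \<in> {1..Suc m}" for k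
        using that m(1) a by (auto simp: Us shock_seq_def)
      show "U s w k < U s w l" if "k \<in> {1..Suc m}" "l \<in> {1..Suc m}" "k < l" for k l
      proof (cases "l = Suc m")
        case T: True
        have "U a w k \<le> a" using that True T by (intro le) auto
        then show ?thesis using that a T by (simp add: Us)
      next
        case False
        then show ?thesis using that m(1) by (auto simp: Us shock_seq_def)
      qed
      show "U s w k = -1" if "k \<in> {Suc m<..n}" for k using that m(1) by (auto simp: Us shock_seq_def)
    qed
    have les: "U s w k \<le> s" if "k \<in> {1..n}" for k using le[OF that] a by (simp add: Us)
    have "U r w = trunc n (U s w) r" if "0 \<le> r" "r \<le> s" for r
    proof (cases "r = s")
      case True
      then show ?thesis using trunc_self[OF ss les] by simp
    next
      case False
      have "U a w (Suc m) = -1" using m(1) True by (auto simp: shock_seq_def)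
      then have "trunc n (U a w) r = trunc n (U s w) r" using that False by (auto simp: trunc_def Us fun_eq_iff)
      then show ?thesis using tr'[of r] that False by simp
    qed
    then show ?thesis unfolding Ginv_def using ss Zs les by blast
  next
    case False
    have "(\<Sum>k=1..n. if jmp (NZ k) s \<and> m = k - 1 then 1 else 0) = (0::real)"
      using False by (intro sum.neutral) force
    then have Zs: "Z s w = m" using Z_local[OF a const] lz m(2) by simp
    have Us: "U s w = U a w"
      using U_local[OF a const] lz m(2) False by (intro ext) force
    have "U r w = trunc n (U s w) r" if "0 \<le> r" "r \<le> s" for r
    proof (cases "r = s")
      case True
      have "trunc n (U a w) s = U a w" using le a by (intro trunc_self[OF m(1)]) force
      then show ?thesis using True Us by simp
    qed (use tr'[of r] that Us in auto)
    moreover have "U s w k \<le> s" if "k \<in> {1..n}" for k using le[OF that] a Us by simp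
    moreover have "shock_seq n T (U s w) m" using m Us by simp
    ultimately show ?thesis unfolding Ginv_def using Zs by blast
  qed
qed

text \<open>The constancy and event cases of \<open>counting_path_induct\<close> merge into one step
  over an interval on which no noise jumps before its right end.\<close>

lemma path_induct [consumes 2, case_names start step]:
  assumes t: "0 \<le> t" "t \<le> T" and 0: "R 0"
    and st: "\<And>a s. 0 \<le> a \<Longrightarrow> a < s \<Longrightarrow> s \<le> T \<Longrightarrow> (\<And>v. a \<le> v \<Longrightarrow> v < s \<Longrightarrow> K v = K a) \<Longrightarrow> R a \<Longrightarrow> R s"
  shows "R t"
proof (rule counting_path_induct[OF cf.counting_path_total order_refl t(1), where Q=R])
  show "R 0" by (rule 0)
  show "R r" if "0 \<le> a" "a < r" "r \<le> t" "K a = K r" "R a" for a r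
  proof (rule st[OF that(1,2) _ _ that(5)])
    show "r \<le> T" using that t by simp
    show "K v = K a" if "a \<le> v" "v < r" for v
      using counting_path_mono[OF cf.counting_path_total, of a v] counting_path_mono[OF cf.counting_path_total, of v r]
        that \<open>0 \<le> a\<close> \<open>K a = K r\<close> by auto
  qed
  show "R s" if a: "0 \<le> a" "a < s" "s \<le> t" and eq: "\<And>r. a \<le> r \<Longrightarrow> r < s \<Longrightarrow> K r = lft K s"
    and R: "\<And>r. 0 \<le> r \<Longrightarrow> r < s \<Longrightarrow> R r" for a s
  proof (rule st[OF a(1,2) _ _ R[OF a(1,2)]])
    show "s \<le> T" using a t by simp
    show "K v = K a" if "a \<le> v" "v < s" for v using eq[OF that] eq[of a] a by simp
  qed
qed

lemma Ginv: "0 \<le> t \<Longrightarrow> t \<le> T \<Longrightarrow> Ginv t"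
proof (induction rule: path_induct)
  case start
  have U0: "U 0 w = (\<lambda>k. if k \<in> {1..n} then -1 else 0)" by (auto simp: Uproc_def pint_0)
  have "Z 0 w = 0" using Z_eq[rule_format, OF w, of 0] T_pos by (simp add: pint_0)
  then show ?case unfolding Ginv_def by (auto simp: shock_seq_def trunc_def fun_eq_iff U0)
next
  case (step a s)
  show ?case by (rule Ginv_step[OF step(1-3) step(4) step(5)])
qed

abbreviation "u \<equiv> U T w"

lemma u_seq: "\<exists>m. shock_seq n T u m"
  using GinvD(1)[OF Ginv[of T]] T_pos by auto

lemma U_eq: "0 \<le> r \<Longrightarrow> r \<le> T \<Longrightarrow> U r w = trunc n u r"
  by (rule GinvD(3)[OF Ginv]) (use T_pos in auto)

lemma Z_eq_Zof: "0 \<le> r \<Longrightarrow> r \<le> T \<Longrightarrow> Z r w = Zof n (U r w)"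
  using GinvD(1)[OF Ginv[of r]] shock_seq_Zof[of n T "U r w"] by auto

lemma lft_U: "0 < t \<Longrightarrow> t \<le> T \<Longrightarrow> lft (\<lambda>r. U r w) t = trunc_left n u t"
  by (rule lft_trunc, assumption, rule U_eq) auto

text \<open>Just before \<open>t\<close> the process \<open>U\<close> is constant and equal to the
  left truncation, so a quantity computed from the time and \<open>U\<close> becomes a function of
  time alone.\<close>

lemma lft_of_U:
  assumes t: "0 < t" "t \<le> T" and f: "\<And>r. 0 < r \<Longrightarrow> r < t \<Longrightarrow> f r = F r (U r w)"
  obtains a where "0 \<le> a" "a < t" "\<And>r. a < r \<Longrightarrow> r < t \<Longrightarrow> f r = F r (trunc_left n u t)"
proof -
  obtain a where a: "0 \<le> a" "a < t" "\<And>r. a \<le> r \<Longrightarrow> r < t \<Longrightarrow> K r = lft K t"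
    using counting_path_left[OF cf.counting_path_total t(1)] by metis
  have c: "K v = K a" if "a \<le> v" "v < t" for v using a(3)[OF that] a(3)[of a] a(2) by simp
  have U: "U r w = U a w" if "a \<le> r" "r < t" for r by (rule const_below(2)[OF a(1,2) t(2) c that])
  have "lft (\<lambda>r. U r w) t = U a w" by (rule lft_eqI[OF t(1) a(2)]) (rule U, auto)
  then have "U a w = trunc_left n u t" using lft_U[OF t] by simp
  then have "f r = F r (trunc_left n u t)" if "a < r" "r < t" for r
    using U[of r] f[of r] that a(1) by simp
  then show ?thesis using that[OF a(1,2)] by blast
qed

lemma lft_Z: "0 < t \<Longrightarrow> t \<le> T \<Longrightarrow> lft (\<lambda>r. Z r w) t = Zof n (trunc_left n u t)"
proof -
  assume t: "0 < t" "t \<le> T"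
  obtain a where "0 \<le> a" "a < t" "\<And>r. a < r \<Longrightarrow> r < t \<Longrightarrow> Z r w = Zof n (trunc_left n u t)"
    by (rule lft_of_U[OF t, of "\<lambda>r. Z r w" "\<lambda>r. Zof n"]) (use Z_eq_Zof t in auto)
  then show ?thesis using lft_eqI[OF t(1)] by metis
qed

text \<open>Absolute continuity is applied to the family that consists of the single interval from
  \<open>r\<close> to \<open>t\<close>.\<close>

lemma abs_continuous_left_limit:
  assumes "abs_continuous_on E f" "a < t" "\<And>r. a < r \<Longrightarrow> r \<le> t \<Longrightarrow> r \<in> E"
  shows "(f \<longlongrightarrow> f t) (at_left t)"
proof (rule tendstoI)
  fix e :: real assume "0 < e"
  then obtain d where d: "0 < d" "\<And>D. finite D \<and> (\<forall>(a,b)\<in>D. a \<le> b \<and> {a..b} \<subseteq> E) \<and>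
        pairwise (\<lambda>(a,b) (c,d). b \<le> c \<or> d \<le> a) D \<and>
        (\<Sum>(a,b)\<in>D. b - a) < d \<longrightarrow> (\<Sum>(a,b)\<in>D. \<bar>f b - f a\<bar>) < e"
    using assms(1) unfolding abs_continuous_on_def by blast
  have "dist (f r) (f t) < e" if "max a (t - d) < r" "r < t" for r
    using d(2)[of "{(r, t)}"] that assms(3) by (auto simp: dist_real_def abs_minus_commute pairwise_def)
  then show "\<forall>\<^sub>F r in at_left t. dist (f r) (f t) < e"
    using assms(2) d(1) by (auto simp: eventually_at_left intro!: exI[of _ "max a (t - d)"])
qed

text \<open>This is where regularity of \<open>mu\<close> enters. Just before \<open>t\<close> the
  flow runs along a constant shock vector that stays admissible up to and including
  \<open>t\<close>, and there \<open>mu\<close> is left-continuous in each coordinate, hence in the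
  product topology.\<close>

lemma lft_Mp:
  assumes t: "0 < t" "t \<le> T" shows "lft (\<lambda>r. mu r (U r w)) t = mu t (trunc_left n u t)"
proof -
  obtain m where m: "shock_seq n T u m" using u_seq by blast
  let ?v = "trunc_left n u t"
  obtain a where a: "0 \<le> a" "a < t" "\<And>r. a < r \<Longrightarrow> r < t \<Longrightarrow> mu r (U r w) = mu r ?v"
    by (rule lft_of_U[OF t, of "\<lambda>r. mu r (U r w)" mu]) auto
  obtain a' where a': "0 \<le> a'" "a' < t" "\<And>r. a' < r \<Longrightarrow> r < t \<Longrightarrow> U r w = ?v"
    by (rule lft_of_U[OF t, of "\<lambda>r. U r w" "\<lambda>r x. x"]) auto
  have TS: "(r, ?v) \<in> TS n T" if "a' < r" "r \<le> t" for r
  proof (cases "r = t")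
    case True then show ?thesis using trunc_left_shock_seq(1)[OF m] t by auto
  next
    case False
    then show ?thesis using trunc_shock_seq(1)[OF m, of r] U_eq[of r] a'(1) a'(3)[of r] that t by auto
  qed
  have "((\<lambda>r. mu r ?v i) \<longlongrightarrow> mu t ?v i) (at_left t)" for i
    using mu_regular unfolding regular_TS_def
    by (intro abs_continuous_left_limit[of "{r. (r, ?v) \<in> TS n T}", OF _ a'(2)]) (auto simp: TS)
  then have "limitin (product_topology (\<lambda>_. euclidean) UNIV) (\<lambda>r. mu r ?v) (mu t ?v) (at_left t)"
    by (simp add: limitin_componentwise)
  then have "((\<lambda>r. mu r ?v) \<longlongrightarrow> mu t ?v) (at_left t)" by (simp add: euclidean_product_topology)
  then have "((\<lambda>r. mu r (U r w)) \<longlongrightarrow> mu t ?v) (at_left t)"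
    by (rule tendsto_cong[THEN iffD2, rotated]) (use a in \<open>auto simp: eventually_at_left intro!: exI[of _ a]\<close>)
  then have "Lim (at_left t) (\<lambda>r. mu r (U r w)) = mu t ?v" by (intro tendsto_Lim) auto
  then show ?thesis using t by (simp add: lft_def)
qed

text \<open>Separates the Poisson jumps accepted by the counter from the ignored ones: the
  \<open>k\<close>-th shock time is the jump of \<open>NZ k\<close> that occurs while the counter
  stands at k - 1.\<close>

lemma shock_iff:
  assumes k: "k \<in> {1..n}" and s: "0 < s" "s \<le> T"
  shows "u k = s \<longleftrightarrow> jmp (NZ k) s \<and> lft (\<lambda>r. Z r w) s = k - 1"
proof -
  obtain a where a: "0 \<le> a" "a < s" "\<And>r. a \<le> r \<Longrightarrow> r < s \<Longrightarrow> K r = lft K s"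
    using counting_path_left[OF cf.counting_path_total s(1)] by metis
  have c: "K v = K a" if "a \<le> v" "v < s" for v using a(3)[OF that] a(3)[of a] a(2) by simp
  have Us: "U s w k = U a w k + (if jmp (NZ k) s \<and> lft (\<lambda>r. Z r w) s = k - 1 then s + 1 else 0)"
    using U_local[OF a(1,2) s(2) c, of k] k by simp
  have tr: "U s w k = (if u k \<le> s then u k else -1)" "U a w k = (if u k \<le> a then u k else -1)"
    using U_eq[of s] U_eq[of a] s a k by (auto simp: trunc_def)
  show ?thesis
  proof
    assume "u k = s"
    then show "jmp (NZ k) s \<and> lft (\<lambda>r. Z r w) s = k - 1" using Us tr a s by (auto split: if_splits)
  next
    assume j: "jmp (NZ k) s \<and> lft (\<lambda>r. Z r w) s = k - 1"
    then have "Z a w = k - 1" using lft_Z_local[OF a(1,2) s(2) c] by simp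
    moreover obtain m where "shock_seq n T (U a w) m" "Z a w = m" using GinvD(1)[OF Ginv[of a]] a s by auto
    ultimately have "U a w k = -1" using k by (auto simp: shock_seq_def)
    then have "U s w k = s" using Us j by simp
    then show "u k = s" using tr s by (auto split: if_splits)
  qed
qed

end

text \<open>Bridges the Henstock-Kurzweil integral in the density and the Lebesgue integral over an
  open interval in the weight. The integrands may differ on a finite set, in the applications the
  shock times.\<close>

lemma integral_eq_LBINT:
  fixes f g :: "real \<Rightarrow> real"
  assumes T: "0 \<le> T" and F: "finite F" "\<And>r. 0 < r \<Longrightarrow> r < T \<Longrightarrow> r \<notin> F \<Longrightarrow> f r = g r"
    and g: "g \<in> borel_measurable borel" "\<And>r. 0 < r \<Longrightarrow> r < T \<Longrightarrow> \<bar>g r\<bar> \<le> M"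
  shows "integral {0..T} f = (LBINT r:{0<..<T}. g r)"
proof -
  define h where "h r = (if 0 < r \<and> r < T then g r else 0)" for r
  have h: "h \<in> borel_measurable borel" unfolding h_def using g(1) by measurable
  have hM: "\<bar>h r\<bar> \<le> \<bar>M\<bar>" for r using g(2)[of r] by (auto simp: h_def)
  have si: "set_integrable lborel {0..T} h"
    unfolding set_integrable_def
    by (rule integrableI_bounded_set_indicator[where B="\<bar>M\<bar>"]) (use h hM T in auto)
  have "integral {0..T} f = integral {0..T} h"
    by (rule integral_spike[of "insert 0 (insert T F)"]) (use F in \<open>auto simp: h_def negligible_finite\<close>)
  also have "\<dots> = (LBINT r:{0..T}. h r)" by (rule set_borel_integral_eq_integral(2)[OF si, symmetric])
  also have "\<dots> = (LBINT r:{0<..<T}. g r)"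
    unfolding set_lebesgue_integral_def
    by (rule Bochner_Integration.integral_cong) (auto simp: h_def indicator_def)
  finally show ?thesis .
qed

section \<open>Factorisation of the density and identification of the state process\<close>

context shock_model
begin

text \<open>The part of the density that belongs to the shock noises, as a function of the final
  shock vector. Among the jumps of \<open>NZ l\<close> only the accepted one carries a factor other
  than one.\<close>

definition dz :: "(nat \<Rightarrow> real) \<Rightarrow> real" where
  "dz u = (\<Prod>l\<in>{1..n}. exp (LBINT r:{0<..<T}. (1 - lam l r (mu r (trunc_left n u r))) *
      (if Zof n (trunc_left n u r) = l - 1 then 1 else 0)) *
    (if 0 < u l then lam l (u l) (mu (u l) (trunc_left n u (u l))) else 1))"

lemma lam_measurable:
  assumes "f \<in> borel_measurable M" "g \<in> borel_measurable M"
  shows "(\<lambda>x. lam l (g x) (mu (g x) (trunc_left n (f x) (g x)))) \<in> borel_measurable M"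
  using measurable_compose[OF measurable_borel_Pair[OF assms(2) mu_trunc_measurable[OF assms]] lam_meas[rule_format, of l]]
  by simp

lemma dz_measurable: "dz \<in> borel_measurable borel"
  unfolding dz_def
proof (intro borel_measurable_prod borel_measurable_times)
  fix l
  have [measurable]: "(\<lambda>x. lam l (snd x) (mu (snd x) (trunc_left n (fst x) (snd x)))) \<in> borel_measurable (borel \<Otimes>\<^sub>M lborel)"
    by (rule lam_measurable) auto
  have [measurable]: "(\<lambda>x. Zof n (trunc_left n (fst x) (snd x))) \<in> measurable (borel \<Otimes>\<^sub>M lborel) (count_space UNIV)"
    by (rule measurable_compose[OF trunc_left_measurable Zof_measurable]) auto
  have "case_prod (\<lambda>u r. indicator {0<..<T} r *\<^sub>R ((1 - lam l r (mu r (trunc_left n u r))) *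
      (if Zof n (trunc_left n u r) = l - 1 then 1 else 0))) \<in> borel_measurable (borel \<Otimes>\<^sub>M lborel)"
    unfolding case_prod_beta' by measurable
  from lborel.borel_measurable_lebesgue_integral[OF this]
  have [measurable]: "(\<lambda>u. LBINT r:{0<..<T}. (1 - lam l r (mu r (trunc_left n u r))) *
      (if Zof n (trunc_left n u r) = l - 1 then 1 else 0)) \<in> borel_measurable borel"
    by (simp add: set_lebesgue_integral_def)
  show "(\<lambda>u. exp (LBINT r:{0<..<T}. (1 - lam l r (mu r (trunc_left n u r))) *
      (if Zof n (trunc_left n u r) = l - 1 then 1 else 0))) \<in> borel_measurable borel" by measurable
  have [measurable]: "(\<lambda>u. u l) \<in> borel_measurable (borel :: (nat \<Rightarrow> real) measure)" by (rule coordinate_measurable)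
  have [measurable]: "(\<lambda>u. lam l (u l) (mu (u l) (trunc_left n u (u l)))) \<in> borel_measurable borel"
    by (rule lam_measurable) auto
  show "(\<lambda>u. if 0 < u l then lam l (u l) (mu (u l) (trunc_left n u (u l))) else 1) \<in> borel_measurable borel"
    by measurable
qed

text \<open>Positivity of \<open>lam\<close> keeps the integrand in the exponent at most one, which
  gives \<open>exp T\<close>; an accepted jump contributes at most the bound of \<open>lam\<close>.
  The bound is uniform in the shock vector and later yields finiteness of the changed
  measure.\<close>

lemma dz_bounds:
  shows "\<exists>M. \<forall>u m. shock_seq n T u m \<longrightarrow> 0 \<le> dz u \<and> dz u \<le> M"
proof -
  obtain Cf where Cf: "\<And>k t m. k \<in> {1..n} \<Longrightarrow> t \<in> {0..T} \<Longrightarrow> m \<in> prob_simplex S \<Longrightarrow> lam k t m \<le> Cf k"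
    using lam_bdd by metis
  show ?thesis
  proof (intro exI[of _ "\<Prod>l\<in>{1..n}. exp T * max 1 (Cf l)"] allI impI)
    fix u m assume u: "shock_seq n T u m"
    interpret frozen_env P S n T A Q J X0 N mu alpha u m by unfold_locales (rule u)
    have pos: "0 < lam l r (mu r (trunc_left n u r))" "lam l r (mu r (trunc_left n u r)) \<le> Cf l"
      if "l \<in> {1..n}" "0 \<le> r" "r \<le> T" for l r
      using lam_pos Cf mu_simplex[OF that(2,3)] that by auto
    have fac: "0 \<le> exp (LBINT r:{0<..<T}. (1 - lam l r (mu r (trunc_left n u r))) *
      (if Zof n (trunc_left n u r) = l - 1 then 1 else 0)) *
      (if 0 < u l then lam l (u l) (mu (u l) (trunc_left n u (u l))) else 1) \<and>
      exp (LBINT r:{0<..<T}. (1 - lam l r (mu r (trunc_left n u r))) *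
      (if Zof n (trunc_left n u r) = l - 1 then 1 else 0)) *
      (if 0 < u l then lam l (u l) (mu (u l) (trunc_left n u (u l))) else 1) \<le> exp T * max 1 (Cf l)" (is "0 \<le> exp ?i * ?b \<and> _")
      if l: "l \<in> {1..n}" for l
    proof -
      have ul: "u l \<le> T" using u l T_pos shock_seq_neg[OF u l] unfolding shock_seq_def
        by (cases "0 < u l") (metis atLeastAtMost_iff greaterThanAtMost_iff not_le_imp_less zero_less_one less_irrefl neg_less_0_iff_less less_trans, simp)
      have b: "0 \<le> ?b" "?b \<le> max 1 (Cf l)" using pos[OF l, of "u l"] ul by (auto simp: less_imp_le max_def)
      let ?g = "\<lambda>r. (1 - lam l r (mu r (trunc_left n u r))) * (if Zof n (trunc_left n u r) = l - 1 then 1 else 0)"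
      have "?i \<le> (LBINT r:{0<..<T}. 1)"
      \<comment> \<open>A non-integrable integrand has integral 0 by convention, and the bound holds
        then too.\<close>
      proof (cases "set_integrable lborel {0<..<T} ?g")
        case True
        then show ?thesis
        proof (rule set_integral_mono)
          show "set_integrable lborel {0<..<T} (\<lambda>_. 1::real)" using T_pos by (simp add: set_integrable_def)
          show "?g r \<le> 1" if "r \<in> {0<..<T}" for r using pos(1)[OF l, of r] that by auto
        qed
      next
        case False
        then have "?i = 0" by (simp add: set_integrable_def set_lebesgue_integral_def not_integrable_integral_eq)
        then show ?thesis using T_pos by (simp add: set_lebesgue_integral_def)
      qed
      also have "\<dots> = T" using T_pos by (simp add: set_lebesgue_integral_def)
      finally have "exp ?i \<le> exp T" by simp
      then have "exp ?i * ?b \<le> exp T * max 1 (Cf l)" using b by (rule_tac mult_mono) auto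
      then show ?thesis using b(1) by (intro conjI mult_nonneg_nonneg) auto
    qed
    show "0 \<le> dz u \<and> dz u \<le> (\<Prod>l\<in>{1..n}. exp T * max 1 (Cf l))"
      unfolding dz_def using fac by (auto intro!: prod_nonneg prod_mono)
  qed
qed

end

context good_path
begin

sublocale fz: frozen_env P S n T A Q J X0 N mu alpha "U T w" "Zof n (U T w)"
proof
  obtain m where "shock_seq n T u m" using u_seq by blast
  then show "shock_seq n T u (Zof n u)" using shock_seq_Zof by blast
qed

abbreviation "I \<equiv> noise_idx S n"

lemma NX_idx: "(i, k, j) \<in> states \<Longrightarrow> NX i k j \<in> I"
  by (simp add: noise_idx_eq NXs_iff states_def)

lemma frozen_jump:
  assumes "0 < s" "s \<le> T" "c \<in> I" "Nf c s u w \<noteq> lft (\<lambda>t. Nf c t u w) s"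
  shows "jmp c s" "\<And>k. c = NZ k \<Longrightarrow> u k = s"
proof -
  have "jmp c s \<and> (\<forall>k. c = NZ k \<longrightarrow> u k = s)"
  proof (cases c)
    case (NX i k j)
    then show ?thesis using assms by (simp add: Nf_def)
  next
    case (NZ k)
    then have k: "k \<in> {1..n}" using assms by (auto simp: noise_idx_eq NXs_iff)
    have "u k = s" using assms(4) unfolding NZ lft_Nf_NZ[OF assms(1)] by (auto simp: Nf_def split: if_splits)
    then show ?thesis using shock_iff[OF k assms(1,2)] NZ by simp
  qed
  then show "jmp c s" "\<And>k. c = NZ k \<Longrightarrow> u k = s" by auto
qed

lemma unit_frozen_path: "unit_jumps (total_count I (fz.fpaths w)) T"
  unfolding unit_jumps_def
proof (intro allI impI)
  fix s assume s: "0 < s \<and> s \<le> T"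
  then have s0: "0 < s" "s \<le> T" by auto
  interpret ff: counting_family I "fz.fpaths w" by (rule fz.fe.ch.counting_family[OF w])
  have le: "Nf c s u w \<le> lft (\<lambda>t. Nf c t u w) s + (N c s w - lft (\<lambda>t. N c t w) s)" if c: "c \<in> I" for c
  proof (cases "Nf c s u w = lft (\<lambda>t. Nf c t u w) s")
    case False
    note fj = frozen_jump[OF s0 c False]
    have "N c s w - lft (\<lambda>t. N c t w) s = 1"
      using cf.unit_event(1)[of s c] unit s fj(1) c by (simp add: unit_jumps_def)
    moreover have "Nf c s u w \<le> Suc (lft (\<lambda>t. Nf c t u w) s)"
    proof (cases c)
      case (NX i k j)
      then show ?thesis using cf.unit_event(1)[of s c] unit s fj(1) c by (simp add: unit_jumps_def Nf_def)
    qed (simp add: Nf_def)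
    ultimately show ?thesis by simp
  qed simp
  have lN: "lft (\<lambda>t. N c t w) s \<le> N c s w" if "c \<in> I" for c
    using lft_counting_path_le[OF all.cp[OF that w] s0(1)] .
  have "total_count I (fz.fpaths w) s \<le> (\<Sum>c\<in>I. lft (\<lambda>t. Nf c t u w) s + (N c s w - lft (\<lambda>t. N c t w) s))"
    unfolding total_count_def by (rule sum_mono) (rule le)
  also have "\<dots> = lft (total_count I (fz.fpaths w)) s + (K s - lft K s)"
    unfolding ff.lft_total[OF s0(1)] cf.lft_total[OF s0(1)] total_count_def sum.distrib
    using lN by (subst sum_subtractf_nat) auto
  also have "\<dots> \<le> Suc (lft (total_count I (fz.fpaths w)) s)"
    using unit s by (auto simp: unit_jumps_def)
  finally show "total_count I (fz.fpaths w) s \<le> Suc (lft (total_count I (fz.fpaths w)) s)" .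
qed

abbreviation "Xf t \<equiv> fz.fe.ch.X t w"
abbreviation "XLf t \<equiv> fz.fe.ch.XL t w"

lemma Xf_left:
  assumes "0 \<le> a" "a < s" "s \<le> T" "\<And>v. a \<le> v \<Longrightarrow> v < s \<Longrightarrow> K v = K a"
  shows "XLf s = Xf a"
proof -
  have "r \<notin> event_times I (fz.fpaths w)" if r: "a < r" "r < s" for r
  proof
    assume "r \<in> event_times I (fz.fpaths w)"
    then obtain c where c: "c \<in> I" "0 < r" "Nf c r u w \<noteq> lft (\<lambda>t. Nf c t u w) r"
      by (auto simp: event_times_def)
    have "jmp c r" using frozen_jump(1)[OF c(2) _ c(1,3)] r assms(3) by simp
    moreover have "\<not> jmp c r"
    proof (rule jump_not_const[OF assms(1) r(1) _ _ _ c(1)])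
      show "K v = K a" if "a \<le> v" "v < r" for v using assms(4)[of v] that r by simp
      show "K a = K r" using assms(4)[of r] r by simp
    qed (use r assms(3) in simp)
    ultimately show False by simp
  qed
  then have "event_times I (fz.fpaths w) \<inter> {..<s} = event_times I (fz.fpaths w) \<inter> {..a}"
    using assms(2) by (auto intro: leI)
  then show ?thesis by (simp add: chain_on_def)
qed

lemma Xf_range: "t \<le> T \<Longrightarrow> Xf t \<in> {1..S}"
proof -
  assume "t \<le> T"
  interpret ff: counting_family I "fz.fpaths w" by (rule fz.fe.ch.counting_family[OF w])
  show ?thesis by (rule fz.chain_range[OF w unit_frozen_path]) (use \<open>t \<le> T\<close> ff.finite_events in auto)
qed

lemma X_local:
  assumes a: "0 \<le> a" "a < s" "s \<le> T" and const: "\<And>v. a \<le> v \<Longrightarrow> v < s \<Longrightarrow> K v = K a"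
  shows "real_of_int (X s w) = real_of_int (X a w) +
    (\<Sum>(i, k, j)\<in>states. if jmp (NX i k j) s then
       (if lft (\<lambda>r. X r w) s = int i \<and> lft (\<lambda>r. Z r w) s = k then 1 else 0) * (real j - real i) else 0) +
    (\<Sum>i=1..S. \<Sum>k=1..n. if jmp (NZ k) s then
       (if lft (\<lambda>r. X r w) s = int i \<and> lft (\<lambda>r. Z r w) s = k - 1 then 1 else 0) *
          (real (J i s (lft (\<lambda>r. mu r (U r w)) s)) - real i) else 0)"
proof -
  have 1: "pint g (\<lambda>r. N (NX i k j) r w) s = pint g (\<lambda>r. N (NX i k j) r w) a + (if jmp (NX i k j) s then g s else 0)"
    if "(i, k, j) \<in> states" for g i j k
    by (rule pint_local[OF assms NX_idx[OF that]])
  have 2: "pint g (\<lambda>r. N (NZ k) r w) s = pint g (\<lambda>r. N (NZ k) r w) a + (if jmp (NZ k) s then g s else 0)"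
    if "k \<in> {1..n}" for g k
    by (rule pint_local[OF assms NZ_idx[OF that]])
  let ?g = "\<lambda>i k j s. (if lft (\<lambda>r. X r w) s = int i \<and> lft (\<lambda>r. Z r w) s = k then 1 else 0) * (real j - real i)"
  let ?h = "\<lambda>i k s. (if lft (\<lambda>r. X r w) s = int i \<and> lft (\<lambda>r. Z r w) s = k - 1 then 1 else 0) *
          (real (J i s (lft (\<lambda>r. mu r (U r w)) s)) - real i)"
  have Xt: "real_of_int (X t w) = real (X0 w) + (\<Sum>(i, k, j)\<in>states. pint (?g i k j) (\<lambda>r. N (NX i k j) r w) t) +
    (\<Sum>i=1..S. \<Sum>k=1..n. pint (?h i k) (\<lambda>r. N (NZ k) r w) t)" if "0 \<le> t" "t \<le> T" for t
    using X_eq[rule_format, OF w, of t] that unfolding sum_states by simp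
  have "(\<Sum>(i, k, j)\<in>states. pint (?g i k j) (\<lambda>r. N (NX i k j) r w) s) =
    (\<Sum>(i, k, j)\<in>states. pint (?g i k j) (\<lambda>r. N (NX i k j) r w) a + (if jmp (NX i k j) s then ?g i k j s else 0))"
    by (rule sum.cong) (auto simp: 1)
  moreover have "(\<Sum>i=1..S. \<Sum>k=1..n. pint (?h i k) (\<lambda>r. N (NZ k) r w) s) =
    (\<Sum>i=1..S. \<Sum>k=1..n. pint (?h i k) (\<lambda>r. N (NZ k) r w) a + (if jmp (NZ k) s then ?h i k s else 0))"
    by (intro sum.cong refl) (rule 2, simp)
  ultimately show ?thesis using Xt[of s] Xt[of a] a by (simp add: sum.distrib case_prod_beta')
qed

lemma X_const_below:
  assumes a: "0 \<le> a" "a < s" "s \<le> T" and const: "\<And>v. a \<le> v \<Longrightarrow> v < s \<Longrightarrow> K v = K a" and v: "a \<le> v" "v < s"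
  shows "X v w = X a w"
proof (cases "v = a")
  case False
  then have av: "a < v" using v by simp
  have c: "K r = K a" if "a \<le> r" "r < v" for r using const[of r] v that by simp
  have vT: "v \<le> T" using a v by simp
  have nj: "\<not> jmp c v" if "c \<in> noise_idx S n" for c
    using const[OF v] by (intro jump_not_const[OF a(1) av vT c _ that]) auto
  have "(\<Sum>(i, k, j)\<in>states. if jmp (NX i k j) v then
       (if lft (\<lambda>r. X r w) v = int i \<and> lft (\<lambda>r. Z r w) v = k then 1 else 0) * (real j - real i) else 0) = 0"
    using nj[OF NX_idx] by (intro sum.neutral) auto
  moreover have "(\<Sum>i=1..S. \<Sum>k=1..n. if jmp (NZ k) v then
       (if lft (\<lambda>r. X r w) v = int i \<and> lft (\<lambda>r. Z r w) v = k - 1 then 1 else 0) *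
          (real (J i v (lft (\<lambda>r. mu r (U r w)) v)) - real i) else 0) = 0"
    using nj[OF NZ_idx] by (intro sum.neutral ballI) auto
  ultimately show ?thesis using X_local[OF a(1) av vT c] by simp
qed simp

lemma X_eq_Xf: "0 \<le> t \<Longrightarrow> t \<le> T \<Longrightarrow> X t w = int (Xf t)"
proof (induction rule: path_induct)
  case start
  interpret ff: counting_family I "fz.fpaths w" by (rule fz.fe.ch.counting_family[OF w])
  show ?case using X_eq[rule_format, OF w, of 0] T_pos ff.chain_0[of 0] by (simp add: pint_0)
next
  case (step a s)
  note a = step(1-3) and const = step(4)
  have s0: "0 < s" using a by simp
  interpret ff: counting_family I "fz.fpaths w" by (rule fz.fe.ch.counting_family[OF w])
  define y where "y = Xf a"
  have Xa: "X a w = int y" using step(5) by (simp add: y_def)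
  have y: "y \<in> {1..S}" unfolding y_def using Xf_range a by simp
  have XL: "XLf s = y" unfolding y_def by (rule Xf_left[OF a const])
  have lX: "lft (\<lambda>r. X r w) s = int y"
  proof (rule lft_eqI[OF s0 a(2)])
    show "X r w = int y" if "a < r" "r < s" for r using X_const_below[OF a const, of r] Xa that by simp
  qed
  let ?S1 = "\<Sum>(i, k, j)\<in>states. if jmp (NX i k j) s then
       (if lft (\<lambda>r. X r w) s = int i \<and> lft (\<lambda>r. Z r w) s = k then 1 else 0) * (real j - real i) else 0"
  let ?S2 = "\<Sum>i=1..S. \<Sum>k=1..n. if jmp (NZ k) s then
       (if lft (\<lambda>r. X r w) s = int i \<and> lft (\<lambda>r. Z r w) s = k - 1 then 1 else 0) *
          (real (J i s (lft (\<lambda>r. mu r (U r w)) s)) - real i) else 0"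
  have Xs: "real_of_int (X s w) = real y + ?S1 + ?S2" using X_local[OF a const] Xa by simp
  have event: "Xf s = actf c s y u" if c: "c \<in> I" "Nf c s u w \<noteq> lft (\<lambda>t. Nf c t u w) s" for c
  proof -
    have "mark I (fz.fpaths w) s = c"
      using unit_frozen_path a s0 by (intro ff.unit_event(3)[OF s0 _ c]) (auto simp: unit_jumps_def)
    then show ?thesis using ff.chain_event[of s] c s0 XL by (auto simp: event_times_def)
  qed
  have no_event: "Xf s = y" if "\<And>c. c \<in> I \<Longrightarrow> Nf c s u w = lft (\<lambda>t. Nf c t u w) s"
    using ff.chain_no_event[of s] that XL by (auto simp: event_times_def)
  show ?case
  proof (cases "\<exists>c\<in>I. jmp c s")
    case False
    have "?S1 = 0" using False NX_idx by (intro sum.neutral) auto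
    moreover have "?S2 = 0" using False NZ_idx by (intro sum.neutral ballI) auto
    moreover have "Xf s = y" using False frozen_jump(1)[OF s0 a(3)] by (intro no_event) blast
    ultimately show ?thesis using Xs by simp
  next
    case True
    then obtain c where c: "c \<in> I" "jmp c s" by blast
    have uniq: "d = c" if "d \<in> I" "jmp d s" for d using jump_unique[OF s0 a(3) that(1) c(1) that(2) c(2)] .
    show ?thesis
    proof (cases c)
      case (NX i k j)
      then have st: "(i, k, j) \<in> states" using c by (auto simp: noise_idx_eq NXs_def)
      have "?S1 = (\<Sum>x\<in>states. if x = (i, k, j) then (if y = i \<and> lft (\<lambda>r. Z r w) s = k then real j - real i else 0) else 0)"
      proof (rule sum.cong[OF refl])
        fix x assume x: "x \<in> states"
        obtain i' k' j' where x': "x = (i', k', j')" by (cases x)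
        have "NX i' k' j' \<in> I" using x x' NX_idx by simp
        then have "jmp (NX i' k' j') s \<longleftrightarrow> x = (i, k, j)" using uniq[of "NX i' k' j'"] c NX x' by auto
        then show "(case x of (i, k, j) \<Rightarrow> if jmp (NX i k j) s then
          (if lft (\<lambda>r. X r w) s = int i \<and> lft (\<lambda>r. Z r w) s = k then 1 else 0) * (real j - real i) else 0) =
          (if x = (i, k, j) then (if y = i \<and> lft (\<lambda>r. Z r w) s = k then real j - real i else 0) else 0)"
          unfolding x' lX by auto
      qed
      then have S1: "?S1 = (if y = i \<and> lft (\<lambda>r. Z r w) s = k then real j - real i else 0)"
        using st finite_states by simp
      have "\<not> jmp (NZ l) s" if "l \<in> {1..n}" for l using uniq[OF NZ_idx[OF that]] NX by auto
      then have S2: "?S2 = 0" by (intro sum.neutral ballI) auto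
      have "Xf s = actf c s y u" using c NX by (intro event) (simp_all add: Nf_def)
      then show ?thesis using Xs S1 S2 NX lft_Z[OF s0 a(3)] by (auto simp: actf_def split: if_splits)
    next
      case (NZ k)
      then have k: "k \<in> {1..n}" using c by (auto simp: noise_idx_eq NXs_iff)
      have "\<not> jmp (NX i k' j) s" if "(i, k', j) \<in> states" for i k' j
        using uniq[OF NX_idx[OF that]] NZ by auto
      then have S1: "?S1 = 0" by (intro sum.neutral) auto
      have jk: "jmp (NZ l) s \<longleftrightarrow> l = k" if "l \<in> {1..n}" for l using uniq[OF NZ_idx[OF that]] NZ c by auto
      have "?S2 = (\<Sum>i=1..S. \<Sum>l=1..n. if l = k then (if y = i \<and> lft (\<lambda>r. Z r w) s = k - 1 then
          real (J i s (mu s (trunc_left n u s))) - real i else 0) else 0)"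
        using jk by (intro sum.cong refl) (auto simp: lX lft_Mp[OF s0 a(3)])
      also have "\<dots> = (\<Sum>i=1..S. if i = y then (if lft (\<lambda>r. Z r w) s = k - 1 then
          real (J i s (mu s (trunc_left n u s))) - real i else 0) else 0)"
        using k by (intro sum.cong refl) auto
      also have "\<dots> = (if lft (\<lambda>r. Z r w) s = k - 1 then real (J y s (mu s (trunc_left n u s))) - real y else 0)"
        using y by simp
      finally have S2: "?S2 = (if lft (\<lambda>r. Z r w) s = k - 1 then real (J y s (mu s (trunc_left n u s))) - real y else 0)" .
      show ?thesis
      proof (cases "lft (\<lambda>r. Z r w) s = k - 1")
        case True
        then have "u k = s" using shock_iff[OF k s0 a(3)] c NZ by simp
        then have "Nf (NZ k) s u w \<noteq> lft (\<lambda>t. Nf (NZ k) t u w) s"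
          unfolding lft_Nf_NZ[OF s0] using s0 by (simp add: Nf_def)
        from event[OF NZ_idx[OF k] this] have "Xf s = actf c s y u" by (simp add: NZ)
        then show ?thesis using Xs S1 S2 True NZ by (simp add: actf_def)
      next
        case False
        have "Nf d s u w = lft (\<lambda>t. Nf d t u w) s" if d: "d \<in> I" for d
        proof (rule ccontr)
          assume ne: "Nf d s u w \<noteq> lft (\<lambda>t. Nf d t u w) s"
          have "d = NZ k" using uniq[OF d frozen_jump(1)[OF s0 a(3) d ne]] NZ by simp
          then have "u k = s" using frozen_jump(2)[OF s0 a(3) d ne] by simp
          then show False using shock_iff[OF k s0 a(3)] False by simp
        qed
        then have "Xf s = y" by (rule no_event)
        then show ?thesis using Xs S1 S2 False by simp
      qed
    qed
  qed
qed

lemma lft_X: "0 < t \<Longrightarrow> t \<le> T \<Longrightarrow> lft (\<lambda>r. X r w) t = int (XLf t)"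
proof -
  assume t: "0 < t" "t \<le> T"
  obtain a where a: "0 \<le> a" "a < t" "\<And>r. a \<le> r \<Longrightarrow> r < t \<Longrightarrow> K r = lft K t"
    using counting_path_left[OF cf.counting_path_total t(1)] by metis
  have c: "K v = K a" if "a \<le> v" "v < t" for v using a(3)[OF that] a(3)[of a] a(2) by simp
  show ?thesis
  proof (rule lft_eqI[OF t(1) a(2)])
    fix r assume r: "a < r" "r < t"
    have "X r w = X a w" by (rule X_const_below[OF a(1,2) t(2) c]) (use r in auto)
    then show "X r w = int (XLf t)"
      using Xf_left[OF a(1,2) t(2) c] X_eq_Xf[of a] a t by simp
  qed
qed

abbreviation "actp s \<equiv> alpha s (lft (\<lambda>r. U r w) s) (nat (lft (\<lambda>r. X r w) s))"

lemma rate_eq: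
  assumes st: "(i, k, j) \<in> states" and s: "0 < s" "s \<le> T"
  shows "pr.rate (NX i k j) s (u, w) =
    Q s k (lft (\<lambda>r. mu r (U r w)) s) (actp s) i j * (if lft (\<lambda>r. Z r w) s = k then 1 else 0) +
      (if lft (\<lambda>r. Z r w) s \<noteq> k then 1 else 0)"
proof -
  have Y: "pr.Y s (u, w) = XLf s" using fz.fe_eq(1) fz.fe.Y_eq_XL[OF unit_frozen_path s(2)] by simp
  have yr: "XLf s \<in> {1..S}" using fz.Y_range_path[OF w unit_frozen_path s(2)] Y by simp
  have m: "mu s (trunc_left n u s) \<in> prob_simplex S" using fz.mu_simplex s by simp
  have a: "alpha s (trunc_left n u s) (XLf s) \<in> A" using fz.alpha_A yr s by simp
  have ik: "i \<in> {1..S}" "j \<in> {1..S}" "i \<noteq> j" "k \<le> n" using st by (auto simp: states_def)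
  have "0 \<le> Q s k (mu s (trunc_left n u s)) (alpha s (trunc_left n u s) (XLf s)) i j"
    using Q_intens s m a ik by auto
  moreover have "Q s k (mu s (trunc_left n u s)) (alpha s (trunc_left n u s) (XLf s)) i j \<le> QB"
    using QB(2)[OF ik(4,1,2) _ m a] s by simp
  moreover have "pr.rate (NX i k j) s (u, w) = qf (NX i k j) s (XLf s) u"
    by (simp add: pr.rate_def Y)
  ultimately show ?thesis
    using lft_Mp[OF s] lft_U[OF s] lft_X[OF s] lft_Z[OF s] by (simp add: qf_def)
qed

lemma off_shock:
  assumes r: "0 < r" "r < T" "r \<notin> u ` {1..n}"
  shows "mu r (U r w) = lft (\<lambda>r. mu r (U r w)) r" "Z r w = lft (\<lambda>r. Z r w) r" "U r w = trunc_left n u r"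
proof -
  show U: "U r w = trunc_left n u r"
    using U_eq[of r] r by (auto simp: trunc_def trunc_left_def fun_eq_iff)
  show "mu r (U r w) = lft (\<lambda>r. mu r (U r w)) r" "Z r w = lft (\<lambda>r. Z r w) r"
    using lft_Mp[of r] lft_Z[of r] Z_eq_Zof[of r] r U by auto
qed

text \<open>The density counts a jump at \<open>T\<close>, whereas the left-limit weight does not;
  \<open>nT\<close> rules such a jump out and holds almost surely.\<close>

lemma density_X_factor:
  assumes st: "(i, k, j) \<in> states" and nT: "lft (\<lambda>r. N (NX i k j) r w) T = N (NX i k j) T w"
  shows "exp (integral {0..T} (\<lambda>s. (1 - Q s k (mu s (U s w)) (actp s) i j) * (if Z s w = k then 1 else 0))) *
      (\<Prod>s\<in>jump_times (\<lambda>r. N (NX i k j) r w) T.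
         Q s k (lft (\<lambda>r. mu r (U r w)) s) (actp s) i j * (if lft (\<lambda>r. Z r w) s = k then 1 else 0)
         + (if lft (\<lambda>r. Z r w) s \<noteq> k then 1 else 0)) =
    exp (LBINT r:{0<..<T}. 1 - pr.rate (NX i k j) r (u, w)) *
      (\<Prod>l\<in>{1..lft (\<lambda>t. Nf (NX i k j) t u w) T}. pr.rate (NX i k j) (nth_jump (\<lambda>t. Nf (NX i k j) t u w) l) (u, w))"
proof -
  let ?c = "NX i k j"
  have c: "?c \<in> NXs" using st by (simp add: NXs_iff states_def)
  have cI: "?c \<in> I" by (rule NX_idx[OF st])
  have Nf: "(\<lambda>t. Nf ?c t u w) = (\<lambda>t. N ?c t w)" by (simp add: Nf_def)
  have "integral {0..T} (\<lambda>s. (1 - Q s k (mu s (U s w)) (actp s) i j) * (if Z s w = k then 1 else 0)) =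
    (LBINT r:{0<..<T}. 1 - fz.fe.pathrate w ?c r)"
  proof (rule integral_eq_LBINT[where F="u ` {1..n}" and M="1 + QB"])
    show "(\<lambda>r. 1 - fz.fe.pathrate w ?c r) \<in> borel_measurable borel"
      using fz.fe.pathrate_meas[OF c w] by simp
    show "\<bar>1 - fz.fe.pathrate w ?c r\<bar> \<le> 1 + QB" for r
      using fz.fe.rate_bd[OF c, of r w] QB(1) by auto
    fix r assume r: "0 < r" "r < T" "r \<notin> u ` {1..n}"
    show "(1 - Q r k (mu r (U r w)) (actp r) i j) * (if Z r w = k then 1 else 0) = 1 - fz.fe.pathrate w ?c r"
      using rate_eq[OF st, of r] off_shock(1,2)[OF r] r by (simp add: fz.fe_eq)
  qed (use T_pos in auto)
  also have "\<dots> = (LBINT r:{0<..<T}. 1 - pr.rate ?c r (u, w))"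
    by (rule set_lebesgue_integral_cong) (auto simp: fz.fe_eq)
  finally have I: "integral {0..T} (\<lambda>s. (1 - Q s k (mu s (U s w)) (actp s) i j) * (if Z s w = k then 1 else 0)) =
    (LBINT r:{0<..<T}. 1 - pr.rate ?c r (u, w))" .
  have "(\<Prod>s\<in>jump_times (\<lambda>r. N ?c r w) T.
         Q s k (lft (\<lambda>r. mu r (U r w)) s) (actp s) i j * (if lft (\<lambda>r. Z r w) s = k then 1 else 0)
         + (if lft (\<lambda>r. Z r w) s \<noteq> k then 1 else 0)) = (\<Prod>s\<in>jump_times (\<lambda>r. N ?c r w) T. pr.rate ?c s (u, w))"
    by (rule prod.cong[OF refl]) (auto simp: jump_times_def rate_eq[OF st])
  also have "(\<Prod>s\<in>jump_times (\<lambda>r. N ?c r w) T. pr.rate ?c s (u, w)) =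
    (\<Prod>s\<in>{s. 0 < s \<and> s < T \<and> N ?c s w \<noteq> lft (\<lambda>t. N ?c t w) s}. pr.rate ?c s (u, w))"
    using nT by (intro prod.cong refl) (auto simp: jump_times_def order_le_less)
  also have "\<dots> =
    (\<Prod>l\<in>{1..lft (\<lambda>t. N ?c t w) T}. pr.rate ?c (nth_jump (\<lambda>t. N ?c t w) l) (u, w))"
  proof (rule prod.reindex_bij_betw[symmetric], rule bij_betw_nth_jump[OF all.cp[OF cI w] _ T_pos])
    show "unit_jumps_before (\<lambda>t. N ?c t w) T"
      using cf.unit_component[OF unit cI] by (auto simp: unit_jumps_def unit_jumps_before_def)
  qed
  finally show ?thesis unfolding I Nf by simp
qed

text \<open>By \<open>shock_iff\<close> the product over all jump times of \<open>NZ l\<close> has a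
  nontrivial factor only at the shock time \<open>u l\<close>, if that shock occurs.\<close>

lemma density_Z_factor:
  assumes l: "l \<in> {1..n}"
  shows "exp (integral {0..T} (\<lambda>s. (1 - lam l s (mu s (U s w))) * (if Z s w = l - 1 then 1 else 0))) *
      (\<Prod>s\<in>jump_times (\<lambda>r. N (NZ l) r w) T.
         lam l s (lft (\<lambda>r. mu r (U r w)) s) * (if lft (\<lambda>r. Z r w) s = l - 1 then 1 else 0)
         + (if lft (\<lambda>r. Z r w) s \<noteq> l - 1 then 1 else 0)) =
    exp (LBINT r:{0<..<T}. (1 - lam l r (mu r (trunc_left n u r))) * (if Zof n (trunc_left n u r) = l - 1 then 1 else 0)) *
      (if 0 < u l then lam l (u l) (mu (u l) (trunc_left n u (u l))) else 1)"
proof -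
  obtain C where C: "\<And>t m. t \<in> {0..T} \<Longrightarrow> m \<in> prob_simplex S \<Longrightarrow> lam l t m \<le> C" using lam_bdd l by blast
  have I: "integral {0..T} (\<lambda>s. (1 - lam l s (mu s (U s w))) * (if Z s w = l - 1 then 1 else 0)) =
    (LBINT r:{0<..<T}. (1 - lam l r (mu r (trunc_left n u r))) * (if Zof n (trunc_left n u r) = l - 1 then 1 else 0))"
  proof (rule integral_eq_LBINT[where F="u ` {1..n}" and M="1 + \<bar>C\<bar>"])
    have [measurable]: "(\<lambda>r. lam l r (mu r (trunc_left n u r))) \<in> borel_measurable borel"
      by (rule lam_measurable) auto
    have [measurable]: "(\<lambda>r. Zof n (trunc_left n u r)) \<in> measurable borel (count_space UNIV)"
      by (rule measurable_compose[OF trunc_left_measurable Zof_measurable]) auto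
    show "(\<lambda>r. (1 - lam l r (mu r (trunc_left n u r))) * (if Zof n (trunc_left n u r) = l - 1 then 1 else 0)) \<in> borel_measurable borel"
      by measurable
    show "\<bar>(1 - lam l r (mu r (trunc_left n u r))) * (if Zof n (trunc_left n u r) = l - 1 then 1 else 0)\<bar> \<le> 1 + \<bar>C\<bar>"
      if r: "0 < r" "r < T" for r
    proof -
      have m: "mu r (trunc_left n u r) \<in> prob_simplex S" using fz.mu_simplex r by simp
      have "0 < lam l r (mu r (trunc_left n u r))" using lam_pos l m r by auto
      moreover have "lam l r (mu r (trunc_left n u r)) \<le> C" using C m r by auto
      ultimately show ?thesis by auto
    qed
    show "(1 - lam l r (mu r (U r w))) * (if Z r w = l - 1 then 1 else 0) =
       (1 - lam l r (mu r (trunc_left n u r))) * (if Zof n (trunc_left n u r) = l - 1 then 1 else 0)"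
      if r: "0 < r" "r < T" "r \<notin> u ` {1..n}" for r
      using off_shock(3)[OF r] Z_eq_Zof[of r] r by simp
  qed (use T_pos in auto)
  have ul: "u l \<le> T" using GinvD(2)[OF Ginv[of T] l] T_pos by simp
  have "(\<Prod>s\<in>jump_times (\<lambda>r. N (NZ l) r w) T.
         lam l s (lft (\<lambda>r. mu r (U r w)) s) * (if lft (\<lambda>r. Z r w) s = l - 1 then 1 else 0)
         + (if lft (\<lambda>r. Z r w) s \<noteq> l - 1 then 1 else 0)) =
    (\<Prod>s\<in>jump_times (\<lambda>r. N (NZ l) r w) T. if s = u l then lam l (u l) (mu (u l) (trunc_left n u (u l))) else 1)"
  proof (rule prod.cong[OF refl])
    fix s assume "s \<in> jump_times (\<lambda>r. N (NZ l) r w) T"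
    then have s: "0 < s" "s \<le> T" "jmp (NZ l) s" by (auto simp: jump_times_def)
    then show "lam l s (lft (\<lambda>r. mu r (U r w)) s) * (if lft (\<lambda>r. Z r w) s = l - 1 then 1 else 0)
         + (if lft (\<lambda>r. Z r w) s \<noteq> l - 1 then 1 else 0) =
      (if s = u l then lam l (u l) (mu (u l) (trunc_left n u (u l))) else 1)"
      using shock_iff[OF l s(1,2)] lft_Mp[OF s(1,2)] by auto
  qed
  also have "\<dots> = (if u l \<in> jump_times (\<lambda>r. N (NZ l) r w) T then lam l (u l) (mu (u l) (trunc_left n u (u l))) else 1)"
    using finite_jumps[OF all.cp[OF NZ_idx[OF l] w], of T] by (simp add: prod.delta jump_times_def)
  also have "u l \<in> jump_times (\<lambda>r. N (NZ l) r w) T \<longleftrightarrow> 0 < u l"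
    using shock_iff[OF l, of "u l"] ul by (auto simp: jump_times_def)
  finally show ?thesis unfolding I by simp
qed

lemma density_eq:
  assumes nT: "\<forall>c\<in>NXs. lft (\<lambda>r. N c r w) T = N c T w"
  shows "density_alpha S n T lam Q N Z (\<lambda>t \<omega>. mu t (U t \<omega>))
      (\<lambda>s \<omega>. alpha s (lft (\<lambda>r. U r \<omega>) s) (nat (lft (\<lambda>r. X r \<omega>) s))) w = dz u * pr.Dm T (u, w)"
proof -
  have inj: "inj_on (\<lambda>(i, k, j). NX i k j) states" by (auto simp: inj_on_def)
  define F where "F c = exp (LBINT r:{0<..<T}. 1 - pr.rate c r (u, w)) *
      (\<Prod>l\<in>{1..lft (\<lambda>t. Nf c t u w) T}. pr.rate c (nth_jump (\<lambda>t. Nf c t u w) l) (u, w))" for c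
  have "pr.Dm T (u, w) = (\<Prod>c\<in>NXs. F c)" by (simp add: pr.Dm_def F_def)
  also have "\<dots> = (\<Prod>(i, k, j)\<in>states. F (NX i k j))"
    unfolding NXs_def prod.reindex[OF inj] by (auto intro!: prod.cong)
  also have "\<dots> = (\<Prod>(i, k, j)\<in>states.
      exp (integral {0..T} (\<lambda>s. (1 - Q s k (mu s (U s w)) (actp s) i j) * (if Z s w = k then 1 else 0))) *
      (\<Prod>s\<in>jump_times (\<lambda>r. N (NX i k j) r w) T.
         Q s k (lft (\<lambda>r. mu r (U r w)) s) (actp s) i j * (if lft (\<lambda>r. Z r w) s = k then 1 else 0)
         + (if lft (\<lambda>r. Z r w) s \<noteq> k then 1 else 0)))"
  proof (rule prod.cong[OF refl])
    fix x assume x: "x \<in> states"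
    obtain i k j where e: "x = (i, k, j)" by (cases x)
    have "lft (\<lambda>r. N (NX i k j) r w) T = N (NX i k j) T w"
      using nT x e by (simp add: NXs_iff states_def)
    from density_X_factor[OF x[unfolded e] this]
    show "(case x of (i, k, j) \<Rightarrow> F (NX i k j)) =
     (case x of (i, k, j) \<Rightarrow>
      exp (integral {0..T} (\<lambda>s. (1 - Q s k (mu s (U s w)) (actp s) i j) * (if Z s w = k then 1 else 0))) *
      (\<Prod>s\<in>jump_times (\<lambda>r. N (NX i k j) r w) T.
         Q s k (lft (\<lambda>r. mu r (U r w)) s) (actp s) i j * (if lft (\<lambda>r. Z r w) s = k then 1 else 0)
         + (if lft (\<lambda>r. Z r w) s \<noteq> k then 1 else 0)))" unfolding e by (simp add: F_def)
  qed
  finally have DX: "pr.Dm T (u, w) = \<dots>" .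
  have DZ: "dz u = (\<Prod>l\<in>{1..n}.
      exp (integral {0..T} (\<lambda>s. (1 - lam l s (mu s (U s w))) * (if Z s w = l - 1 then 1 else 0))) *
      (\<Prod>s\<in>jump_times (\<lambda>r. N (NZ l) r w) T.
         lam l s (lft (\<lambda>r. mu r (U r w)) s) * (if lft (\<lambda>r. Z r w) s = l - 1 then 1 else 0)
         + (if lft (\<lambda>r. Z r w) s \<noteq> l - 1 then 1 else 0)))"
    unfolding dz_def by (rule prod.cong[OF refl]) (rule density_Z_factor[symmetric])
  show ?thesis unfolding density_alpha_def DX DZ prod_states by (simp only: mult.commute)
qed

end

section \<open>Conditioning on the shocks\<close>

text \<open>The identity, read as a variable into \<open>A\<close> and as a variable into
  \<open>B\<close>, yields two independent variables; the law of the diagonal on the product is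
  therefore the product law, and Fubini applies.\<close>

lemma (in prob_space) freeze:
  assumes A: "space A = space M" "sets A \<subseteq> sets M" and B: "space B = space M" "sets B \<subseteq> sets M"
    and ind: "indep_set (sets A) (sets B)" and f: "f \<in> borel_measurable (A \<Otimes>\<^sub>M B)"
  shows "(\<integral>\<^sup>+w. f (w, w) \<partial>M) = (\<integral>\<^sup>+w. \<integral>\<^sup>+w'. f (w, w') \<partial>M \<partial>M)"
proof -
  have idA: "(\<lambda>w. w) \<in> measurable M A" and idB: "(\<lambda>w. w) \<in> measurable M B"
    using A B by (auto simp: measurable_def sets.Int_space_eq2)
  have *: "sigma_sets (space M) {(\<lambda>w. w) -` X \<inter> space M | X. X \<in> sets C} = sets C"
    if C: "space C = space M" for C
  proof -
    have "{(\<lambda>w. w) -` X \<inter> space M | X. X \<in> sets C} = sets C"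
      using sets.sets_into_space[of _ C] C by (auto simp: Int_absorb2)
    then show ?thesis using sets.sigma_sets_eq[of C] C by simp
  qed
  have "indep_var A (\<lambda>w. w) B (\<lambda>w. w)"
    unfolding indep_var_eq *[OF A(1)] *[OF B(1)] using idA idB ind by blast
  then have eq: "distr M A (\<lambda>w. w) \<Otimes>\<^sub>M distr M B (\<lambda>w. w) = distr M (A \<Otimes>\<^sub>M B) (\<lambda>w. (w, w))"
    unfolding indep_var_distribution_eq by blast
  interpret DB: prob_space "distr M B (\<lambda>w. w)" by (rule prob_space_distr[OF idB])
  have pair: "(\<lambda>w. (w, w)) \<in> measurable M (A \<Otimes>\<^sub>M B)" by (intro measurable_Pair idA idB)
  have f': "f \<in> borel_measurable (distr M A (\<lambda>w. w) \<Otimes>\<^sub>M distr M B (\<lambda>w. w))" using f by simp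
  have sec: "(\<lambda>w'. f (w, w')) \<in> borel_measurable B" if "w \<in> space M" for w
    using measurable_compose[OF measurable_Pair1' f, of w] that A by simp
  have fi: "(\<lambda>w. \<integral>\<^sup>+w'. f (w, w') \<partial>distr M B (\<lambda>w. w)) \<in> borel_measurable A"
    using DB.borel_measurable_nn_integral_fst[OF f'] by simp
  have "(\<integral>\<^sup>+w. f (w, w) \<partial>M) = (\<integral>\<^sup>+x. f x \<partial>distr M (A \<Otimes>\<^sub>M B) (\<lambda>w. (w, w)))"
    by (rule nn_integral_distr[OF pair, symmetric]) (use f in simp)
  also have "\<dots> = (\<integral>\<^sup>+w. \<integral>\<^sup>+w'. f (w, w') \<partial>distr M B (\<lambda>w. w) \<partial>distr M A (\<lambda>w. w))"
    unfolding eq[symmetric] by (rule DB.nn_integral_fst[OF f', symmetric])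
  also have "\<dots> = (\<integral>\<^sup>+w. \<integral>\<^sup>+w'. f (w, w') \<partial>distr M B (\<lambda>w. w) \<partial>M)"
    by (rule nn_integral_distr[OF idA]) (use fi in simp)
  also have "\<dots> = (\<integral>\<^sup>+w. \<integral>\<^sup>+w'. f (w, w') \<partial>M \<partial>M)"
    by (intro nn_integral_cong nn_integral_distr[OF idB]) (use sec in simp)
  finally show ?thesis .
qed

text \<open>A density measure is defined by nonnegative integrals, which respect almost everywhere
  equality for arbitrary functions. This form is used because \<open>density_alpha\<close> is a raw
  path functional, controlled on good paths only.\<close>

lemma density_cong_AE:
  assumes "AE x in M. f x = g x" shows "density M f = density M g"
proof -
  have "(\<integral>\<^sup>+x. f x * indicator A x \<partial>M) = (\<integral>\<^sup>+x. g x * indicator A x \<partial>M)" for A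
    by (rule nn_integral_cong_AE) (use assms in auto)
  then show ?thesis unfolding density_def by simp
qed

context good_path
begin

lemma Z_ge_iff:
  assumes "0 \<le> t" "t \<le> T" "k \<in> {1..n}" shows "k \<le> Z t w \<longleftrightarrow> 0 < u k \<and> u k \<le> t"
proof -
  obtain m where m: "shock_seq n T (U t w) m" "Z t w = m" using GinvD(1)[OF Ginv[OF assms(1,2)]] by blast
  have "k \<le> Z t w \<longleftrightarrow> 0 < U t w k" using shock_seq_nonneg_iff[OF m(1) assms(3)] m(2) by simp
  also have "\<dots> \<longleftrightarrow> 0 < u k \<and> u k \<le> t" using U_eq[OF assms(1,2)] assms(3) by (auto simp: trunc_def)
  finally show ?thesis .
qed

lemma Z_le: "0 \<le> t \<Longrightarrow> t \<le> T \<Longrightarrow> Z t w \<le> n"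
  using GinvD(1)[OF Ginv[of t]] by (auto simp: shock_seq_def)

text \<open>A recursion for the shocks that tests the noise at rational times. Backwards, take the
  last jump of \<open>NZ (Suc k)\<close> up to \<open>t\<close>: either the counter stands at
  \<open>k\<close> just before and the jump is accepted, or the shock in question has already
  happened.\<close>

lemma Z_Suc_iff:
  assumes t: "0 \<le> t" "t \<le> T" and k: "Suc k \<le> n"
  shows "Suc k \<le> Z t w \<longleftrightarrow> (\<exists>a\<in>\<rat>. 0 \<le> a \<and> a < t \<and> k \<le> Z a w \<and> N (NZ (Suc k)) a w < N (NZ (Suc k)) t w)"
proof -
  let ?f = "\<lambda>t. N (NZ (Suc k)) t w"
  have kn: "Suc k \<in> {1..n}" using k by simp
  note f = all.cp[OF NZ_idx[OF kn] w]
  have left: "\<exists>a. 0 \<le> a \<and> a0 \<le> a \<and> a < s \<and> (\<forall>r. a \<le> r \<and> r < s \<longrightarrow> Z r w = lft (\<lambda>r. Z r w) s)"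
    if s: "0 < s" "s \<le> T" "a0 < s" for s a0
  proof -
    obtain a where a: "0 \<le> a" "a < s" "\<And>r. a \<le> r \<Longrightarrow> r < s \<Longrightarrow> K r = lft K s"
      using counting_path_left[OF cf.counting_path_total s(1)] by metis
    have c: "K v = K a" if "a \<le> v" "v < s" for v using a(3)[OF that] a(3)[of a] a(2) by simp
    have "Z r w = lft (\<lambda>r. Z r w) s" if "a \<le> r" "r < s" for r
      using const_below(1)[OF a(1,2) \<open>s \<le> T\<close> c that] lft_Z_local[OF a(1,2) \<open>s \<le> T\<close> c] by simp
    then show ?thesis using a(1,2) s(3) by (intro exI[of _ "max a a0"]) auto
  qed
  show ?thesis
  proof
    assume "Suc k \<le> Z t w"
    then have s: "0 < u (Suc k)" "u (Suc k) \<le> t" using Z_ge_iff[OF t kn] by auto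
    let ?s = "u (Suc k)"
    have sT: "?s \<le> T" using s t by simp
    have "jmp (NZ (Suc k)) ?s \<and> lft (\<lambda>r. Z r w) ?s = Suc k - 1" using shock_iff[OF kn s(1) sT] by (rule iffD1) (rule refl)
    then have j: "jmp (NZ (Suc k)) ?s" "lft (\<lambda>r. Z r w) ?s = k" by simp_all
    obtain b where b: "0 \<le> b" "b < ?s" and Zb: "\<forall>r. b \<le> r \<and> r < ?s \<longrightarrow> Z r w = lft (\<lambda>r. Z r w) ?s"
      using left[OF s(1) sT s(1)] by blast
    obtain a where a: "a \<in> \<rat>" "b < a" "a < ?s" using Rats_dense_in_real[OF b(2)] by auto
    have "?f a \<le> lft ?f ?s" using le_lft_counting_path[OF f, of a ?s] a b by simp
    also have "\<dots> < ?f ?s" using lft_counting_path_le[OF f s(1)] j(1) by simp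
    also have "\<dots> \<le> ?f t" using counting_path_mono[OF f, of ?s t] s by simp
    finally show "\<exists>a\<in>\<rat>. 0 \<le> a \<and> a < t \<and> k \<le> Z a w \<and> ?f a < ?f t"
      using a b s Zb[rule_format, of a] j(2) by (intro bexI[of _ a]) auto
  next
    assume "\<exists>a\<in>\<rat>. 0 \<le> a \<and> a < t \<and> k \<le> Z a w \<and> ?f a < ?f t"
    then obtain a where a: "0 \<le> a" "a < t" "k \<le> Z a w" "?f a < ?f t" by blast
    obtain s where s: "a < s" "s \<le> t" "lft ?f s < ?f s"
      using counting_path_last_jump[OF f a(1) less_imp_le[OF a(2)] less_imp_neq[OF a(4)]] by blast
    have s0: "0 < s" "s \<le> T" using s a t by auto
    obtain b where b: "0 \<le> b" "a \<le> b" "b < s" "Z b w = lft (\<lambda>r. Z r w) s"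
      using left[OF s0 s(1)] by (metis order_refl)
    have bT: "b \<le> T" "a \<le> T" using b s0 by auto
    have "k \<le> Z b w"
    proof (cases "k = 0")
      case False
      then have kk: "k \<in> {1..n}" using k by simp
      show ?thesis using Z_ge_iff[OF a(1) bT(2) kk] Z_ge_iff[OF b(1) bT(1) kk] a(3) b(2) by auto
    qed simp
    show "Suc k \<le> Z t w"
    proof (cases "Z b w = k")
      case True
      then have "u (Suc k) = s" using shock_iff[OF kn s0] s(3) b(4) by auto
      then show ?thesis using Z_ge_iff[OF t kn] s s0 by simp
    next
      case False
      then have "Suc k \<le> Z b w" using \<open>k \<le> Z b w\<close> by simp
      then show ?thesis using Z_ge_iff[OF b(1) bT(1) kn] Z_ge_iff[OF t kn] b s by auto
    qed
  qed
qed

end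

context shock_model
begin

abbreviation "good w \<equiv> good_path P S n T A Q J X0 N mu alpha lam Z X w"

lemma AE_good: "AE w in P. good w"
  using AE_space all.AE_unit_jumps[OF less_imp_le[OF T_pos]]
proof eventually_elim
  case (elim w)
  then show ?case by unfold_locales
qed

definition GsT :: "'w measure" where
  "GsT = sigma (space P) {Z s -` B \<inter> space P | s B. s \<in> {0..T}}"

lemma space_GsT [simp]: "space GsT = space P"
  unfolding GsT_def by (rule space_measure_of) auto

lemma sets_GsT: "sets GsT = sigma_sets (space P) {Z s -` B \<inter> space P | s B. s \<in> {0..T}}"
  unfolding GsT_def by (rule sets_measure_of) auto

lemma GsT_subset: "sets GsT \<subseteq> sets P"
  unfolding sets_GsT
proof (rule sets.sigma_sets_subset, safe)
  show "Z s -` B \<inter> space P \<in> sets P" if "s \<in> {0..T}" for s B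
    using Z_meas that by (intro measurable_sets[of "Z s" P "count_space UNIV"]) auto
qed

lemma Z_GsT: "t \<in> {0..T} \<Longrightarrow> Z t \<in> measurable GsT (count_space UNIV)"
  by (rule measurableI) (auto simp: sets_GsT intro!: sigma_sets.Basic)

lemma GsT_P: "f \<in> measurable GsT M \<Longrightarrow> f \<in> measurable P M"
  using GsT_subset by (auto simp: measurable_def)

definition grid :: "real set" where "grid = insert T {q \<in> \<rat>. 0 \<le> q \<and> q \<le> T}"

text \<open>The terminal shock vector rebuilt from the counter on a countable grid, hence measurable
  for the shock sigma-algebra without exceptional paths. The grid includes \<open>T\<close> because
  it may be irrational.\<close>

definition V :: "'w \<Rightarrow> nat \<Rightarrow> real" where
  "V w = (\<lambda>k. if k \<in> {1..n} then (if k \<le> Z T w then (INF q\<in>grid. if k \<le> Z q w then q else T) else -1) else 0)"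

lemma V_meas: "V \<in> borel_measurable GsT"
proof (rule measurable_coordinatewise_then_product)
  fix k
  have Zq: "Measurable.pred GsT (\<lambda>w. k \<le> Z q w)" if "q \<in> {0..T}" for q
  proof -
    note [measurable] = borel_measurable_natI[OF Z_GsT[OF that]]
    show ?thesis by measurable
  qed
  have "(\<lambda>w. INF q\<in>grid. if k \<le> Z q w then q else T) \<in> borel_measurable GsT"
  proof (rule borel_measurable_cINF)
    show "countable grid" unfolding grid_def using countable_rat by (intro countable_insert countable_subset[OF _ countable_rat]) auto
    show "(\<lambda>w. if k \<le> Z q w then q else T) \<in> borel_measurable GsT" if "q \<in> grid" for q
    proof -
      have "q \<in> {0..T}" using that T_pos by (auto simp: grid_def)
      note [measurable] = Zq[OF this]
      show ?thesis by measurable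
    qed
    show "bdd_below ((\<lambda>q. if k \<le> Z q w then q else T) ` grid)" for w
      using T_pos by (intro bdd_belowI[of _ 0]) (auto simp: grid_def)
  qed
  moreover have "Measurable.pred GsT (\<lambda>w. k \<le> Z T w)" by (rule Zq) (use T_pos in simp)
  ultimately show "(\<lambda>w. V w k) \<in> borel_measurable GsT" unfolding V_def by measurable
qed

text \<open>Grid points approach a shock time from the right and the counter has reached
  \<open>k\<close> there. The default \<open>T\<close> does not lower the infimum, since shocks
  occur no later than \<open>T\<close>.\<close>

lemma V_eq: "good w \<Longrightarrow> V w = U T w"
proof
  fix k assume g: "good w"
  interpret gp: good_path P S n T A Q J X0 N mu alpha lam Z X w by (rule g)
  obtain m where m: "shock_seq n T (U T w) m" using gp.u_seq by blast
  show "V w k = U T w k"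
  proof (cases "k \<in> {1..n}")
    case False
    then show ?thesis using m by (auto simp: V_def shock_seq_def)
  next
    case k: True
    have ulT: "U T w k \<le> T" using gp.GinvD(2)[OF gp.Ginv[of T] k] T_pos by simp
    have ge: "k \<le> Z q w \<longleftrightarrow> 0 < U T w k \<and> U T w k \<le> q" if "q \<in> {0..T}" for q
      using gp.Z_ge_iff[of q k] k that by auto
    show ?thesis
    proof (cases "0 < U T w k")
      case False
      then show ?thesis using ge[of T] T_pos k shock_seq_neg[OF m k] by (auto simp: V_def)
    next
      case pos: True
      have gT: "q \<in> {0..T}" if "q \<in> grid" for q using that T_pos by (auto simp: grid_def)
      let ?F = "\<lambda>q. if k \<le> Z q w then q else T"
      have bdd: "bdd_below (?F ` grid)" using T_pos by (intro bdd_belowI[of _ 0]) (auto simp: grid_def)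
      have "(INF q\<in>grid. ?F q) = U T w k"
      proof (rule antisym)
        show "U T w k \<le> (INF q\<in>grid. ?F q)"
        proof (rule cINF_greatest)
          show "grid \<noteq> {}" by (auto simp: grid_def)
          show "U T w k \<le> ?F q" if "q \<in> grid" for q using ge[OF gT[OF that]] ulT by auto
        qed
        show "(INF q\<in>grid. ?F q) \<le> U T w k"
        proof (rule field_le_epsilon)
          fix e :: real assume e: "0 < e"
          obtain q where q: "q \<in> grid" "U T w k \<le> q" "q \<le> U T w k + e"
          proof (cases "U T w k = T")
            case True then show ?thesis using that[of T] e by (auto simp: grid_def)
          next
            case False
            then have "U T w k < min T (U T w k + e)" using ulT e by simp
            then obtain q where "q \<in> \<rat>" "U T w k < q" "q < min T (U T w k + e)" using Rats_dense_in_real by blast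
            then show ?thesis using that[of q] pos by (auto simp: grid_def)
          qed
          have "(INF q\<in>grid. ?F q) \<le> ?F q" by (rule cINF_lower[OF bdd q(1)])
          also have "?F q = q" using ge[OF gT[OF q(1)]] pos q by auto
          finally show "(INF q\<in>grid. ?F q) \<le> U T w k + e" using q by simp
        qed
      qed
      then show ?thesis using ge[of T] T_pos k pos ulT by (auto simp: V_def)
    qed
  qed
qed

abbreviation "FZ \<equiv> all.noise_sigma (Some ` NZ ` {1..n})"

lemma FZ_subset: "sets FZ \<subseteq> sets P"
  by (rule all.noise_sigma_sets) (auto simp: noise_idx_eq)

text \<open>On good paths the recursion \<open>Z_Suc_iff\<close> involves the shock noises alone.
  Goodness itself involves all noises, which is why membership in \<open>FZ\<close> is obtained up
  to null sets.\<close>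

lemma Z_mod_null:
  "0 \<le> t \<Longrightarrow> t \<le> T \<Longrightarrow> \<exists>B\<in>sets FZ. AE w in P. k \<le> Z t w \<longleftrightarrow> w \<in> B"
proof (induction k arbitrary: t)
  case 0
  show ?case by (rule bexI[of _ "space P"]) (use sets.top[of FZ] in auto)
next
  case (Suc k)
  show ?case
  proof (cases "Suc k \<le> n")
    case False
    have "AE w in P. Suc k \<le> Z t w \<longleftrightarrow> w \<in> {}"
      using AE_good
    proof eventually_elim
      case (elim w)
      then show ?case using good_path.Z_le[OF elim Suc.prems] False by auto
    qed
    then show ?thesis by blast
  next
    case True
    let ?D = "{a \<in> \<rat>. 0 \<le> a \<and> a < t}"
    have D: "countable ?D" by (rule countable_subset[OF _ countable_rat]) auto
    have "\<forall>a\<in>?D. \<exists>B. B \<in> sets FZ \<and> (AE w in P. k \<le> Z a w \<longleftrightarrow> w \<in> B)"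
    proof
      fix a assume "a \<in> ?D"
      then have "\<exists>B\<in>sets FZ. AE w in P. k \<le> Z a w \<longleftrightarrow> w \<in> B" using Suc.prems by (intro Suc.IH) auto
      then show "\<exists>B. B \<in> sets FZ \<and> (AE w in P. k \<le> Z a w \<longleftrightarrow> w \<in> B)" by blast
    qed
    from bchoice[OF this] obtain B where
      BB: "\<forall>a\<in>?D. B a \<in> sets FZ \<and> (AE w in P. k \<le> Z a w \<longleftrightarrow> w \<in> B a)" by blast
    have B: "B a \<in> sets FZ" "AE w in P. k \<le> Z a w \<longleftrightarrow> w \<in> B a" if "a \<in> ?D" for a
      using BB that by blast+
    let ?N = "N (NZ (Suc k))"
    have [measurable]: "?N s \<in> measurable FZ (count_space UNIV)" for s
      by (rule all.N_noise_meas) (use True in auto)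
    define E where "E = (\<Union>a\<in>?D. B a \<inter> {w \<in> space FZ. ?N a w < ?N t w})"
    have "{w \<in> space FZ. ?N a w < ?N t w} \<in> sets FZ" for a
    proof -
      note [measurable] = borel_measurable_natI[OF all.N_noise_meas]
      have [measurable]: "?N s \<in> borel_measurable FZ" for s
        by (rule borel_measurable_natI[OF all.N_noise_meas]) (use True in auto)
      show ?thesis by measurable
    qed
    then have "E \<in> sets FZ" unfolding E_def using B(1) by (intro sets.countable_UN'[OF D] image_subsetI sets.Int) auto
    moreover have "AE w in P. Suc k \<le> Z t w \<longleftrightarrow> w \<in> E"
    proof -
      have "AE w in P. \<forall>a\<in>?D. k \<le> Z a w \<longleftrightarrow> w \<in> B a" by (subst AE_ball_countable[OF D]) (use B(2) in blast)
      with AE_good AE_space show ?thesis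
      proof eventually_elim
        case (elim w)
        then show ?case using good_path.Z_Suc_iff[OF elim(1) Suc.prems True] by (auto simp: E_def)
      qed
    qed
    ultimately show ?thesis by blast
  qed
qed

lemma GsT_mod_null: "E \<in> sets GsT \<Longrightarrow> \<exists>B\<in>sets FZ. AE w in P. w \<in> E \<longleftrightarrow> w \<in> B"
  unfolding sets_GsT
proof (induction rule: sigma_sets.induct)
  case (Basic E)
  then obtain s D where E: "E = Z s -` D \<inter> space P" and s: "0 \<le> s" "s \<le> T" by auto
  obtain B where B: "\<And>k. B k \<in> sets FZ" "\<And>k. AE w in P. k \<le> Z s w \<longleftrightarrow> w \<in> B k"
    using Z_mod_null[OF s] by metis
  have "(\<Union>k\<in>D. B k - B (Suc k)) \<in> sets FZ" using B(1) by auto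
  moreover have "AE w in P. w \<in> E \<longleftrightarrow> w \<in> (\<Union>k\<in>D. B k - B (Suc k))"
  proof -
    have "AE w in P. \<forall>k. k \<le> Z s w \<longleftrightarrow> w \<in> B k" using B(2) by (simp add: AE_all_countable)
    with AE_space show ?thesis
    proof eventually_elim
      case (elim w)
      have "w \<in> B k - B (Suc k) \<longleftrightarrow> Z s w = k" for k using elim(2)[rule_format, of k] elim(2)[rule_format, of "Suc k"] by auto
      then show ?case using elim(1) unfolding E by auto
    qed
  qed
  ultimately show ?case by blast
next
  case Empty then show ?case by (intro bexI[of _ "{}"]) auto
next
  case (Compl E)
  then obtain B where B: "B \<in> sets FZ" "AE w in P. w \<in> E \<longleftrightarrow> w \<in> B" by blast
  have "AE w in P. w \<in> space P - E \<longleftrightarrow> w \<in> space FZ - B" using B(2) by auto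
  then show ?case using B(1) by blast
next
  case (Union E)
  then obtain B where B: "\<And>i. B i \<in> sets FZ" "\<And>i. AE w in P. w \<in> E i \<longleftrightarrow> w \<in> B i" by metis
  have "AE w in P. \<forall>i. w \<in> E i \<longleftrightarrow> w \<in> B i" using B(2) by (simp add: AE_all_countable)
  then have "AE w in P. w \<in> (\<Union>i. E i) \<longleftrightarrow> w \<in> (\<Union>i. B i)" by eventually_elim auto
  then show ?case using B(1) by (intro bexI[of _ "\<Union>i. B i"]) auto
qed

text \<open>Independence of the two groups of noises is transferred to the shock sigma-algebra,
  because probabilities do not change under null modifications of events.\<close>

lemma GsT_indep: "indep_set (sets GsT) (sets (G T))"
  unfolding indep_sets2_eq
proof (intro conjI ballI)
  show "sets GsT \<subseteq> events" by (rule GsT_subset)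
  show "sets (G T) \<subseteq> events" by (rule sets_G_subset)
  fix E D assume E: "E \<in> sets GsT" and D: "D \<in> sets (G T)"
  let ?FX = "all.noise_sigma (insert None (Some ` NXs))"
  have "sets (G T) \<subseteq> sets ?FX"
    unfolding sets_G
  proof (rule sets.sigma_sets_subset[of _ ?FX, simplified], safe)
    show "X0 -` B \<inter> space P \<in> sets ?FX" for B
      using measurable_sets[OF all.X0_noise_meas[of "insert None (Some ` NXs)"], of B] by simp
    show "N c s -` B \<inter> space P \<in> sets ?FX" if "c \<in> NXs" for c s B
      using measurable_sets[OF all.N_noise_meas[of c "insert None (Some ` NXs)" s], of B] that by simp
  qed
  then have D': "D \<in> sets ?FX" using D by blast
  obtain B where B: "B \<in> sets FZ" "AE w in P. w \<in> E \<longleftrightarrow> w \<in> B" using GsT_mod_null[OF E] by blast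
  have [measurable]: "E \<in> sets P" "D \<in> sets P" "B \<in> sets P"
    using E D B GsT_subset sets_G_subset FZ_subset by auto
  have "indep_set (sets FZ) (sets ?FX)"
    by (rule all.noise_sigma_indep) (auto simp: noise_idx_eq NXs_iff)
  then have "prob (B \<inter> D) = prob B * prob D" using B(1) D' unfolding indep_sets2_eq by blast
  moreover have "prob E = prob B" using B(2) by (intro measure_eq_AE) auto
  moreover have "prob (E \<inter> D) = prob (B \<inter> D)" using B(2) by (intro measure_eq_AE) auto
  ultimately show "prob (E \<inter> D) = prob E * prob D" by simp
qed

end

section \<open>Dependence on the shocks up to the present\<close>

context frozen_model
begin

lemma trunc_left_trunc:
  "r \<le> t \<Longrightarrow> trunc_left n (trunc n u t) r = trunc_left n u r"
  "r \<le> t \<Longrightarrow> trunc_left n (trunc_left n u t) r = trunc_left n u r"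
  by (auto simp: trunc_left_def trunc_def fun_eq_iff)

lemma pm_trunc:
  assumes t: "0 \<le> t"
  shows "pm t (trunc n u t) i = pm t u i" "pm t (trunc_left n u t) i = pm t u i"
proof -
  have *: "pr.Y t (v, w) = pr.Y t (u, w) \<and> pr.Dm t (v, w) = pr.Dm t (u, w)"
    if w: "w \<in> space P" and v: "v = trunc n u t \<or> v = trunc_left n u t" for v w
  proof -
    have L: "trunc_left n v r = trunc_left n u r" if "r \<le> t" for r
      using v trunc_left_trunc[OF that] by auto
    have k: "(0 < v k \<and> v k \<le> r) = (0 < u k \<and> u k \<le> r)" if "k \<in> {1..n}" "r < t" for k r
      using v that by (auto simp: trunc_left_def trunc_def split: if_splits)
    show ?thesis using frozen_cong[OF w t L k] by simp
  qed
  show "pm t (trunc n u t) i = pm t u i" "pm t (trunc_left n u t) i = pm t u i"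
    unfolding pm_def using * by (auto intro!: Bochner_Integration.integral_cong)
qed

lemma p_trunc: "0 \<le> t \<Longrightarrow> p t (trunc n u t) j = p t u j"
proof -
  assume t: "0 \<le> t"
  have "XS t (trunc n u t) i = XS t u i" for i
  proof (cases "0 < t")
    case True
    have "(\<exists>k\<in>{1..n}. trunc n u t k = t) = (\<exists>k\<in>{1..n}. u k = t)"
      using True by (intro bex_cong refl) (auto simp: trunc_def)
    then show ?thesis by (simp only: XS_def trunc_left_trunc(1)[OF order_refl])
  qed (simp add: XS_def)
  then show ?thesis unfolding p_def using pm_trunc(1)[OF t] by simp
qed

text \<open>Truncating strictly before \<open>t\<close> deletes a shock at \<open>t\<close>, so
  \<open>XS\<close> becomes the identity. Along the left limit of \<open>U\<close> the function
  \<open>p\<close> is thus the mass before relabelling.\<close>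

lemma p_trunc_left:
  assumes t: "0 < t" and i: "i \<in> {1..S}"
  shows "p t (trunc_left n u t) i = pm t u i"
proof -
  have "\<not> (\<exists>k\<in>{1..n}. trunc_left n u t k = t)" using t by (auto simp: trunc_left_def)
  then have "XS t (trunc_left n u t) j = j" for j by (auto simp: XS_def)
  then show ?thesis unfolding p_def using pm_trunc(2)[of t u] t i
    by (simp add: if_distrib sum.delta cong: if_cong)
qed

lemma p_init:
  assumes j: "j \<in> {1..S}" shows "p 0 u j = prob {\<omega> \<in> space P. X0 \<omega> = j}"
proof -
  note [measurable] = X0_meas
  have "pm 0 u i = prob {\<omega> \<in> space P. X0 \<omega> = i}" for i
  proof -
    have "pm 0 u i = (\<integral>w. indicator {\<omega> \<in> space P. X0 \<omega> = i} w \<partial>P)"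
      unfolding pm_def by (intro Bochner_Integration.integral_cong) (auto simp: pr_Dm_0 pr_Y_0)
    then show ?thesis by simp
  qed
  moreover have "XS 0 u i = i" for i by (simp add: XS_def)
  ultimately show ?thesis unfolding p_def using j by (simp add: if_distrib sum.delta cong: if_cong)
qed

end

section \<open>Conditional probabilities under the changed measure\<close>

context shock_model
begin

lemma V_seq: "AE w in P. V w = U T w \<and> (\<exists>m. shock_seq n T (V w) m)"
  using AE_good
proof eventually_elim
  case (elim w)
  then show ?case using V_eq[OF elim] good_path.u_seq[OF elim] by simp
qed

lemma DmT_V_meas: "(\<lambda>(w, w'). pr.Dm T (V w, w')) \<in> borel_measurable (GsT \<Otimes>\<^sub>M G T)"
  and Y_V_meas: "0 \<le> t \<Longrightarrow> t \<le> T \<Longrightarrow> (\<lambda>(w, w'). pr.Y t (V w, w')) \<in> measurable (GsT \<Otimes>\<^sub>M G T) (count_space UNIV)"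
proof -
  have "(\<lambda>x. (V (fst x), snd x)) \<in> measurable (GsT \<Otimes>\<^sub>M G T) (G2 T)"
    by (intro measurable_Pair measurable_compose[OF measurable_fst V_meas] measurable_snd)
  note comp = measurable_compose[OF this]
  show "(\<lambda>(w, w'). pr.Dm T (V w, w')) \<in> borel_measurable (GsT \<Otimes>\<^sub>M G T)"
    using comp[OF pr_Dm_meas] T_pos by (simp add: case_prod_beta')
  show "(\<lambda>(w, w'). pr.Y t (V w, w')) \<in> measurable (GsT \<Otimes>\<^sub>M G T) (count_space UNIV)" if "0 \<le> t" "t \<le> T"
    using comp[OF pr.measurable_F_mono[OF that pr_Y_meas[OF that(1)]]] by (simp add: case_prod_beta')
qed

lemma diagonal_meas: "f \<in> measurable (GsT \<Otimes>\<^sub>M G T) M \<Longrightarrow> (\<lambda>w. f (w, w)) \<in> measurable P M"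
proof -
  assume f: "f \<in> measurable (GsT \<Otimes>\<^sub>M G T) M"
  have "(\<lambda>w. (w, w)) \<in> measurable P (GsT \<Otimes>\<^sub>M G T)"
    using GsT_subset sets_G_subset[of T]
    by (intro measurable_Pair) (auto simp: measurable_def sets.Int_space_eq2)
  from measurable_compose[OF this f] show ?thesis .
qed

abbreviation "hit t j u w \<equiv> (if XS t u (pr.Y t (u, w)) = j then 1 else (0::real))"

lemma hit_V_meas:
  assumes "0 \<le> t" "t \<le> T"
  shows "(\<lambda>x. hit t j (V (fst x)) (snd x)) \<in> borel_measurable (GsT \<Otimes>\<^sub>M G T)"
proof -
  have Y: "(\<lambda>x. pr.Y t (V (fst x), snd x)) \<in> measurable (GsT \<Otimes>\<^sub>M G T) (count_space UNIV)"
    using Y_V_meas[OF assms] by (simp add: case_prod_beta')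
  have "(\<lambda>x. XS t (V (fst x)) i) \<in> measurable (GsT \<Otimes>\<^sub>M G T) (count_space UNIV)" for i
    by (rule XS_measurable, rule measurable_compose[OF measurable_fst V_meas])
  from measurable_compose_countable[of "\<lambda>i x. XS t (V (fst x)) i", OF this Y]
  have [measurable]: "(\<lambda>x. XS t (V (fst x)) (pr.Y t (V (fst x), snd x))) \<in> measurable (GsT \<Otimes>\<^sub>M G T) (count_space UNIV)" .
  show ?thesis by measurable
qed

text \<open>\<open>V\<close> is known from the shocks and the remaining noises are independent of
  them, so \<open>freeze\<close> allows the shock vector to be held fixed in an inner integral. That
  integral is given by \<open>p_eq_T\<close>, respectively by \<open>total_mass\<close>.\<close>

lemma frozen_expectation:
  assumes H: "H \<in> borel_measurable GsT" and t: "0 \<le> t" "t \<le> T"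
  shows "(\<integral>\<^sup>+w. H w * ennreal (pr.Dm T (V w, w) * hit t j (V w) w) \<partial>P) = (\<integral>\<^sup>+w. H w * ennreal (p t (V w) j) \<partial>P)"
    and "(\<integral>\<^sup>+w. H w * ennreal (pr.Dm T (V w, w)) \<partial>P) = (\<integral>\<^sup>+w. H w \<partial>P)"
proof -
  have D: "(\<lambda>x. pr.Dm T (V (fst x), snd x)) \<in> borel_measurable (GsT \<Otimes>\<^sub>M G T)"
    using DmT_V_meas by (simp add: case_prod_beta')
  have general: "(\<integral>\<^sup>+w. H w * ennreal (pr.Dm T (V w, w) * f w w) \<partial>P) = (\<integral>\<^sup>+w. H w * ennreal (e w) \<partial>P)"
    if f: "(\<lambda>x. f (fst x) (snd x)) \<in> borel_measurable (GsT \<Otimes>\<^sub>M G T)" "\<And>w w'. 0 \<le> f w w' \<and> f w w' \<le> 1"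
      and e: "\<And>w m. shock_seq n T (V w) m \<Longrightarrow> (\<integral>w'. pr.Dm T (V w, w') * f w w' \<partial>P) = e w" for f e
  proof -
    note [measurable] = D f(1) measurable_compose[OF measurable_fst H]
    have "(\<integral>\<^sup>+w. H w * ennreal (pr.Dm T (V w, w) * f w w) \<partial>P) =
      (\<integral>\<^sup>+w. \<integral>\<^sup>+w'. H w * ennreal (pr.Dm T (V w, w') * f w w') \<partial>P \<partial>P)"
      using freeze[OF space_GsT GsT_subset space_G sets_G_subset GsT_indep,
          of "\<lambda>x. H (fst x) * ennreal (pr.Dm T (V (fst x), snd x) * f (fst x) (snd x))"]
      by simp
    also have "\<dots> = (\<integral>\<^sup>+w. H w * ennreal (e w) \<partial>P)"
    proof (rule nn_integral_cong_AE)
      show "AE w in P. (\<integral>\<^sup>+w'. H w * ennreal (pr.Dm T (V w, w') * f w w') \<partial>P) = H w * ennreal (e w)"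
        using V_seq AE_space
      proof eventually_elim
        case (elim w)
        then obtain m where m: "shock_seq n T (V w) m" by blast
        interpret fe: frozen_env P S n T A Q J X0 N mu alpha "V w" m by unfold_locales (rule m)
        have sec: "(\<lambda>w'. g (w, w')) \<in> borel_measurable P"
          if "g \<in> borel_measurable (GsT \<Otimes>\<^sub>M G T)" for g :: "'w \<times> 'w \<Rightarrow> real"
        proof -
          have "(\<lambda>w'. g (w, w')) \<in> borel_measurable (G T)"
            using measurable_compose[OF measurable_Pair1' that, of w] elim by simp
          then show ?thesis using sets_G_subset[of T] by (auto simp: measurable_def)
        qed
        note [measurable] = sec[OF D, simplified] sec[OF f(1), simplified]
        have "(\<integral>\<^sup>+w'. H w * ennreal (pr.Dm T (V w, w') * f w w') \<partial>P) =
          H w * (\<integral>\<^sup>+w'. ennreal (pr.Dm T (V w, w') * f w w') \<partial>P)"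
          by (rule nn_integral_cmult) measurable
        also have "(\<integral>\<^sup>+w'. ennreal (pr.Dm T (V w, w') * f w w') \<partial>P) = ennreal (\<integral>w'. pr.Dm T (V w, w') * f w w' \<partial>P)"
        proof (rule nn_integral_eq_integral)
          show "integrable P (\<lambda>w'. pr.Dm T (V w, w') * f w w')"
            by (rule fe.integrable_Dm_T[where M=1]) (use f(2) in auto)
          show "AE w' in P. 0 \<le> pr.Dm T (V w, w') * f w w'"
            using fe.fe.Dm_nonneg[unfolded fe.fe_eq] f(2) by (intro AE_I2 mult_nonneg_nonneg) auto
        qed
        finally show ?case using e[OF m] by simp
      qed
    qed
    finally show ?thesis .
  qed
  show "(\<integral>\<^sup>+w. H w * ennreal (pr.Dm T (V w, w) * hit t j (V w) w) \<partial>P) = (\<integral>\<^sup>+w. H w * ennreal (p t (V w) j) \<partial>P)"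
  proof (rule general[of "\<lambda>w w'. hit t j (V w) w'" "\<lambda>w. p t (V w) j"])
    show "(\<lambda>x. hit t j (V (fst x)) (snd x)) \<in> borel_measurable (GsT \<Otimes>\<^sub>M G T)" by (rule hit_V_meas[OF t])
    fix w m assume m: "shock_seq n T (V w) m"
    interpret fe: frozen_env P S n T A Q J X0 N mu alpha "V w" m by unfold_locales (rule m)
    show "(\<integral>w'. pr.Dm T (V w, w') * hit t j (V w) w' \<partial>P) = p t (V w) j" by (rule fe.p_eq_T[OF t])
  qed auto
  have "(\<integral>\<^sup>+w. H w * ennreal (pr.Dm T (V w, w) * 1) \<partial>P) = (\<integral>\<^sup>+w. H w * ennreal 1 \<partial>P)"
  proof (rule general[of "\<lambda>_ _. 1" "\<lambda>_. 1"])
    fix w m assume m: "shock_seq n T (V w) m"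
    interpret fe: frozen_env P S n T A Q J X0 N mu alpha "V w" m by unfold_locales (rule m)
    show "(\<integral>w'. pr.Dm T (V w, w') * 1 \<partial>P) = 1" using fe.total_mass by simp
  qed auto
  then show "(\<integral>\<^sup>+w. H w * ennreal (pr.Dm T (V w, w)) \<partial>P) = (\<integral>\<^sup>+w. H w \<partial>P)" by simp
qed

definition dens :: "'w \<Rightarrow> ennreal" where
  "dens w = ennreal (dz (V w)) * ennreal (pr.Dm T (V w, w))"

definition Pa :: "'w measure" where
  "Pa = density P (\<lambda>\<omega>. ennreal (density_alpha S n T lam Q N Z (\<lambda>t \<omega>. mu t (U t \<omega>))
      (\<lambda>s \<omega>. alpha s (lft (\<lambda>r. U r \<omega>) s) (nat (lft (\<lambda>r. X r \<omega>) s))) \<omega>))"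

lemma AE_no_NX_jump: "AE w in P. \<forall>c\<in>NXs. 0 < t \<longrightarrow> lft (\<lambda>r. N c r w) t = N c t w"
  using AE_no_jump_at[of _ t] finite_noise by (cases "0 < t") (auto simp: AE_finite_all)

lemma Pa_eq: "Pa = density P dens"
  unfolding Pa_def
proof (rule density_cong_AE)
  show "AE w in P. ennreal (density_alpha S n T lam Q N Z (\<lambda>t \<omega>. mu t (U t \<omega>))
      (\<lambda>s \<omega>. alpha s (lft (\<lambda>r. U r \<omega>) s) (nat (lft (\<lambda>r. X r \<omega>) s))) w) = dens w"
    using AE_good AE_no_NX_jump[of T]
  proof eventually_elim
    case (elim w)
    interpret gp: good_path P S n T A Q J X0 N mu alpha lam Z X w by (rule elim)
    have "0 \<le> dz (U T w)" using dz_bounds gp.u_seq by blast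
    then show ?case using gp.density_eq elim(2) T_pos V_eq[OF elim(1)] by (simp add: dens_def ennreal_mult')
  qed
qed

lemma dens_meas: "dens \<in> borel_measurable P"
proof -
  have "(\<lambda>w. dz (V w)) \<in> borel_measurable P"
    by (rule GsT_P, rule measurable_compose[OF V_meas dz_measurable])
  moreover have "(\<lambda>w. pr.Dm T (V w, w)) \<in> borel_measurable P"
    using diagonal_meas[OF DmT_V_meas] by simp
  ultimately show ?thesis unfolding dens_def by measurable
qed

lemma AE_Pa: "AE w in P. R w \<Longrightarrow> AE w in Pa. R w"
  unfolding Pa_eq AE_density[OF dens_meas] by auto

lemma space_Pa [simp]: "space Pa = space P" and sets_Pa [simp]: "sets Pa = sets P"
  by (simp_all add: Pa_eq)

lemma dz_V_meas: "(\<lambda>w. ennreal (dz (V w))) \<in> borel_measurable GsT"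
  using measurable_compose[OF V_meas dz_measurable] by simp

text \<open>The martingale factor integrates to one given the shocks, and the remaining factor
  \<open>dz\<close> is bounded on admissible vectors.\<close>

lemma finite_Pa: "finite_measure Pa"
proof (rule finite_measureI)
  obtain M where M: "\<And>u m. shock_seq n T u m \<Longrightarrow> 0 \<le> dz u \<and> dz u \<le> M" using dz_bounds by blast
  have "emeasure Pa (space Pa) = (\<integral>\<^sup>+w. dens w \<partial>P)"
    using emeasure_density[OF dens_meas sets.top] by (simp add: Pa_eq nn_integral_eq_simple_integral cong: nn_integral_cong)
  also have "\<dots> = (\<integral>\<^sup>+w. ennreal (dz (V w)) \<partial>P)"
    unfolding dens_def by (rule frozen_expectation(2)[OF dz_V_meas, of 0]) (use T_pos in auto)
  also have "\<dots> \<le> (\<integral>\<^sup>+w. ennreal M \<partial>P)"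
  proof (rule nn_integral_mono_AE)
    show "AE w in P. ennreal (dz (V w)) \<le> ennreal M"
      using V_seq by eventually_elim (auto intro!: ennreal_leI dest: M)
  qed
  also have "\<dots> < \<infinity>" by (simp add: emeasure_space_1)
  finally show "emeasure Pa (space Pa) \<noteq> \<infinity>" by simp
qed

text \<open>Rewrites the event in terms of the shock vector and the predictable left limit, the two
  arguments that can be separated by freezing.\<close>

lemma X_hit:
  assumes t: "0 \<le> t" "t \<le> T"
  shows "AE w in P. (X t w = int j) \<longleftrightarrow> XS t (V w) (pr.Y t (V w, w)) = j"
  using AE_good AE_no_NX_jump[of t]
proof eventually_elim
  case (elim w)
  interpret gp: good_path P S n T A Q J X0 N mu alpha lam Z X w by (rule elim)
  have "pr.Y t (U T w, w) = gp.XLf t"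
    using gp.fz.fe_eq(1) gp.fz.fe.Y_eq_XL[OF gp.unit_frozen_path t(2)] by simp
  then show ?case
    using gp.X_eq_Xf[OF t] gp.fz.chain_XS[OF gp.w gp.unit_frozen_path t elim(2)] V_eq[OF elim(1)] by simp
qed

lemma cond_exp_eq:
  assumes t: "0 \<le> t" "t \<le> T"
    and F: "space F = space P" "sets F \<subseteq> sets P" "\<And>E. E \<in> sets F \<Longrightarrow> \<exists>E'\<in>sets GsT. AE w in P. w \<in> E \<longleftrightarrow> w \<in> E'"
    and g: "g \<in> borel_measurable F" "AE w in P. g w = p t (V w) j"
  shows "AE w in Pa. real_cond_exp Pa F (indicator {\<omega>. X t \<omega> = int j}) w = g w"
proof -
  interpret Pa: finite_measure Pa by (rule finite_Pa)
  have sub: "subalgebra Pa F" using F by (simp add: subalgebra_def)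
  interpret fin: finite_measure_subalgebra Pa F by unfold_locales (rule sub)
  have gP [measurable]: "g \<in> borel_measurable P" using g(1) F by (auto simp: measurable_def)
  have [measurable]: "X t \<in> measurable P (count_space UNIV)" using X_meas t by simp
  have [measurable]: "dens \<in> borel_measurable P" by (rule dens_meas)
  let ?ind = "indicator {\<omega>. X t \<omega> = int j} :: 'w \<Rightarrow> real"
  have ind [measurable]: "?ind \<in> borel_measurable P"
  proof -
    have "(\<lambda>w. if X t w = int j then 1 else (0::real)) \<in> borel_measurable P" by measurable
    also have "(\<lambda>w. if X t w = int j then 1 else (0::real)) = ?ind" by (auto simp: fun_eq_iff)
    finally show ?thesis .
  qed
  have p01: "AE w in P. 0 \<le> g w \<and> g w \<le> 1"
    using V_seq g(2)
  proof eventually_elim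
    case (elim w)
    then obtain m where m: "shock_seq n T (V w) m" by blast
    interpret fe: frozen_env P S n T A Q J X0 N mu alpha "V w" m by unfold_locales (rule m)
    have [measurable]: "(\<lambda>w'. hit t j (V w) w') \<in> borel_measurable P"
      by (rule measurable_compose[OF fe.fe.Y_meas_at[OF t(1), unfolded fe.fe_eq]]) simp
    have "p t (V w) j \<le> (\<integral>w'. pr.Dm T (V w, w') * 1 \<partial>P)"
      unfolding fe.p_eq_T[OF t, symmetric]
      using fe.fe.Dm_nonneg[unfolded fe.fe_eq]
      by (intro integral_mono fe.integrable_Dm_T[where M=1]) auto
    then show ?case using elim fe.p_nonneg[OF t, of j] fe.total_mass by simp
  qed
  show ?thesis
  proof (rule fin.real_cond_exp_charact)
    show "g \<in> borel_measurable F" by (rule g)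
    show "integrable Pa ?ind"
      by (rule Pa.integrable_const_bound[where B=1]) (auto simp: Pa_eq indicator_def)
    show "integrable Pa g"
      by (rule Pa.integrable_const_bound[where B=1]) (use AE_Pa[OF p01] in \<open>auto simp: Pa_eq\<close>)
    fix E assume E: "E \<in> sets F"
    then have EP [measurable]: "E \<in> sets P" using F by auto
    obtain E' where E': "E' \<in> sets GsT" "AE w in P. w \<in> E \<longleftrightarrow> w \<in> E'" using F(3)[OF E] by blast
    define H where "H w = indicator E' w * ennreal (dz (V w))" for w
    have H: "H \<in> borel_measurable GsT" unfolding H_def using E'(1) dz_V_meas by measurable
    have "(\<integral>\<^sup>+w. ennreal (indicator E w * ?ind w) \<partial>Pa) = (\<integral>\<^sup>+w. dens w * ennreal (indicator E w * ?ind w) \<partial>P)"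
      unfolding Pa_eq by (rule nn_integral_density) measurable
    also have "\<dots> = (\<integral>\<^sup>+w. H w * ennreal (pr.Dm T (V w, w) * hit t j (V w) w) \<partial>P)"
    proof (rule nn_integral_cong_AE)
      show "AE w in P. dens w * ennreal (indicator E w * ?ind w) = H w * ennreal (pr.Dm T (V w, w) * hit t j (V w) w)"
        using X_hit[OF t, of j] E'(2)
        by eventually_elim (auto simp: H_def dens_def indicator_def)
    qed
    also have "\<dots> = (\<integral>\<^sup>+w. H w * ennreal (p t (V w) j) \<partial>P)" by (rule frozen_expectation(1)[OF H t])
    \<comment> \<open>Total mass one read backwards: the martingale factor is put back next to a
      function of the shocks, which restores the density.\<close>
    also have "\<dots> = (\<integral>\<^sup>+w. H w * ennreal (p t (V w) j) * ennreal (pr.Dm T (V w, w)) \<partial>P)"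
    proof (rule frozen_expectation(2)[symmetric, OF _ t])
      have "(\<lambda>w. p t (V w) j) \<in> borel_measurable GsT"
        by (rule measurable_compose[OF V_meas p_measurable[OF t(1)]])
      then show "(\<lambda>w. H w * ennreal (p t (V w) j)) \<in> borel_measurable GsT" using H by measurable
    qed
    also have "\<dots> = (\<integral>\<^sup>+w. dens w * ennreal (indicator E w * g w) \<partial>P)"
    proof (rule nn_integral_cong_AE)
      show "AE w in P. H w * ennreal (p t (V w) j) * ennreal (pr.Dm T (V w, w)) = dens w * ennreal (indicator E w * g w)"
        using g(2) E'(2) by eventually_elim (auto simp: H_def dens_def indicator_def ac_simps)
    qed
    also have "\<dots> = (\<integral>\<^sup>+w. ennreal (indicator E w * g w) \<partial>Pa)"
      unfolding Pa_eq by (rule nn_integral_density[symmetric]) measurable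
    finally have eq: "(\<integral>\<^sup>+w. ennreal (indicator E w * ?ind w) \<partial>Pa) = (\<integral>\<^sup>+w. ennreal (indicator E w * g w) \<partial>Pa)" .
    have "(\<integral>w. indicator E w * ?ind w \<partial>Pa) = enn2real (\<integral>\<^sup>+w. ennreal (indicator E w * ?ind w) \<partial>Pa)"
      by (rule integral_eq_nn_integral) (auto simp: Pa_eq)
    also have "\<dots> = (\<integral>w. indicator E w * g w \<partial>Pa)"
      unfolding eq
    proof (rule integral_eq_nn_integral[symmetric])
      show "(\<lambda>w. indicator E w * g w) \<in> borel_measurable Pa" by (simp add: Pa_eq)
      show "AE w in Pa. 0 \<le> indicator E w * g w"
        using AE_Pa[OF p01] by eventually_elim (auto simp: indicator_def)
    qed
    finally show "(\<integral>x\<in>E. ?ind x \<partial>Pa) = (\<integral>x\<in>E. g x \<partial>Pa)"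
      by (simp add: set_lebesgue_integral_def)
  qed
qed

lemma p_U: "0 \<le> t \<Longrightarrow> t \<le> T \<Longrightarrow> AE w in P. p t (U t w) j = p t (V w) j"
  using AE_good
proof eventually_elim
  case (elim w)
  then show ?case using V_eq[OF elim(3)] good_path.U_eq[OF elim(3,1,2)] p_trunc[OF elim(1)] by simp
qed

lemma cond_exp_GsT:
  assumes "0 \<le> t" "t \<le> T"
  shows "AE w in Pa. real_cond_exp Pa GsT (indicator {\<omega>. X t \<omega> = int j}) w = p t (V w) j"
proof (rule cond_exp_eq[OF assms space_GsT GsT_subset])
  show "(\<lambda>w. p t (V w) j) \<in> borel_measurable GsT"
    by (rule measurable_compose[OF V_meas p_measurable[OF assms(1)]])
  show "\<exists>E'\<in>sets GsT. AE w in P. w \<in> E \<longleftrightarrow> w \<in> E'" if "E \<in> sets GsT" for E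
    using that by (intro bexI[of _ E]) auto
qed auto

text \<open>On good paths \<open>U t\<close> is the truncation of \<open>V\<close> at
  \<open>t\<close>, so every event of \<open>U t\<close> agrees with an event of the shock
  sigma-algebra up to a null set.\<close>

lemma cond_exp_U:
  assumes t: "0 \<le> t" "t \<le> T"
  shows "AE w in Pa. real_cond_exp Pa (vimage_algebra (space P) (U t) borel) (indicator {\<omega>. X t \<omega> = int j}) w = p t (U t w) j"
proof (rule cond_exp_eq[OF t])
  let ?F = "vimage_algebra (space P) (U t) borel"
  have Um: "U t \<in> borel_measurable P" using U_meas t by simp
  show "space ?F = space P" by simp
  have sets: "sets ?F = {U t -` B \<inter> space P | B. B \<in> sets borel}"
    by (rule sets_vimage_algebra2) auto
  show "sets ?F \<subseteq> sets P" unfolding sets using measurable_sets[OF Um] by auto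
  show "(\<lambda>w. p t (U t w) j) \<in> borel_measurable ?F"
    by (rule measurable_compose[OF measurable_vimage_algebra1 p_measurable[OF t(1)]]) auto
  show "AE w in P. p t (U t w) j = p t (V w) j" by (rule p_U[OF t])
  fix E assume "E \<in> sets ?F"
  then obtain B where B: "B \<in> sets borel" "E = U t -` B \<inter> space P" unfolding sets by blast
  have "(\<lambda>w. trunc n (V w) t) \<in> borel_measurable GsT" by (rule trunc_measurable[OF V_meas]) simp
  from measurable_sets[OF this B(1)]
  have "(\<lambda>w. trunc n (V w) t) -` B \<inter> space P \<in> sets GsT" by simp
  moreover have "AE w in P. w \<in> E \<longleftrightarrow> w \<in> (\<lambda>w. trunc n (V w) t) -` B \<inter> space P"
    using AE_good AE_space
  proof eventually_elim
    case (elim w)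
    then show ?case using V_eq[OF elim(1)] good_path.U_eq[OF elim(1) t] by (simp add: B(2))
  qed
  ultimately show "\<exists>E'\<in>sets GsT. AE w in P. w \<in> E \<longleftrightarrow> w \<in> E'" by blast
qed

end

section \<open>Evolution between shocks and at shocks\<close>

context good_path
begin

text \<open>Constancy of \<open>U\<close> excludes shocks in (s,t]: at such a time a coordinate
  would change from -1 to that time. On the half-open interval present values and left truncations
  then agree, and \<open>p_evolution\<close> applies.\<close>

lemma flow:
  assumes s: "0 \<le> s" "s \<le> t" "t \<le> T" and j: "j \<in> {1..S}" and const: "\<forall>r\<in>{s..t}. U r w = U s w"
  shows "((\<lambda>r. \<Sum>i=1..S. p r (U r w) i * Q r (Zof n (U r w)) (mu r (U r w)) (alpha r (U r w) i) i j)
     has_integral (p t (U t w) j - p s (U s w) j)) {s..t}"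
proof -
  let ?f = "\<lambda>r. \<Sum>i=1..S. p r (U r w) i * Q r (Zof n (U r w)) (mu r (U r w)) (alpha r (U r w) i) i j"
  let ?g = "\<lambda>r. \<Sum>i=1..S. p r u i * Q r (Zof n (trunc_left n u r)) (mu r (trunc_left n u r)) (alpha r (trunc_left n u r) i) i j"
  have no: "\<not> (s < u k \<and> u k \<le> t)" if k: "k \<in> {1..n}" for k
  proof
    assume a: "s < u k \<and> u k \<le> t"
    then have "U (u k) w = U s w" using const by (intro const[rule_format]) auto
    then have "U (u k) w k = U s w k" by simp
    moreover have "U (u k) w k = u k" "U s w k = -1"
      using U_eq[of "u k"] U_eq[of s] a s k by (simp_all add: trunc_def)
    ultimately show False using a s by simp
  qed
  have pU: "p r (U r w) i = p r u i" if "0 \<le> r" "r \<le> T" for r i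
    using U_eq[OF that] p_trunc[OF that(1)] by simp
  have fg: "?f r = ?g r" if r: "s < r" "r \<le> t" for r
  proof -
    have "U r w = trunc_left n u r"
    proof -
      have "trunc n u r k = trunc_left n u r k" for k
        using no[of k] r by (cases "k \<in> {1..n}") (auto simp: trunc_def trunc_left_def)
      then show ?thesis using U_eq[of r] r s by auto
    qed
    then show ?thesis using pU[of r] r s by simp
  qed
  note ev = fz.p_evolution[OF s no j]
  have "(?g has_integral (LBINT r:{s<..t}. ?g r)) {s<..t}"
    using set_borel_integral_eq_integral[OF ev(2)] by (simp add: has_integral_integral[symmetric] integrable_integral)
  then have "(?g has_integral (p t u j - p s u j)) {s<..t}" using ev(1) by simp
  moreover have "(?g has_integral (p t u j - p s u j)) {s<..t} \<longleftrightarrow> (?g has_integral (p t u j - p s u j)) {s..t}"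
  proof (rule has_integral_spike_set_eq)
    have "negligible {s}" by simp
    then show "negligible {x \<in> {s<..t} - {s..t}. ?g x \<noteq> 0}" "negligible {x \<in> {s..t} - {s<..t}. ?g x \<noteq> 0}"
      by (rule negligible_subset, force)+
  qed
  ultimately have "(?g has_integral (p t u j - p s u j)) {s..t}" by blast
  then have "(?f has_integral (p t u j - p s u j)) {s..t}"
  \<comment> \<open>The left end point may itself be a shock time, where the two integrands can
    differ.\<close>
  proof (rule has_integral_spike[of "{s}", rotated -1])
    show "?f r = ?g r" if "r \<in> {s..t} - {s}" for r using that by (intro fg) auto
  qed simp
  then show ?thesis using pU s by simp
qed

text \<open>\<open>U\<close> moves only at a shock time. There \<open>p\<close> is the image of
  \<open>pm\<close> under the relabelling, and \<open>pm\<close> is \<open>p\<close> evaluated along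
  the left limit of \<open>U\<close>.\<close>

lemma jump:
  assumes t: "0 < t" "t \<le> T" and j: "j \<in> {1..S}" and ne: "U t w \<noteq> lft (\<lambda>r. U r w) t"
  shows "p t (U t w) j = (\<Sum>i=1..S. (if J i t (lft (\<lambda>r. mu r (U r w)) t) = j then 1 else 0) * p t (lft (\<lambda>r. U r w) t) i)"
proof -
  have ut: "U t w = trunc n u t" using U_eq[of t] t by simp
  have "\<exists>k\<in>{1..n}. u k = t"
  proof (rule ccontr)
    assume no: "\<not> ?thesis"
    have "trunc n u t k = trunc_left n u t k" for k
      using no by (cases "k \<in> {1..n}"; cases "u k" t rule: linorder_cases) (auto simp: trunc_def trunc_left_def)
    then show False using ne ut lft_U[OF t] by auto
  qed
  then have XS: "XS t u i = J i t (mu t (trunc_left n u t))" for i using t by (auto simp: XS_def)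
  have "p t (U t w) j = p t u j" using ut p_trunc[of t u j] t by simp
  also have "\<dots> = (\<Sum>i=1..S. (if J i t (mu t (trunc_left n u t)) = j then 1 else 0) * pm t u i)"
    unfolding p_def XS by (intro sum.cong refl) (simp add: mult.commute)
  also have "\<dots> = (\<Sum>i=1..S. (if J i t (mu t (trunc_left n u t)) = j then 1 else 0) * p t (trunc_left n u t) i)"
    by (intro sum.cong refl) (simp add: p_trunc_left[OF t(1)])
  finally show ?thesis using lft_Mp[OF t] lft_U[OF t] by simp
qed

end

theorem theorem3p8:
  fixes P :: "'w measure"
    and S n :: nat and T :: real
    and A :: "'a::euclidean_space set"
    and lam :: "nat \<Rightarrow> real \<Rightarrow> (nat \<Rightarrow> real) \<Rightarrow> real"
    and Q :: "real \<Rightarrow> nat \<Rightarrow> (nat \<Rightarrow> real) \<Rightarrow> 'a \<Rightarrow> nat \<Rightarrow> nat \<Rightarrow> real"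
    and J :: "nat \<Rightarrow> real \<Rightarrow> (nat \<Rightarrow> real) \<Rightarrow> nat"
    and X0 :: "'w \<Rightarrow> nat"
    and N :: "noise \<Rightarrow> real \<Rightarrow> 'w \<Rightarrow> nat"
    and Z :: "real \<Rightarrow> 'w \<Rightarrow> nat"
    and X :: "real \<Rightarrow> 'w \<Rightarrow> int"
    and mu :: "real \<Rightarrow> (nat \<Rightarrow> real) \<Rightarrow> (nat \<Rightarrow> real)"
    and alpha :: "real \<Rightarrow> (nat \<Rightarrow> real) \<Rightarrow> nat \<Rightarrow> 'a"
  defines "U \<equiv> Uproc n N Z"
  defines "Mp \<equiv> (\<lambda>t \<omega>. mu t (U t \<omega>))"
  defines "act \<equiv> (\<lambda>s \<omega>. alpha s (lft (\<lambda>r. U r \<omega>) s) (nat (lft (\<lambda>r. X r \<omega>) s)))"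
  defines "Pa \<equiv> density P (\<lambda>\<omega>. ennreal (density_alpha S n T lam Q N Z Mp act \<omega>))"
  defines "GsT \<equiv> sigma (space P) {Z s -` B \<inter> space P | s B. s \<in> {0..T}}"
  defines "sigU \<equiv> (\<lambda>t. vimage_algebra (space P) (U t) borel)"
  assumes P: "prob_space P"
    and S_pos: "1 \<le> S" and T_pos: "0 < T"
    (* coefficients lambda *)
    and lam_pos: "\<forall>k\<in>{1..n}. \<forall>t\<in>{0..T}. \<forall>m\<in>prob_simplex S. 0 < lam k t m"
    and lam_bdd: "\<forall>k\<in>{1..n}. \<exists>C. \<forall>t\<in>{0..T}. \<forall>m\<in>prob_simplex S. lam k t m \<le> C"
    and lam_meas: "\<forall>k. (\<lambda>(t, m). lam k t m) \<in> borel_measurable borel"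
    (* coefficients Q: intensity matrices *)
    and Q_intens: "\<forall>t\<in>{0..T}. \<forall>k\<le>n. \<forall>m\<in>prob_simplex S. \<forall>a\<in>A.
         (\<forall>i\<in>{1..S}. \<forall>j\<in>{1..S}. i \<noteq> j \<longrightarrow> 0 \<le> Q t k m a i j) \<and>
         (\<forall>i\<in>{1..S}. (\<Sum>j=1..S. Q t k m a i j) = 0)"
    and Q_bdd: "\<forall>k\<le>n. \<forall>i\<in>{1..S}. \<forall>j\<in>{1..S}. \<exists>C. \<forall>t\<in>{0..T}. \<forall>m\<in>prob_simplex S. \<forall>a\<in>A.
         \<bar>Q t k m a i j\<bar> \<le> C"
    and Q_meas: "\<forall>k i j. (\<lambda>(t, m, a). Q t k m a i j) \<in> borel_measurable borel"
    (* coefficient J *)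
    and J_range: "\<forall>i\<in>{1..S}. \<forall>t\<in>{0..T}. \<forall>m\<in>prob_simplex S. J i t m \<in> {1..S}"
    and J_meas: "\<forall>i. (\<lambda>(t, m). J i t m) \<in> measurable borel (count_space UNIV)"
    (* initial state and driving noise *)
    and X0_meas: "X0 \<in> measurable P (count_space UNIV)"
    and X0_range: "\<forall>\<omega>\<in>space P. X0 \<omega> \<in> {1..S}"
    and N_poisson: "\<forall>c\<in>noise_idx S n. unit_poisson_process P (N c)"
    and indep: "prob_space.indep_vars P (\<lambda>_. PiM UNIV (\<lambda>_::real. count_space (UNIV::nat set)))
         (\<lambda>c \<omega>. case c of None \<Rightarrow> (\<lambda>_. X0 \<omega>) | Some c' \<Rightarrow> (\<lambda>t. N c' t \<omega>))
         (insert None (Some ` noise_idx S n))"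
    (* the shock counter Z: Z_0 = 0, dZ_t = sum_k 1{Z_{t-}=k-1} dN^k_t *)
    and Z_eq: "\<forall>\<omega>\<in>space P. \<forall>t\<in>{0..T}. real (Z t \<omega>) =
         (\<Sum>k=1..n. pint (\<lambda>s. if lft (\<lambda>r. Z r \<omega>) s = k - 1 then 1 else 0) (\<lambda>r. N (NZ k) r \<omega>) t)"
    and Z_meas: "\<forall>t\<in>{0..T}. Z t \<in> measurable P (count_space UNIV)"
    and U_meas: "\<forall>t\<in>{0..T}. U t \<in> borel_measurable P"
    (* the flow mu *)
    and mu_regular: "regular_TS n T mu"
    and mu_range: "\<forall>(t, u)\<in>TS n T. mu t u \<in> prob_simplex S"
    and mu_meas: "(\<lambda>(t, u). mu t u) \<in> borel_measurable borel"
    (* the state process X *)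
    and X_eq: "\<forall>\<omega>\<in>space P. \<forall>t\<in>{0..T}. real_of_int (X t \<omega>) = real (X0 \<omega>)
         + (\<Sum>i=1..S. \<Sum>j\<in>{1..S}-{i}. \<Sum>k=0..n.
              pint (\<lambda>s. (if lft (\<lambda>r. X r \<omega>) s = int i \<and> lft (\<lambda>r. Z r \<omega>) s = k then 1 else 0)
                         * (real j - real i)) (\<lambda>r. N (NX i k j) r \<omega>) t)
         + (\<Sum>i=1..S. \<Sum>k=1..n.
              pint (\<lambda>s. (if lft (\<lambda>r. X r \<omega>) s = int i \<and> lft (\<lambda>r. Z r \<omega>) s = k - 1 then 1 else 0)
                         * (real (J i s (lft (\<lambda>r. Mp r \<omega>) s)) - real i)) (\<lambda>r. N (NZ k) r \<omega>) t)"
    and X_meas: "\<forall>t\<in>{0..T}. X t \<in> measurable P (count_space UNIV)"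
    (* the Borel feedback strategy *)
    and alpha_meas: "\<forall>i. (\<lambda>(t, u). alpha t u i) \<in> borel_measurable borel"
    and alpha_range: "\<forall>(t, u)\<in>TS n T. \<forall>i\<in>{1..S}. alpha t u i \<in> A"
  shows
    "(\<forall>t\<in>{0..T}. \<forall>j\<in>{1..S}.
        AE \<omega> in Pa. real_cond_exp Pa GsT (indicator {\<omega>. X t \<omega> = int j}) \<omega>
                    = real_cond_exp Pa (sigU t) (indicator {\<omega>. X t \<omega> = int j}) \<omega>)
     \<and> (\<exists>p :: real \<Rightarrow> (nat \<Rightarrow> real) \<Rightarrow> nat \<Rightarrow> real.
        (\<forall>t\<in>{0..T}. \<forall>j\<in>{1..S}.
           AE \<omega> in Pa. p t (U t \<omega>) j = real_cond_exp Pa (sigU t) (indicator {\<omega>. X t \<omega> = int j}) \<omega>)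
      \<and> (AE \<omega> in Pa.
           (\<forall>s t j. 0 \<le> s \<and> s \<le> t \<and> t \<le> T \<and> j \<in> {1..S} \<and> (\<forall>r\<in>{s..t}. U r \<omega> = U s \<omega>) \<longrightarrow>
              ((\<lambda>r. \<Sum>i=1..S. p r (U r \<omega>) i * Q r (Zof n (U r \<omega>)) (Mp r \<omega>) (alpha r (U r \<omega>) i) i j)
                 has_integral (p t (U t \<omega>) j - p s (U s \<omega>) j)) {s..t})
         \<and> (\<forall>t j. 0 < t \<and> t \<le> T \<and> j \<in> {1..S} \<and> U t \<omega> \<noteq> lft (\<lambda>r. U r \<omega>) t \<longrightarrow>
              p t (U t \<omega>) j = (\<Sum>i=1..S. (if J i t (lft (\<lambda>r. Mp r \<omega>) t) = j then 1 else 0)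
                                            * p t (lft (\<lambda>r. U r \<omega>) t) i)))
      \<and> (\<forall>j\<in>{1..S}. p 0 (u_init n) j = prob_space.prob P {\<omega>\<in>space P. X0 \<omega> = j}))"
proof -
  interpret sm: shock_model P S n T A Q J X0 N mu alpha lam Z X
    using assms(7-) unfolding Mp_def U_def
    by (intro shock_model.intro frozen_model.intro frozen_model_axioms.intro shock_model_axioms.intro)
  have Pa: "Pa = sm.Pa" unfolding Pa_def act_def Mp_def U_def sm.Pa_def ..
  have GsT: "GsT = sm.GsT" unfolding GsT_def sm.GsT_def ..
  have 1: "AE \<omega> in Pa. real_cond_exp Pa GsT (indicator {\<omega>. X t \<omega> = int j}) \<omega>
      = real_cond_exp Pa (sigU t) (indicator {\<omega>. X t \<omega> = int j}) \<omega>" if "0 \<le> t" "t \<le> T" for t j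
    using sm.cond_exp_GsT[OF that, of j] sm.cond_exp_U[OF that, of j] sm.AE_Pa[OF sm.p_U[OF that, of j]]
    unfolding Pa GsT sigU_def U_def by eventually_elim simp
  have 2: "AE \<omega> in Pa. sm.p t (U t \<omega>) j = real_cond_exp Pa (sigU t) (indicator {\<omega>. X t \<omega> = int j}) \<omega>"
    if "0 \<le> t" "t \<le> T" for t j
    using sm.cond_exp_U[OF that, of j] unfolding Pa sigU_def U_def by eventually_elim simp
  have 3: "AE \<omega> in Pa.
      (\<forall>s t j. 0 \<le> s \<and> s \<le> t \<and> t \<le> T \<and> j \<in> {1..S} \<and> (\<forall>r\<in>{s..t}. U r \<omega> = U s \<omega>) \<longrightarrow>
        ((\<lambda>r. \<Sum>i=1..S. sm.p r (U r \<omega>) i * Q r (Zof n (U r \<omega>)) (Mp r \<omega>) (alpha r (U r \<omega>) i) i j)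
           has_integral (sm.p t (U t \<omega>) j - sm.p s (U s \<omega>) j)) {s..t}) \<and>
      (\<forall>t j. 0 < t \<and> t \<le> T \<and> j \<in> {1..S} \<and> U t \<omega> \<noteq> lft (\<lambda>r. U r \<omega>) t \<longrightarrow>
        sm.p t (U t \<omega>) j = (\<Sum>i=1..S. (if J i t (lft (\<lambda>r. Mp r \<omega>) t) = j then 1 else 0)
                                       * sm.p t (lft (\<lambda>r. U r \<omega>) t) i))"
    \<comment> \<open>A single null set, off which the path is good, serves all \<open>s\<close>,
      \<open>t\<close> and \<open>j\<close> simultaneously.\<close>
    using sm.AE_Pa[OF sm.AE_good] unfolding Pa Mp_def U_def
  proof eventually_elim
    case (elim w)
    show ?case
      by (intro conjI allI impI; elim conjE) (rule good_path.flow[OF elim] good_path.jump[OF elim]; assumption)+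
  qed
  show ?thesis
  proof (intro conjI ballI exI[of _ sm.p])
    show "sm.p 0 (u_init n) j = sm.prob {\<omega>\<in>space P. X0 \<omega> = j}" if "j \<in> {1..S}" for j
      by (rule sm.p_init[OF that])
  qed (use 1 2 in simp, use 1 2 in simp, rule 3)
qed

end
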